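(* Let $X$ be a Banach space with finite cotype and let $T:X\to X$ be a Ritt$_E$ operator which admits a bounded $H^\infty(E_r)$ functional calculus for some $r\in(0,1)$. Then for any $\alpha>0$ there exists a constant $C>0$ such that $$\|x\|_{T,\alpha}\le C\|x\|,\qquad x\in X.$$
   Context: $X$ is a complex Banach space, $B(X)$ the algebra of bounded operators on $X$, $R(z,T)=(z-T)^{-1}$, $\mathbb D$ the open unit disc, $\mathbb T$ the unit circle, $D(0,2)$ the open disc of radius 2. $E=\{\xi_1,\dots,\xi_N\}\subset\mathbb T$ is a fixed finite set of $N\ge1$ distinct points. $T\in B(X)$ is a Ritt$_E$ operator if $\sigma(T)\subset\overline{\mathbb D}$, $\sigma(T)\cap\mathbb T\subset E$ and for every $C>1$ the set $\{\prod_{j=1}^N(1-\overline{\xi_j}z)R(z,T):1<|z|<C\}$ is bounded. For such $T$ each $I-\overline{\xi_j}T$ is a bounded sectorial operator, and $(I-\overline{\xi_j}T)^\alpha$ is the usual fractional power, a bounded operator. For $r\in(0,1)$, $E_r$ is the interior of the convex hull of $E\cup r\mathbb D$; $r$ is $E$-large enough if every segment $[\xi_i,\xi_j]$, $i\neq j$, meets $r\mathbb D$. A Ritt$_E$ operator $T$ is of type $r$ if $r$ is $E$-large enough, $\sigma(T)\subset\overline{E_r}$, and for every $s\in(r,1)$ the set $\{R(z,T)\prod_{j=1}^N(\xi_j-z): z\in D(0,2)\setminus\overline{E_s}\}$ is bounded; it is of type $<s$ if it is of type $r$ for some $r<s$. $H_0^\infty(E_s)$ is the space of bounded holomorphic $\phi:E_s\to\mathbb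 C$ such that $|\phi(z)|\le C_1\prod_{j=1}^N|\xi_j-z|^{s_j}$ on $E_s$ for some $C_1,s_1,\dots,s_N>0$; $\|\cdot\|_{\infty,E_s}$ is the sup norm on $E_s$. If $T$ is of type $r<s$ and $\phi\in H_0^\infty(E_s)$, then $\phi(T)=\frac1{2\pi i}\int_{\partial E_u}\phi(z)R(z,T)\,dz$ for any $u\in(r,s)$. $T$ admits a bounded $H^\infty(E_s)$ functional calculus if it is of type $<s$ and there is $K\ge1$ with $\|\phi(T)\|\le K\|\phi\|_{\infty,E_s}$ for all $\phi\in H_0^\infty(E_s)$. $(\varepsilon_k)_{k\ge1}$ are independent Rademacher variables on a probability space $(\Omega,\mathbb P)$ and $\|\sum_k\varepsilon_k\otimes x_k\|_{\mathrm{Rad}(X)}=\big(\int_\Omega\|\sum_k\varepsilon_k(u)x_k\|_X^2\,d\mathbb P(u)\big)^{1/2}$. For $\alpha>0$ and $x\in X$ the square function is (nondecreasing limit, possibly $+\infty$) $$\|x\|_{T,\alpha}=\lim_{n\to\infty}\Big\|\sum_{k=1}^nk^{\alpha-1/2}\varepsilon_k\otimes T^{k-1}\prod_{j=1}^N(I-\overline{\xi_j}T)^\alpha x\Big\|_{\mathrm{Rad}(X)}.$$ *)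

theory Defs
  imports "HOL-Probability.Probability"
begin

class complex_normed_vector = real_normed_vector +
  fixes scaleC :: "complex \<Rightarrow> 'a \<Rightarrow> 'a"  (infixr \<open>*\<^sub>C\<close> 75)
  assumes scaleC_of_real: "complex_of_real r *\<^sub>C x = r *\<^sub>R x"
    and scaleC_add_right: "a *\<^sub>C (x + y) = a *\<^sub>C x + a *\<^sub>C y"
    and scaleC_add_left: "(a + b) *\<^sub>C x = a *\<^sub>C x + b *\<^sub>C x"
    and scaleC_scaleC: "a *\<^sub>C b *\<^sub>C x = (a * b) *\<^sub>C x"
    and norm_scaleC: "norm (a *\<^sub>C x) = cmod a * norm x"

class complex_banach = complex_normed_vector + banach

instantiation complex :: complex_banach
begin
definition scaleC_complex :: "complex \<Rightarrow> complex \<Rightarrow> complex"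
  where "scaleC_complex a x = a * x"
instance
  by standard (auto simp: scaleC_complex_def scaleR_conv_of_real algebra_simps norm_mult)
end

lemma scaleC_one: "1 *\<^sub>C x = (x::'a::complex_normed_vector)"
  using scaleC_of_real[of 1 x] by simp

lemma scaleC_scaleR_commute:
  fixes x :: "'a::complex_normed_vector"
  shows "c *\<^sub>C r *\<^sub>R x = r *\<^sub>R c *\<^sub>C x"
  by (metis mult.commute scaleC_of_real scaleC_scaleC)

lemma bounded_linear_scaleC: "bounded_linear (\<lambda>x::'a::complex_normed_vector. c *\<^sub>C x)"
  by (rule bounded_linear_intro[where K = "cmod c"])
    (auto simp: scaleC_add_right scaleC_scaleR_commute norm_scaleC mult.commute)

instantiation blinfun :: (real_normed_vector, complex_normed_vector) complex_normed_vector
begin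

lift_definition scaleC_blinfun :: "complex \<Rightarrow> ('a \<Rightarrow>\<^sub>L 'b) \<Rightarrow> ('a \<Rightarrow>\<^sub>L 'b)" is "\<lambda>c f x. c *\<^sub>C f x"
  by (rule bounded_linear_compose[OF bounded_linear_scaleC])

instance
proof
  fix a b :: complex and r :: real and f g :: "'a \<Rightarrow>\<^sub>L 'b"
  show "complex_of_real r *\<^sub>C f = r *\<^sub>R f"
    by transfer (simp add: scaleC_of_real)
  show "a *\<^sub>C (f + g) = a *\<^sub>C f + a *\<^sub>C g"
    by transfer (simp add: scaleC_add_right)
  show "(a + b) *\<^sub>C f = a *\<^sub>C f + b *\<^sub>C f"
    by transfer (simp add: scaleC_add_left)
  show "a *\<^sub>C b *\<^sub>C f = (a * b) *\<^sub>C f"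
    by transfer (simp add: scaleC_scaleC)
  show "norm (a *\<^sub>C f) = cmod a * norm f"
  proof (rule antisym)
    have le: "norm (c *\<^sub>C h) \<le> cmod c * norm h" for c and h :: "'a \<Rightarrow>\<^sub>L 'b"
      by (rule norm_blinfun_bound)
        (auto simp: scaleC_blinfun.rep_eq norm_scaleC mult.assoc intro!: mult_left_mono norm_blinfun)
    show "norm (a *\<^sub>C f) \<le> cmod a * norm f"
      by (rule le)
    show "cmod a * norm f \<le> norm (a *\<^sub>C f)"
    proof (cases "a = 0")
      case False
      have "f = inverse a *\<^sub>C a *\<^sub>C f"
        using False by (intro blinfun_eqI) (simp add: scaleC_blinfun.rep_eq scaleC_scaleC scaleC_one)
      with le[of "inverse a" "a *\<^sub>C f"] have "norm f \<le> inverse (cmod a) * norm (a *\<^sub>C f)"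
        by (simp add: norm_inverse)
      with False show ?thesis
        by (simp add: field_simps)
    qed simp
  qed
qed

end

instance blinfun :: (real_normed_vector, complex_banach) complex_banach ..

text \<open>The type \<open>'a \<Rightarrow>\<^sub>L 'a\<close> consists of the real-linear bounded operators; an operator \<open>T\<close> belongs
  to \<open>B(X)\<close> iff it also satisfies the following predicate. A two-sided inverse of a complex-linear
  operator is automatically complex-linear, so the inverses below may be taken
  in \<open>'a \<Rightarrow>\<^sub>L 'a\<close>.\<close>

definition complex_linear :: "('a::complex_normed_vector \<Rightarrow>\<^sub>L 'a) \<Rightarrow> bool"
  where "complex_linear T \<longleftrightarrow> (\<forall>c x. blinfun_apply T (c *\<^sub>C x) = c *\<^sub>C blinfun_apply T x)"

definition is_inverse_op :: "('a::real_normed_vector \<Rightarrow>\<^sub>L 'a) \<Rightarrow> ('a \<Rightarrow>\<^sub>L 'a) \<Rightarrow> bool"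
  where "is_inverse_op A B \<longleftrightarrow> A o\<^sub>L B = id_blinfun \<and> B o\<^sub>L A = id_blinfun"

definition inverse_op :: "('a::real_normed_vector \<Rightarrow>\<^sub>L 'a) \<Rightarrow> ('a \<Rightarrow>\<^sub>L 'a)"
  where "inverse_op A = (THE B. is_inverse_op A B)"

definition resolvent :: "complex \<Rightarrow> ('a::complex_normed_vector \<Rightarrow>\<^sub>L 'a) \<Rightarrow> ('a \<Rightarrow>\<^sub>L 'a)"
  where "resolvent z T = inverse_op (z *\<^sub>C id_blinfun - T)"

definition spectrum :: "('a::complex_normed_vector \<Rightarrow>\<^sub>L 'a) \<Rightarrow> complex set"
  where "spectrum T = {z. \<nexists>B. is_inverse_op (z *\<^sub>C id_blinfun - T) B}"

definition op_power :: "('a::real_normed_vector \<Rightarrow>\<^sub>L 'a) \<Rightarrow> nat \<Rightarrow> ('a \<Rightarrow>\<^sub>L 'a)"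
  where "op_power A n = ((\<lambda>B. A o\<^sub>L B) ^^ n) id_blinfun"

text \<open>Balakrishnan's definition of the fractional power of a bounded sectorial operator \<open>A\<close>:
  for \<open>0 < \<beta> < 1\<close>,
  \<open>A\<^sup>\<beta> = sin (\<pi> \<beta>) / \<pi> \<integral>\<^sub>0\<^sup>\<infinity> t\<^sup>\<beta>\<^sup>-\<^sup>1 (t + A)\<^sup>-\<^sup>1 A dt\<close>, and
  \<open>A\<^sup>n\<^sup>+\<^sup>\<beta> = A\<^sup>n A\<^sup>\<beta>\<close> for \<open>n \<in> \<nat>\<close>. Since \<open>A\<close> is bounded and sectorial, the integral converges
  absolutely in operator norm.\<close>

definition balakrishnan :: "('a::banach \<Rightarrow>\<^sub>L 'a) \<Rightarrow> real \<Rightarrow> ('a \<Rightarrow>\<^sub>L 'a)"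
  where "balakrishnan A \<beta> = (sin (pi * \<beta>) / pi) *\<^sub>R
    integral {0<..} (\<lambda>t. (t powr (\<beta> - 1)) *\<^sub>R (inverse_op (t *\<^sub>R id_blinfun + A) o\<^sub>L A))"

definition frac_power :: "('a::banach \<Rightarrow>\<^sub>L 'a) \<Rightarrow> real \<Rightarrow> ('a \<Rightarrow>\<^sub>L 'a)"
  where "frac_power A \<alpha> = op_power A (nat \<lfloor>\<alpha>\<rfloor>) o\<^sub>L
    (if frac \<alpha> = 0 then id_blinfun else balakrishnan A (frac \<alpha>))"

definition ritt_op :: "complex set \<Rightarrow> ('a::complex_banach \<Rightarrow>\<^sub>L 'a) \<Rightarrow> bool"
  where "ritt_op E T \<longleftrightarrow> complex_linear T \<and> spectrum T \<subseteq> cball 0 1 \<and> spectrum T \<inter> sphere 0 1 \<subseteq> E \<and>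
    (\<forall>C>1. bounded ((\<lambda>z. (\<Prod>\<xi>\<in>E. 1 - cnj \<xi> * z) *\<^sub>C resolvent z T) ` {z. 1 < cmod z \<and> cmod z < C}))"

definition stolz_domain :: "complex set \<Rightarrow> real \<Rightarrow> complex set"
  where "stolz_domain E r = interior (convex hull (E \<union> ball 0 r))"

definition large_enough :: "complex set \<Rightarrow> real \<Rightarrow> bool"
  where "large_enough E r \<longleftrightarrow>
    (\<forall>\<xi>\<in>E. \<forall>\<eta>\<in>E. \<xi> \<noteq> \<eta> \<longrightarrow> closed_segment \<xi> \<eta> \<inter> ball 0 r \<noteq> {})"

definition of_type :: "complex set \<Rightarrow> real \<Rightarrow> ('a::complex_banach \<Rightarrow>\<^sub>L 'a) \<Rightarrow> bool"
  where "of_type E r T \<longleftrightarrow> ritt_op E T \<and> 0 < r \<and> r < 1 \<and> large_enough E r \<and>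
    spectrum T \<subseteq> closure (stolz_domain E r) \<and>
    (\<forall>s. r < s \<and> s < 1 \<longrightarrow>
      bounded ((\<lambda>z. (\<Prod>\<xi>\<in>E. \<xi> - z) *\<^sub>C resolvent z T) ` (ball 0 2 - closure (stolz_domain E s))))"

definition of_type_less :: "complex set \<Rightarrow> real \<Rightarrow> ('a::complex_banach \<Rightarrow>\<^sub>L 'a) \<Rightarrow> bool"
  where "of_type_less E s T \<longleftrightarrow> (\<exists>r<s. of_type E r T)"

definition H0_inf :: "complex set \<Rightarrow> real \<Rightarrow> (complex \<Rightarrow> complex) set"
  where "H0_inf E s = {\<phi>. \<phi> holomorphic_on stolz_domain E s \<and> bounded (\<phi> ` stolz_domain E s) \<and>
    (\<exists>C>0. \<exists>\<sigma>. (\<forall>\<xi>\<in>E. \<sigma> \<xi> > 0) \<and>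
      (\<forall>z\<in>stolz_domain E s. cmod (\<phi> z) \<le> C * (\<Prod>\<xi>\<in>E. cmod (\<xi> - z) powr \<sigma> \<xi>)))}"

definition sup_norm_on :: "complex set \<Rightarrow> (complex \<Rightarrow> complex) \<Rightarrow> real"
  where "sup_norm_on S \<phi> = (SUP z\<in>S. cmod (\<phi> z))"

text \<open>The boundary of \<open>stolz_domain E u\<close>, a bounded convex open set containing \<open>0\<close>, traversed once
  counterclockwise for \<open>0 \<le> t \<le> 2\<pi>\<close>, in polar coordinates. The curve is Lipschitz and
  piecewise smooth (it consists of line segments and circular arcs).\<close>

definition boundary_curve :: "complex set \<Rightarrow> real \<Rightarrow> real \<Rightarrow> complex"
  where "boundary_curve E u t = complex_of_real (Sup {\<rho>. complex_of_real \<rho> * cis t \<in> stolz_domain E u}) * cis t"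

text \<open>\<open>1/(2\<pi>\<i>) \<integral>\<^bsub>\<partial>E\<^sub>u\<^esub> \<phi>(z) R(z,T) dz\<close>. The boundary meets \<open>E\<close> only in finitely many parameters \<open>t\<close>,
  so neither the values of \<open>\<phi>\<close> on \<open>E\<close> nor the derivative at the corners matter.\<close>

definition dunford_integral ::
    "complex set \<Rightarrow> real \<Rightarrow> (complex \<Rightarrow> complex) \<Rightarrow> ('a::complex_banach \<Rightarrow>\<^sub>L 'a) \<Rightarrow> ('a \<Rightarrow>\<^sub>L 'a)"
  where "dunford_integral E u \<phi> T = (1 / (2 * complex_of_real pi * \<i>)) *\<^sub>C
    integral {0..2*pi} (\<lambda>t.
      (\<phi> (boundary_curve E u t) * vector_derivative (boundary_curve E u) (at t))
        *\<^sub>C resolvent (boundary_curve E u t) T)"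

text \<open>\<open>\<phi>(T)\<close> for \<open>T\<close> of type \<open>r < s\<close> and \<open>\<phi>\<close> in \<open>H0_inf E s\<close>: the contour parameter \<open>u\<close> is any number in
  \<open>(r,s)\<close>, on which the integral does not depend by Cauchy's theorem. The chosen \<open>u\<close> depends
  only on \<open>E\<close>, \<open>s\<close> and \<open>T\<close>.\<close>

definition fun_calc ::
    "complex set \<Rightarrow> real \<Rightarrow> (complex \<Rightarrow> complex) \<Rightarrow> ('a::complex_banach \<Rightarrow>\<^sub>L 'a) \<Rightarrow> ('a \<Rightarrow>\<^sub>L 'a)"
  where "fun_calc E s \<phi> T = dunford_integral E (SOME u. u < s \<and> of_type_less E u T) \<phi> T"

definition bounded_H_inf_calculus :: "complex set \<Rightarrow> real \<Rightarrow> ('a::complex_banach \<Rightarrow>\<^sub>L 'a) \<Rightarrow> bool"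
  where "bounded_H_inf_calculus E s T \<longleftrightarrow> of_type_less E s T \<and>
    (\<exists>K\<ge>1. \<forall>\<phi>\<in>H0_inf E s. norm (fun_calc E s \<phi> T) \<le> K * sup_norm_on (stolz_domain E s) \<phi>)"

definition rademacher_seq :: "'w measure \<Rightarrow> (nat \<Rightarrow> 'w \<Rightarrow> real) \<Rightarrow> bool"
  where "rademacher_seq M \<epsilon> \<longleftrightarrow> prob_space M \<and>
    prob_space.indep_vars M (\<lambda>_. borel) \<epsilon> {1..} \<and>
    (\<forall>k\<ge>1. measure M {\<omega>\<in>space M. \<epsilon> k \<omega> = 1} = 1/2 \<and> measure M {\<omega>\<in>space M. \<epsilon> k \<omega> = -1} = 1/2)"

definition rad_norm ::
    "'w measure \<Rightarrow> (nat \<Rightarrow> 'w \<Rightarrow> real) \<Rightarrow> nat \<Rightarrow> (nat \<Rightarrow> 'a::real_normed_vector) \<Rightarrow> real"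
  where "rad_norm M \<epsilon> n x = sqrt (\<integral>\<omega>. (norm (\<Sum>k=1..n. \<epsilon> k \<omega> *\<^sub>R x k))\<^sup>2 \<partial>M)"

text \<open>The space \<open>'a\<close> has cotype \<open>q\<close> for some \<open>2 \<le> q < \<infinity>\<close>; the property does not depend on the Rademacher
  sequence \<open>\<epsilon>\<close> used to express it.\<close>

definition finite_cotype ::
    "'w measure \<Rightarrow> (nat \<Rightarrow> 'w \<Rightarrow> real) \<Rightarrow> 'a::real_normed_vector itself \<Rightarrow> bool"
  where "finite_cotype M \<epsilon> (_ :: 'a itself) \<longleftrightarrow>
    (\<exists>q\<ge>2. \<exists>K. \<forall>n. \<forall>x :: nat \<Rightarrow> 'a.
      (\<Sum>k=1..n. norm (x k) powr q) powr (1/q) \<le> K * rad_norm M \<epsilon> n x)"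

text \<open>The list \<open>\<xi>s\<close> enumerates \<open>\<xi>\<^sub>1, \<dots>, \<xi>\<^sub>N\<close>; the factors of the product commute.\<close>

definition frac_prod :: "complex list \<Rightarrow> real \<Rightarrow> ('a::complex_banach \<Rightarrow>\<^sub>L 'a) \<Rightarrow> ('a \<Rightarrow>\<^sub>L 'a)"
  where "frac_prod \<xi>s \<alpha> T =
    foldr (\<lambda>\<xi> B. frac_power (id_blinfun - cnj \<xi> *\<^sub>C T) \<alpha> o\<^sub>L B) \<xi>s id_blinfun"

definition square_fun ::
    "'w measure \<Rightarrow> (nat \<Rightarrow> 'w \<Rightarrow> real) \<Rightarrow> complex list \<Rightarrow> ('a::complex_banach \<Rightarrow>\<^sub>L 'a) \<Rightarrow> real \<Rightarrow> 'a \<Rightarrow> ennreal"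
  where "square_fun M \<epsilon> \<xi>s T \<alpha> x = lim (\<lambda>n. ennreal (rad_norm M \<epsilon> n
    (\<lambda>k. (real k powr (\<alpha> - 1/2)) *\<^sub>R blinfun_apply (op_power T (k - 1) o\<^sub>L frac_prod \<xi>s \<alpha> T) x)))"

end

theory Submission
  imports Defs
begin

text \<open>Lagrange interpolation at the points of \<open>E\<close> splits the square function sum into one block for
  each \<open>\<xi>\<^sub>j\<close>. In the block of \<open>\<xi>\<^sub>j\<close>, Abel summation in the rotated operator \<open>\<xi>\<^sub>j\<^sup>-\<^sup>1 T\<close> produces
  \<open>\<Sum>\<^sub>l S\<^sub>l \<phi>\<^sub>l(T) x\<close> with subgaussian random coefficients \<open>S\<^sub>l\<close> and with \<open>\<Sum>\<^sub>l \<bar>\<phi>\<^sub>l\<bar>\<close> bounded on the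
  Stolz domain \<open>E\<^sub>s\<close>, so that the functional calculus makes \<open>\<Sum>\<^sub>l \<eta>\<^sub>l \<phi>\<^sub>l(T) x\<close> bounded uniformly in
  \<open>\<bar>\<eta>\<^sub>l\<bar> \<le> 1\<close>. Since \<open>X\<close> has finite cotype, Pisier's extrapolation of \<open>(q,1)\<close>-summing estimates then
  bounds the mean square of the block.

  The calculus is only needed for polynomials vanishing on \<open>E\<close>. Their Dunford integral over the
  boundary of \<open>E\<^sub>u\<close> is the polynomial in \<open>T\<close>, because the resolvent differs from the one of the zero
  operator by the derivative in \<open>z\<close> of \<open>- \<integral>\<^sub>0\<^sup>1 T (z - \<mu> T)\<^sup>-\<^sup>1 d\<mu>\<close>; and the fractional powers
  are norm limits of such polynomials.\<close>

subsection \<open>Complex-linear bounded operators as a normed ring\<close>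

text \<open>The calculus only bounds sums with deterministic bounded coefficients, and the weights
  k^(\<alpha> - 1/2) do not yield such sums directly. The partial sums S_l have standard deviation
  about l^\<alpha>; this is where the exponent \<alpha> - 1/2 is used. Normalising them moves a
  factor l^\<alpha> to the operator side, while Abel summation supplies a factor 1 - V. Lagrange
  interpolation gives the j-th block the other linear factors, so that 1 - V is completed to the
  whole product over E. With the fractional powers this is the product to the power 1 + \<alpha>,
  which on a Stolz domain is at most a constant times (1 - |z|)^(1 + \<alpha>) and cancels the
  growth of the sum of l^\<alpha> |z|^(l - 1). The normalised S_l have uniform exponential tails but
  no uniform bound, hence the extrapolation. On the operator side the obstacle is that
  \<open>fun_calc\<close> is tied to one contour, which may meet the spectrum in E and is only known
  to be differentiable off a countable set; explicit primitives replace Cauchy's theorem.\<close>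

text \<open>The zero space is allowed, so this ring need not satisfy \<open>0 \<noteq> 1\<close>.\<close>

typedef (overloaded) 'a cop = "{A :: 'a::complex_banach \<Rightarrow>\<^sub>L 'a. complex_linear A}"
  morphisms rep_cop abs_cop
  by (rule exI[of _ 0]) (simp add: complex_linear_def scaleC_of_real[of 0, simplified]
      bounded_linear.linear[OF bounded_linear_scaleC, THEN linear_0])

setup_lifting type_definition_cop

lemma scaleC_linear_simps:
  fixes x y :: "'a::complex_normed_vector"
  shows "c *\<^sub>C 0 = (0::'a)" "0 *\<^sub>C x = 0" "c *\<^sub>C (x - y) = c *\<^sub>C x - c *\<^sub>C y"
    "c *\<^sub>C (- x) = - (c *\<^sub>C x)" "(a - c) *\<^sub>C x = a *\<^sub>C x - c *\<^sub>C x" "(- c) *\<^sub>C x = - (c *\<^sub>C x)"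
proof -
  have lin: "linear (\<lambda>x::'a. c *\<^sub>C x)"
    by (rule bounded_linear.linear[OF bounded_linear_scaleC])
  show "c *\<^sub>C 0 = (0::'a)" "c *\<^sub>C (x - y) = c *\<^sub>C x - c *\<^sub>C y" "c *\<^sub>C (- x) = - (c *\<^sub>C x)"
    using linear_0[OF lin] linear_diff[OF lin] linear_neg[OF lin] by auto
  show zero: "0 *\<^sub>C x = 0"
    using scaleC_of_real[of 0 x] by simp
  show "(a - c) *\<^sub>C x = a *\<^sub>C x - c *\<^sub>C x"
    using scaleC_add_left[of "a - c" c x] by (simp add: algebra_simps)
  show "(- c) *\<^sub>C x = - (c *\<^sub>C x)"
    using scaleC_add_left[of "- c" c x] zero by (simp add: eq_neg_iff_add_eq_0)
qed

instantiation cop :: (complex_banach) "{ring, monoid_mult}"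
begin
lift_definition zero_cop :: "'a cop" is 0
  by (simp add: complex_linear_def scaleC_linear_simps)
lift_definition one_cop :: "'a cop" is id_blinfun
  by (simp add: complex_linear_def)
lift_definition plus_cop :: "'a cop \<Rightarrow> 'a cop \<Rightarrow> 'a cop" is "(+)"
  by (simp add: complex_linear_def plus_blinfun.rep_eq scaleC_add_right)
lift_definition minus_cop :: "'a cop \<Rightarrow> 'a cop \<Rightarrow> 'a cop" is "(-)"
  by (simp add: complex_linear_def minus_blinfun.rep_eq scaleC_linear_simps)
lift_definition uminus_cop :: "'a cop \<Rightarrow> 'a cop" is "uminus"
  by (simp add: complex_linear_def uminus_blinfun.rep_eq scaleC_linear_simps)
lift_definition times_cop :: "'a cop \<Rightarrow> 'a cop \<Rightarrow> 'a cop" is "(o\<^sub>L)"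
  by (simp add: complex_linear_def)
instance
  by standard (transfer, auto intro!: blinfun_eqI simp: plus_blinfun.rep_eq minus_blinfun.rep_eq
    uminus_blinfun.rep_eq blinfun.add_right algebra_simps)+
end

instantiation cop :: (complex_banach) real_normed_algebra
begin
lift_definition scaleR_cop :: "real \<Rightarrow> 'a cop \<Rightarrow> 'a cop" is "(*\<^sub>R)"
  by (simp add: complex_linear_def scaleR_blinfun.rep_eq scaleC_scaleR_commute)
lift_definition norm_cop :: "'a cop \<Rightarrow> real" is norm .
definition dist_cop :: "'a cop \<Rightarrow> 'a cop \<Rightarrow> real" where "dist_cop a b = norm (a - b)"
definition sgn_cop :: "'a cop \<Rightarrow> 'a cop" where "sgn_cop a = inverse (norm a) *\<^sub>R a"
definition uniformity_cop :: "('a cop \<times> 'a cop) filter"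
  where "uniformity_cop = (INF e\<in>{0 <..}. principal {(x, y). dist x y < e})"
definition open_cop :: "'a cop set \<Rightarrow> bool"
  where "open_cop S = (\<forall>x\<in>S. \<forall>\<^sub>F (x', y) in uniformity. x' = x \<longrightarrow> y \<in> S)"
instance
proof
  fix a b c :: "'a cop" and r s :: real
  show "dist a b = norm (a - b)" by (rule dist_cop_def)
  show "sgn a = inverse (norm a) *\<^sub>R a" by (rule sgn_cop_def)
  show "uniformity = (INF e\<in>{0 <..}. principal {(x, y). dist x (y::'a cop) < e})"
    by (rule uniformity_cop_def)
  show "open S = (\<forall>x\<in>S. \<forall>\<^sub>F (x', y) in uniformity. x' = x \<longrightarrow> y \<in> S)" for S :: "'a cop set"
    by (rule open_cop_def)
  show "r *\<^sub>R (a + b) = r *\<^sub>R a + r *\<^sub>R b" "(r + s) *\<^sub>R a = r *\<^sub>R a + s *\<^sub>R a"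
    "r *\<^sub>R s *\<^sub>R a = (r * s) *\<^sub>R a" "1 *\<^sub>R a = a"
    by (transfer, simp add: algebra_simps)+
  show "(r *\<^sub>R a) * b = r *\<^sub>R (a * b)" "a * (r *\<^sub>R b) = r *\<^sub>R (a * b)"
    by (transfer, auto intro!: blinfun_eqI simp: scaleR_blinfun.rep_eq blinfun.scaleR_right)+
  show "(norm a = 0) = (a = 0)" "norm (r *\<^sub>R a) = \<bar>r\<bar> * norm a"
    by (transfer, simp)+
  show "norm (a + b) \<le> norm a + norm b"
    by transfer (rule norm_triangle_ineq)
  show "norm (a * b) \<le> norm a * norm b"
    by transfer (rule norm_blinfun_compose)
qed
end

lemma rep_cop_simps [simp]:
  "rep_cop (a + b) = rep_cop a + rep_cop b" "rep_cop (a - b) = rep_cop a - rep_cop b"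
  "rep_cop (a * b) = rep_cop a o\<^sub>L rep_cop b" "rep_cop (r *\<^sub>R a) = r *\<^sub>R rep_cop a"
  "norm (rep_cop a) = norm a" "rep_cop 1 = id_blinfun" "rep_cop 0 = 0"
  by (simp_all add: plus_cop.rep_eq minus_cop.rep_eq times_cop.rep_eq scaleR_cop.rep_eq
      norm_cop.rep_eq one_cop.rep_eq zero_cop.rep_eq)

lemma bounded_linear_rep_cop: "bounded_linear rep_cop"
  by (rule bounded_linear_intro[where K = 1]) auto

text \<open>Completeness serves the integrals of ring-valued functions below. Complex linearity
  passes to pointwise limits, so the subspace is closed.\<close>

instance cop :: (complex_banach) banach
proof
  fix X :: "nat \<Rightarrow> 'a cop"
  assume "Cauchy X"
  then have "Cauchy (\<lambda>n. rep_cop (X n))"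
    by (rule bounded_linear.Cauchy[OF bounded_linear_rep_cop])
  then obtain L where L: "(\<lambda>n. rep_cop (X n)) \<longlonglongrightarrow> L"
    using Cauchy_convergent convergent_def by blast
  have "complex_linear L"
    unfolding complex_linear_def
  proof (intro allI)
    fix c x
    have lim: "(\<lambda>n. rep_cop (X n) y) \<longlonglongrightarrow> L y" for y
      by (rule blinfun.tendsto[OF L tendsto_const])
    have "(\<lambda>n. c *\<^sub>C rep_cop (X n) x) \<longlonglongrightarrow> c *\<^sub>C L x"
      by (rule bounded_linear.tendsto[OF bounded_linear_scaleC lim])
    moreover have "rep_cop (X n) (c *\<^sub>C x) = c *\<^sub>C rep_cop (X n) x" for n
      using rep_cop[of "X n"] by (simp add: complex_linear_def)
    ultimately show "L (c *\<^sub>C x) = c *\<^sub>C L x"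
      using lim[of "c *\<^sub>C x"] LIMSEQ_unique by auto
  qed
  then obtain l where l: "rep_cop l = L"
    by (metis abs_cop_inverse mem_Collect_eq)
  have "(\<lambda>n. norm (X n - l)) \<longlonglongrightarrow> 0"
  proof -
    have "norm (X n - l) = norm (rep_cop (X n) - L)" for n
      using rep_cop_simps(5)[of "X n - l"] l by simp
    with tendsto_norm_zero[OF LIM_zero[OF L]] show ?thesis by simp
  qed
  then have "X \<longlonglongrightarrow> l"
    by (rule LIM_zero_cancel[OF tendsto_norm_zero_cancel])
  then show "convergent X" by (auto simp: convergent_def)
qed

text \<open>Complex scalars enter as central elements of the ring: complex scalar multiplication
  becomes ring multiplication, and \<open>cs_commute\<close> moves it past everything.\<close>

lift_definition cs :: "complex \<Rightarrow> 'a::complex_banach cop" is "\<lambda>c. c *\<^sub>C id_blinfun"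
  by (simp add: complex_linear_def scaleC_blinfun.rep_eq scaleC_scaleC mult.commute)

lemma rep_cs: "rep_cop (cs c) = c *\<^sub>C id_blinfun" "rep_cop (cs c * a) = c *\<^sub>C rep_cop a"
  by (auto simp: cs.rep_eq scaleC_blinfun.rep_eq intro!: blinfun_eqI)

lemma cs_simps:
  "cs (a + b) = cs a + cs b" "cs (a - b) = cs a - cs b" "cs (a * b) = cs a * cs b"
  "cs 0 = 0" "cs 1 = 1" "cs (- a) = - cs a"
  by (transfer, auto intro!: blinfun_eqI simp: scaleC_blinfun.rep_eq blinfun.add_left
      blinfun.diff_left blinfun.minus_left scaleC_linear_simps scaleC_add_left scaleC_scaleC scaleC_one)+

lemma cs_commute: "a * cs c = cs c * a"
  by transfer (auto intro!: blinfun_eqI simp: scaleC_blinfun.rep_eq complex_linear_def)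

lemma cs_left_commute: "a * (cs c * b) = cs c * (a * b)"
  by (metis cs_commute mult.assoc)

lemma cs_cancel: "c \<noteq> 0 \<Longrightarrow> cs c * (cs (1 / c) * a) = a" "c \<noteq> 0 \<Longrightarrow> cs (1 / c) * (cs c * a) = a"
  by (simp_all add: mult.assoc[symmetric] cs_simps(3)[symmetric] cs_simps(5))

lemma cs_of_real: "cs (of_real r) * a = r *\<^sub>R a"
  by transfer (auto intro!: blinfun_eqI simp: scaleC_blinfun.rep_eq scaleR_blinfun.rep_eq scaleC_of_real)

lemma norm_cs_mult: "norm (cs c * a) = cmod c * norm a"
  by (metis rep_cop_simps(5) norm_scaleC rep_cs(2))

lemma norm_one_cop_le: "norm (1 :: 'a::complex_banach cop) \<le> 1"
  by transfer (rule norm_blinfun_id_le)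

lemma norm_cs_le: "norm (cs c :: 'a::complex_banach cop) \<le> cmod c"
  using norm_cs_mult[of c "1 :: 'a cop"] norm_one_cop_le[where 'a = 'a]
  by (simp add: mult_left_le)

lemma bounded_linear_cs: "bounded_linear (cs :: complex \<Rightarrow> 'a::complex_banach cop)"
proof (rule bounded_linear_intro[where K = 1])
  show "cs (r *\<^sub>R x) = r *\<^sub>R (cs x :: 'a cop)" for r x
    using cs_of_real[of r "cs x :: 'a cop"] by (simp add: scaleR_conv_of_real cs_simps)
qed (auto simp: cs_simps norm_cs_le)

lemmas tendsto_cs [tendsto_intros] = bounded_linear.tendsto[OF bounded_linear_cs]
  and continuous_on_cs [continuous_intros] = bounded_linear.continuous_on[OF bounded_linear_cs]

text \<open>A Horner scheme with the coefficients embedded by \<open>cs\<close>, because the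
  coefficients are complex while the values live in a noncommutative ring.\<close>

definition pop :: "complex poly \<Rightarrow> 'a::complex_banach cop \<Rightarrow> 'a cop"
  where "pop p T = fold_coeffs (\<lambda>a r. cs a + T * r) p 0"

lemma pop_0 [simp]: "pop 0 T = 0"
  by (simp add: pop_def)

lemma pop_pCons: "pop (pCons a p) T = cs a + T * pop p T"
  by (cases "p = 0 \<and> a = 0") (auto simp: pop_def fold_coeffs_pCons_coeff_not_0_eq
      fold_coeffs_pCons_not_0_0_eq cs_simps)

lemma pop_const: "pop [:c:] T = cs c" and pop_1 [simp]: "pop 1 T = 1"
  by (simp_all add: pop_pCons one_pCons cs_simps)

lemma pop_add: "pop (p + q) T = pop p T + pop q T"
  by (induction p q rule: poly_induct2) (simp_all add: pop_pCons cs_simps algebra_simps)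

lemma pop_smult: "pop (Polynomial.smult c p) T = cs c * pop p T"
  by (induction p) (simp_all add: pop_pCons cs_simps(3,4) distrib_left cs_left_commute)

lemma pop_minus: "pop (- p) T = - pop p T"
  using pop_add[of p "- p" T] by (simp add: eq_neg_iff_add_eq_0 add.commute)

lemma pop_diff: "pop (p - q) T = pop p T - pop q T"
  using pop_add[of p "- q" T] by (simp add: pop_minus)

lemma pop_commute_gen:
  assumes "S * T = T * S"
  shows "S * pop p T = pop p T * S"
proof (induction p)
  case (pCons a p)
  have "S * (T * pop p T) = T * (S * pop p T)"
    by (metis assms mult.assoc)
  then show ?case
    using pCons by (simp add: pop_pCons distrib_left distrib_right cs_commute mult.assoc)
qed simp

lemma pop_mult: "pop (p * q) T = pop p T * pop q T"
  by (induction p) (simp_all add: pop_pCons pop_add pop_smult algebra_simps cs_simps)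

lemma pop_power: "pop (p ^ n) T = pop p T ^ n"
  by (induction n) (simp_all add: pop_mult)

lemma pop_sum: "pop (\<Sum>i\<in>A. p i) T = (\<Sum>i\<in>A. pop (p i) T)"
  by (induction A rule: infinite_finite_induct) (simp_all add: pop_add)

lemma pop_X [simp]: "pop [:0, 1:] T = T"
  by (simp add: pop_pCons cs_simps)

lemma pop_linear: "pop [:a, b:] T = cs a + cs b * T"
  by (simp add: pop_pCons cs_commute)

section \<open>Inverses in the ring and the resolvent\<close>

definition cop_unit :: "'a::complex_banach cop \<Rightarrow> bool"
  where "cop_unit a \<longleftrightarrow> (\<exists>b. a * b = 1 \<and> b * a = 1)"

text \<open>On non-units the choice is arbitrary; hence the \<open>cop_unit\<close> premises of the
  facts about it.\<close>

definition cop_inv :: "'a::complex_banach cop \<Rightarrow> 'a cop"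
  where "cop_inv a = (SOME b. a * b = 1 \<and> b * a = 1)"

lemma cop_inv: "cop_unit a \<Longrightarrow> a * cop_inv a = 1" "cop_unit a \<Longrightarrow> cop_inv a * a = 1"
  unfolding cop_unit_def cop_inv_def by (metis (mono_tags, lifting) someI_ex)+

lemma cop_inv_left_cancel:
  "cop_unit a \<Longrightarrow> a * (cop_inv a * b) = b" "cop_unit a \<Longrightarrow> cop_inv a * (a * b) = b"
  by (simp_all add: mult.assoc[symmetric] cop_inv)

lemma cop_inv_unique:
  assumes "a * b = 1" "b * a = 1"
  shows "cop_unit a" "cop_inv a = b"
proof -
  show u: "cop_unit a" using assms by (auto simp: cop_unit_def)
  show "cop_inv a = b"
    using cop_inv_left_cancel(2)[OF u, of b] assms by simp
qed

lemma cop_inv_commute: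
  assumes "cop_unit a" "a * b = b * a"
  shows "cop_inv a * b = b * cop_inv a"
proof -
  have "cop_inv a * b = cop_inv a * (b * (a * cop_inv a))"
    using assms by (simp add: cop_inv)
  also have "\<dots> = cop_inv a * (a * (b * cop_inv a))"
    using assms(2) by (metis mult.assoc)
  finally show ?thesis using assms(1) by (simp add: cop_inv_left_cancel)
qed

text \<open>The resolvent identity for two arbitrary units, so that it serves in the spectral
  variable z and in the homotopy parameter \<mu> alike.\<close>

lemma cop_inv_diff:
  assumes "cop_unit a" "cop_unit b"
  shows "cop_inv a - cop_inv b = cop_inv a * (b - a) * cop_inv b"
  using assms by (simp add: left_diff_distrib right_diff_distrib cop_inv cop_inv_left_cancel mult.assoc)

text \<open>Invertibility of both elements is given, so no Neumann series is summed: in the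
  resolvent identity the norm of \<open>cop_inv a\<close> occurs on both sides, with a factor at
  most 1/2 on the right, and is absorbed.\<close>

lemma norm_cop_inv_le:
  assumes "cop_unit a" "cop_unit b" "norm (b - a) * norm (cop_inv b) \<le> 1/2"
  shows "norm (cop_inv a) \<le> 2 * norm (cop_inv b)"
proof -
  have "norm (cop_inv a) \<le> norm (cop_inv b) + norm (cop_inv a - cop_inv b)"
    by norm
  also have "norm (cop_inv a - cop_inv b) \<le> norm (cop_inv a) * (norm (b - a) * norm (cop_inv b))"
    unfolding cop_inv_diff[OF assms(1,2)] mult.assoc
    by (intro order_trans[OF norm_mult_ineq] mult_left_mono norm_mult_ineq) auto
  also have "\<dots> \<le> norm (cop_inv a) * (1/2)"
    by (intro mult_left_mono assms) auto
  finally show ?thesis by simp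
qed

lemma is_inverse_op_unique: "is_inverse_op A B \<Longrightarrow> is_inverse_op A C \<Longrightarrow> B = C"
  unfolding is_inverse_op_def
proof (rule blinfun_eqI)
  fix x
  assume B: "A o\<^sub>L B = id_blinfun \<and> B o\<^sub>L A = id_blinfun"
    and C: "A o\<^sub>L C = id_blinfun \<and> C o\<^sub>L A = id_blinfun"
  have "B x = B ((A o\<^sub>L C) x)"
    using C by simp
  also have "\<dots> = (B o\<^sub>L A) (C x)"
    by simp
  finally show "B x = C x"
    using B by simp
qed

lemma inverse_op_rep_cop:
  assumes "cop_unit a"
  shows "is_inverse_op (rep_cop a) (rep_cop (cop_inv a))"
    and "inverse_op (rep_cop a) = rep_cop (cop_inv a)"
proof -
  show i: "is_inverse_op (rep_cop a) (rep_cop (cop_inv a))"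
    using cop_inv[OF assms] by (metis is_inverse_op_def rep_cop_simps(3) rep_cop_simps(6))
  then show "inverse_op (rep_cop a) = rep_cop (cop_inv a)"
    unfolding inverse_op_def by (intro the_equality is_inverse_op_unique)
qed

text \<open>The bridge to \<open>spectrum\<close> and \<open>resolvent\<close>, whose inverses range
  over real-linear operators. Complex linearity of B follows by applying B to
  \<open>c *\<^sub>C x = rep_cop a (c *\<^sub>C B x)\<close>.\<close>

lemma cop_unit_iff: "cop_unit a \<longleftrightarrow> (\<exists>B. is_inverse_op (rep_cop a) B)"
proof
  assume "\<exists>B. is_inverse_op (rep_cop a) B"
  then obtain B where B: "rep_cop a o\<^sub>L B = id_blinfun" "B o\<^sub>L rep_cop a = id_blinfun"
    by (auto simp: is_inverse_op_def)
  have "B (c *\<^sub>C x) = c *\<^sub>C B x" for c x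
  proof -
    have "c *\<^sub>C x = rep_cop a (c *\<^sub>C B x)"
      using rep_cop[of a] B(1) by (metis blinfun_apply_blinfun_compose blinfun_apply_id_blinfun
          complex_linear_def id_apply mem_Collect_eq)
    then show ?thesis
      using B(2) by (metis blinfun_apply_blinfun_compose blinfun_apply_id_blinfun id_apply)
  qed
  then obtain b where "rep_cop b = B"
    by (metis abs_cop_inverse mem_Collect_eq complex_linear_def)
  with B have "a * b = 1" "b * a = 1"
    by (simp_all flip: rep_cop_inject)
  then show "cop_unit a" by (auto simp: cop_unit_def)
qed (use inverse_op_rep_cop in blast)

lemma rep_cs_diff: "rep_cop (cs z - T) = z *\<^sub>C id_blinfun - rep_cop T"
  by (simp add: rep_cs)

lemma cop_unit_iff_spectrum: "cop_unit (cs z - T) \<longleftrightarrow> z \<notin> spectrum (rep_cop T)"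
  by (simp add: cop_unit_iff spectrum_def rep_cs_diff del: rep_cop_simps)

lemma resolvent_rep_cop: "cop_unit (cs z - T) \<Longrightarrow> resolvent z (rep_cop T) = rep_cop (cop_inv (cs z - T))"
  by (simp add: resolvent_def rep_cs_diff inverse_op_rep_cop(2)[symmetric] del: rep_cop_simps)

lemma op_power_rep_cop: "op_power (rep_cop T) n = rep_cop (T ^ n)"
  by (induction n) (simp_all add: op_power_def)

subsection \<open>The fundamental theorem of calculus off a countable set\<close>

text \<open>The right derivative \<open>s\<close> is a subgradient everywhere and hence monotone.
  The difference quotient between x and y lies between \<open>s x\<close> and \<open>s y\<close>, so
  f is differentiable wherever \<open>s\<close> is continuous, and a monotone function has only
  countably many jumps.\<close>

lemma convex_on_real_countable_nondifferentiable:
  fixes f :: "real \<Rightarrow> real"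
  assumes "convex_on UNIV f"
  shows "countable {x. \<nexists>d. (f has_real_derivative d) (at x)}"
proof -
  define s where "s x = Inf ((\<lambda>t. (f x - f t) / (x - t)) ` ({x<..} \<inter> UNIV))" for x
  have tangent: "f y \<ge> f x + s x * (y - x)" for x y
    using convex_le_Inf_differential[OF assms, of x y] by (simp add: s_def)
  have "mono s"
  proof (rule monoI)
    fix x y :: real assume "x \<le> y"
    show "s x \<le> s y"
    proof (cases "x = y")
      case False
      have "s x * (y - x) \<le> s y * (y - x)"
        using tangent[of x y] tangent[of y x] by (simp add: algebra_simps)
      with False \<open>x \<le> y\<close> show ?thesis by simp
    qed simp
  qed
  have "(f has_real_derivative s x) (at x)" if cont: "isCont s x" for x
    unfolding has_field_derivative_iff
  proof (rule LIM_I)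
    fix e :: real assume "e > 0"
    then obtain d where d: "d > 0" "\<And>y. \<bar>y - x\<bar> < d \<Longrightarrow> \<bar>s y - s x\<bar> < e"
      using cont unfolding continuous_at_eps_delta dist_real_def by meson
    have "\<bar>(f y - f x) / (y - x) - s x\<bar> < e" if "y \<noteq> x" "\<bar>y - x\<bar> < d" for y
    proof -
      \<comment> \<open>The tangent at x gives the lower bound, the tangent at y the upper
        one.\<close>
      have "0 \<le> f y - f x - s x * (y - x)" "f y - f x - s x * (y - x) \<le> (s y - s x) * (y - x)"
        using tangent[of x y] tangent[of y x] by (auto simp: algebra_simps)
      then have "\<bar>f y - f x - s x * (y - x)\<bar> \<le> \<bar>s y - s x\<bar> * \<bar>y - x\<bar>"
        by (simp add: abs_mult[symmetric])
      moreover have "(f y - f x) / (y - x) - s x = (f y - f x - s x * (y - x)) / (y - x)"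
        using \<open>y \<noteq> x\<close> by (simp add: diff_divide_distrib)
      ultimately have "\<bar>(f y - f x) / (y - x) - s x\<bar> \<le> \<bar>s y - s x\<bar>"
        using \<open>y \<noteq> x\<close> by (simp add: abs_divide divide_le_eq)
      with d(2)[OF that(2)] show ?thesis by simp
    qed
    with d(1) show "\<exists>d>0. \<forall>y. y \<noteq> x \<and> norm (y - x) < d \<longrightarrow> norm ((f y - f x) / (y - x) - s x) < e"
      by auto
  qed
  then have "{x. \<nexists>d. (f has_real_derivative d) (at x)} \<subseteq> {x. \<not> isCont s x}"
    by blast
  with mono_ctble_discont[OF \<open>mono s\<close>] show ?thesis
    using countable_subset by blast
qed

text \<open>The exceptional points are controlled by comparing the increments of \<open>f\<close> with those of a
  monotone function \<open>J\<close> that has a small jump at each of them.\<close>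

theorem fundamental_theorem_of_calculus_countable:
  fixes f :: "real \<Rightarrow> 'a::banach"
  assumes "countable S" "a \<le> b"
    and vecd: "\<And>x. x \<in> {a..b} - S \<Longrightarrow> (f has_vector_derivative f' x) (at x within {a..b})"
    and cont: "continuous_on {a..b} f"
  shows "(f' has_integral (f b - f a)) {a..b}"
proof (cases "a = b")
  case True
  then show ?thesis
    using has_integral_refl(2)[of f' b] by simp
next
  case False
  with \<open>a \<le> b\<close> have ab: "a < b" by simp
  \<comment> \<open>With the value 0 on S an exceptional tag adds nothing to the Riemann sum, so
    only the increment of f over its interval has to be small. The integral of f' is the same
    because S is a null set.\<close>
  define g where "g x = (if x \<in> S then 0 else f' x)" for x
  obtain c :: "nat \<Rightarrow> real" where c: "S \<subseteq> range c"
    using \<open>countable S\<close> by (metis empty_subsetI order_refl uncountable_def)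
  have "(g has_integral (f b - f a)) {a..b}"
    unfolding has_integral_factor_content box_real[symmetric]
  proof safe
    fix e' :: real
    assume "e' > 0"
    show "\<exists>d. gauge d \<and> (\<forall>p. p tagged_division_of (cbox a b) \<and> d fine p \<longrightarrow>
      norm ((\<Sum>(x, k)\<in>p. measure lborel k *\<^sub>R g x) - (f b - f a)) \<le> e' * measure lborel (cbox a b))"
    proof -
      define e where "e = e' / 2"
      define h where "h n = e * (b - a) * (1/2) ^ (n + 2)" for n :: nat
      have "e > 0" and h: "h n > 0" for n
        using \<open>e' > 0\<close> ab by (auto simp: e_def h_def)
      \<comment> \<open>The jump at \<open>c n\<close> is split into \<open>h n\<close> on reaching
        the point and \<open>h n\<close> just after it, so that an interval having
        \<open>c n\<close> as an endpoint still gains \<open>h n\<close>. The total mass is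
        \<open>e * (b - a)\<close> with e = e'/2, which leaves the other half of e' for the
        differentiable tags.\<close>
      define J where "J t = (\<Sum>n. h n * (of_bool (c n \<le> t) + of_bool (c n < t)))" for t
      have sumh: "summable h"
        unfolding h_def by (intro summable_mult) (simp add: summable_geometric power_add)
      have suminf_h: "suminf h = e * (b - a) / 2"
      proof -
        have "(\<lambda>n. e * (b - a) / 4 * (1/2) ^ n) sums (e * (b - a) / 4 * (1 / (1 - 1/2)))"
          by (intro sums_mult geometric_sums) simp
        moreover have "h = (\<lambda>n. e * (b - a) / 4 * (1/2) ^ n)"
          by (auto simp: h_def power_add)
        ultimately show ?thesis by (simp add: sums_iff)
      qed
      have summ: "summable (\<lambda>n. h n * (of_bool (c n \<le> t) + of_bool (c n < t)))" for t
        by (rule summable_comparison_test[OF _ summable_mult[OF sumh, of 2]])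
          (auto intro!: exI[of _ 0] simp: less_imp_le[OF h] abs_mult)
      have Jdiff: "J v - J u \<le> e * (b - a)" for u v
      proof -
        have "J v \<le> (\<Sum>n. 2 * h n)"
          unfolding J_def by (rule suminf_le[OF _ summ summable_mult[OF sumh]])
            (auto simp: less_imp_le[OF h])
        also have "\<dots> = e * (b - a)"
          using suminf_mult[OF sumh, of 2] suminf_h by simp
        finally have "J v \<le> e * (b - a)" .
        moreover have "0 \<le> J u"
          unfolding J_def by (rule suminf_nonneg[OF summ]) (auto simp: less_imp_le[OF h])
        ultimately show ?thesis by simp
      qed
      have Jmono: "J u \<le> J v" if "u \<le> v" for u v
        unfolding J_def using that
        by (intro suminf_le[OF _ summ summ] mult_left_mono) (auto simp: less_imp_le[OF h])
      have Jjump: "J u + h n \<le> J v" if "u \<le> c n" "c n \<le> v" "u < v" for u v n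
      proof -
        have "J u + h n = (\<Sum>m. h m * (of_bool (c m \<le> u) + of_bool (c m < u)) + (if m = n then h m else 0))"
          unfolding J_def
          by (subst suminf_add[OF summ, symmetric]) (auto simp: sums_iff[THEN iffD1, OF sums_single])
        also have "\<dots> \<le> J v"
          unfolding J_def
        proof (rule suminf_le[OF _ _ summ])
          fix m
          show "h m * (of_bool (c m \<le> u) + of_bool (c m < u)) + (if m = n then h m else 0)
            \<le> h m * (of_bool (c m \<le> v) + of_bool (c m < v))"
            using that h[of m] by (auto simp: algebra_simps)
        next
          show "summable (\<lambda>m. h m * (of_bool (c m \<le> u) + of_bool (c m < u)) + (if m = n then h m else 0))"
            by (intro summable_add[OF summ] sums_summable[OF sums_single])
        qed
        finally show ?thesis .
      qed
      have "\<exists>d>0. \<forall>y\<in>{a..b}. norm (y-x) < d \<longrightarrow>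
         (if x \<in> S then norm (f y - f x) \<le> h (SOME n. c n = x) / 2
          else norm (f y - f x - (y-x) *\<^sub>R f' x) \<le> e * norm (y-x))"
        if xab: "x \<in> {a..b}" for x
      proof (cases "x \<in> S")
        case True
        have "h (SOME n. c n = x) / 2 > 0" using h by simp
        then obtain d where "d > 0" "\<forall>y\<in>{a..b}. dist y x < d \<longrightarrow> dist (f y) (f x) < h (SOME n. c n = x) / 2"
          using cont xab unfolding continuous_on_iff by blast
        then show ?thesis
          using True by (intro exI[of _ d]) (auto simp: dist_norm less_imp_le)
      next
        case False
        with vecd[of x] xab \<open>e > 0\<close> show ?thesis
          unfolding has_vector_derivative_def has_derivative_within_alt by auto
      qed
      then obtain d where d0: "\<And>x. x \<in> {a..b} \<Longrightarrow> 0 < d x" and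
        d: "\<And>x y. x \<in> {a..b} \<Longrightarrow> y \<in> {a..b} \<Longrightarrow> norm (y - x) < d x \<Longrightarrow>
          (if x \<in> S then norm (f y - f x) \<le> h (SOME n. c n = x) / 2
          else norm (f y - f x - (y-x) *\<^sub>R f' x) \<le> e * norm (y-x))"
        by metis
      define d' where "d' x = (if x \<in> {a..b} then d x else 1)" for x
      show ?thesis
      proof (rule exI[of _ "\<lambda>x. ball x (d' x)"], safe)
        show "gauge (\<lambda>x. ball x (d' x))"
          using d0 by (intro gauge_ball_dependent) (auto simp: d'_def)
      next
        fix p
        assume ptag: "p tagged_division_of cbox a b" and finep: "(\<lambda>x. ball x (d' x)) fine p"
        have ba: "b - a = (\<Sum>(x,K)\<in>p. Sup K - Inf K)" "f b - f a = (\<Sum>(x,K)\<in>p. f(Sup K) - f(Inf K))"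
          "J b - J a = (\<Sum>(x,K)\<in>p. J(Sup K) - J(Inf K))"
          using additive_tagged_division_1[where f= "\<lambda>x. x"] additive_tagged_division_1[where f= f]
            additive_tagged_division_1[where f= J] \<open>a \<le> b\<close> ptag by auto
        have "norm (\<Sum>(x, K) \<in> p. (measure lborel K *\<^sub>R g x) - (f (Sup K) - f (Inf K)))
          \<le> (\<Sum>n\<in>p. case n of (x, k) \<Rightarrow> e * (Sup k - Inf k) + (J (Sup k) - J (Inf k)))"
        proof (rule sum_norm_le, safe)
          fix x K
          assume xK: "(x, K) \<in> p"
          then have "x \<in> K" and kab: "K \<subseteq> cbox a b"
            using ptag by blast+
          then obtain u v where k: "K = cbox u v"
            using ptag xK by auto
          have uv: "u \<le> x" "x \<le> v" "u \<in> {a..b}" "v \<in> {a..b}" "x \<in> {a..b}"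
            using \<open>x \<in> K\<close> kab unfolding k by auto
          then have "u \<le> v" by simp
          have "K \<subseteq> ball x (d' x)"
            using finep xK by blast
          moreover have "u \<in> K" "v \<in> K"
            using \<open>u \<le> v\<close> by (auto simp: k)
          ultimately have "u \<in> ball x (d' x)" "v \<in> ball x (d' x)"
            by blast+
          then have du: "norm (u - x) < d x" and dv: "norm (v - x) < d x"
            using uv by (auto simp: d'_def dist_real_def)
          have "norm ((v - u) *\<^sub>R g x - (f v - f u)) \<le> e * (v - u) + (J v - J u)"
          proof (cases "x \<in> S")
            case True
            then have ex: "\<exists>n. c n = x" using c by blast
            define n where "n = (SOME n. c n = x)"
            have cn: "c n = x" unfolding n_def using someI_ex[OF ex] .
            show ?thesis
            proof (cases "u = v")
              case False
              have "norm ((v - u) *\<^sub>R g x - (f v - f u)) = norm ((f u - f x) - (f v - f x))"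
                using True by (simp add: g_def norm_minus_commute)
              also have "\<dots> \<le> norm (f u - f x) + norm (f v - f x)"
                by (rule norm_triangle_ineq4)
              also have "\<dots> \<le> h n"
                using d[OF uv(5) uv(3) du] d[OF uv(5) uv(4) dv] True by (simp add: n_def)
              also have "\<dots> \<le> J v - J u"
                using Jjump[of u n v] False \<open>u \<le> v\<close> uv cn by simp
              finally show ?thesis
                using \<open>e > 0\<close> \<open>u \<le> v\<close> by (smt (verit) mult_nonneg_nonneg)
            qed simp
          next
            case False
            have "norm ((v - u) *\<^sub>R f' x - (f v - f u)) =
              norm (f u - f x - (u - x) *\<^sub>R f' x - (f v - f x - (v - x) *\<^sub>R f' x))"
              by (auto simp: algebra_simps)
            also have "\<dots> \<le> norm (f u - f x - (u - x) *\<^sub>R f' x) + norm (f v - f x - (v - x) *\<^sub>R f' x)"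
              by (rule norm_triangle_ineq4)
            also have "\<dots> \<le> e * norm (u - x) + e * norm (v - x)"
              using d[OF uv(5) uv(3) du] d[OF uv(5) uv(4) dv] False by simp
            also have "\<dots> = e * (v - u)"
              using uv by (simp add: algebra_simps)
            finally show ?thesis
              using False Jmono[OF \<open>u \<le> v\<close>] by (simp add: g_def)
          qed
          then show "norm (measure lborel K *\<^sub>R g x - (f (Sup K) - f (Inf K))) \<le>
            e * (Sup K - Inf K) + (J (Sup K) - J (Inf K))"
            using \<open>u \<le> v\<close> by (simp add: k)
        qed
        also have "\<dots> = e * (b - a) + (J b - J a)"
          by (simp add: ba split_def sum.distrib sum_distrib_left)
        also have "\<dots> \<le> e' * (b - a)"
          using Jdiff[of b a] by (simp add: e_def)
        finally show "norm ((\<Sum>(x, K)\<in>p. measure lborel K *\<^sub>R g x) - (f b - f a)) \<le> e' * measure lborel (cbox a b)"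
          using \<open>a \<le> b\<close> by (simp add: ba split_def sum_subtractf [symmetric])
      qed
    qed
  qed
  then show ?thesis
    by (rule has_integral_spike[rotated 2]) (use \<open>countable S\<close> in
      \<open>auto simp: g_def negligible_iff_null_sets intro!: null_sets_completionI countable_imp_null_set_lborel\<close>)
qed

subsection \<open>Radial functions of bounded convex domains\<close>

text \<open>The reciprocal of the Minkowski gauge of \<Omega>. At v = 0 the supremum would run over
  all reals, hence the premises v \<noteq> 0 below.\<close>

definition radial :: "complex set \<Rightarrow> complex \<Rightarrow> real"
  where "radial \<Omega> v = Sup {\<rho>. complex_of_real \<rho> * v \<in> \<Omega>}"

locale convex_domain =
  fixes \<Omega> :: "complex set"
  assumes open_dom: "open \<Omega>" and convex_dom: "convex \<Omega>" and bounded_dom: "bounded \<Omega>"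
    and zero_dom: "0 \<in> \<Omega>"
begin

lemma star: "z \<in> \<Omega> \<Longrightarrow> 0 \<le> c \<Longrightarrow> c \<le> 1 \<Longrightarrow> complex_of_real c * z \<in> \<Omega>"
  using convexD_alt[OF convex_dom zero_dom, of z c] by (simp add: scaleR_conv_of_real)

lemma bdd_above_radial:
  assumes "v \<noteq> 0"
  shows "bdd_above {\<rho>. complex_of_real \<rho> * v \<in> \<Omega>}"
proof -
  obtain B where B: "\<And>z. z \<in> \<Omega> \<Longrightarrow> cmod z \<le> B"
    using bounded_dom by (auto simp: bounded_iff)
  have "\<rho> \<le> B / cmod v" if "complex_of_real \<rho> * v \<in> \<Omega>" for \<rho>
  proof -
    have "\<rho> \<le> \<bar>\<rho>\<bar>" by simp
    also have "\<dots> \<le> B / cmod v"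
      using B[OF that] assms by (simp add: norm_mult field_simps)
    finally show ?thesis .
  qed
  then show ?thesis unfolding bdd_above_def by blast
qed

lemma mem_iff_radial:
  assumes "v \<noteq> 0" "c \<ge> 0"
  shows "complex_of_real c * v \<in> \<Omega> \<longleftrightarrow> c < radial \<Omega> v"
proof
  assume c: "complex_of_real c * v \<in> \<Omega>"
  have "open ((\<lambda>\<rho>. complex_of_real \<rho> * v) -` \<Omega>)"
    by (intro open_vimage open_dom continuous_intros)
  then obtain e where "e > 0" and e: "ball c e \<subseteq> (\<lambda>\<rho>. complex_of_real \<rho> * v) -` \<Omega>"
    using c by (metis open_contains_ball vimageI)
  then have "complex_of_real (c + e/2) * v \<in> \<Omega>"
    using subsetD[OF e, of "c + e/2"] by (auto simp: dist_real_def)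
  then have "c + e/2 \<le> radial \<Omega> v"
    unfolding radial_def by (intro cSup_upper bdd_above_radial assms) auto
  with \<open>e > 0\<close> show "c < radial \<Omega> v" by simp
next
  assume "c < radial \<Omega> v"
  then obtain \<rho> where \<rho>: "c < \<rho>" "complex_of_real \<rho> * v \<in> \<Omega>"
    unfolding radial_def
    using less_cSupD[of "{\<rho>. complex_of_real \<rho> * v \<in> \<Omega>}" c] zero_dom
    by (metis (mono_tags, lifting) empty_iff mem_Collect_eq mult_zero_left of_real_0)
  then have "complex_of_real (c / \<rho>) * (complex_of_real \<rho> * v) \<in> \<Omega>"
    using assms \<rho>(1) by (intro star[OF \<rho>(2)]) (auto simp: divide_le_eq)
  then show "complex_of_real c * v \<in> \<Omega>"
    using \<rho> assms by simp
qed

lemma radial_pos: "v \<noteq> 0 \<Longrightarrow> 0 < radial \<Omega> v"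
  using mem_iff_radial[of v 0] zero_dom by simp

lemma radial_scale:
  assumes "v \<noteq> 0" "c > 0"
  shows "radial \<Omega> (complex_of_real c * v) = radial \<Omega> v / c"
proof -
  have mem: "x < radial \<Omega> (complex_of_real c * v) \<longleftrightarrow> x < radial \<Omega> v / c" if "x \<ge> 0" for x
    using mem_iff_radial[of "complex_of_real c * v" x] mem_iff_radial[of v "x * c"] assms that
    by (simp add: field_simps mult.assoc)
  have pos: "0 < radial \<Omega> (complex_of_real c * v)" "0 < radial \<Omega> v / c"
    using assms by (auto intro!: radial_pos divide_pos_pos)
  show ?thesis
    using mem[OF less_imp_le[OF pos(1)]] mem[OF less_imp_le[OF pos(2)]] by auto
qed

text \<open>Subadditivity of the gauge. Points on the two rays, weighted by b/(a+b) and a/(a+b),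
  combine to a point on the ray of v + w; the factor c < 1 keeps them off the boundary, which does
  not belong to the open \<Omega>.\<close>

lemma radial_add:
  assumes "v \<noteq> 0" "w \<noteq> 0" "v + w \<noteq> 0"
  shows "1 / radial \<Omega> (v + w) \<le> 1 / radial \<Omega> v + 1 / radial \<Omega> w"
proof -
  define a b where "a = radial \<Omega> v" and "b = radial \<Omega> w"
  have ab: "a > 0" "b > 0" using assms by (auto simp: a_def b_def radial_pos)
  have "c * (a * b / (a + b)) \<le> radial \<Omega> (v + w)" if c: "0 < c" "c < 1" for c
  proof -
    have 1: "complex_of_real (c * a) * v \<in> \<Omega>"
      using mem_iff_radial[of v "c * a"] assms c ab by (simp add: a_def)
    have 2: "complex_of_real (c * b) * w \<in> \<Omega>"
      using mem_iff_radial[of w "c * b"] assms c ab by (simp add: b_def)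
    have sum: "b / (a + b) + a / (a + b) = 1"
      using ab by (simp add: add_divide_distrib[symmetric])
    have "(b / (a + b)) *\<^sub>R (complex_of_real (c * a) * v) + (a / (a + b)) *\<^sub>R (complex_of_real (c * b) * w) \<in> \<Omega>"
      using ab sum by (intro convexD[OF convex_dom 1 2]) auto
    also have "(b / (a + b)) *\<^sub>R (complex_of_real (c * a) * v) + (a / (a + b)) *\<^sub>R (complex_of_real (c * b) * w)
      = complex_of_real (c * (a * b / (a + b))) * (v + w)"
      by (simp add: scaleR_conv_of_real algebra_simps add_divide_distrib)
    finally show ?thesis
      using mem_iff_radial[of "v + w" "c * (a * b / (a + b))"] assms c ab by simp
  qed
  then have "a * b / (a + b) \<le> radial \<Omega> (v + w)"
    using ab by (intro field_le_mult_one_interval[of "a * b / (a + b)"]) auto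
  then have "1 / radial \<Omega> (v + w) \<le> 1 / (a * b / (a + b))"
    using ab by (intro divide_left_mono mult_pos_pos divide_pos_pos add_pos_pos radial_pos assms) auto
  also have "\<dots> = 1 / a + 1 / b"
    using ab by (simp add: field_simps)
  finally show ?thesis by (simp add: a_def b_def)
qed

text \<open>The gauge along the line that touches the unit circle at \<open>cis t\<close>, a convex
  function of the position x on this line. In this way the regularity of convex functions of one
  real variable is handed on to the polar radius.\<close>

definition kfun :: "real \<Rightarrow> real \<Rightarrow> real"
  where "kfun t x = 1 / radial \<Omega> (cis t * Complex 1 x)"

lemma kfun_nz: "cis t * Complex 1 x \<noteq> 0"
  using cis_neq_zero[of t] by (auto simp: complex_eq_iff[of "Complex 1 x"])

lemma kfun_pos: "kfun t x > 0"
  unfolding kfun_def by (intro divide_pos_pos radial_pos kfun_nz) auto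

lemma convex_kfun: "convex_on UNIV (kfun t)"
proof (rule convex_onI)
  fix a x y :: real assume a: "0 < a" "a < 1"
  define v w where "v = complex_of_real (1 - a) * (cis t * Complex 1 x)"
    and "w = complex_of_real a * (cis t * Complex 1 y)"
  have eq: "cis t * Complex 1 ((1 - a) *\<^sub>R x + a *\<^sub>R y) = v + w"
    unfolding v_def w_def by (simp add: complex_eq_iff algebra_simps)
  have nz: "v \<noteq> 0" "w \<noteq> 0" "v + w \<noteq> 0"
    using a kfun_nz unfolding eq[symmetric] by (auto simp: v_def w_def complex_eq_iff)
  have "kfun t ((1 - a) *\<^sub>R x + a *\<^sub>R y) \<le> 1 / radial \<Omega> v + 1 / radial \<Omega> w"
    unfolding kfun_def eq by (rule radial_add[OF nz])
  also have "\<dots> = (1 - a) * kfun t x + a * kfun t y"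
    using a radial_scale[OF kfun_nz, of "1 - a" t x] radial_scale[OF kfun_nz, of a t y]
    by (simp only: v_def w_def kfun_def) simp
  finally show "kfun t ((1 - a) *\<^sub>R x + a *\<^sub>R y) \<le> (1 - a) * kfun t x + a * kfun t y" .
qed simp

text \<open>Homogeneity of the gauge applied to cis t = cos (t - t0) cis t0 (1 + i tan (t - t0)),
  which is possible as long as the cosine is positive.\<close>

lemma radial_cis:
  assumes "\<bar>t - t0\<bar> < pi / 2"
  shows "radial \<Omega> (cis t) = 1 / (cos (t - t0) * kfun t0 (tan (t - t0)))"
proof -
  have c: "cos (t - t0) > 0"
    using assms unfolding abs_less_iff by (intro cos_gt_zero_pi) linarith+
  have "cis t = cis t0 * cis (t - t0)"
    by (simp add: cis_mult)
  also have "\<dots> = complex_of_real (cos (t - t0)) * (cis t0 * Complex 1 (tan (t - t0)))"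
    using c by (simp add: complex_eq_iff tan_def distrib_left right_diff_distrib)
  finally have "radial \<Omega> (cis t) = radial \<Omega> (cis t0 * Complex 1 (tan (t - t0))) / cos (t - t0)"
    using c by (simp only: radial_scale kfun_nz not_False_eq_True)
  then show ?thesis
    by (simp add: kfun_def)
qed

lemma eventually_radial_cis:
  assumes "\<bar>t - t0\<bar> < pi / 2"
  shows "eventually (\<lambda>t. 1 / (cos (t - t0) * kfun t0 (tan (t - t0))) = radial \<Omega> (cis t)) (nhds t)"
proof (rule eventually_mono)
  have "open {t. \<bar>t - t0\<bar> < pi / 2}"
    by (intro open_Collect_less continuous_intros)
  with assms show "eventually (\<lambda>t. \<bar>t - t0\<bar> < pi / 2) (nhds t)"
    using eventually_nhds by (metis (mono_tags, lifting) mem_Collect_eq)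
qed (simp add: radial_cis)

lemma continuous_radial_cis: "continuous_on UNIV (\<lambda>t. radial \<Omega> (cis t))"
  unfolding continuous_on_eq_continuous_at[OF open_UNIV]
proof
  fix t0 :: real
  have "isCont (kfun t0) 0"
    using convex_on_continuous[OF open_UNIV convex_kfun[of t0]]
    by (simp add: continuous_on_eq_continuous_at)
  moreover have "isCont (\<lambda>t. tan (t - t0)) t0"
    by (rule isCont_tan') (auto intro!: continuous_intros)
  ultimately have k: "isCont (\<lambda>t. kfun t0 (tan (t - t0))) t0"
    using isCont_o2[of t0 "\<lambda>t. tan (t - t0)" "kfun t0"] by simp
  have "isCont (\<lambda>t. 1 / (cos (t - t0) * kfun t0 (tan (t - t0)))) t0"
    using kfun_pos[of t0 0]
    by (intro isCont_divide isCont_mult k) (auto intro!: continuous_intros)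
  moreover have "\<bar>t0 - t0\<bar> < pi / 2"
    by simp
  ultimately show "isCont (\<lambda>t. radial \<Omega> (cis t)) t0"
    using isCont_cong[OF eventually_radial_cis] by blast
qed

text \<open>One tangent line sees an open half circle of directions, on which tan is injective, so
  each line contributes countably many bad angles. The lines at integer angles suffice, since t
  differs from its floor by less than 1 < \<pi>/2.\<close>

lemma countable_nondifferentiable_radial_cis:
  "countable {t. \<nexists>d. ((\<lambda>t. radial \<Omega> (cis t)) has_real_derivative d) (at t)}"
proof -
  define N where "N t0 = {x. \<nexists>d. (kfun t0 has_real_derivative d) (at x)}" for t0
  define B where "B t0 = {t. \<bar>t - t0\<bar> < pi / 2 \<and> tan (t - t0) \<in> N t0}" for t0
  have "countable (B t0)" for t0
  proof -
    have "inj_on (\<lambda>t. tan (t - t0)) (B t0)"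
    proof (rule inj_onI)
      fix x y assume "x \<in> B t0" "y \<in> B t0" and eq: "tan (x - t0) = tan (y - t0)"
      then have "- (pi/2) < x - t0" "x - t0 < pi/2" "- (pi/2) < y - t0" "y - t0 < pi/2"
        unfolding B_def mem_Collect_eq abs_less_iff by linarith+
      then have "x - t0 = y - t0"
        using eq by (metis arctan_tan)
      then show "x = y" by simp
    qed
    moreover have "countable ((\<lambda>t. tan (t - t0)) ` B t0)"
      by (rule countable_subset[of _ "N t0"]) (use convex_on_real_countable_nondifferentiable[OF convex_kfun] in \<open>auto simp: B_def N_def\<close>)
    ultimately show ?thesis
      using countable_image_inj_on by blast
  qed
  then have "countable (\<Union>n::int. B (of_int n))" by blast
  moreover have "{t. \<nexists>d. ((\<lambda>t. radial \<Omega> (cis t)) has_real_derivative d) (at t)} \<subseteq> (\<Union>n::int. B (of_int n))"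
  proof (rule subsetI, rule ccontr)
    fix t assume t: "t \<in> {t. \<nexists>d. ((\<lambda>t. radial \<Omega> (cis t)) has_real_derivative d) (at t)}"
      and "t \<notin> (\<Union>n::int. B (of_int n))"
    define t0 where "t0 = real_of_int \<lfloor>t\<rfloor>"
    have near: "\<bar>t - t0\<bar> < pi / 2"
      using pi_gt3 unfolding t0_def by linarith
    have c: "cos (t - t0) > 0"
      using near unfolding abs_less_iff by (intro cos_gt_zero_pi) linarith+
    have "t \<notin> B t0"
      using \<open>t \<notin> _\<close> unfolding t0_def by blast
    then obtain d where d: "(kfun t0 has_real_derivative d) (at (tan (t - t0)))"
      using near by (auto simp: B_def N_def)
    have "((\<lambda>t. tan (t - t0)) has_real_derivative (inverse ((cos (t - t0))\<^sup>2))) (at t)"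
      using c by (auto intro!: derivative_eq_intros)
    then have "((\<lambda>t. kfun t0 (tan (t - t0))) has_real_derivative d * inverse ((cos (t - t0))\<^sup>2)) (at t)"
      using DERIV_chain2[of "kfun t0" d "\<lambda>t. tan (t - t0)" t, OF d] by blast
    moreover have "((\<lambda>t. cos (t - t0)) has_real_derivative - sin (t - t0)) (at t)"
      by (auto intro!: derivative_eq_intros)
    ultimately have dF: "((\<lambda>t. cos (t - t0) * kfun t0 (tan (t - t0))) has_real_derivative
        - sin (t - t0) * kfun t0 (tan (t - t0)) +
        d * inverse ((cos (t - t0))\<^sup>2) * cos (t - t0)) (at t)"
      by (rule DERIV_mult[rotated])
    have "cos (t - t0) * kfun t0 (tan (t - t0)) \<noteq> 0"
      using c kfun_pos[of t0 "tan (t - t0)"] by simp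
    from DERIV_inverse_fun[OF dF this]
    obtain D where "((\<lambda>t. 1 / (cos (t - t0) * kfun t0 (tan (t - t0)))) has_real_derivative D) (at t)"
      unfolding inverse_eq_divide by blast
    then have "((\<lambda>t. radial \<Omega> (cis t)) has_real_derivative D) (at t)"
      using DERIV_cong_ev[OF refl eventually_radial_cis[OF near] refl] by blast
    with t show False by blast
  qed
  ultimately show ?thesis by (rule countable_subset[rotated])
qed

end

subsection \<open>Stolz domains\<close>

context
  fixes E :: "complex set" and u :: real
  assumes E: "finite E" "E \<subseteq> sphere 0 1" and u: "0 < u" "u < 1"
begin

lemma stolz_hull_subset: "convex hull (E \<union> ball 0 u) \<subseteq> cball 0 1"
  using E u by (intro hull_minimal) auto

lemma ball_subset_stolz: "ball 0 u \<subseteq> stolz_domain E u"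
  unfolding stolz_domain_def by (intro interior_maximal) (auto intro: hull_inc)

lemma stolz_subset_ball: "stolz_domain E u \<subseteq> ball 0 1"
  using interior_mono[OF stolz_hull_subset] by (simp add: stolz_domain_def)

lemma convex_stolz: "convex (stolz_domain E u)"
  by (simp add: stolz_domain_def)

lemma convex_domain_stolz: "convex_domain (stolz_domain E u)"
proof
  show "bounded (stolz_domain E u)"
    by (rule bounded_subset[OF bounded_ball stolz_subset_ball])
  show "0 \<in> stolz_domain E u"
    using ball_subset_stolz u by force
qed (auto simp: convex_stolz stolz_domain_def)

lemma closure_stolz: "closure (stolz_domain E u) = closure (convex hull (E \<union> ball 0 u))"
proof -
  have "interior (convex hull (E \<union> ball 0 u)) \<noteq> {}"
    using ball_subset_stolz u unfolding stolz_domain_def by force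
  then show ?thesis
    unfolding stolz_domain_def by (intro convex_closure_interior) auto
qed

lemma points_in_closure_stolz: "E \<subseteq> closure (stolz_domain E u)"
proof -
  have "E \<subseteq> convex hull (E \<union> ball 0 u)"
    by (meson Un_subset_iff hull_subset)
  then show ?thesis
    unfolding closure_stolz using closure_subset by blast
qed

lemma closure_stolz_subset: "closure (stolz_domain E u) \<subseteq> convex hull (E \<union> cball 0 u)"
  unfolding closure_stolz
proof (rule closure_minimal)
  show "convex hull (E \<union> ball 0 u) \<subseteq> convex hull (E \<union> cball 0 u)"
    by (intro hull_mono) auto
  show "closed (convex hull (E \<union> cball 0 u))"
    using E by (intro compact_imp_closed compact_convex_hull compact_Un) (auto intro: finite_imp_compact)
qed

text \<open>A segment from an interior point to a point of the closure stays in the open domain. For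
  two points of E neither end is interior; there \<open>large_enough\<close> supplies a point of the
  small disc on the segment. An edge of the hull lying on the boundary is thereby excluded.\<close>

lemma convex_stolz_points:
  assumes "large_enough E u"
  shows "convex (stolz_domain E u \<union> E)"
proof -
  have seg: "open_segment a b \<subseteq> stolz_domain E u" if "a \<in> stolz_domain E u" "b \<in> stolz_domain E u \<union> E" for a b
  proof -
    have "a \<in> interior (stolz_domain E u)"
      using that by (simp add: stolz_domain_def)
    moreover have "b \<in> closure (stolz_domain E u)"
      using that points_in_closure_stolz closure_subset by blast
    ultimately show ?thesis
      using in_interior_closure_convex_segment[OF convex_stolz] interior_subset by blast
  qed
  have segE: "open_segment a b \<subseteq> stolz_domain E u" if ab: "a \<in> E" "b \<in> E" "a \<noteq> b" for a b
  proof -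
    obtain p where p: "p \<in> closed_segment a b" "p \<in> ball 0 u"
      using assms ab by (force simp: large_enough_def)
    have pS: "p \<in> stolz_domain E u"
      using p ball_subset_stolz by blast
    have "x \<in> stolz_domain E u" if x: "x \<in> open_segment a b" for x
    proof -
      have "x \<in> closed_segment a p \<or> x \<in> closed_segment p b"
        using x p(1) Un_closed_segment[of p a b] by (auto simp: open_segment_def)
      moreover have "x \<noteq> a" "x \<noteq> b"
        using x by (auto simp: open_segment_def)
      ultimately have "x = p \<or> x \<in> open_segment p a \<or> x \<in> open_segment p b"
        by (auto simp: open_segment_def closed_segment_commute)
      moreover have "open_segment p a \<subseteq> stolz_domain E u"
        by (rule seg[OF pS]) (use ab in simp)
      moreover have "open_segment p b \<subseteq> stolz_domain E u"
        by (rule seg[OF pS]) (use ab in simp)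
      ultimately show ?thesis
        using pS by blast
    qed
    then show ?thesis by blast
  qed
  have "closed_segment a b \<subseteq> stolz_domain E u \<union> E"
    if ab: "a \<in> stolz_domain E u \<union> E" "b \<in> stolz_domain E u \<union> E" for a b
  proof (cases "a = b")
    case False
    consider "a \<in> stolz_domain E u" | "b \<in> stolz_domain E u" | "a \<in> E" "b \<in> E"
      using ab by blast
    then have "open_segment a b \<subseteq> stolz_domain E u"
    proof cases
      case 1
      then show ?thesis by (rule seg) (fact ab(2))
    next
      case 2
      have "open_segment b a \<subseteq> stolz_domain E u"
        by (rule seg[OF 2 ab(1)])
      then show ?thesis by (simp add: open_segment_commute)
    next
      case 3
      then show ?thesis by (rule segE) (fact False)
    qed
    then show ?thesis
      unfolding closed_segment_eq_open using ab by blast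
  next
    case True
    then show ?thesis using ab by simp
  qed
  then show ?thesis
    unfolding convex_contains_segment by blast
qed

text \<open>Together with \<open>closure_stolz_subset\<close>: the closure of a smaller Stolz
  domain, where the spectrum lies, meets the boundary of the larger one only in E.\<close>

lemma hull_subset_stolz_points:
  assumes "large_enough E u" "s < u"
  shows "convex hull (E \<union> cball 0 s) \<subseteq> stolz_domain E u \<union> E"
proof (rule hull_minimal)
  have "cball 0 s \<subseteq> ball 0 u"
    using \<open>s < u\<close> by auto
  then show "E \<union> cball 0 s \<subseteq> stolz_domain E u \<union> E"
    using ball_subset_stolz by blast
qed (rule convex_stolz_points[OF assms(1)])

end

text \<open>For a convex combination \<open>z\<close> of points of the closed unit disc, \<open>1 - \<bar>z\<bar>\<^sup>2\<close> dominates
  the variance of the combination.\<close>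

lemma convex_comb_variance:
  fixes z :: complex
  assumes "finite I" "\<And>i. i \<in> I \<Longrightarrow> c i \<ge> 0" "sum c I = 1" "z = (\<Sum>i\<in>I. c i *\<^sub>R p i)"
  shows "(\<Sum>i\<in>I. c i * (cmod (p i))\<^sup>2) - (cmod z)\<^sup>2 = (\<Sum>i\<in>I. c i * (cmod (p i - z))\<^sup>2)"
proof -
  have "(\<Sum>i\<in>I. c i * (cmod (p i - z))\<^sup>2) = (\<Sum>i\<in>I. c i * (cmod (p i))\<^sup>2 - 2 * ((c i *\<^sub>R p i) \<bullet> z) + c i * (cmod z)\<^sup>2)"
    by (intro sum.cong) (simp_all add: power2_norm_eq_inner inner_diff algebra_simps inner_commute)
  also have "\<dots> = (\<Sum>i\<in>I. c i * (cmod (p i))\<^sup>2) - 2 * ((\<Sum>i\<in>I. c i *\<^sub>R p i) \<bullet> z) + (cmod z)\<^sup>2"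
    using assms(3) by (simp add: sum.distrib sum_subtractf inner_sum_left sum_distrib_left sum_distrib_right[symmetric])
  also have "\<dots> = (\<Sum>i\<in>I. c i * (cmod (p i))\<^sup>2) - (cmod z)\<^sup>2"
    using assms(4) by (simp add: power2_norm_eq_inner)
  finally show ?thesis by simp
qed

lemma stolz_hull_decomp:
  assumes "finite E" "E \<noteq> {}" "u > 0" "z \<in> convex hull (E \<union> ball 0 u)"
  obtains c c0 w where "\<And>\<xi>. \<xi> \<in> E \<Longrightarrow> 0 \<le> c \<xi>" "0 \<le> c0" "sum c E + c0 = 1" "cmod w < u"
    "z = (\<Sum>\<xi>\<in>E. c \<xi> *\<^sub>R \<xi>) + c0 *\<^sub>R w"
proof -
  have "convex hull (E \<union> ball 0 u) = convex hull (convex hull E \<union> ball 0 u)"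
    by (rule hull_Un_left)
  also have "\<dots> = {u' *\<^sub>R s + v *\<^sub>R t | u' v s t. u' \<ge> 0 \<and> v \<ge> 0 \<and> u' + v = 1 \<and> s \<in> convex hull E \<and> t \<in> ball 0 u}"
    using assms by (intro convex_hull_union_two) auto
  finally obtain c1 c0 e w where c: "c1 \<ge> 0" "c0 \<ge> 0" "c1 + c0 = 1" "e \<in> convex hull E" "w \<in> ball 0 u"
    and z: "z = c1 *\<^sub>R e + c0 *\<^sub>R w"
    using assms(4) by blast
  obtain a where a: "\<forall>x\<in>E. 0 \<le> a x" "sum a E = 1" "(\<Sum>x\<in>E. a x *\<^sub>R x) = e"
    using c(4) by (auto simp: convex_hull_finite[OF assms(1)])
  show thesis
  proof (rule that[of "\<lambda>\<xi>. c1 * a \<xi>" c0 w])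
    show "z = (\<Sum>\<xi>\<in>E. (c1 * a \<xi>) *\<^sub>R \<xi>) + c0 *\<^sub>R w"
      by (simp add: z a(3)[symmetric] scaleR_sum_right)
    show "(\<Sum>\<xi>\<in>E. c1 * a \<xi>) + c0 = 1"
      using c a by (simp add: sum_distrib_left[symmetric])
  qed (use a c in auto)
qed

text \<open>The Stolz property: z approaches the circle only at points of E, and nontangentially.
  For z as a convex combination, let j be the vertex of largest weight and \<delta> the weight of
  everything else. Then |j - z| \<le> 2\<delta>, so the product is at most a constant times
  \<delta>, while the variance identity bounds 1 - |z|^2 below by \<kappa>\<delta>.\<close>

lemma stolz_prod_bound:
  assumes E: "finite E" "E \<noteq> {}" "E \<subseteq> sphere 0 1" and u: "0 < u" "u < 1"
  obtains C where "C > 0" "\<And>z. z \<in> stolz_domain E u \<Longrightarrow> (\<Prod>\<xi>\<in>E. cmod (\<xi> - z)) \<le> C * (1 - cmod z)"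
proof -
  define N where "N = card E"
  have N: "N > 0" using E by (auto simp: N_def card_gt_0_iff)
  \<comment> \<open>The inserted 1 keeps the minimum meaningful when E has a single point.\<close>
  define d where "d = Min (insert 1 ((\<lambda>(\<xi>, \<eta>). cmod (\<xi> - \<eta>)) ` (E \<times> E - Id)))"
  have d0: "d > 0"
    unfolding d_def using E by (subst Min_gr_iff) auto
  have d: "d \<le> cmod (\<xi> - \<eta>)" if "\<xi> \<in> E" "\<eta> \<in> E" "\<xi> \<noteq> \<eta>" for \<xi> \<eta>
    unfolding d_def using E that by (intro Min_le) force+
  define \<kappa> where "\<kappa> = min (1 - u\<^sup>2) (d\<^sup>2 / 2) / N"
  have \<kappa>: "\<kappa> > 0"
    using u d0 N by (auto simp: \<kappa>_def abs_square_less_1 intro!: divide_pos_pos)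
  have norm_E: "cmod \<xi> = 1" if "\<xi> \<in> E" for \<xi>
    using that E(3) by auto
  have main: "(\<Prod>\<xi>\<in>E. cmod (\<xi> - z)) \<le> 2 ^ N / \<kappa> * 2 * (1 - cmod z)" if z: "z \<in> stolz_domain E u" for z
  proof -
    have "z \<in> convex hull (E \<union> ball 0 u)"
      using z interior_subset by (auto simp: stolz_domain_def)
    then obtain c c0 w where c: "\<And>\<xi>. \<xi> \<in> E \<Longrightarrow> 0 \<le> c \<xi>" "0 \<le> c0" "sum c E + c0 = 1" "cmod w < u"
      and zc: "z = (\<Sum>\<xi>\<in>E. c \<xi> *\<^sub>R \<xi>) + c0 *\<^sub>R w"
      using stolz_hull_decomp[OF E(1,2) u(1)] by blast
    have z1: "cmod z \<le> 1"
      using stolz_subset_ball[OF E(1,3) u] z by auto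
    \<comment> \<open>The index \<open>None\<close> stands for the disc point w,
      \<open>Some \<xi>\<close> for the vertex \<xi>.\<close>
    define I where "I = insert None (Some ` E)"
    define c' where "c' = case_option c0 c"
    define p where "p = case_option w (\<lambda>\<xi>. \<xi>)"
    have sumI: "sum f I = f None + (\<Sum>\<xi>\<in>E. f (Some \<xi>))" for f :: "complex option \<Rightarrow> 'b::comm_monoid_add"
      using E unfolding I_def by (subst sum.insert) (auto simp: sum.reindex)
    have "(\<Sum>i\<in>I. c' i * (cmod (p i))\<^sup>2) - (cmod z)\<^sup>2 = (\<Sum>i\<in>I. c' i * (cmod (p i - z))\<^sup>2)"
    proof (rule convex_comb_variance)
      show "sum c' I = 1" "z = (\<Sum>i\<in>I. c' i *\<^sub>R p i)"
        using c(3) by (simp_all add: sumI c'_def p_def zc add.commute)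
    qed (use E c in \<open>auto simp: I_def c'_def\<close>)
    then have var: "c0 * (cmod w)\<^sup>2 + (\<Sum>\<xi>\<in>E. c \<xi> * (cmod \<xi>)\<^sup>2) - (cmod z)\<^sup>2
        = c0 * (cmod (w - z))\<^sup>2 + (\<Sum>\<xi>\<in>E. c \<xi> * (cmod (\<xi> - z))\<^sup>2)"
      by (simp add: sumI c'_def p_def)
    have "(\<Sum>\<xi>\<in>E. c \<xi> * (cmod \<xi>)\<^sup>2) = sum c E"
      using E(3) by (intro sum.cong) auto
    moreover have "c0 * (cmod w)\<^sup>2 \<le> c0 * u\<^sup>2"
      using c by (intro mult_left_mono power_mono) auto
    moreover have "0 \<le> c0 * (cmod (w - z))\<^sup>2"
      using c by simp
    ultimately have lower: "c0 * (1 - u\<^sup>2) + (\<Sum>\<xi>\<in>E. c \<xi> * (cmod (\<xi> - z))\<^sup>2) \<le> 1 - (cmod z)\<^sup>2"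
      using var c(3) by (simp add: right_diff_distrib)
    obtain j where j: "j \<in> E" "\<And>i. i \<in> E \<Longrightarrow> c i \<le> c j"
    proof -
      have "Max (c ` E) \<in> c ` E"
        using E by (intro Max_in) auto
      then obtain j where "j \<in> E" "c j = Max (c ` E)" by force
      with E that show thesis by simp
    qed
    define \<delta> where "\<delta> = c0 + sum c (E - {j})"
    have \<delta>1: "sum c E = c j + sum c (E - {j})"
      using E j by (simp add: sum.remove)
    have "j - z = c0 *\<^sub>R (j - w) + (\<Sum>i\<in>E - {j}. c i *\<^sub>R (j - i))"
    proof -
      have "j - z = (sum c E + c0) *\<^sub>R j - z"
        using c(3) by simp
      also have "\<dots> = c0 *\<^sub>R (j - w) + (\<Sum>i\<in>E. c i *\<^sub>R (j - i))"
        by (simp add: zc algebra_simps sum_subtractf scaleR_sum_left)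
      also have "(\<Sum>i\<in>E. c i *\<^sub>R (j - i)) = (\<Sum>i\<in>E - {j}. c i *\<^sub>R (j - i))"
        using E j by (simp add: sum.remove)
      finally show ?thesis .
    qed
    then have "cmod (j - z) \<le> c0 * cmod (j - w) + (\<Sum>i\<in>E - {j}. c i * cmod (j - i))"
      using c by (auto intro!: order_trans[OF norm_triangle_ineq] add_mono order_trans[OF norm_sum] sum_mono)
    also have "\<dots> \<le> c0 * 2 + (\<Sum>i\<in>E - {j}. c i * 2)"
    proof (intro add_mono sum_mono mult_left_mono)
      show "cmod (j - w) \<le> 2"
        using norm_E[OF j(1)] c(4) u norm_triangle_ineq4[of j w] by auto
      show "cmod (j - i) \<le> 2" if "i \<in> E - {j}" for i
        using that norm_E[of i] norm_E[OF j(1)] norm_triangle_ineq4[of j i] by auto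
    qed (use c in auto)
    also have "\<dots> = 2 * \<delta>"
      by (simp add: \<delta>_def sum_distrib_right[symmetric])
    finally have jz: "cmod (j - z) \<le> 2 * \<delta>" .
    have "(\<Prod>\<xi>\<in>E. cmod (\<xi> - z)) = cmod (j - z) * (\<Prod>\<xi>\<in>E - {j}. cmod (\<xi> - z))"
      using E j by (simp add: prod.remove)
    also have "\<dots> \<le> (2 * \<delta>) * (\<Prod>\<xi>\<in>E - {j}. 2)"
    proof (intro mult_mono prod_mono jz conjI)
      show "cmod (i - z) \<le> 2" if "i \<in> E - {j}" for i
        using that norm_E[of i] z1 norm_triangle_ineq4[of i z] by auto
      show "0 \<le> 2 * \<delta>" using jz norm_ge_zero order_trans by blast
    qed (auto intro!: prod_nonneg)
    also have "\<dots> = 2 ^ N * \<delta>"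
      using E j N by (simp add: N_def power_eq_if)
    finally have prod_le: "(\<Prod>\<xi>\<in>E. cmod (\<xi> - z)) \<le> 2 ^ N * \<delta>" .
    have \<delta>0: "\<delta> \<ge> 0" using jz norm_ge_zero[of "j - z"] by linarith
    \<comment> \<open>Pigeonhole among the N weights that make up \<delta>. A large c0 keeps z away
      from the circle because |w| < u; a large \<open>c i\<close> contributes to the variance
      because \<open>c j\<close> is at least as large and z cannot be close to both i and j.\<close>
    have "\<delta> / N \<le> c0 \<or> (\<exists>i\<in>E - {j}. \<delta> / N \<le> c i)"
    proof (rule ccontr)
      assume "\<not> ?thesis"
      then have less: "c0 < \<delta> / N" "\<And>i. i \<in> E - {j} \<Longrightarrow> c i < \<delta> / N" by (auto simp: not_le)
      have "sum c (E - {j}) \<le> (\<Sum>i\<in>E - {j}. \<delta> / N)"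
        using less(2) by (intro sum_mono) (simp add: less_imp_le)
      also have "\<dots> = (real N - 1) * (\<delta> / N)"
        using E j N by (simp add: N_def of_nat_diff)
      finally have "\<delta> < \<delta> / N + (real N - 1) * (\<delta> / N)"
        using less(1) by (simp add: \<delta>_def)
      also have "\<dots> = \<delta>" using N by (simp add: field_simps)
      finally show False by simp
    qed
    then have "\<kappa> * \<delta> \<le> 1 - (cmod z)\<^sup>2"
    proof
      assume c0: "\<delta> / N \<le> c0"
      have "\<kappa> * \<delta> = min (1 - u\<^sup>2) (d\<^sup>2 / 2) * (\<delta> / N)"
        by (simp add: \<kappa>_def)
      also have "\<dots> \<le> (1 - u\<^sup>2) * c0"
        using c0 u \<delta>0 by (intro mult_mono) (auto simp: abs_square_le_1)
      also have "\<dots> \<le> c0 * (1 - u\<^sup>2) + (\<Sum>\<xi>\<in>E. c \<xi> * (cmod (\<xi> - z))\<^sup>2)"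
        using c by (auto intro!: sum_nonneg)
      finally show ?thesis using lower by simp
    next
      assume "\<exists>i\<in>E - {j}. \<delta> / N \<le> c i"
      then obtain i where i: "i \<in> E" "i \<noteq> j" "\<delta> / N \<le> c i" by auto
      have "cmod (i - j) \<le> cmod (i - z) + cmod (j - z)"
        using norm_triangle_ineq4[of "i - z" "j - z"] by simp
      with d[OF i(1) j(1) i(2)] have "d\<^sup>2 \<le> (cmod (i - z) + cmod (j - z))\<^sup>2"
        using d0 by (intro power_mono) auto
      also have "\<dots> \<le> 2 * ((cmod (i - z))\<^sup>2 + (cmod (j - z))\<^sup>2)"
        using zero_le_power2[of "cmod (i - z) - cmod (j - z)"] by (simp add: power2_sum power2_diff)
      finally have d2: "d\<^sup>2 / 2 \<le> (cmod (i - z))\<^sup>2 + (cmod (j - z))\<^sup>2" by simp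
      have "\<kappa> * \<delta> = min (1 - u\<^sup>2) (d\<^sup>2 / 2) * (\<delta> / N)"
        by (simp add: \<kappa>_def)
      also have "\<dots> \<le> ((cmod (i - z))\<^sup>2 + (cmod (j - z))\<^sup>2) * (\<delta> / N)"
        using d2 \<delta>0 by (intro mult_right_mono) auto
      also have "\<dots> = (\<delta> / N) * (cmod (i - z))\<^sup>2 + (\<delta> / N) * (cmod (j - z))\<^sup>2"
        by (subst mult.commute) (rule distrib_left)
      also have "\<dots> \<le> c i * (cmod (i - z))\<^sup>2 + c j * (cmod (j - z))\<^sup>2"
        using i(3) j(2)[OF i(1)] by (intro add_mono mult_right_mono) auto
      also have "\<dots> = (\<Sum>\<xi>\<in>{i, j}. c \<xi> * (cmod (\<xi> - z))\<^sup>2)"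
        using i by simp
      also have "\<dots> \<le> (\<Sum>\<xi>\<in>E. c \<xi> * (cmod (\<xi> - z))\<^sup>2)"
        using E i j c by (intro sum_mono2) auto
      also have "\<dots> \<le> c0 * (1 - u\<^sup>2) + (\<Sum>\<xi>\<in>E. c \<xi> * (cmod (\<xi> - z))\<^sup>2)"
        using c u by (simp add: abs_square_le_1)
      finally show ?thesis using lower by simp
    qed
    also have "1 - (cmod z)\<^sup>2 \<le> 2 * (1 - cmod z)"
      using zero_le_power2[of "1 - cmod z"] by (simp add: power2_diff)
    finally have "2 ^ N * \<delta> \<le> 2 ^ N / \<kappa> * (2 * (1 - cmod z))"
      using \<kappa> by (simp add: pos_le_divide_eq mult_ac)
    with prod_le show ?thesis by (simp add: mult.assoc)
  qed
  show thesis
    by (rule that[of "2 ^ N / \<kappa> * 2"]) (use \<kappa> main in auto)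
qed

subsection \<open>Dunford integrals of polynomials\<close>

text \<open>The resolvent identity makes the difference of the inverses linear in
  \<open>f x - b\<close>, once \<open>norm_cop_inv_le\<close> has bounded the inverses near
  b.\<close>

lemma tendsto_cop_inv:
  assumes f: "(f \<longlongrightarrow> b) F" and u: "eventually (\<lambda>x. cop_unit (f x)) F" "cop_unit b"
  shows "((\<lambda>x. cop_inv (f x)) \<longlongrightarrow> cop_inv b) F"
proof (rule LIM_zero_cancel, rule Lim_null_comparison)
  define e where "e = 1 / (2 * (norm (cop_inv b) + 1))"
  have e: "e > 0" "e * norm (cop_inv b) \<le> 1/2"
    by (auto simp: e_def field_simps add_pos_nonneg intro!: divide_pos_pos)
  have "eventually (\<lambda>x. norm (f x - b) < e) F"
    using tendstoD[OF f e(1)] by (simp add: dist_norm)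
  with u(1) show "eventually (\<lambda>x. norm (cop_inv (f x) - cop_inv b)
      \<le> 2 * norm (cop_inv b) * (norm (f x - b) * norm (cop_inv b))) F"
  proof eventually_elim
    case (elim x)
    have "norm (f x - b) * norm (cop_inv b) \<le> e * norm (cop_inv b)"
      using elim(2) by (intro mult_right_mono) auto
    then have le: "norm (cop_inv (f x)) \<le> 2 * norm (cop_inv b)"
      using elim(1) u(2) e(2) by (intro norm_cop_inv_le) (auto simp: norm_minus_commute)
    have "norm (cop_inv (f x) - cop_inv b) \<le> norm (cop_inv (f x)) * (norm (f x - b) * norm (cop_inv b))"
      unfolding cop_inv_diff[OF elim(1) u(2)] mult.assoc norm_minus_commute[of "f x"]
      by (intro order_trans[OF norm_mult_ineq] mult_left_mono norm_mult_ineq) auto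
    also have "\<dots> \<le> 2 * norm (cop_inv b) * (norm (f x - b) * norm (cop_inv b))"
      by (intro mult_right_mono le) auto
    finally show ?case .
  qed
  show "((\<lambda>x. 2 * norm (cop_inv b) * (norm (f x - b) * norm (cop_inv b))) \<longlongrightarrow> 0) F"
    using tendsto_norm_zero[OF LIM_zero[OF f]]
    by (intro tendsto_mult_right_zero tendsto_mult_left_zero)
qed

lemma poly_antiderivative:
  fixes p :: "complex poly"
  shows "\<exists>q. pderiv q = p"
proof
  have pderiv_sum: "pderiv (\<Sum>i\<in>A. f i) = (\<Sum>i\<in>A. pderiv (f i))" for f :: "nat \<Rightarrow> complex poly" and A
    by (induction A rule: infinite_finite_induct) (simp_all add: pderiv_add)
  have "of_nat (Suc i) * (coeff p i / of_nat (Suc i)) = coeff p i" for i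
    by (simp del: of_nat_Suc)
  then show "pderiv (\<Sum>i\<le>degree p. monom (coeff p i / of_nat (Suc i)) (Suc i)) = p"
    by (simp add: pderiv_sum pderiv_monom poly_as_sum_of_monoms del: of_nat_Suc)
qed

text \<open>Since \<open>p(z) - p(T) = (z - T) H(z)\<close> with a polynomial \<open>H\<close>, the functions \<open>p(z) (z - T)\<^sup>-\<^sup>1\<close> and
  \<open>p(T) (z - T)\<^sup>-\<^sup>1\<close> differ by an exact term.\<close>

lemma pop_quotient:
  "\<exists>H \<Psi>. (\<forall>z. cs (poly p z) - pop p T = (cs z - T) * H z) \<and> continuous_on UNIV H \<and>
    (\<forall>z. (\<Psi> has_derivative (\<lambda>h. cs h * H z)) (at z))"
proof (induction p)
  case 0
  show ?case
    by (rule exI[of _ "\<lambda>_. 0"], rule exI[of _ "\<lambda>_. 0"]) (simp add: cs_simps)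
next
  case (pCons a p)
  then obtain H \<Psi> where H: "\<And>z. cs (poly p z) - pop p T = (cs z - T) * H z"
    and cont: "continuous_on UNIV H"
    and \<Psi>: "\<And>z. (\<Psi> has_derivative (\<lambda>h. cs h * H z)) (at z)" by blast
  obtain q where q: "pderiv q = p" using poly_antiderivative by blast
  show ?case
  proof (intro exI conjI allI)
    fix z
    have "T * (cs (poly p z) - pop p T) = T * ((cs z - T) * H z)"
      by (simp add: H)
    then show "cs (poly (pCons a p) z) - pop (pCons a p) T = (cs z - T) * (cs (poly p z) + T * H z)"
      by (simp add: cs_simps pop_pCons algebra_simps cs_left_commute[of T] cs_commute[of T])
    have "(poly q has_derivative (\<lambda>h. poly p z * h)) (at z)"
      using poly_DERIV[of q z] q by (simp add: has_field_derivative_def)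
    then have "((\<lambda>z. cs (poly q z) + T * \<Psi> z) has_derivative (\<lambda>h. cs (poly p z * h) + T * (cs h * H z))) (at z)"
      by (intro has_derivative_add has_derivative_mult_right \<Psi> bounded_linear.has_derivative[OF bounded_linear_cs])
    then show "((\<lambda>z. cs (poly q z) + T * \<Psi> z) has_derivative (\<lambda>h. cs h * (cs (poly p z) + T * H z))) (at z)"
      by (simp add: cs_simps(3) distrib_left cs_left_commute[of T] mult.commute[of "poly p z"])
  next
    show "continuous_on UNIV (\<lambda>z. cs (poly p z) + T * H z)"
      by (intro continuous_intros cont)
  qed
qed

section \<open>An operator logarithm as a primitive of the resolvent\<close>

context
  fixes T :: "'a::complex_banach cop"
begin

definition rinv :: "complex \<Rightarrow> real \<Rightarrow> 'a cop"
  where "rinv z \<mu> = cop_inv (cs z - \<mu> *\<^sub>R T)"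

text \<open>All of [0, c] is required because \<open>rlog\<close> integrates over it. The cut-off c
  is a parameter since at a point of E the inverse may fail to exist for \<mu> = 1, but not for
  \<mu> < 1 (\<open>in_rdom\<close>).\<close>

definition rdom :: "real \<Rightarrow> complex set"
  where "rdom c = {z. \<forall>\<mu>\<in>{0..c}. cop_unit (cs z - \<mu> *\<^sub>R T)}"

lemma rinv_inv:
  assumes "z \<in> rdom c" "\<mu> \<in> {0..c}"
  shows "(cs z - \<mu> *\<^sub>R T) * rinv z \<mu> = 1" "rinv z \<mu> * (cs z - \<mu> *\<^sub>R T) = 1"
    "cop_unit (cs z - \<mu> *\<^sub>R T)"
  using assms by (auto simp: rinv_def rdom_def cop_inv)

lemma continuous_on_rinv:
  assumes "z \<in> rdom c"
  shows "continuous_on {0..c} (rinv z)"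
  unfolding continuous_on_def rinv_def
proof
  fix \<mu> assume "\<mu> \<in> {0..c}"
  then show "((\<lambda>\<mu>. cop_inv (cs z - \<mu> *\<^sub>R T)) \<longlongrightarrow> cop_inv (cs z - \<mu> *\<^sub>R T)) (at \<mu> within {0..c})"
    using assms by (intro tendsto_cop_inv tendsto_intros)
      (auto simp: rdom_def eventually_at_filter)
qed

lemma rinv_diff_z:
  assumes "z \<in> rdom c" "w \<in> rdom c" "\<mu> \<in> {0..c}"
  shows "rinv z \<mu> - rinv w \<mu> = cs (w - z) * (rinv z \<mu> * rinv w \<mu>)"
  unfolding rinv_def using assms
  by (subst cop_inv_diff) (auto simp: rdom_def cs_simps(2)[symmetric] cs_commute[of "cop_inv _"] mult.assoc)

lemma rinv_diff_\<mu>: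
  assumes "z \<in> rdom c" "\<mu> \<in> {0..c}" "\<nu> \<in> {0..c}"
  shows "rinv z \<mu> - rinv z \<nu> = (\<mu> - \<nu>) *\<^sub>R (rinv z \<mu> * T * rinv z \<nu>)"
  unfolding rinv_def using assms
  by (subst cop_inv_diff) (auto simp: rdom_def algebra_simps)

lemma has_vector_derivative_rinv:
  assumes z: "z \<in> rdom c" "\<nu> \<in> {0..c}"
  shows "(rinv z has_vector_derivative rinv z \<nu> * T * rinv z \<nu>) (at \<nu> within {0..c})"
  unfolding has_vector_derivative_def has_derivative_within
proof (intro conjI bounded_linear_scaleR_left)
  show "((\<lambda>\<mu>. (1 / norm (\<mu> - \<nu>)) *\<^sub>R (rinv z \<mu> - (rinv z \<nu> + (\<mu> - \<nu>) *\<^sub>R (rinv z \<nu> * T * rinv z \<nu>)))) \<longlongrightarrow> 0)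
    (at \<nu> within {0..c})"
  proof (rule Lim_null_comparison)
    show "eventually (\<lambda>\<mu>. norm ((1 / norm (\<mu> - \<nu>)) *\<^sub>R (rinv z \<mu> - (rinv z \<nu> + (\<mu> - \<nu>) *\<^sub>R (rinv z \<nu> * T * rinv z \<nu>))))
      \<le> norm (rinv z \<mu> - rinv z \<nu>) * norm (T * rinv z \<nu>)) (at \<nu> within {0..c})"
      unfolding eventually_at_filter
    proof (intro always_eventually allI impI)
      fix \<mu> assume \<mu>: "\<mu> \<noteq> \<nu>" "\<mu> \<in> {0..c}"
      have "rinv z \<mu> - (rinv z \<nu> + (\<mu> - \<nu>) *\<^sub>R (rinv z \<nu> * T * rinv z \<nu>)) = (\<mu> - \<nu>) *\<^sub>R ((rinv z \<mu> - rinv z \<nu>) * (T * rinv z \<nu>))"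
        using rinv_diff_\<mu>[OF z(1) \<mu>(2) z(2)] by (simp add: algebra_simps)
      then show "norm ((1 / norm (\<mu> - \<nu>)) *\<^sub>R (rinv z \<mu> - (rinv z \<nu> + (\<mu> - \<nu>) *\<^sub>R (rinv z \<nu> * T * rinv z \<nu>))))
          \<le> norm (rinv z \<mu> - rinv z \<nu>) * norm (T * rinv z \<nu>)"
        using \<mu>(1) norm_mult_ineq[of "rinv z \<mu> - rinv z \<nu>" "T * rinv z \<nu>"] by simp
    qed
    have "(rinv z \<longlongrightarrow> rinv z \<nu>) (at \<nu> within {0..c})"
      using continuous_on_rinv[OF z(1)] z(2) by (auto simp: continuous_on_def)
    then show "((\<lambda>\<mu>. norm (rinv z \<mu> - rinv z \<nu>) * norm (T * rinv z \<nu>)) \<longlongrightarrow> 0) (at \<nu> within {0..c})"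
      by (intro tendsto_mult_left_zero tendsto_norm_zero LIM_zero)
  qed
qed

text \<open>With R for \<open>rinv z \<mu>\<close>, the function \<mu> R / z has \<mu>-derivative (R
  + \<mu> R T R) / z, and R = R (z - \<mu> T) R turns this into R^2. This closed form makes the
  z-derivative of \<open>rlog\<close> explicit.\<close>

lemma integral_rinv_sq:
  assumes z: "z \<in> rdom c" "z \<noteq> 0" "c \<ge> 0"
  shows "((\<lambda>\<mu>. rinv z \<mu> * rinv z \<mu>) has_integral cs (1 / z) * (c *\<^sub>R rinv z c)) {0..c}"
proof -
  have "((\<lambda>\<mu>. cs (1 / z) * (\<mu> *\<^sub>R rinv z \<mu>)) has_vector_derivative rinv z \<nu> * rinv z \<nu>) (at \<nu> within {0..c})"
    if \<nu>: "\<nu> \<in> {0..c}" for \<nu>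
  proof -
    have "((\<lambda>\<mu>. cs (1 / z) * (\<mu> *\<^sub>R rinv z \<mu>)) has_vector_derivative
        cs (1 / z) * (\<nu> *\<^sub>R (rinv z \<nu> * T * rinv z \<nu>) + 1 *\<^sub>R rinv z \<nu>)) (at \<nu> within {0..c})"
      by (intro has_vector_derivative_mult_right has_vector_derivative_scaleR
          has_vector_derivative_rinv[OF z(1) \<nu>] DERIV_ident)
    also have "\<nu> *\<^sub>R (rinv z \<nu> * T * rinv z \<nu>) + 1 *\<^sub>R rinv z \<nu> = cs z * (rinv z \<nu> * rinv z \<nu>)"
    proof -
      have "1 *\<^sub>R rinv z \<nu> = rinv z \<nu> * ((cs z - \<nu> *\<^sub>R T) * rinv z \<nu>)"
        by (simp add: rinv_inv[OF z(1) \<nu>])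
      then show ?thesis by (simp add: algebra_simps cs_left_commute[of "rinv z \<nu>"])
    qed
    finally show ?thesis using z(2) by (simp add: cs_cancel)
  qed
  from fundamental_theorem_of_calculus[OF z(3) this] show ?thesis by simp
qed

text \<open>For B = T and c = 1 this is formally log (1 - T/z). Later B is T times a polynomial in T
  that tames the resolvent near E.\<close>

definition rlog :: "'a cop \<Rightarrow> real \<Rightarrow> complex \<Rightarrow> 'a cop"
  where "rlog B c z = - integral {0..c} (\<lambda>\<mu>. B * rinv z \<mu>)"

lemma integrable_rinv: "z \<in> rdom c \<Longrightarrow> (\<lambda>\<mu>. B * rinv z \<mu>) integrable_on {0..c}"
  by (intro integrable_continuous_real continuous_intros continuous_on_rinv)

text \<open>Differentiation under the integral sign by a direct estimate: two uses of the resolvent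
  identity leave an error of order |z - w|^2 uniformly in \<mu>, and \<open>integral_rinv_sq\<close>
  evaluates the integral of the squares.\<close>

lemma has_derivative_rlog:
  assumes w: "w \<in> rdom c" "w \<noteq> 0" "c \<ge> 0"
  shows "(rlog B c has_derivative (\<lambda>h. cs h * (B * (cs (1 / w) * (c *\<^sub>R rinv w c))))) (at w within rdom c)"
proof -
  define D where "D = B * (cs (1 / w) * (c *\<^sub>R rinv w c))"
  have D: "((\<lambda>\<mu>. B * (rinv w \<mu> * rinv w \<mu>)) has_integral D) {0..c}"
    unfolding D_def
    by (rule has_integral_linear[OF integral_rinv_sq[OF w] bounded_linear_mult_right, unfolded o_def])
  have "compact (rinv w ` {0..c})"
    by (intro compact_continuous_image continuous_on_rinv w compact_Icc)
  then obtain M where M: "\<And>\<mu>. \<mu> \<in> {0..c} \<Longrightarrow> norm (rinv w \<mu>) \<le> M" "M > 0"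
    using bounded_pos[of "rinv w ` {0..c}"] compact_imp_bounded by (metis imageI)
  have est: "norm (rlog B c z - rlog B c w - cs (z - w) * D) \<le> c * norm B * (2 * M * M * M) * (cmod (z - w))\<^sup>2"
    if z: "z \<in> rdom c" "cmod (z - w) * M \<le> 1/2" for z
  proof -
    have "((\<lambda>\<mu>. B * rinv z \<mu> - B * rinv w \<mu> + cs (z - w) * (B * (rinv w \<mu> * rinv w \<mu>))) has_integral
        - rlog B c z - - rlog B c w + cs (z - w) * D) {0..c}"
      unfolding rlog_def minus_minus
      by (intro has_integral_add has_integral_diff integrable_integral integrable_rinv z w
         has_integral_linear[OF D bounded_linear_mult_right, unfolded o_def])
    moreover have "norm (B * rinv z \<mu> - B * rinv w \<mu> + cs (z - w) * (B * (rinv w \<mu> * rinv w \<mu>)))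
        \<le> norm B * (2 * M * M * M) * (cmod (z - w))\<^sup>2" if \<mu>: "\<mu> \<in> {0..c}" for \<mu>
    proof -
      have "norm (rinv z \<mu>) \<le> 2 * norm (rinv w \<mu>)"
        unfolding rinv_def
      proof (rule norm_cop_inv_le)
        have "norm ((cs w - \<mu> *\<^sub>R T) - (cs z - \<mu> *\<^sub>R T)) \<le> cmod (z - w)"
          using norm_cs_le[of "w - z", where 'a = 'a] by (simp add: cs_simps norm_minus_commute)
        then have "norm ((cs w - \<mu> *\<^sub>R T) - (cs z - \<mu> *\<^sub>R T)) * norm (rinv w \<mu>) \<le> cmod (z - w) * M"
          using M(1)[OF \<mu>] by (intro mult_mono) auto
        with z(2) show "norm ((cs w - \<mu> *\<^sub>R T) - (cs z - \<mu> *\<^sub>R T)) * norm (cop_inv (cs w - \<mu> *\<^sub>R T)) \<le> 1/2"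
          by (simp add: rinv_def)
      qed (use z w \<mu> rinv_inv in auto)
      with M(1)[OF \<mu>] have rz: "norm (rinv z \<mu>) \<le> 2 * M" by simp
      have "B * rinv z \<mu> - B * rinv w \<mu> + cs (z - w) * (B * (rinv w \<mu> * rinv w \<mu>))
        = B * (cs (w - z) * (rinv z \<mu> * rinv w \<mu>)) + cs (z - w) * (B * (rinv w \<mu> * rinv w \<mu>))"
        by (simp only: rinv_diff_z[OF z(1) w(1) \<mu>, symmetric] right_diff_distrib)
      also have "\<dots> = cs (w - z) * (B * ((rinv z \<mu> - rinv w \<mu>) * rinv w \<mu>))"
        by (simp add: cs_left_commute[of B] left_diff_distrib right_diff_distrib mult.assoc
            cs_simps(2)[of w z] cs_simps(2)[of z w])
      also have "\<dots> = cs ((w - z) * (w - z)) * (B * (rinv z \<mu> * rinv w \<mu> * rinv w \<mu>))"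
        by (simp add: rinv_diff_z[OF z(1) w(1) \<mu>] cs_simps(3) cs_left_commute[of B] mult.assoc)
      finally have "norm (B * rinv z \<mu> - B * rinv w \<mu> + cs (z - w) * (B * (rinv w \<mu> * rinv w \<mu>)))
        = (cmod (z - w))\<^sup>2 * norm (B * (rinv z \<mu> * rinv w \<mu> * rinv w \<mu>))"
        by (simp add: norm_cs_mult norm_mult power2_eq_square norm_minus_commute)
      also have "\<dots> \<le> (cmod (z - w))\<^sup>2 * (norm B * (2 * M * M * M))"
        using rz M(1)[OF \<mu>] M(2)
        by (intro mult_left_mono order_trans[OF norm_mult_ineq] mult_mono) auto
      finally show ?thesis by (simp only: mult.commute)
    qed
    ultimately have "norm (- rlog B c z - - rlog B c w + cs (z - w) * D)
        \<le> norm B * (2 * M * M * M) * (cmod (z - w))\<^sup>2 * measure lborel (cbox 0 c)"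
      using M(2) by (intro has_integral_bound[where f = "\<lambda>\<mu>. B * rinv z \<mu> - B * rinv w \<mu> + cs (z - w) * (B * (rinv w \<mu> * rinv w \<mu>))"]) auto
    moreover have "norm (- rlog B c z - - rlog B c w + cs (z - w) * D) = norm (rlog B c z - rlog B c w - cs (z - w) * D)"
      by (subst norm_minus_cancel[symmetric]) (simp add: algebra_simps)
    ultimately show ?thesis
      using w(3) by (simp add: mult_ac)
  qed
  define L where "L = c * norm B * (2 * M * M * M)"
  have "((\<lambda>z. (1 / norm (z - w)) *\<^sub>R (rlog B c z - (rlog B c w + cs (z - w) * D))) \<longlongrightarrow> 0) (at w within rdom c)"
  proof (rule Lim_null_comparison)
    have "eventually (\<lambda>z. cmod (z - w) < 1 / (2 * M)) (at w within rdom c)"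
      using eventually_at_ball[of "1 / (2 * M)" w "rdom c"] M(2)
      by (auto elim!: eventually_mono simp: dist_norm norm_minus_commute)
    moreover have "eventually (\<lambda>z. z \<in> rdom c \<and> z \<noteq> w) (at w within rdom c)"
      by (simp add: eventually_at_filter)
    ultimately show "eventually (\<lambda>z. norm ((1 / norm (z - w)) *\<^sub>R (rlog B c z - (rlog B c w + cs (z - w) * D))) \<le> L * cmod (z - w)) (at w within rdom c)"
    proof eventually_elim
      case (elim z)
      define X where "X = rlog B c z - rlog B c w - cs (z - w) * D"
      have "norm X \<le> L * (cmod (z - w))\<^sup>2"
        unfolding L_def X_def using elim M(2) by (intro est) (auto simp: field_simps)
      then have "norm ((1 / norm (z - w)) *\<^sub>R X) \<le> L * cmod (z - w)"
        using elim by (simp add: divide_le_eq power2_eq_square mult.assoc)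
      then show ?case by (simp only: X_def diff_diff_add)
    qed
    show "((\<lambda>z. L * cmod (z - w)) \<longlongrightarrow> 0) (at w within rdom c)"
      by (intro tendsto_mult_right_zero tendsto_norm_zero LIM_zero tendsto_ident_at)
  qed
  then show ?thesis
    unfolding has_derivative_within D_def[symmetric]
    by (intro conjI bounded_linear_mult_const[THEN bounded_linear_compose, OF _ bounded_linear_cs]
        bounded_linear_compose[OF bounded_linear_mult_left bounded_linear_cs])
qed

end

lemma countable_cis_eq: "countable {t. cis t = \<xi>}"
proof (cases "{t. cis t = \<xi>} = {}")
  case False
  then obtain t0 where t0: "cis t0 = \<xi>" by blast
  have "{t. cis t = \<xi>} \<subseteq> range (\<lambda>n::int. t0 + 2 * pi * of_int n)"
  proof
    fix t assume "t \<in> {t. cis t = \<xi>}"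
    then have "sin t = sin t0 \<and> cos t = cos t0"
      using t0 by (auto simp: complex_eq_iff)
    then show "t \<in> range (\<lambda>n::int. t0 + 2 * pi * of_int n)"
      using sin_cos_eq_iff[of t t0] by auto
  qed
  then show ?thesis
    by (rule countable_subset) simp
qed simp

lemma has_vector_derivative_cis: "(cis has_vector_derivative \<i> * cis t) (at t)"
  unfolding has_vector_derivative_complex_iff
  by (auto intro!: derivative_eq_intros simp: has_real_derivative_iff_has_vector_derivative[symmetric])

lemma rinv_eq:
  assumes "\<mu> > 0" "cop_unit (cs (z / of_real \<mu>) - T)"
  shows "cop_unit (cs z - \<mu> *\<^sub>R T)" "rinv T z \<mu> = (1 / \<mu>) *\<^sub>R cop_inv (cs (z / of_real \<mu>) - T)"
proof -
  have "cs z - \<mu> *\<^sub>R T = \<mu> *\<^sub>R (cs (z / of_real \<mu>) - T)"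
    using assms(1) cs_of_real[of \<mu> "cs (z / of_real \<mu>)"]
    by (simp add: scaleR_diff_right cs_simps(3)[symmetric])
  then show "cop_unit (cs z - \<mu> *\<^sub>R T)" "rinv T z \<mu> = (1 / \<mu>) *\<^sub>R cop_inv (cs (z / of_real \<mu>) - T)"
    using cop_inv_unique[of "cs z - \<mu> *\<^sub>R T" "(1 / \<mu>) *\<^sub>R cop_inv (cs (z / of_real \<mu>) - T)"]
      cop_inv[OF assms(2)] assms(1) by (simp_all add: rinv_def)
qed

context
  fixes E :: "complex set" and u :: real and T :: "'a::complex_banach cop"
    and Q :: "complex poly" and M :: real
  assumes E: "finite E" "E \<subseteq> sphere 0 1" and u: "0 < u" "u < 1"
    and unit: "\<And>z. z \<notin> stolz_domain E u \<union> E \<Longrightarrow> cop_unit (cs z - T)"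
    and bnd: "\<And>z. z \<notin> stolz_domain E u \<union> E \<Longrightarrow> cmod z < 2 \<Longrightarrow>
      norm (pop Q T * cop_inv (cs z - T)) \<le> M"
begin

interpretation dom: convex_domain "stolz_domain E u"
  by (rule convex_domain_stolz[OF E u])

lemma curve_props:
  defines "\<Omega> \<equiv> stolz_domain E u"
  shows "boundary_curve E u t = complex_of_real (radial \<Omega> (cis t)) * cis t"
    and "radial \<Omega> (cis t) > 0" "boundary_curve E u t \<notin> \<Omega>" "cmod (boundary_curve E u t) \<le> 1"
    "boundary_curve E u t \<noteq> 0"
proof -
  show eq: "boundary_curve E u t = complex_of_real (radial \<Omega> (cis t)) * cis t"
    by (simp add: boundary_curve_def radial_def \<Omega>_def)
  show pos: "radial \<Omega> (cis t) > 0"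
    unfolding \<Omega>_def by (intro dom.radial_pos) simp
  show "boundary_curve E u t \<notin> \<Omega>"
    using dom.mem_iff_radial[of "cis t" "radial \<Omega> (cis t)"] pos by (simp add: eq \<Omega>_def)
  have "\<not> 1 < radial \<Omega> (cis t)"
    using dom.mem_iff_radial[of "cis t" 1] stolz_subset_ball[OF E u] by (auto simp: \<Omega>_def)
  with pos show "cmod (boundary_curve E u t) \<le> 1" "boundary_curve E u t \<noteq> 0"
    by (auto simp: eq norm_mult)
qed

text \<open>Division by \<mu> moves z outwards along its ray. Were the result in the closure, z
  would lie strictly between it and the interior point 0, hence in the open domain.\<close>

lemma ray_avoids:
  assumes z: "z \<notin> stolz_domain E u" and \<mu>: "0 < \<mu>" "\<mu> < 1"
  shows "z / complex_of_real \<mu> \<notin> stolz_domain E u \<union> E"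
proof
  assume "z / complex_of_real \<mu> \<in> stolz_domain E u \<union> E"
  then have "z / complex_of_real \<mu> \<in> closure (stolz_domain E u)"
    using points_in_closure_stolz[OF E u] closure_subset by blast
  moreover have "0 \<in> interior (stolz_domain E u)"
    using dom.open_dom dom.zero_dom by (simp add: interior_open)
  ultimately have sub: "open_segment 0 (z / complex_of_real \<mu>) \<subseteq> stolz_domain E u"
    using in_interior_closure_convex_segment[OF dom.convex_dom] interior_subset by blast
  have "z \<noteq> 0" using z dom.zero_dom by auto
  then have "z \<in> open_segment 0 (z / complex_of_real \<mu>)"
    using \<mu> by (auto simp: in_segment scaleR_conv_of_real intro!: exI[of _ \<mu>])
  with sub z show False by blast
qed

lemma in_rdom:
  assumes z: "z \<notin> stolz_domain E u" and c: "c < 1 \<or> c = 1 \<and> z \<notin> E"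
  shows "z \<in> rdom T c"
  unfolding rdom_def
proof (intro CollectI ballI)
  fix \<mu> assume \<mu>: "\<mu> \<in> {0..c}"
  have "z \<noteq> 0" using z dom.zero_dom by auto
  show "cop_unit (cs z - \<mu> *\<^sub>R T)"
  proof (cases "\<mu> = 0")
    case True
    have "cs z * cs (1 / z) = (1 :: 'a cop)" "cs (1 / z) * cs z = (1 :: 'a cop)"
      using \<open>z \<noteq> 0\<close> by (simp_all add: cs_simps(3)[symmetric] cs_simps(5))
    then show ?thesis
      using True by (auto intro: cop_inv_unique(1))
  next
    case False
    have "z / complex_of_real \<mu> \<notin> stolz_domain E u \<union> E"
    proof (cases "\<mu> = 1")
      case True
      with z c \<mu> show ?thesis by auto
    next
      case False
      with \<open>\<mu> \<noteq> 0\<close> \<mu> c show ?thesis by (intro ray_avoids z) auto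
    qed
    with False \<mu> show ?thesis by (intro rinv_eq unit) auto
  qed
qed

text \<open>Since z - \<mu> T is \<mu> times z/\<mu> - T, the assumption \<open>bnd\<close> applies
  at z/\<mu>. The threshold 2/3 keeps |z/\<mu>| \<le> 3/2 inside the disc of radius 2 and bounds the
  factor 1/\<mu>.\<close>

lemma rinv_bound:
  assumes z: "z \<notin> stolz_domain E u" "cmod z \<le> 1" and \<mu>: "2/3 \<le> \<mu>" "\<mu> < 1 \<or> \<mu> = 1 \<and> z \<notin> E"
  shows "norm (T * pop Q T * rinv T z \<mu>) \<le> norm T * (3 / 2 * M)"
proof -
  have out: "z / complex_of_real \<mu> \<notin> stolz_domain E u \<union> E"
  proof (cases "\<mu> = 1")
    case True
    with z \<mu> show ?thesis by auto
  next
    case False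
    with \<mu> show ?thesis by (intro ray_avoids z) auto
  qed
  have "cmod (z / complex_of_real \<mu>) \<le> 1 / \<mu>"
    using z(2) \<mu>(1) by (simp add: norm_divide divide_right_mono)
  also have "\<dots> < 2" using \<mu>(1) by (simp add: field_simps)
  finally have "norm (pop Q T * cop_inv (cs (z / of_real \<mu>) - T)) \<le> M"
    by (rule bnd[OF out])
  then have "1 / \<mu> * norm (pop Q T * cop_inv (cs (z / of_real \<mu>) - T)) \<le> 3 / 2 * M"
    using \<mu>(1) by (intro mult_mono) (auto simp: field_simps)
  then have "norm ((1 / \<mu>) *\<^sub>R (pop Q T * cop_inv (cs (z / of_real \<mu>) - T))) \<le> 3 / 2 * M"
    using \<mu>(1) by simp
  then have "norm (T * ((1 / \<mu>) *\<^sub>R (pop Q T * cop_inv (cs (z / of_real \<mu>) - T)))) \<le> norm T * (3 / 2 * M)"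
    by (intro order_trans[OF norm_mult_ineq] mult_left_mono) auto
  then show ?thesis
    using \<mu>(1) rinv_eq(2)[OF _ unit[OF out]] by (simp add: mult.assoc)
qed

text \<open>Uniformity in z is the point: the estimate does not degenerate near E, where the
  resolvent alone may blow up.\<close>

lemma rlog_diff:
  assumes z: "z \<notin> stolz_domain E u" "cmod z \<le> 1" and b: "b < 1 \<or> b = 1 \<and> z \<notin> E"
    and a: "2/3 \<le> a" "a \<le> b"
  shows "norm (rlog T (T * pop Q T) b z - rlog T (T * pop Q T) a z) \<le> norm T * (3 / 2 * M) * (b - a)"
proof -
  let ?f = "\<lambda>\<mu>. T * pop Q T * rinv T z \<mu>"
  have zd: "z \<in> rdom T b" by (rule in_rdom[OF z(1) b])
  have "integral {0..a} ?f + integral {a..b} ?f = integral {0..b} ?f"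
    using a by (intro Henstock_Kurzweil_Integration.integral_combine integrable_rinv zd) auto
  then have "rlog T (T * pop Q T) b z - rlog T (T * pop Q T) a z = - integral {a..b} ?f"
    by (simp add: rlog_def algebra_simps)
  moreover have "norm (integral {a..b} ?f) \<le> norm T * (3 / 2 * M) * (b - a)"
  proof (rule integral_bound[OF a(2)])
    have "continuous_on {0..b} ?f"
      by (intro continuous_intros continuous_on_rinv zd)
    then show "continuous_on {a..b} ?f"
      by (rule continuous_on_subset) (use a in auto)
    show "norm (?f \<mu>) \<le> norm T * (3 / 2 * M)" if "\<mu> \<in> {a..b}" for \<mu>
      using that a b by (intro rinv_bound z) auto
  qed
  ultimately show ?thesis by simp
qed

text \<open>The primitive \<open>rlog\<close> extends continuously to the points of \<open>E\<close>, as a uniform limit.\<close>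

lemma rlog_extension:
  obtains g where "continuous_on (cball 0 1 - stolz_domain E u) g"
    "\<And>z. z \<in> cball 0 1 - stolz_domain E u - E \<Longrightarrow> g z = rlog T (T * pop Q T) 1 z"
proof -
  define V where "V = cball 0 1 - stolz_domain E u"
  \<comment> \<open>The shift by 3 starts the sequence at 2/3, the threshold of
    \<open>rlog_diff\<close>.\<close>
  define c where "c n = 1 - 1 / (real n + 3)" for n
  define F where "F n = rlog T (T * pop Q T) (c n)" for n
  define K where "K = norm T * (3 / 2 * M)"
  have c: "2/3 \<le> c n" "c n < 1" "1 - c n \<le> 1 / (real n + 1)" for n
    by (auto simp: c_def field_simps)
  have c_mono: "c n \<le> c m" if "n \<le> m" for n m
    using that by (auto simp: c_def intro!: divide_left_mono)
  have diff: "norm (F m z - F n z) \<le> K * (c m - c n)" if "z \<in> V" "n \<le> m" for z n m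
    using that c c_mono unfolding F_def K_def V_def by (intro rlog_diff) auto
  \<comment> \<open>The sign of M is not among the assumptions. It is read off from the norm
    estimate at the point 1, which belongs to V because the domain lies in the open disc.\<close>
  have K: "0 \<le> K"
  proof -
    have "0 \<le> K * (c 1 - c 0)"
    proof (rule order_trans[OF norm_ge_zero diff])
      show "1 \<in> V"
        using stolz_subset_ball[OF E u] by (auto simp: V_def)
    qed simp
    moreover have "c 1 - c 0 > 0" by (simp add: c_def)
    ultimately show ?thesis by (simp add: zero_le_mult_iff)
  qed
  have lim0: "(\<lambda>n. K * (1 / (real n + 1))) \<longlonglongrightarrow> 0"
    by (intro tendsto_mult_right_zero) (use LIMSEQ_Suc[OF lim_1_over_n[where 'a = real]] in \<open>simp add: add.commute\<close>)
  have "uniformly_convergent_on V F"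
  proof (rule Cauchy_uniformly_convergent, rule uniformly_Cauchy_onI')
    fix e :: real assume "e > 0"
    then obtain N where N: "K * (1 / (real N + 1)) < e"
      using order_tendstoD(2)[OF lim0 \<open>e > 0\<close>] by (auto simp: eventually_sequentially)
    show "\<exists>N. \<forall>z\<in>V. \<forall>m\<ge>N. \<forall>n>m. dist (F m z) (F n z) < e"
    proof (intro exI[of _ N] ballI allI impI)
      fix z m n assume "z \<in> V" "N \<le> m" "m < n"
      then have "dist (F m z) (F n z) \<le> K * (c n - c m)"
        using diff[of z m n] by (simp add: dist_norm norm_minus_commute)
      also have "\<dots> \<le> K * (1 / (real N + 1))"
        using c(2)[of n] c(3)[of N] c_mono[OF \<open>N \<le> m\<close>] by (intro mult_left_mono K) auto
      finally show "dist (F m z) (F n z) < e" using N by simp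
    qed
  qed
  then obtain g where g: "uniform_limit V F g sequentially"
    by (auto simp: uniformly_convergent_on_def)
  show thesis
  proof (rule that[of g])
    show "continuous_on (cball 0 1 - stolz_domain E u) g"
      unfolding V_def[symmetric]
    proof (rule uniform_limit_theorem[OF _ g])
      have "continuous_on V (F n)" for n
        unfolding continuous_on_eq_continuous_within
      proof
        fix z assume z: "z \<in> V"
        have sub: "V \<subseteq> rdom T (c n)"
          using in_rdom c by (auto simp: V_def)
        have "z \<noteq> 0" using z dom.zero_dom by (auto simp: V_def)
        with z sub c(1)[of n] have "(F n has_derivative
            (\<lambda>h. cs h * (T * pop Q T * (cs (1 / z) * (c n *\<^sub>R rinv T z (c n)))))) (at z within rdom T (c n))"
          unfolding F_def by (intro has_derivative_rlog) auto
        then show "continuous (at z within V) (F n)"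
          using has_derivative_continuous has_derivative_subset sub by blast
      qed
      then show "\<forall>\<^sub>F n in sequentially. continuous_on V (F n)" by simp
    qed simp
  next
    fix z assume z: "z \<in> cball 0 1 - stolz_domain E u - E"
    have "(\<lambda>n. F n z) \<longlonglongrightarrow> g z"
      using tendsto_uniform_limitI[OF g] z by (auto simp: V_def)
    moreover have "(\<lambda>n. F n z) \<longlonglongrightarrow> rlog T (T * pop Q T) 1 z"
    proof (rule LIM_zero_cancel, rule Lim_null_comparison[OF always_eventually lim0], rule allI)
      fix n
      have "norm (rlog T (T * pop Q T) 1 z - F n z) \<le> K * (1 - c n)"
        unfolding F_def K_def using z c[of n] by (intro rlog_diff) auto
      also have "\<dots> \<le> K * (1 / (real n + 1))"
        using c(3) by (intro mult_left_mono K)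
      finally show "norm (F n z - rlog T (T * pop Q T) 1 z) \<le> K * (1 / (real n + 1))"
        by (simp add: norm_minus_commute)
    qed
    ultimately show "g z = rlog T (T * pop Q T) 1 z"
      using LIMSEQ_unique by blast
  qed
qed

text \<open>The integrand has the primitive \<Phi> along the curve. Of its three terms the last two
  take the same value at both ends. In the first, ln \<rho> + i t is a branch of log \<gamma> that
  gains 2\<pi>i in one turn and so leaves 2\<pi>i Q(T). No contour is deformed.\<close>

lemma dunford_integral_pop:
  "dunford_integral E u (poly Q) (rep_cop T) = rep_cop (pop Q T)"
proof -
  define \<Omega> where "\<Omega> = stolz_domain E u"
  define \<rho> where "\<rho> t = radial \<Omega> (cis t)" for t
  define \<gamma> where "\<gamma> = boundary_curve E u"
  have \<gamma>: "\<gamma> t = complex_of_real (\<rho> t) * cis t" "\<rho> t > 0" "\<gamma> t \<in> cball 0 1 - \<Omega>" "\<gamma> t \<noteq> 0" for t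
    unfolding \<gamma>_def \<rho>_def \<Omega>_def using curve_props[of t]
    by (simp_all only: Diff_iff mem_cball dist_0_norm not_False_eq_True simp_thms)
  obtain g where g: "continuous_on (cball 0 1 - \<Omega>) g"
    "\<And>z. z \<in> cball 0 1 - \<Omega> - E \<Longrightarrow> g z = rlog T (T * pop Q T) 1 z"
    unfolding \<Omega>_def by (rule rlog_extension) (rule that[unfolded \<Omega>_def])
  obtain H \<Psi> where H: "\<And>z. cs (poly Q z) - pop Q T = (cs z - T) * H z"
    and \<Psi>: "\<And>z. (\<Psi> has_derivative (\<lambda>h. cs h * H z)) (at z)"
    using pop_quotient[of Q T] by metis
  have cont_\<rho>: "continuous_on UNIV \<rho>"
    unfolding \<rho>_def \<Omega>_def by (rule dom.continuous_radial_cis)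
  have cont_\<gamma>: "continuous_on UNIV \<gamma>"
    unfolding \<gamma>(1)[abs_def] by (intro continuous_intros cont_\<rho>)
  define \<Phi> where "\<Phi> t = pop Q T * cs (complex_of_real (ln (\<rho> t)) + \<i> * complex_of_real t)
      + g (\<gamma> t) + \<Psi> (\<gamma> t)" for t
  \<comment> \<open>The exceptional parameters: the corners of the curve and the angles at which it
    may pass through E, where the resolvent need not exist.\<close>
  define S where "S = {t. \<nexists>d. (\<rho> has_real_derivative d) (at t)} \<union> (\<Union>\<xi>\<in>E. {t. cis t = \<xi>})"
  have "countable S"
    unfolding S_def \<rho>_def \<Omega>_def using E(1)
    by (intro countable_Un countable_UN countable_cis_eq dom.countable_nondifferentiable_radial_cis)
      (simp add: countable_finite)
  define f where "f t = (poly Q (\<gamma> t) * vector_derivative \<gamma> (at t)) *\<^sub>C resolvent (\<gamma> t) (rep_cop T)" for t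
  have d\<Phi>: "((\<lambda>t. rep_cop (\<Phi> t)) has_vector_derivative f t) (at t)" if t: "t \<notin> S" for t
  proof -
    obtain \<rho>' where \<rho>': "(\<rho> has_real_derivative \<rho>') (at t)"
      using t by (auto simp: S_def)
    have E': "\<gamma> t \<notin> E"
    proof
      assume a: "\<gamma> t \<in> E"
      then have "cmod (\<gamma> t) = 1" using E by auto
      then have "\<rho> t = 1" using \<gamma>(1,2)[of t] by (simp add: norm_mult)
      with a t show False by (auto simp: S_def \<gamma>(1))
    qed
    define \<gamma>' where "\<gamma>' = complex_of_real \<rho>' * cis t + complex_of_real (\<rho> t) * (\<i> * cis t)"
    have d\<gamma>: "(\<gamma> has_vector_derivative \<gamma>') (at t)"
    proof -
      have "((\<lambda>t. complex_of_real (\<rho> t)) has_vector_derivative complex_of_real \<rho>') (at t)"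
        using \<rho>' by (intro has_vector_derivative_of_real)
          (simp add: has_real_derivative_iff_has_vector_derivative)
      from has_vector_derivative_mult[OF this has_vector_derivative_cis[of t]]
      show ?thesis unfolding \<gamma>(1)[abs_def] \<gamma>'_def by (simp add: add.commute)
    qed
    have "(\<lambda>t. complex_of_real (ln (\<rho> t)) + \<i> * complex_of_real t) = (\<lambda>t. Complex (ln (\<rho> t)) t)"
      by (auto simp: complex_eq_iff)
    moreover have "((\<lambda>t. Complex (ln (\<rho> t)) t) has_vector_derivative Complex (\<rho>' / \<rho> t) 1) (at t)"
      unfolding has_vector_derivative_complex_iff
      using \<rho>' \<gamma>(2)[of t] by (auto intro!: derivative_eq_intros)
    moreover have "Complex (\<rho>' / \<rho> t) 1 = \<gamma>' / \<gamma> t"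
    proof -
      have "\<gamma>' = Complex (\<rho>' / \<rho> t) 1 * \<gamma> t"
        using \<gamma>(2)[of t] by (simp add: \<gamma>(1) \<gamma>'_def complex_eq_iff algebra_simps)
      then show ?thesis using \<gamma>(4)[of t] by simp
    qed
    ultimately have d1: "((\<lambda>t. pop Q T * cs (complex_of_real (ln (\<rho> t)) + \<i> * complex_of_real t))
        has_vector_derivative pop Q T * cs (\<gamma>' / \<gamma> t)) (at t)"
      by (intro has_vector_derivative_mult_right bounded_linear.has_vector_derivative[OF bounded_linear_cs]) simp
    define R where "R = cop_inv (cs (\<gamma> t) - T)"
    have unit_t: "cop_unit (cs (\<gamma> t) - T)"
      using \<gamma>(3)[of t] E' by (intro unit) (auto simp: \<Omega>_def)
    have d2: "((\<lambda>t. g (\<gamma> t)) has_vector_derivative cs \<gamma>' * (T * pop Q T * (cs (1 / \<gamma> t) * R))) (at t)"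
    proof -
      define S0 where "S0 = \<gamma> -` (- E)"
      have S0: "open S0" "t \<in> S0"
        using E' open_vimage[OF open_Compl[OF finite_imp_closed[OF E(1)]] cont_\<gamma>]
        by (simp_all add: S0_def)
      have sub: "\<gamma> ` S0 \<subseteq> rdom T 1"
        using \<gamma>(3) by (auto simp: S0_def \<Omega>_def intro!: in_rdom)
      have "(rlog T (T * pop Q T) 1 has_derivative
          (\<lambda>h. cs h * (T * pop Q T * (cs (1 / \<gamma> t) * (1 *\<^sub>R rinv T (\<gamma> t) 1))))) (at (\<gamma> t) within rdom T 1)"
        using sub S0(2) \<gamma>(4) by (intro has_derivative_rlog) auto
      moreover have "rinv T (\<gamma> t) 1 = R"
        by (simp add: rinv_def R_def)
      ultimately have dR: "(rlog T (T * pop Q T) 1 has_derivative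
          (\<lambda>h. cs h * (T * pop Q T * (cs (1 / \<gamma> t) * R)))) (at (\<gamma> t) within \<gamma> ` S0)"
        using has_derivative_subset[OF _ sub] by simp
      have "(rlog T (T * pop Q T) 1 \<circ> \<gamma> has_vector_derivative
          cs \<gamma>' * (T * pop Q T * (cs (1 / \<gamma> t) * R))) (at t within S0)"
        by (rule vector_derivative_diff_chain_within[OF has_vector_derivative_at_within[OF d\<gamma>] dR])
      then have dL: "(rlog T (T * pop Q T) 1 \<circ> \<gamma> has_vector_derivative
          cs \<gamma>' * (T * pop Q T * (cs (1 / \<gamma> t) * R))) (at t)"
        by (simp only: at_within_open[OF S0(2,1)])
      have "(rlog T (T * pop Q T) 1 \<circ> \<gamma>) y = g (\<gamma> y)" if "y \<in> S0" for y
        using g(2)[of "\<gamma> y"] \<gamma>(3)[of y] that by (simp add: S0_def)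
      then show ?thesis
        by (rule has_vector_derivative_transform_within_open[OF dL S0])
    qed
    have d3: "((\<lambda>t. \<Psi> (\<gamma> t)) has_vector_derivative cs \<gamma>' * H (\<gamma> t)) (at t)"
      using vector_derivative_diff_chain_within[OF d\<gamma> has_derivative_at_withinI[OF \<Psi>[of "\<gamma> t"]]]
      by (simp add: o_def)
    have "(\<Phi> has_vector_derivative pop Q T * cs (\<gamma>' / \<gamma> t) +
        cs \<gamma>' * (T * pop Q T * (cs (1 / \<gamma> t) * R)) + cs \<gamma>' * H (\<gamma> t)) (at t)"
      unfolding \<Phi>_def[abs_def] by (intro has_vector_derivative_add d1 d2 d3)
    \<comment> \<open>Up to the factor \<gamma>', the first two terms combine by (1 + T R) /
      \<gamma> = R to Q(T) R, and the third adds H = Q(\<gamma>) R - Q(T) R.\<close>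
    also have "pop Q T * cs (\<gamma>' / \<gamma> t) + cs \<gamma>' * (T * pop Q T * (cs (1 / \<gamma> t) * R)) + cs \<gamma>' * H (\<gamma> t)
      = cs (poly Q (\<gamma> t) * \<gamma>') * R"
    proof -
      have comm: "T * pop Q T = pop Q T * T"
        using pop_commute_gen[of T T Q] by simp
      have RH: "R * cs (poly Q (\<gamma> t)) - R * pop Q T = H (\<gamma> t)"
        using cop_inv_left_cancel(2)[OF unit_t, of "H (\<gamma> t)"]
        by (simp add: R_def right_diff_distrib[symmetric] H[symmetric])
      have R1: "cs (\<gamma> t) * R = 1 + T * R"
        using cop_inv(1)[OF unit_t] by (simp add: R_def left_diff_distrib algebra_simps)
      have Rcomm: "R * pop Q T = pop Q T * R"
        unfolding R_def by (rule cop_inv_commute[OF unit_t])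
          (simp add: left_diff_distrib right_diff_distrib comm cs_commute[of "pop Q T"])
      have "pop Q T * cs (\<gamma>' / \<gamma> t) + cs \<gamma>' * (T * pop Q T * (cs (1 / \<gamma> t) * R))
        = cs (\<gamma>' / \<gamma> t) * (pop Q T * (1 + T * R))"
      proof -
        have "cs \<gamma>' * (T * pop Q T * (cs (1 / \<gamma> t) * R)) = (cs \<gamma>' * cs (1 / \<gamma> t)) * (T * pop Q T * R)"
          by (simp only: cs_left_commute[of "T * pop Q T"] mult.assoc[of "cs _"])
        also have "\<dots> = cs (\<gamma>' / \<gamma> t) * (pop Q T * (T * R))"
          by (simp add: cs_simps(3)[symmetric] comm mult.assoc)
        finally show ?thesis
          by (simp add: cs_commute[of "pop Q T"] distrib_left)
      qed
      also have "\<dots> = (cs (\<gamma>' / \<gamma> t) * cs (\<gamma> t)) * (pop Q T * R)"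
        by (simp add: R1[symmetric] cs_left_commute[of "pop Q T"] mult.assoc)
      also have "\<dots> = cs \<gamma>' * (pop Q T * R)"
        using \<gamma>(4)[of t] by (simp add: cs_simps(3)[symmetric])
      finally have "pop Q T * cs (\<gamma>' / \<gamma> t) + cs \<gamma>' * (T * pop Q T * (cs (1 / \<gamma> t) * R)) + cs \<gamma>' * H (\<gamma> t)
        = cs \<gamma>' * (R * cs (poly Q (\<gamma> t)))"
        by (simp add: RH[symmetric] Rcomm right_diff_distrib)
      then show ?thesis
        by (simp add: cs_commute[of R] cs_simps(3) mult.assoc[symmetric] mult.commute[of "poly Q (\<gamma> t)"])
    qed
    finally have "((\<lambda>t. rep_cop (\<Phi> t)) has_vector_derivative rep_cop (cs (poly Q (\<gamma> t) * \<gamma>') * R)) (at t)"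
      by (rule bounded_linear.has_vector_derivative[OF bounded_linear_rep_cop])
    then show ?thesis
      by (simp only: rep_cs f_def resolvent_rep_cop[OF unit_t] R_def vector_derivative_at[OF d\<gamma>])
  qed
  have "(f has_integral (rep_cop (\<Phi> (2 * pi)) - rep_cop (\<Phi> 0))) {0..2 * pi}"
  proof (rule fundamental_theorem_of_calculus_countable[OF \<open>countable S\<close>])
    have "continuous_on {0..2 * pi} \<Phi>"
      unfolding \<Phi>_def
    proof (intro continuous_intros)
      show "continuous_on {0..2 * pi} \<rho>"
        using cont_\<rho> continuous_on_subset by blast
      show "\<forall>x\<in>{0..2 * pi}. \<rho> x \<noteq> 0"
        using \<gamma>(2) less_imp_neq by metis
      show "continuous_on {0..2 * pi} (\<lambda>x. g (\<gamma> x))"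
        by (rule continuous_on_compose2[OF g(1) continuous_on_subset[OF cont_\<gamma>]]) (use \<gamma>(3) in auto)
      have "continuous_on UNIV \<Psi>"
        using has_derivative_continuous[OF \<Psi>] by (simp add: continuous_on_eq_continuous_within)
      then show "continuous_on {0..2 * pi} (\<lambda>x. \<Psi> (\<gamma> x))"
        by (rule continuous_on_compose2[OF _ continuous_on_subset[OF cont_\<gamma>]]) auto
    qed
    then show "continuous_on {0..2 * pi} (\<lambda>t. rep_cop (\<Phi> t))"
      by (rule bounded_linear.continuous_on[OF bounded_linear_rep_cop])
    show "((\<lambda>t. rep_cop (\<Phi> t)) has_vector_derivative f t) (at t within {0..2 * pi})"
      if "t \<in> {0..2 * pi} - S" for t
      using that by (intro has_vector_derivative_at_within[OF d\<Phi>]) simp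
  qed simp
  moreover have "rep_cop (\<Phi> (2 * pi)) - rep_cop (\<Phi> 0) = (2 * complex_of_real pi * \<i>) *\<^sub>C rep_cop (pop Q T)"
  proof -
    have "cis (2 * pi) = cis 0" by (simp add: complex_eq_iff)
    then have eq: "\<rho> (2 * pi) = \<rho> 0" "\<gamma> (2 * pi) = \<gamma> 0"
      by (simp_all only: \<rho>_def \<gamma>(1))
    have "\<Phi> (2 * pi) - \<Phi> 0 = cs (2 * complex_of_real pi * \<i>) * pop Q T"
      unfolding \<Phi>_def eq by (simp add: cs_simps(1,4) distrib_left cs_commute[of "pop Q T"] mult_ac)
    then have "rep_cop (\<Phi> (2 * pi) - \<Phi> 0) = rep_cop (cs (2 * complex_of_real pi * \<i>) * pop Q T)"
      by (rule arg_cong)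
    then show ?thesis
      unfolding rep_cs rep_cop_simps(2) .
  qed
  ultimately have "integral {0..2 * pi} f = (2 * complex_of_real pi * \<i>) *\<^sub>C rep_cop (pop Q T)"
    by (simp add: integral_unique)
  moreover have "dunford_integral E u (poly Q) (rep_cop T) =
      (1 / (2 * complex_of_real pi * \<i>)) *\<^sub>C integral {0..2 * pi} f"
    unfolding dunford_integral_def \<gamma>_def f_def[abs_def] ..
  moreover have "1 / (2 * complex_of_real pi * \<i>) * (2 * complex_of_real pi * \<i>) = 1"
    by simp
  ultimately show ?thesis
    by (simp only: scaleC_scaleC scaleC_one)
qed

end

section \<open>The functional calculus on polynomials vanishing on E\<close>

lemma prod_linear_dvd:
  fixes Q :: "complex poly"
  assumes "finite E" "\<And>\<xi>. \<xi> \<in> E \<Longrightarrow> poly Q \<xi> = 0"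
  shows "(\<Prod>\<xi>\<in>E. [:\<xi>, - 1:]) dvd Q"
  using assms
proof (induction E)
  case (insert \<xi> E)
  then obtain R where R: "Q = (\<Prod>\<xi>\<in>E. [:\<xi>, - 1:]) * R" by (auto elim: dvdE)
  have "poly (\<Prod>\<xi>\<in>E. [:\<xi>, - 1:]) \<xi> \<noteq> 0"
    using insert.hyps by (auto simp: poly_prod)
  then have "poly R \<xi> = 0"
    using insert.prems[of \<xi>] R by simp
  then have "[:- \<xi>, 1:] dvd R"
    by (simp add: poly_eq_0_iff_dvd)
  then have "- [:- \<xi>, 1:] dvd R"
    by (simp only: minus_dvd_iff)
  then have "[:\<xi>, - 1:] dvd R" by simp
  then have "[:\<xi>, - 1:] * (\<Prod>\<xi>\<in>E. [:\<xi>, - 1:]) dvd R * (\<Prod>\<xi>\<in>E. [:\<xi>, - 1:])"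
    by (rule mult_dvd_mono) simp
  then show ?case
    by (simp only: prod.insert[OF insert.hyps] R mult.commute[of _ R])
qed simp

lemma large_enough_mono: "large_enough E r \<Longrightarrow> r \<le> u \<Longrightarrow> large_enough E u"
  unfolding large_enough_def using subset_ball[of r u "0::complex"] by blast

lemma bounded_poly_cball: obtains C where "C > 0" "\<And>z. cmod z \<le> R \<Longrightarrow> cmod (poly p z) \<le> C"
proof -
  have "compact (poly p ` cball 0 R)"
    by (intro compact_continuous_image continuous_intros) auto
  then obtain C where "C > 0" "\<And>x. x \<in> poly p ` cball 0 R \<Longrightarrow> cmod x \<le> C"
    using compact_imp_bounded bounded_pos by metis
  then show thesis by (intro that[of C]) auto
qed

text \<open>Every later use of the calculus goes through this form. A polynomial vanishing on E is
  divisible by the product P of the factors \<xi> - z. This gives membership in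
  \<open>H0_inf\<close> with all exponents 1. It also bounds Q(T) R(z,T) off the contour domain:
  P(T) R(z,T) is P(z) R(z,T), which the type hypothesis controls, minus the continuous function
  H.\<close>

lemma poly_calculus_bound:
  fixes T :: "'a::complex_banach cop"
  assumes E: "finite E" "E \<subseteq> sphere 0 1" and s: "s < 1"
    and calc: "bounded_H_inf_calculus E s (rep_cop T)"
  obtains K where "K > 0"
    "\<And>Q B. (\<And>\<xi>. \<xi> \<in> E \<Longrightarrow> poly Q \<xi> = 0) \<Longrightarrow> (\<And>z. z \<in> stolz_domain E s \<Longrightarrow> cmod (poly Q z) \<le> B) \<Longrightarrow>
      norm (pop Q T) \<le> K * B"
proof -
  obtain r0 where r0: "r0 < s" "of_type E r0 (rep_cop T)"
    using calc by (auto simp: bounded_H_inf_calculus_def of_type_less_def)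
  obtain K where K: "K \<ge> 1" "\<And>\<phi>. \<phi> \<in> H0_inf E s \<Longrightarrow>
      norm (fun_calc E s \<phi> (rep_cop T)) \<le> K * sup_norm_on (stolz_domain E s) \<phi>"
    using calc by (auto simp: bounded_H_inf_calculus_def)
  \<comment> \<open>The very contour that \<open>fun_calc\<close> picks; only the two properties in
    its choice are available.\<close>
  define u where "u = (SOME u. u < s \<and> of_type_less E u (rep_cop T))"
  have "\<exists>u. u < s \<and> of_type_less E u (rep_cop T)"
    using r0 by (intro exI[of _ "(r0 + s) / 2"]) (auto simp: of_type_less_def intro!: exI[of _ r0])
  then have u_props: "u < s" "of_type_less E u (rep_cop T)"
    unfolding u_def by (metis (mono_tags, lifting) someI_ex)+
  then obtain r where r: "r < u" "of_type E r (rep_cop T)"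
    by (auto simp: of_type_less_def)
  have r_props: "0 < r" "r < 1" "large_enough E r" "spectrum (rep_cop T) \<subseteq> closure (stolz_domain E r)"
    using r(2) by (auto simp: of_type_def)
  have u: "0 < u" "u < 1" and s0: "0 < s"
    using r r_props u_props s by auto
  have large: "large_enough E u"
    using large_enough_mono[OF r_props(3)] r by simp
  have sub: "closure (stolz_domain E t) \<subseteq> stolz_domain E u \<union> E" if "0 < t" "t < u" for t
    using closure_stolz_subset[OF E that(1)] hull_subset_stolz_points[OF E u large that(2)] that u by auto
  have unit: "cop_unit (cs z - T)" if "z \<notin> stolz_domain E u \<union> E" for z
    using that sub[OF r_props(1) r(1)] r_props(4) by (auto simp: cop_unit_iff_spectrum)
  \<comment> \<open>t > r makes the type bound available off the closure of
    \<open>stolz_domain E t\<close>, and t < u puts this closure into the union of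
    \<open>stolz_domain E u\<close> and E.\<close>
  define t where "t = (r + u) / 2"
  have t: "r < t" "t < u" "0 < t" "t < 1" using r u r_props by (auto simp: t_def)
  then have "bounded ((\<lambda>z. (\<Prod>\<xi>\<in>E. \<xi> - z) *\<^sub>C resolvent z (rep_cop T)) ` (ball 0 2 - closure (stolz_domain E t)))"
    using r(2) by (simp add: of_type_def)
  then obtain b where b: "\<And>z. z \<in> ball 0 2 \<Longrightarrow> z \<notin> closure (stolz_domain E t) \<Longrightarrow>
      norm ((\<Prod>\<xi>\<in>E. \<xi> - z) *\<^sub>C resolvent z (rep_cop T)) \<le> b"
    unfolding bounded_iff by blast
  define P where "P = (\<Prod>\<xi>\<in>E. [:\<xi>, - 1:])"
  have poly_P: "poly P z = (\<Prod>\<xi>\<in>E. \<xi> - z)" for z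
    by (simp add: P_def poly_prod)
  obtain H \<Psi> where H: "\<And>z. cs (poly P z) - pop P T = (cs z - T) * H z" "continuous_on UNIV H"
    using pop_quotient[of P T] by metis
  have "compact (H ` cball 0 2)"
    by (intro compact_continuous_image continuous_on_subset[OF H(2)]) auto
  then have "bounded (H ` cball 0 2)"
    by (rule compact_imp_bounded)
  then obtain h where h: "\<And>z. z \<in> cball 0 2 \<Longrightarrow> norm (H z) \<le> h"
    unfolding bounded_iff by blast
  have P_bound: "norm (pop P T * cop_inv (cs z - T)) \<le> b + h"
    if z: "z \<notin> stolz_domain E u \<union> E" "cmod z < 2" for z
  proof -
    note un = unit[OF z(1)]
    have "pop P T * cop_inv (cs z - T) = cop_inv (cs z - T) * pop P T"
      by (rule cop_inv_commute[OF un, symmetric])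
        (simp add: left_diff_distrib right_diff_distrib cs_commute[of "pop P T"] pop_commute_gen[of T T P])
    also have "\<dots> = cop_inv (cs z - T) * cs (poly P z) - cop_inv (cs z - T) * (cs (poly P z) - pop P T)"
      by (simp add: right_diff_distrib)
    also have "\<dots> = cs (poly P z) * cop_inv (cs z - T) - H z"
      by (simp only: H(1) cop_inv_left_cancel[OF un] cs_commute[of "cop_inv _"])
    finally have "norm (pop P T * cop_inv (cs z - T)) \<le> norm (cs (poly P z) * cop_inv (cs z - T)) + norm (H z)"
      by (simp add: norm_triangle_ineq4)
    also have "norm (cs (poly P z) * cop_inv (cs z - T)) = norm ((\<Prod>\<xi>\<in>E. \<xi> - z) *\<^sub>C resolvent z (rep_cop T))"
      by (simp add: norm_cs_mult norm_scaleC resolvent_rep_cop[OF un] poly_P)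
    also have "\<dots> \<le> b"
      using z sub[OF t(3,2)] by (intro b) auto
    also have "norm (H z) \<le> h" using z by (intro h) auto
    finally show ?thesis by simp
  qed
  show thesis
  proof (rule that[of K])
    fix Q B
    assume Q0: "\<And>\<xi>. \<xi> \<in> E \<Longrightarrow> poly Q \<xi> = 0" and B: "\<And>z. z \<in> stolz_domain E s \<Longrightarrow> cmod (poly Q z) \<le> B"
    obtain Q' where Q': "Q = Q' * P"
      using prod_linear_dvd[OF E(1) Q0] unfolding P_def by (metis dvdE mult.commute)
    have "dunford_integral E u (poly Q) (rep_cop T) = rep_cop (pop Q T)"
    proof (rule dunford_integral_pop[OF E u unit])
      fix z assume z: "z \<notin> stolz_domain E u \<union> E" "cmod z < 2"
      have "norm (pop Q T * cop_inv (cs z - T)) = norm (pop Q' T * (pop P T * cop_inv (cs z - T)))"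
        by (simp add: Q' pop_mult mult.assoc)
      also have "\<dots> \<le> norm (pop Q' T) * (b + h)"
        by (intro order_trans[OF norm_mult_ineq] mult_left_mono P_bound z) auto
      finally show "norm (pop Q T * cop_inv (cs z - T)) \<le> norm (pop Q' T) * (b + h)" .
    qed
    then have fc: "fun_calc E s (poly Q) (rep_cop T) = rep_cop (pop Q T)"
      by (simp add: fun_calc_def u_def)
    have disc: "cmod z \<le> 1" if "z \<in> stolz_domain E s" for z
      using stolz_subset_ball[OF E s0 s] that by auto
    have "poly Q \<in> H0_inf E s"
      unfolding H0_inf_def mem_Collect_eq
    proof (intro conjI)
      show "poly Q holomorphic_on stolz_domain E s"
        by (intro holomorphic_intros)
      show "bounded (poly Q ` stolz_domain E s)"
        using B by (auto simp: bounded_iff)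
      obtain C where C: "C > 0" "\<And>z. cmod z \<le> 1 \<Longrightarrow> cmod (poly Q' z) \<le> C"
        by (rule bounded_poly_cball[of 1 Q']) (rule that)
      show "\<exists>C>0. \<exists>\<sigma>. (\<forall>\<xi>\<in>E. \<sigma> \<xi> > 0) \<and>
          (\<forall>z\<in>stolz_domain E s. cmod (poly Q z) \<le> C * (\<Prod>\<xi>\<in>E. cmod (\<xi> - z) powr \<sigma> \<xi>))"
        using C disc
        by (intro exI[of _ C] conjI exI[of _ "\<lambda>_. 1"])
          (auto simp: Q' poly_P norm_mult prod_norm intro!: mult_right_mono)
    qed
    from K(2)[OF this] have "norm (pop Q T) \<le> K * sup_norm_on (stolz_domain E s) (poly Q)"
      by (simp add: fc)
    also have "\<dots> \<le> K * B"
    proof (rule mult_left_mono)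
      have "stolz_domain E s \<noteq> {}"
        using ball_subset_stolz[OF E s0 s] s0 by fastforce
      then show "sup_norm_on (stolz_domain E s) (poly Q) \<le> B"
        unfolding sup_norm_on_def using B by (intro cSUP_least) auto
    qed (use K in simp)
    finally show "norm (pop Q T) \<le> K * B" .
  qed (use K in simp)
qed

subsection \<open>Balakrishnan powers as limits of polynomials\<close>

text \<open>Needed for the half-line integral in \<open>balakrishnan\<close>. The limit at 0
  continues the primitive as a constant to the left, which gives a continuous primitive on the whole
  line with 0 as the only exceptional point; the limit at infinity then evaluates the improper
  integral.\<close>

lemma has_integral_improper_Ioi:
  fixes f :: "real \<Rightarrow> 'a::banach"
  assumes deriv: "\<And>x. x > 0 \<Longrightarrow> (\<Phi> has_vector_derivative f x) (at x)"
    and L0: "(\<Phi> \<longlongrightarrow> L0) (at_right 0)" and L1: "(\<Phi> \<longlongrightarrow> L1) at_top"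
  shows "(f has_integral (L1 - L0)) {0<..}"
proof -
  define \<Phi>' where "\<Phi>' x = (if x \<le> 0 then L0 else \<Phi> x)" for x
  define g where "g x = (if x \<in> {0<..} then f x else 0)" for x
  have d_pos: "(\<Phi>' has_vector_derivative g x) (at x)" if "x > 0" for x
  proof -
    have "(\<Phi> has_vector_derivative g x) (at x)"
      using deriv[OF that] that by (simp add: g_def)
    from has_vector_derivative_transform_within_open[OF this, of "{0<..}" \<Phi>'] show ?thesis
      using that by (simp add: \<Phi>'_def)
  qed
  have d_neg: "(\<Phi>' has_vector_derivative g x) (at x)" if "x < 0" for x
    using has_vector_derivative_transform_within_open[OF has_vector_derivative_const[of L0 "at x"], of "{..<0}" \<Phi>']
      that by (simp add: \<Phi>'_def g_def)
  have deriv': "(\<Phi>' has_vector_derivative g x) (at x)" if "x \<noteq> 0" for x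
    using that d_pos d_neg by (cases "x > 0") auto
  have "isCont \<Phi>' 0"
    unfolding continuous_at_split
  proof
    have "eventually (\<lambda>x. \<Phi> x = \<Phi>' x) (at_right 0)"
      by (auto simp: eventually_at_filter \<Phi>'_def)
    then have "(\<Phi>' \<longlongrightarrow> L0) (at_right 0)"
      using L0 tendsto_cong by blast
    then show "continuous (at_right 0) \<Phi>'"
      by (simp add: continuous_within \<Phi>'_def)
    have "eventually (\<lambda>x. L0 = \<Phi>' x) (at_left 0)"
      by (auto simp: eventually_at_filter \<Phi>'_def)
    then have "(\<Phi>' \<longlongrightarrow> L0) (at_left 0)"
      by (rule Lim_transform_eventually[OF tendsto_const])
    then show "continuous (at_left 0) \<Phi>'"
      by (simp add: continuous_within \<Phi>'_def)
  qed
  then have cont: "isCont \<Phi>' x" for x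
    using deriv'[of x] has_vector_derivative_continuous by (cases "x = 0") auto
  have int: "(g has_integral (\<Phi>' b - \<Phi>' a)) {a..b}" if "a \<le> b" for a b
    by (rule fundamental_theorem_of_calculus_interior_strong[of "{0}"])
      (use that deriv' cont in \<open>auto intro: continuous_at_imp_continuous_on\<close>)
  show ?thesis
    unfolding has_integral_alt'[of f] g_def[symmetric]
  proof (intro conjI allI impI)
    show "g integrable_on cbox a b" for a b
      using int[of a b] by (cases "a \<le> b") (auto simp: integrable_on_def)
    fix e :: real assume "e > 0"
    then have "eventually (\<lambda>x. dist (\<Phi> x) L1 < e) at_top"
      by (rule tendstoD[OF L1])
    then obtain B where B: "\<And>x. x \<ge> B \<Longrightarrow> dist (\<Phi> x) L1 < e"
      by (auto simp: eventually_at_top_linorder)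
    show "\<exists>B>0. \<forall>a b. ball 0 B \<subseteq> cbox a b \<longrightarrow> norm (integral (cbox a b) g - (L1 - L0)) < e"
    proof (intro exI[of _ "max B 1 + 1"] conjI allI impI)
      fix a b :: real assume "ball 0 (max B 1 + 1) \<subseteq> cbox a b"
      then have "- max B 1 \<in> cbox a b" "max B 1 \<in> cbox a b"
        using subsetD[of "ball 0 (max B 1 + 1)" "cbox a b" "max B 1"]
          subsetD[of "ball 0 (max B 1 + 1)" "cbox a b" "- max B 1"] by simp_all
      then have ab: "a < 0" "b \<ge> B" "b > 0" by auto
      then have "integral (cbox a b) g = \<Phi> b - L0"
        using int[of a b] by (simp add: integral_unique \<Phi>'_def)
      then show "norm (integral (cbox a b) g - (L1 - L0)) < e"
        using B[of b] ab by (simp add: dist_norm)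
    qed simp
  qed
qed

text \<open>Cauchy's criterion along the sequence X produces L, and the domination carries the
  convergence over from the sequence to the filter.\<close>

lemma convergent_if_dominated:
  fixes \<Phi> :: "real \<Rightarrow> 'a::banach" and g :: "real \<Rightarrow> real"
  assumes g: "(g \<longlongrightarrow> l) F" and ev: "eventually (\<lambda>x. x \<in> S) F"
    and X: "filterlim X F sequentially"
    and le: "\<And>x y. x \<in> S \<Longrightarrow> y \<in> S \<Longrightarrow> norm (\<Phi> x - \<Phi> y) \<le> \<bar>g x - g y\<bar>"
  obtains L where "(\<Phi> \<longlongrightarrow> L) F"
proof -
  have gX: "(\<lambda>n. g (X n)) \<longlonglongrightarrow> l"
    using g X by (rule filterlim_compose)
  obtain N where N: "\<And>n. n \<ge> N \<Longrightarrow> X n \<in> S"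
    using X[unfolded filterlim_iff, rule_format, OF ev] by (auto simp: eventually_sequentially)
  have "Cauchy (\<lambda>n. \<Phi> (X n))"
  proof (rule CauchyI)
    fix e :: real assume "e > 0"
    moreover have "Cauchy (\<lambda>n. g (X n))"
      using gX by (rule LIMSEQ_imp_Cauchy)
    ultimately obtain M where M: "\<And>m n. m \<ge> M \<Longrightarrow> n \<ge> M \<Longrightarrow> norm (g (X m) - g (X n)) < e"
      by (meson CauchyD)
    have "norm (\<Phi> (X m) - \<Phi> (X n)) < e" if "m \<ge> max M N" "n \<ge> max M N" for m n
      using le[OF N N, of m n] M[of m n] that by simp
    then show "\<exists>M. \<forall>m\<ge>M. \<forall>n\<ge>M. norm (\<Phi> (X m) - \<Phi> (X n)) < e"
      by blast
  qed
  then obtain L where L: "(\<lambda>n. \<Phi> (X n)) \<longlonglongrightarrow> L"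
    using Cauchy_convergent convergent_def by blast
  have "norm (\<Phi> x - L) \<le> \<bar>g x - l\<bar>" if "x \<in> S" for x
  proof (rule LIMSEQ_le)
    show "(\<lambda>n. norm (\<Phi> x - \<Phi> (X n))) \<longlonglongrightarrow> norm (\<Phi> x - L)"
      by (intro tendsto_intros L)
    show "(\<lambda>n. \<bar>g x - g (X n)\<bar>) \<longlonglongrightarrow> \<bar>g x - l\<bar>"
      by (intro tendsto_intros gX)
    show "\<exists>N. \<forall>n\<ge>N. norm (\<Phi> x - \<Phi> (X n)) \<le> \<bar>g x - g (X n)\<bar>"
      using le[OF that N] by blast
  qed
  then have "eventually (\<lambda>x. norm (\<Phi> x - L) \<le> \<bar>g x - l\<bar>) F"
    using ev by (auto elim: eventually_mono)
  then have "((\<lambda>x. \<Phi> x - L) \<longlongrightarrow> 0) F"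
    by (rule Lim_null_comparison) (rule tendsto_rabs_zero[OF LIM_zero[OF g]])
  then have "(\<Phi> \<longlongrightarrow> L) F"
    by (rule LIM_zero_cancel)
  then show thesis by (rule that)
qed

text \<open>The increments of a primitive are dominated by those of M x^\<beta> / \<beta> on (0, 1]
  and of M x^(\<beta>-1) / (\<beta>-1) on [1, \<infinity>), and both functions converge at their
  ends as 0 < \<beta> < 1. The second conclusion is kept because the polynomials below approximate
  the integral over these cut-offs.\<close>

lemma improper_power_integral:
  fixes J :: "real \<Rightarrow> 'a::banach"
  assumes \<beta>: "0 < \<beta>" "\<beta> < 1" and cont: "continuous_on {0<..} J"
    and M: "\<And>t. 0 < t \<Longrightarrow> t \<le> 1 \<Longrightarrow> norm (J t) \<le> M" "\<And>t. 1 \<le> t \<Longrightarrow> norm (J t) \<le> M / t"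
  obtains L where "((\<lambda>t. t powr (\<beta> - 1) *\<^sub>R J t) has_integral L) {0<..}"
    "(\<lambda>n. integral {1 / real (Suc n)..real (Suc n)} (\<lambda>t. t powr (\<beta> - 1) *\<^sub>R J t)) \<longlonglongrightarrow> L"
proof -
  define f where "f t = t powr (\<beta> - 1) *\<^sub>R J t" for t
  have contf: "continuous_on {a..b} f" if "a > 0" for a b
    unfolding f_def using that
    by (intro continuous_intros continuous_on_subset[OF cont]) auto
  have intf: "f integrable_on {a..b}" if "a > 0" for a b
    by (intro integrable_continuous_real contf that)
  define \<Phi> where "\<Phi> x = (if x \<ge> 1 then integral {1..x} f else - integral {x..1} f)" for x
  have diff: "\<Phi> y - \<Phi> x = integral {x..y} f" if "0 < x" "x \<le> y" for x y
  proof -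
    consider "1 \<le> x" | "x < 1" "1 \<le> y" | "y < 1" by linarith
    then show ?thesis
    proof cases
      case 1
      then show ?thesis
        using that Henstock_Kurzweil_Integration.integral_combine[of 1 x y f] intf[of 1 y]
        by (simp add: \<Phi>_def algebra_simps)
    next
      case 2
      then show ?thesis
        using that Henstock_Kurzweil_Integration.integral_combine[of x 1 y f] intf[of x y]
        by (simp add: \<Phi>_def algebra_simps)
    next
      case 3
      then show ?thesis
        using that Henstock_Kurzweil_Integration.integral_combine[of x y 1 f] intf[of x 1]
        by (simp add: \<Phi>_def algebra_simps)
    qed
  qed
  have deriv: "(\<Phi> has_vector_derivative f x) (at x)" if "x > 0" for x
  proof -
    have "((\<lambda>y. integral {x/2..y} f) has_vector_derivative f x) (at x within {x/2..x + 1})"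
      using that by (intro integral_has_vector_derivative contf) auto
    then have "((\<lambda>y. integral {x/2..y} f) has_vector_derivative f x) (at x)"
      using that by (simp add: at_within_Icc_at)
    then have D: "((\<lambda>y. \<Phi> (x/2) + integral {x/2..y} f) has_vector_derivative 0 + f x) (at x)"
      by (intro has_vector_derivative_add has_vector_derivative_const)
    have "\<Phi> (x/2) + integral {x/2..y} f = \<Phi> y" if "y \<in> {x/2<..}" for y
      using diff[of "x/2" y] that \<open>x > 0\<close> by (simp add: algebra_simps)
    with has_vector_derivative_transform_within_open[OF D, of "{x/2<..}" \<Phi>] show ?thesis
      using that by simp
  qed
  have est: "norm (\<Phi> y - \<Phi> x) \<le> g y - g x"
    if xy: "0 < x" "x \<le> y" and g: "\<And>t. t \<in> {x..y} \<Longrightarrow> (g has_real_derivative g' t) (at t within {x..y})"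
      "\<And>t. t \<in> {x..y} \<Longrightarrow> norm (f t) \<le> g' t" for x y g g'
  proof -
    have "(g' has_integral (g y - g x)) {x..y}"
      using xy g(1) by (intro fundamental_theorem_of_calculus)
        (auto simp: has_real_derivative_iff_has_vector_derivative)
    moreover have "(f has_integral (\<Phi> y - \<Phi> x)) {x..y}"
      using diff[OF xy] intf[OF xy(1)] by (simp add: has_integral_iff)
    ultimately show ?thesis
      using g(2) by (metis has_integral_integrable integral_norm_bound_integral integral_unique)
  qed
  obtain L0 where L0: "(\<Phi> \<longlongrightarrow> L0) (at_right 0)"
  proof (rule convergent_if_dominated[where g = "\<lambda>x. M * (x powr \<beta> / \<beta>)" and S = "{0<..1}" and X = "\<lambda>n. 1 / real (Suc n)"])
    show "((\<lambda>x. M * (x powr \<beta> / \<beta>)) \<longlongrightarrow> M * (0 powr \<beta> / \<beta>)) (at_right 0)"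
      using \<beta> by (intro tendsto_intros) (auto simp: eventually_at_filter)
    show "eventually (\<lambda>x. x \<in> {0<..1}) (at_right (0::real))"
      using eventually_at_right_real[of 0 1] by (auto elim: eventually_mono)
    show "filterlim (\<lambda>n. 1 / real (Suc n)) (at_right 0) sequentially"
      unfolding filterlim_at using LIMSEQ_Suc[OF lim_1_over_n[where 'a = real]] by auto
    have *: "norm (\<Phi> y - \<Phi> x) \<le> M * (y powr \<beta> / \<beta>) - M * (x powr \<beta> / \<beta>)" if "0 < x" "x \<le> y" "y \<le> 1" for x y
    proof (rule est[OF that(1,2), where g' = "\<lambda>t. M * t powr (\<beta> - 1)"])
      fix t assume t: "t \<in> {x..y}"
      show "((\<lambda>x. M * (x powr \<beta> / \<beta>)) has_real_derivative M * t powr (\<beta> - 1)) (at t within {x..y})"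
        using t that \<beta> by (auto intro!: derivative_eq_intros simp: powr_diff)
      show "norm (f t) \<le> M * t powr (\<beta> - 1)"
        using M(1)[of t] t that by (simp add: f_def mult.commute mult_right_mono)
    qed
    show "norm (\<Phi> x - \<Phi> y) \<le> \<bar>M * (x powr \<beta> / \<beta>) - M * (y powr \<beta> / \<beta>)\<bar>"
      if "x \<in> {0<..1}" "y \<in> {0<..1}" for x y
      using *[of x y] *[of y x] that by (cases "x \<le> y") (auto simp: norm_minus_commute)
  qed
  obtain L1 where L1: "(\<Phi> \<longlongrightarrow> L1) at_top"
  proof (rule convergent_if_dominated[where g = "\<lambda>x. M * (x powr (\<beta> - 1) / (\<beta> - 1))" and S = "{1..}" and X = "\<lambda>n. real (Suc n)"])
    show "((\<lambda>x. M * (x powr (\<beta> - 1) / (\<beta> - 1))) \<longlongrightarrow> M * (0 / (\<beta> - 1))) at_top"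
      using \<beta> by (intro tendsto_intros tendsto_neg_powr filterlim_ident) auto
    show "eventually (\<lambda>x. x \<in> {1..}) (at_top :: real filter)"
      using eventually_ge_at_top[of 1] by simp
    show "filterlim (\<lambda>n. real (Suc n)) at_top sequentially"
      by (intro filterlim_compose[OF filterlim_real_sequentially filterlim_Suc])
    have *: "norm (\<Phi> y - \<Phi> x) \<le> M * (y powr (\<beta> - 1) / (\<beta> - 1)) - M * (x powr (\<beta> - 1) / (\<beta> - 1))"
      if "1 \<le> x" "x \<le> y" for x y
    proof (rule est[where g' = "\<lambda>t. M * t powr (\<beta> - 1) / t"])
      fix t assume t: "t \<in> {x..y}"
      show "((\<lambda>x. M * (x powr (\<beta> - 1) / (\<beta> - 1))) has_real_derivative M * t powr (\<beta> - 1) / t) (at t within {x..y})"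
      proof -
        have "((\<lambda>x. x powr (\<beta> - 1)) has_real_derivative (\<beta> - 1) * t powr (\<beta> - 1 - 1)) (at t within {x..y})"
          using t that by (intro DERIV_subset[OF has_real_derivative_powr]) auto
        then have "((\<lambda>x. M * (x powr (\<beta> - 1) / (\<beta> - 1))) has_real_derivative
            M * ((\<beta> - 1) * t powr (\<beta> - 1 - 1) / (\<beta> - 1))) (at t within {x..y})"
          by (intro DERIV_cmult DERIV_cdivide)
        moreover have "t powr (\<beta> - 1 - 1) = t powr (\<beta> - 1) / t"
          using t that powr_diff[of t "\<beta> - 1" 1] by simp
        ultimately show ?thesis using \<beta> by simp
      qed
      have "norm (f t) \<le> t powr (\<beta> - 1) * (M / t)"
        using M(2)[of t] t that unfolding f_def by (simp add: mult_left_mono del: times_divide_eq_right)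
      then show "norm (f t) \<le> M * t powr (\<beta> - 1) / t"
        by (simp add: mult.commute)
    qed (use that in auto)
    show "norm (\<Phi> x - \<Phi> y) \<le> \<bar>M * (x powr (\<beta> - 1) / (\<beta> - 1)) - M * (y powr (\<beta> - 1) / (\<beta> - 1))\<bar>"
      if "x \<in> {1..}" "y \<in> {1..}" for x y
      using *[of x y] *[of y x] that by (cases "x \<le> y") (auto simp: norm_minus_commute)
  qed
  show thesis
  proof (rule that[of "L1 - L0"])
    show "((\<lambda>t. t powr (\<beta> - 1) *\<^sub>R J t) has_integral L1 - L0) {0<..}"
      using has_integral_improper_Ioi[OF deriv L0 L1] unfolding f_def .
    have "(\<lambda>n. \<Phi> (real (Suc n))) \<longlonglongrightarrow> L1"
      by (rule filterlim_compose[OF L1 filterlim_compose[OF filterlim_real_sequentially filterlim_Suc]])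
    moreover have "(\<lambda>n. \<Phi> (1 / real (Suc n))) \<longlonglongrightarrow> L0"
      by (rule filterlim_compose[OF L0])
        (use LIMSEQ_Suc[OF lim_1_over_n[where 'a = real]] in \<open>auto simp: filterlim_at\<close>)
    ultimately have "(\<lambda>n. \<Phi> (real (Suc n)) - \<Phi> (1 / real (Suc n))) \<longlonglongrightarrow> L1 - L0"
      by (rule tendsto_diff)
    moreover have "\<Phi> (real (Suc n)) - \<Phi> (1 / real (Suc n)) = integral {1 / real (Suc n)..real (Suc n)} f" for n
      by (rule diff) (auto simp: field_simps)
    ultimately show "(\<lambda>n. integral {1 / real (Suc n)..real (Suc n)} (\<lambda>t. t powr (\<beta> - 1) *\<^sub>R J t)) \<longlonglongrightarrow> L1 - L0"
      by (simp add: f_def[abs_def])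
  qed
qed

section \<open>Polynomial approximation of the cut-off integral\<close>

lemma norm_cs_complex: "norm (cs w :: complex cop) = cmod w"
proof -
  have "norm (1 :: complex cop) = 1"
    by transfer simp
  then show ?thesis
    using norm_cs_mult[of w "1 :: complex cop"] by simp
qed

lemma pop_cs: "pop q (cs w) = cs (poly q w)"
  by (induction q) (simp_all add: pop_pCons cs_simps)

lemma pop_monom: "pop (monom c k) V = cs c * V ^ k"
proof (induction k)
  case (Suc k)
  then show ?case
    by (simp add: monom_Suc pop_pCons cs_simps cs_left_commute[of V])
qed (simp add: monom_0 pop_const)

text \<open>Up to the factor sin (\<pi>\<beta>) / \<pi>, the Balakrishnan integral of 1 - w cut off
  to [a, b]. In (1 - w)/(t + 1 - w) = 1 - t/(1 + t - w) the last fraction is expanded in powers of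
  w/(1 + t), truncated after K terms, and integrated coefficient by coefficient.\<close>

definition bal_poly :: "real \<Rightarrow> real \<Rightarrow> real \<Rightarrow> nat \<Rightarrow> complex poly"
  where "bal_poly a b \<beta> K = [:complex_of_real (integral {a..b} (\<lambda>t. t powr (\<beta> - 1))):] -
    (\<Sum>k<K. monom (complex_of_real (integral {a..b} (\<lambda>t. t powr (\<beta> - 1) * (t / (1 + t) ^ Suc k)))) k)"

lemma pop_bal_poly:
  assumes "0 < a"
  shows "((\<lambda>t. t powr (\<beta> - 1) *\<^sub>R (1 - t *\<^sub>R (\<Sum>k<K. (1 / (1 + t) ^ Suc k) *\<^sub>R V ^ k))) has_integral
    pop (bal_poly a b \<beta> K) V) {a..b}"
proof -
  have "(\<lambda>t. t powr (\<beta> - 1)) integrable_on {a..b}"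
    using assms by (intro integrable_continuous_real continuous_intros) auto
  then have 1: "((\<lambda>t. t powr (\<beta> - 1) *\<^sub>R 1) has_integral cs (complex_of_real (integral {a..b} (\<lambda>t. t powr (\<beta> - 1))))) {a..b}"
    using cs_of_real[of _ 1] has_integral_scaleR_left[OF integrable_integral] by (metis mult.right_neutral)
  have "(\<lambda>t. t powr (\<beta> - 1) * (t / (1 + t) ^ Suc k)) integrable_on {a..b}" for k
    using assms by (intro integrable_continuous_real continuous_intros) (auto simp: add_nonneg_eq_0_iff)
  then have "((\<lambda>t. (t powr (\<beta> - 1) * (t / (1 + t) ^ Suc k)) *\<^sub>R V ^ k) has_integral
      cs (complex_of_real (integral {a..b} (\<lambda>t. t powr (\<beta> - 1) * (t / (1 + t) ^ Suc k)))) * V ^ k) {a..b}" for k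
    unfolding cs_of_real by (intro has_integral_scaleR_left integrable_integral)
  then have "((\<lambda>t. t powr (\<beta> - 1) *\<^sub>R 1 - (\<Sum>k<K. (t powr (\<beta> - 1) * (t / (1 + t) ^ Suc k)) *\<^sub>R V ^ k)) has_integral
      pop (bal_poly a b \<beta> K) V) {a..b}"
    unfolding bal_poly_def pop_diff pop_sum pop_const pop_monom
    by (intro has_integral_diff has_integral_sum 1) auto
  then show ?thesis
    by (rule has_integral_eq[rotated]) (simp add: scaleR_diff_right scaleR_sum_right)
qed

text \<open>The remainder is kept exact, so that the growth of the powers of V can be weighed
  against that of (1 + t)^K.\<close>

lemma neumann_sum:
  assumes t: "t > 0" and unit: "cop_unit (t *\<^sub>R 1 + (1 - V))"
  defines "R \<equiv> cop_inv (t *\<^sub>R 1 + (1 - V))"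
  shows "(\<Sum>k<K. (1 / (1 + t) ^ Suc k) *\<^sub>R V ^ k) = R - (1 / (1 + t) ^ K) *\<^sub>R (R * V ^ K)"
    and "(1 - V) * R = 1 - t *\<^sub>R R"
proof -
  have "(t *\<^sub>R 1 + (1 - V)) * (\<Sum>k<K. (1 / (1 + t) ^ Suc k) *\<^sub>R V ^ k) = 1 - (1 / (1 + t) ^ K) *\<^sub>R V ^ K"
  proof (induction K)
    case (Suc K)
    have "(t *\<^sub>R 1 + (1 - V)) * ((1 / (1 + t) ^ Suc K) *\<^sub>R V ^ K)
      = ((1 + t) * (1 / (1 + t) ^ Suc K)) *\<^sub>R V ^ K - (1 / (1 + t) ^ Suc K) *\<^sub>R V ^ Suc K"
      by (simp add: algebra_simps add_divide_distrib)
    also have "(1 + t) * (1 / (1 + t) ^ Suc K) = 1 / (1 + t) ^ K"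
      using t by simp
    finally show ?case
      using Suc by (simp add: distrib_left)
  qed simp
  then have "R * ((t *\<^sub>R 1 + (1 - V)) * (\<Sum>k<K. (1 / (1 + t) ^ Suc k) *\<^sub>R V ^ k)) = R * (1 - (1 / (1 + t) ^ K) *\<^sub>R V ^ K)"
    by simp
  then show "(\<Sum>k<K. (1 / (1 + t) ^ Suc k) *\<^sub>R V ^ k) = R - (1 / (1 + t) ^ K) *\<^sub>R (R * V ^ K)"
    unfolding R_def cop_inv_left_cancel(2)[OF unit] by (simp add: right_diff_distrib)
  show "(1 - V) * R = 1 - t *\<^sub>R R"
    using cop_inv(1)[OF unit] by (simp add: R_def algebra_simps)
qed

text \<open>On [a, b] the remainder of the geometric expansion carries the factor (1/(1+a))^K, which
  beats polynomial growth of the powers of V as K grows.\<close>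

lemma bal_poly_error:
  assumes ab: "0 < a" "a \<le> b" and \<beta>: "\<beta> < 1"
    and unit: "\<And>t. t \<in> {a..b} \<Longrightarrow> cop_unit (t *\<^sub>R 1 + (1 - V))"
    and I: "\<And>t. t \<in> {a..b} \<Longrightarrow> norm (cop_inv (t *\<^sub>R 1 + (1 - V))) \<le> I"
    and G: "norm (V ^ K) \<le> G"
    and L: "((\<lambda>t. t powr (\<beta> - 1) *\<^sub>R ((1 - V) * cop_inv (t *\<^sub>R 1 + (1 - V)))) has_integral L) {a..b}"
  shows "norm (pop (bal_poly a b \<beta> K) V - L) \<le> a powr (\<beta> - 1) * b * I * G * (1 / (1 + a)) ^ K * (b - a)"
proof -
  define R where "R t = cop_inv (t *\<^sub>R 1 + (1 - V))" for t
  define f where "f t = t powr (\<beta> - 1) *\<^sub>R (1 - t *\<^sub>R (\<Sum>k<K. (1 / (1 + t) ^ Suc k) *\<^sub>R V ^ k)) -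
     t powr (\<beta> - 1) *\<^sub>R ((1 - V) * R t)" for t
  have I0: "0 \<le> I" using I[of a] ab norm_ge_zero order_trans by (metis atLeastAtMost_iff order_refl)
  have G0: "0 \<le> G" using G norm_ge_zero order_trans by blast
  have "(f has_integral (pop (bal_poly a b \<beta> K) V - L)) {a..b}"
    unfolding f_def R_def by (intro has_integral_diff pop_bal_poly ab L)
  moreover have "norm (f t) \<le> a powr (\<beta> - 1) * b * I * G * (1 / (1 + a)) ^ K" if t: "t \<in> {a..b}" for t
  proof -
    have t0: "t > 0" using t ab by auto
    have "f t = t powr (\<beta> - 1) *\<^sub>R (t *\<^sub>R ((1 / (1 + t) ^ K) *\<^sub>R (R t * V ^ K)))"
      unfolding f_def R_def neumann_sum[OF t0 unit[OF t]] by (simp add: algebra_simps)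
    then have "norm (f t) = t powr (\<beta> - 1) * t * (norm (R t * V ^ K)) * (1 / (1 + t)) ^ K"
      using t0 by (simp add: power_divide)
    also have "\<dots> \<le> (a powr (\<beta> - 1) * b) * (I * G) * (1 / (1 + a)) ^ K"
    proof (intro mult_mono power_mono)
      show "t powr (\<beta> - 1) \<le> a powr (\<beta> - 1)"
        using t ab \<beta> by (intro powr_mono2') auto
      show "norm (R t * V ^ K) \<le> I * G"
        using I[OF t] G I0 by (intro order_trans[OF norm_mult_ineq] mult_mono) (auto simp: R_def)
      show "1 / (1 + t) \<le> 1 / (1 + a)"
        using t ab by (intro divide_left_mono) auto
    qed (use t ab t0 I0 G0 in auto)
    finally show ?thesis by (simp add: mult_ac)
  qed
  ultimately have "norm (pop (bal_poly a b \<beta> K) V - L) \<le>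
      a powr (\<beta> - 1) * b * I * G * (1 / (1 + a)) ^ K * measure lborel (cbox a b)"
    using I0 G0 ab by (intro has_integral_bound[where f = f]) auto
  then show ?thesis using ab by simp
qed

text \<open>The first bound is integrated below t = r and the second above it; each part yields a
  multiple of r^\<beta>, independent of a and b.\<close>

lemma norm_integral_two_powers:
  fixes f :: "real \<Rightarrow> 'a::banach"
  assumes ab: "0 < a" "a \<le> b" and \<beta>: "0 < \<beta>" "\<beta> < 1" and r: "r > 0"
    and f: "f integrable_on {a..b}"
    and le1: "\<And>t. t \<in> {a..b} \<Longrightarrow> norm (f t) \<le> t powr (\<beta> - 1)"
    and le2: "\<And>t. t \<in> {a..b} \<Longrightarrow> norm (f t) \<le> r * t powr (\<beta> - 2)"
  shows "norm (integral {a..b} f) \<le> (1 / \<beta> + 1 / (1 - \<beta>)) * r powr \<beta>"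
proof -
  \<comment> \<open>r clipped to [a, b]; one of the two pieces may shrink to a point.\<close>
  define m where "m = max a (min b r)"
  have m: "a \<le> m" "m \<le> b" "0 < m" using ab by (auto simp: m_def)
  have f1: "f integrable_on {a..m}" and f2: "f integrable_on {m..b}"
    by (rule integrable_subinterval_real[OF f]; use m in auto)+
  have "norm (integral {a..m} f) \<le> r powr \<beta> / \<beta>"
  proof (cases "a = m")
    case False
    then have "m \<le> r" by (auto simp: m_def max_def split: if_splits)
    have "((\<lambda>t. t powr (\<beta> - 1)) has_integral (m powr \<beta> / \<beta> - a powr \<beta> / \<beta>)) {a..m}"
    proof (rule fundamental_theorem_of_calculus[OF m(1)])
      fix t assume t: "t \<in> {a..m}"
      have "((\<lambda>t. t powr \<beta> / \<beta>) has_real_derivative \<beta> * t powr (\<beta> - 1) / \<beta>) (at t within {a..m})"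
        using t ab by (intro DERIV_cdivide DERIV_subset[OF has_real_derivative_powr]) auto
      then show "((\<lambda>t. t powr \<beta> / \<beta>) has_vector_derivative t powr (\<beta> - 1)) (at t within {a..m})"
        using \<beta> by (simp add: has_real_derivative_iff_has_vector_derivative)
    qed
    then have "norm (integral {a..m} f) \<le> m powr \<beta> / \<beta> - a powr \<beta> / \<beta>"
      using integral_norm_bound_integral[OF f1 has_integral_integrable, of _ "m powr \<beta> / \<beta> - a powr \<beta> / \<beta>"]
        le1 m by (simp add: integral_unique)
    also have "\<dots> \<le> r powr \<beta> / \<beta>"
      using \<open>m \<le> r\<close> m \<beta> by (simp add: divide_right_mono powr_mono2 order_trans[of "_ - _" "m powr \<beta> / \<beta>"])
    finally show ?thesis .
  qed (use \<beta> in simp)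
  moreover have "norm (integral {m..b} f) \<le> r powr \<beta> / (1 - \<beta>)"
  proof (cases "m = b")
    case False
    then have "r \<le> m" using ab by (auto simp: m_def max_def min_def split: if_splits)
    have "((\<lambda>t. r * t powr (\<beta> - 2)) has_integral (r * (b powr (\<beta> - 1) / (\<beta> - 1)) - r * (m powr (\<beta> - 1) / (\<beta> - 1)))) {m..b}"
    proof (rule fundamental_theorem_of_calculus[OF m(2)])
      fix t assume t: "t \<in> {m..b}"
      have "((\<lambda>t. r * (t powr (\<beta> - 1) / (\<beta> - 1))) has_real_derivative r * ((\<beta> - 1) * t powr (\<beta> - 1 - 1) / (\<beta> - 1))) (at t within {m..b})"
        using t m by (intro DERIV_cmult DERIV_cdivide DERIV_subset[OF has_real_derivative_powr]) auto
      then show "((\<lambda>t. r * (t powr (\<beta> - 1) / (\<beta> - 1))) has_vector_derivative r * t powr (\<beta> - 2)) (at t within {m..b})"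
        using \<beta> by (simp add: has_real_derivative_iff_has_vector_derivative)
    qed
    then have "norm (integral {m..b} f) \<le> r * (b powr (\<beta> - 1) / (\<beta> - 1)) - r * (m powr (\<beta> - 1) / (\<beta> - 1))"
      using integral_norm_bound_integral[OF f2 has_integral_integrable,
          of _ "r * (b powr (\<beta> - 1) / (\<beta> - 1)) - r * (m powr (\<beta> - 1) / (\<beta> - 1))"]
        le2 m by (simp add: integral_unique)
    also have "\<dots> = r * m powr (\<beta> - 1) / (1 - \<beta>) - r * b powr (\<beta> - 1) / (1 - \<beta>)"
      using \<beta> by (simp add: field_simps)
    also have "\<dots> \<le> r * m powr (\<beta> - 1) / (1 - \<beta>)"
      using r \<beta> by simp
    also have "\<dots> \<le> r * r powr (\<beta> - 1) / (1 - \<beta>)"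
      using r \<beta> \<open>r \<le> m\<close> by (intro divide_right_mono mult_left_mono powr_mono2') auto
    also have "r * r powr (\<beta> - 1) = r powr \<beta>"
      using r by (simp add: powr_diff)
    finally show ?thesis .
  qed (use \<beta> in simp)
  moreover have "integral {a..m} f + integral {m..b} f = integral {a..b} f"
    by (intro Henstock_Kurzweil_Integration.integral_combine m f)
  ultimately show ?thesis
    using norm_triangle_ineq[of "integral {a..m} f" "integral {m..b} f"]
    by (simp add: distrib_right)
qed

text \<open>The scalar estimate is the operator estimate for multiplication by \<open>w\<close> on \<open>\<complex>\<close>.\<close>

lemma bal_poly_scalar:
  assumes ab: "0 < a" "a \<le> b" and \<beta>: "0 < \<beta>" "\<beta> < 1" and w: "cmod w \<le> 1"
  shows "cmod (poly (bal_poly a b \<beta> K) w) \<le>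
    (1 / \<beta> + 1 / (1 - \<beta>)) * cmod (1 - w) powr \<beta> + a powr (\<beta> - 1) * b * (1 / a) * 1 * (1 / (1 + a)) ^ K * (b - a)"
proof -
  define V :: "complex cop" where "V = cs w"
  define z where "z t = complex_of_real (1 + t) - w" for t
  have W: "t *\<^sub>R 1 + (1 - V) = cs (z t)" for t
    using cs_of_real[of t "1 :: complex cop"] by (simp add: V_def z_def cs_simps)
  have Re_w: "Re w \<le> 1"
    using complex_Re_le_cmod[of w] w by linarith
  \<comment> \<open>1 - w has nonnegative real part, so adding t > 0 gives a number that dominates
    both t and |1 - w|. These are the two bounds that \<open>norm_integral_two_powers\<close> asks
    for.\<close>
  have z: "t \<le> cmod (z t)" "cmod (1 - w) \<le> cmod (z t)" "z t \<noteq> 0" if "t > 0" for t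
  proof -
    have "Re (z t) \<le> cmod (z t)" by (rule complex_Re_le_cmod)
    then show "t \<le> cmod (z t)" "z t \<noteq> 0"
      using that Re_w by (auto simp: z_def)
    show "cmod (1 - w) \<le> cmod (z t)"
    proof -
      have "(Re (1 - w))\<^sup>2 \<le> (Re (z t))\<^sup>2"
        using that Re_w by (intro power_mono) (auto simp: z_def)
      then show ?thesis by (simp add: cmod_def z_def)
    qed
  qed
  have inv: "cop_unit (t *\<^sub>R 1 + (1 - V))" "cop_inv (t *\<^sub>R 1 + (1 - V)) = cs (1 / z t)" if "t > 0" for t
    using z(3)[OF that] cop_inv_unique[of "cs (z t) :: complex cop" "cs (1 / z t)"] unfolding W
    by (simp_all add: cs_simps(3)[symmetric] cs_simps(5))
  define f where "f t = t powr (\<beta> - 1) *\<^sub>R (cs ((1 - w) / z t) :: complex cop)" for t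
  have "f integrable_on {a..b}"
    unfolding f_def z_def using ab z(3)
    by (intro integrable_continuous_real continuous_intros) (auto simp: z_def)
  then have fint: "(f has_integral integral {a..b} f) {a..b}"
    by (rule integrable_integral)
  have L: "((\<lambda>t. t powr (\<beta> - 1) *\<^sub>R ((1 - V) * cop_inv (t *\<^sub>R 1 + (1 - V)))) has_integral integral {a..b} f) {a..b}"
  proof (rule has_integral_eq[OF _ fint])
    fix t assume "t \<in> {a..b}"
    then have "t > 0" using ab by auto
    have "(1 - V) * cs (1 / z t) = cs ((1 - w) / z t)"
      by (simp add: V_def cs_simps(2,5)[symmetric] cs_simps(3)[symmetric])
    then show "f t = t powr (\<beta> - 1) *\<^sub>R ((1 - V) * cop_inv (t *\<^sub>R 1 + (1 - V)))"
      using inv(2)[OF \<open>t > 0\<close>] by (simp add: f_def)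
  qed
  have "norm (pop (bal_poly a b \<beta> K) V - integral {a..b} f) \<le>
      a powr (\<beta> - 1) * b * (1 / a) * 1 * (1 / (1 + a)) ^ K * (b - a)"
  proof (rule bal_poly_error[OF ab \<beta>(2) _ _ _ L])
    fix t assume t: "t \<in> {a..b}"
    then have "t > 0" using ab by auto
    then show "cop_unit (t *\<^sub>R 1 + (1 - V))" by (rule inv)
    have "1 / cmod (z t) \<le> 1 / a"
      using z[OF \<open>t > 0\<close>] t ab by (intro divide_left_mono mult_pos_pos) auto
    then show "norm (cop_inv (t *\<^sub>R 1 + (1 - V))) \<le> 1 / a"
      using inv(2)[OF \<open>t > 0\<close>] by (simp add: norm_cs_complex norm_divide)
  next
    have "V ^ K = cs (w ^ K)"
      by (induction K) (simp_all add: V_def cs_simps)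
    then show "norm (V ^ K) \<le> 1"
      using w by (simp add: norm_cs_complex norm_power power_le_one)
  qed
  moreover have "norm (integral {a..b} f) \<le> (1 / \<beta> + 1 / (1 - \<beta>)) * cmod (1 - w) powr \<beta>"
  proof (cases "w = 1")
    case True
    then have "f = (\<lambda>_. 0)" by (auto simp: f_def cs_simps)
    then show ?thesis using \<beta> by simp
  next
    case False
    have nf: "norm (f t) = t powr (\<beta> - 1) * (cmod (1 - w) / cmod (z t))" if "t > 0" for t
      by (simp add: f_def norm_cs_complex norm_divide)
    show ?thesis
    proof (rule norm_integral_two_powers[OF ab \<beta> _ \<open>f integrable_on _\<close>])
      fix t assume "t \<in> {a..b}"
      then have t: "t > 0" using ab by auto
      have "cmod (1 - w) / cmod (z t) \<le> 1"
        using z[OF t] t by (simp add: divide_le_eq)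
      then show "norm (f t) \<le> t powr (\<beta> - 1)"
        unfolding nf[OF t] by (intro mult_left_le) auto
      have "cmod (1 - w) / cmod (z t) \<le> cmod (1 - w) / t"
        using z[OF t] t by (intro divide_left_mono mult_pos_pos) auto
      then have "norm (f t) \<le> t powr (\<beta> - 1) * (cmod (1 - w) / t)"
        unfolding nf[OF t] by (intro mult_left_mono) auto
      also have "\<dots> = cmod (1 - w) * t powr (\<beta> - 2)"
        using t powr_diff[of t "\<beta> - 1" 1] by simp
      finally show "norm (f t) \<le> cmod (1 - w) * t powr (\<beta> - 2)" .
    qed (use False in simp)
  qed
  moreover have "norm (pop (bal_poly a b \<beta> K) V) = cmod (poly (bal_poly a b \<beta> K) w)"
    by (simp add: V_def pop_cs norm_cs_complex)
  ultimately show ?thesis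
    using norm_triangle_sub[of "pop (bal_poly a b \<beta> K) V" "integral {a..b} f"] by simp
qed

lemma blinfun_compose_id_right: "A o\<^sub>L id_blinfun = A"
  by (rule blinfun_eqI) simp

text \<open>Convergence of the operators alone would not do: the scalar bound is what the calculus
  is applied to. For each n the integral is cut off to [1/(n+1), n+1], and then K is taken so large
  that the operator error and the scalar error are both at most half of 1/(n+1).\<close>

lemma frac_power_approx_balakrishnan:
  fixes V :: "'a::complex_banach cop"
  assumes unit: "\<And>t. t > 0 \<Longrightarrow> cop_unit (t *\<^sub>R 1 + (1 - V))"
    and M: "\<And>t. 0 < t \<Longrightarrow> t \<le> 1 \<Longrightarrow> t * norm (cop_inv (t *\<^sub>R 1 + (1 - V))) \<le> M"
    and growth: "\<And>k. norm (V ^ k) \<le> C * (real k + 1)" and \<beta>: "0 < \<beta>" "\<beta> < 1"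
  obtains F q where "rep_cop F = balakrishnan (rep_cop (1 - V)) \<beta>" "(\<lambda>n. pop (q n) V) \<longlonglongrightarrow> F"
    "\<And>n. poly (q n) 1 = 0"
    "\<And>n w. cmod w \<le> 1 \<Longrightarrow> cmod (poly (q n) w) \<le> (1 / \<beta> + 1 / (1 - \<beta>)) * cmod (1 - w) powr \<beta> + 1 / real (Suc n)"
proof -
  define R where "R t = cop_inv (t *\<^sub>R 1 + (1 - V))" for t
  define J where "J t = (1 - V) * R t" for t
  have contR: "continuous_on {0<..} R"
    unfolding continuous_on_def
  proof
    fix t :: real assume "t \<in> {0<..}"
    then show "(R \<longlongrightarrow> R t) (at t within {0<..})"
      unfolding R_def by (intro tendsto_cop_inv tendsto_intros unit) (auto simp: eventually_at_filter unit)
  qed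
  have contJ: "continuous_on {0<..} J"
    unfolding J_def by (intro continuous_intros contR)
  have M0: "M \<ge> 0"
    using M[of 1] norm_ge_zero order_trans[of 0 "1 * norm (cop_inv (1 *\<^sub>R 1 + (1 - V)))" M] by simp
  have J1: "norm (J t) \<le> 1 + M" if "0 < t" "t \<le> 1" for t
  proof -
    have "J t = 1 - t *\<^sub>R R t"
      unfolding J_def R_def by (rule neumann_sum(2)[OF that(1) unit[OF that(1)]])
    then have "norm (J t) \<le> norm (1 :: 'a cop) + t * norm (R t)"
      using norm_triangle_ineq4[of 1 "t *\<^sub>R R t"] that by simp
    then show ?thesis
      using norm_one_cop_le[where 'a = 'a] M[OF that] by (simp add: R_def)
  qed
  \<comment> \<open>For t \<ge> 2 |V| the term V R in (1 + t) R = 1 + V R is absorbed on the left;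
    the compact range [1, r] is settled by continuity.\<close>
  define r where "r = max 1 (2 * norm V)"
  have large: "t * norm (R t) \<le> 2" if "t \<ge> r" for t
  proof -
    have t: "t > 0" "2 * norm V \<le> t" using that by (auto simp: r_def)
    have "(1 + t) *\<^sub>R R t = 1 + V * R t"
      using cop_inv(1)[OF unit[OF t(1)]] by (simp add: R_def algebra_simps)
    then have "(1 + t) * norm (R t) = norm (1 + V * R t)"
      using t by (metis abs_of_pos add_pos_pos norm_scaleR zero_less_one)
    also have "\<dots> \<le> norm (1 :: 'a cop) + norm V * norm (R t)"
      by (intro order_trans[OF norm_triangle_ineq] add_left_mono norm_mult_ineq)
    also have "\<dots> \<le> 1 + (t / 2) * norm (R t)"
      using t norm_one_cop_le[where 'a = 'a] by (intro add_mono mult_right_mono) auto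
    finally have "norm (R t) + t * norm (R t) / 2 \<le> 1" by (simp add: algebra_simps)
    then show ?thesis
      using norm_ge_zero[of "R t"] by linarith
  qed
  have "compact ((\<lambda>t. t *\<^sub>R R t) ` {1..r})"
    by (intro compact_continuous_image continuous_intros continuous_on_subset[OF contR]) auto
  then have "bounded ((\<lambda>t. t *\<^sub>R R t) ` {1..r})"
    by (rule compact_imp_bounded)
  then obtain B where B: "\<And>t. t \<in> {1..r} \<Longrightarrow> norm (t *\<^sub>R R t) \<le> B"
    unfolding bounded_iff by blast
  define M' where "M' = max (1 + M) ((1 + norm V) * max 2 B)"
  have J2: "norm (J t) \<le> (1 + norm V) * max 2 B / t" if "1 \<le> t" for t
  proof -
    have "t * norm (R t) \<le> max 2 B"
      using B[of t] large[of t] that by (cases "t \<le> r") auto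
    moreover have "norm (J t) \<le> (1 + norm V) * norm (R t)"
      unfolding J_def using norm_triangle_ineq4[of 1 V] norm_one_cop_le[where 'a = 'a]
      by (intro order_trans[OF norm_mult_ineq] mult_right_mono) auto
    moreover have "(1 + norm V) * norm (R t) \<le> (1 + norm V) * (max 2 B / t)"
      using calculation(1) that by (intro mult_left_mono) (auto simp: pos_le_divide_eq mult.commute)
    ultimately show ?thesis by simp
  qed
  define f where "f t = t powr (\<beta> - 1) *\<^sub>R J t" for t
  obtain L where L: "(f has_integral L) {0<..}"
    and lim: "(\<lambda>n. integral {1 / real (Suc n)..real (Suc n)} f) \<longlonglongrightarrow> L"
  proof (rule improper_power_integral[OF \<beta> contJ, of M'])
    show "norm (J t) \<le> M'" if "0 < t" "t \<le> 1" for t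
      using J1[OF that] by (simp add: M'_def)
    show "norm (J t) \<le> M' / t" if "1 \<le> t" for t
    proof (rule order_trans[OF J2[OF that]])
      show "(1 + norm V) * max 2 B / t \<le> M' / t"
        using that by (intro divide_right_mono) (auto simp: M'_def)
    qed
  qed (use that in \<open>auto simp: f_def[abs_def]\<close>)
  define c where "c = sin (pi * \<beta>) / pi"
  have c: "\<bar>c\<bar> \<le> 1"
  proof -
    have "\<bar>sin (pi * \<beta>)\<bar> \<le> pi"
      using abs_sin_le_one[of "pi * \<beta>"] pi_gt3 by linarith
    then show ?thesis by (simp add: c_def abs_divide divide_le_eq)
  qed
  have bal: "rep_cop (c *\<^sub>R L) = balakrishnan (rep_cop (1 - V)) \<beta>"
  proof -
    have "((\<lambda>t. rep_cop (f t)) has_integral rep_cop L) {0<..}"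
      using has_integral_linear[OF L bounded_linear_rep_cop] by (simp add: o_def)
    then have "((\<lambda>t. t powr (\<beta> - 1) *\<^sub>R (inverse_op (t *\<^sub>R id_blinfun + rep_cop (1 - V)) o\<^sub>L rep_cop (1 - V)))
        has_integral rep_cop L) {0<..}"
    proof (rule has_integral_eq[rotated])
      fix t :: real assume "t \<in> {0<..}"
      then have t: "t > 0" by simp
      have "t *\<^sub>R id_blinfun + rep_cop (1 - V) = rep_cop (t *\<^sub>R 1 + (1 - V))"
        by simp
      moreover have "(1 - V) * R t = R t * (1 - V)"
        unfolding R_def by (rule cop_inv_commute[OF unit[OF t], symmetric]) (simp add: algebra_simps)
      ultimately show "rep_cop (f t) = t powr (\<beta> - 1) *\<^sub>R (inverse_op (t *\<^sub>R id_blinfun + rep_cop (1 - V)) o\<^sub>L rep_cop (1 - V))"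
        by (simp only: inverse_op_rep_cop(2)[OF unit[OF t]] f_def J_def R_def rep_cop_simps(3,4))
    qed
    then show ?thesis
      unfolding balakrishnan_def by (simp add: c_def integral_unique)
  qed
  have "\<exists>K. norm (pop (bal_poly (1 / real (Suc n)) (real (Suc n)) \<beta> K) V - integral {1 / real (Suc n)..real (Suc n)} f) \<le> 1 / real (Suc n) / 2 \<and>
      (\<forall>w. cmod w \<le> 1 \<longrightarrow> cmod (poly (bal_poly (1 / real (Suc n)) (real (Suc n)) \<beta> K) w) \<le>
        (1 / \<beta> + 1 / (1 - \<beta>)) * cmod (1 - w) powr \<beta> + 1 / real (Suc n) / 2)" for n
  proof -
    define a b where "a = 1 / real (Suc n)" and "b = real (Suc n)"
    have "a \<le> 1" "1 \<le> b" by (auto simp: a_def b_def)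
    moreover have "0 < a" by (simp add: a_def)
    ultimately have ab: "0 < a" "a \<le> b" by linarith+
    have "compact (R ` {a..b})"
      by (intro compact_continuous_image continuous_on_subset[OF contR]) (use ab in auto)
    then have "bounded (R ` {a..b})"
      by (rule compact_imp_bounded)
    then obtain I where I: "\<And>t. t \<in> {a..b} \<Longrightarrow> norm (R t) \<le> I"
      unfolding bounded_iff by blast
    define x where "x = 1 / (1 + a)"
    have x: "norm x < 1" using ab by (simp add: x_def)
    \<comment> \<open>The linear growth of the powers of V enters here: K x^K still tends to
      0.\<close>
    define e1 where "e1 K = a powr (\<beta> - 1) * b * I * (C * (real K + 1)) * x ^ K * (b - a)" for K
    define e2 where "e2 K = a powr (\<beta> - 1) * b * (1 / a) * 1 * x ^ K * (b - a)" for K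
    have xK: "(\<lambda>K. x ^ K) \<longlonglongrightarrow> 0" by (rule LIMSEQ_power_zero[OF x])
    have "(\<lambda>K. a powr (\<beta> - 1) * b * I * C * (b - a) * (real K * x ^ K + x ^ K)) \<longlonglongrightarrow>
        a powr (\<beta> - 1) * b * I * C * (b - a) * (0 + 0)"
      by (intro tendsto_intros powser_times_n_limit_0 x xK)
    then have "e1 \<longlonglongrightarrow> 0"
      by (simp add: e1_def[abs_def] algebra_simps)
    then have ev1: "eventually (\<lambda>K. e1 K < a / 2) sequentially"
      using ab by (intro order_tendstoD) auto
    have "(\<lambda>K. a powr (\<beta> - 1) * b * (1 / a) * 1 * x ^ K * (b - a)) \<longlonglongrightarrow> a powr (\<beta> - 1) * b * (1 / a) * 1 * 0 * (b - a)"
      by (intro tendsto_intros xK)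
    then have "e2 \<longlonglongrightarrow> 0"
      by (simp add: e2_def[abs_def])
    then have "eventually (\<lambda>K. e2 K < a / 2) sequentially"
      using ab by (intro order_tendstoD) auto
    with ev1 have "eventually (\<lambda>K. e1 K < a / 2 \<and> e2 K < a / 2) sequentially"
      by (rule eventually_conj)
    then obtain K where K: "e1 K < a / 2" "e2 K < a / 2"
      using eventually_happens[of _ sequentially] by auto
    have contf: "continuous_on {a..b} f"
      unfolding f_def using ab by (intro continuous_intros continuous_on_subset[OF contJ]) auto
    have "norm (pop (bal_poly a b \<beta> K) V - integral {a..b} f) \<le> e1 K"
      unfolding e1_def x_def
    proof (rule bal_poly_error[OF ab \<beta>(2)])
      show "((\<lambda>t. t powr (\<beta> - 1) *\<^sub>R ((1 - V) * cop_inv (t *\<^sub>R 1 + (1 - V)))) has_integral integral {a..b} f) {a..b}"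
        using integrable_integral[OF integrable_continuous_real[OF contf]]
        by (simp add: f_def[abs_def] J_def R_def)
    qed (use ab I unit growth in \<open>auto simp: R_def\<close>)
    moreover have "cmod (poly (bal_poly a b \<beta> K) w) \<le> (1 / \<beta> + 1 / (1 - \<beta>)) * cmod (1 - w) powr \<beta> + e2 K"
      if "cmod w \<le> 1" for w
      unfolding e2_def x_def by (rule bal_poly_scalar[OF ab \<beta> that])
    ultimately have "norm (pop (bal_poly a b \<beta> K) V - integral {a..b} f) \<le> a / 2 \<and>
      (\<forall>w. cmod w \<le> 1 \<longrightarrow> cmod (poly (bal_poly a b \<beta> K) w) \<le>
        (1 / \<beta> + 1 / (1 - \<beta>)) * cmod (1 - w) powr \<beta> + a / 2)"
      using K by (smt (verit))
    then show ?thesis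
      unfolding a_def b_def by (rule exI)
  qed
  then obtain K where K1: "\<And>n. norm (pop (bal_poly (1 / real (Suc n)) (real (Suc n)) \<beta> (K n)) V - integral {1 / real (Suc n)..real (Suc n)} f) \<le> 1 / real (Suc n) / 2"
    and K2: "\<And>n w. cmod w \<le> 1 \<Longrightarrow> cmod (poly (bal_poly (1 / real (Suc n)) (real (Suc n)) \<beta> (K n)) w) \<le>
        (1 / \<beta> + 1 / (1 - \<beta>)) * cmod (1 - w) powr \<beta> + 1 / real (Suc n) / 2"
    by metis
  define p where "p n = bal_poly (1 / real (Suc n)) (real (Suc n)) \<beta> (K n)" for n
  \<comment> \<open>Subtracting the value at 1 makes the polynomials vanish there exactly, as the
    calculus requires. By the scalar bound at w = 1 this value is at most half of 1/(n+1), and the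
    factor c of modulus at most 1 preserves the bounds.\<close>
  define q where "q n = Polynomial.smult (complex_of_real c) (p n - [:poly (p n) 1:])" for n
  have p1: "cmod (poly (p n) 1) \<le> 1 / real (Suc n) / 2" for n
    using K2[of 1 n] by (simp add: p_def)
  have inv_lim: "(\<lambda>n. 1 / real (Suc n) / 2) \<longlonglongrightarrow> 0"
    using tendsto_divide[OF LIMSEQ_Suc[OF lim_1_over_n[where 'a = real]] tendsto_const[of 2]] by simp
  have "(\<lambda>n. pop (p n) V - integral {1 / real (Suc n)..real (Suc n)} f) \<longlonglongrightarrow> 0"
    by (rule Lim_null_comparison[OF always_eventually inv_lim]) (use K1 in \<open>simp add: p_def\<close>)
  from tendsto_add[OF this lim] have lim_p: "(\<lambda>n. pop (p n) V) \<longlonglongrightarrow> L" by simp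
  have "(\<lambda>n. poly (p n) 1) \<longlonglongrightarrow> 0"
    by (rule Lim_null_comparison[OF always_eventually inv_lim]) (use p1 in simp)
  then have "(\<lambda>n. cs (complex_of_real c) * (pop (p n) V - cs (poly (p n) 1))) \<longlonglongrightarrow> cs (complex_of_real c) * (L - cs 0)"
    by (intro tendsto_intros lim_p)
  then have "(\<lambda>n. pop (q n) V) \<longlonglongrightarrow> c *\<^sub>R L"
    by (simp add: q_def pop_smult pop_diff pop_const cs_simps cs_of_real)
  moreover have "cmod (poly (q n) w) \<le> (1 / \<beta> + 1 / (1 - \<beta>)) * cmod (1 - w) powr \<beta> + 1 / real (Suc n)"
    if "cmod w \<le> 1" for n w
  proof -
    have "cmod (poly (q n) w) = \<bar>c\<bar> * cmod (poly (p n) w - poly (p n) 1)"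
      by (simp add: q_def norm_mult)
    also have "\<dots> \<le> cmod (poly (p n) w) + cmod (poly (p n) 1)"
      using c mult_right_mono[OF c norm_ge_zero[of "poly (p n) w - poly (p n) 1"]]
        norm_triangle_ineq4[of "poly (p n) w" "poly (p n) 1"] by simp
    finally show ?thesis
      using K2[OF that, of n] p1[of n] unfolding p_def[symmetric] by linarith
  qed
  moreover have "poly (q n) 1 = 0" for n
    by (simp add: q_def)
  ultimately show thesis
    using that bal by blast
qed

text \<open>The integer part of \<alpha> contributes the exact polynomial (1 - w)^m. In the
  fractional case it multiplies the error of the other factor by |1 - w|^m \<le> 2^m, whence the
  maximum in B.\<close>

lemma frac_power_approx:
  fixes V :: "'a::complex_banach cop"
  assumes unit: "\<And>t. t > 0 \<Longrightarrow> cop_unit (t *\<^sub>R 1 + (1 - V))"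
    and M: "\<And>t. 0 < t \<Longrightarrow> t \<le> 1 \<Longrightarrow> t * norm (cop_inv (t *\<^sub>R 1 + (1 - V))) \<le> M"
    and growth: "\<And>k. norm (V ^ k) \<le> C * (real k + 1)" and \<alpha>: "0 < \<alpha>"
  obtains F q B where "rep_cop F = frac_power (rep_cop (1 - V)) \<alpha>" "(\<lambda>n. pop (q n) V) \<longlonglongrightarrow> F"
    "\<And>n. poly (q n) 1 = 0" "B \<ge> 0"
    "\<And>n w. cmod w \<le> 1 \<Longrightarrow> cmod (poly (q n) w) \<le> B * cmod (1 - w) powr \<alpha> + B / real (Suc n)"
proof -
  define m where "m = nat \<lfloor>\<alpha>\<rfloor>"
  have m: "\<alpha> = real m + frac \<alpha>"
    using \<alpha> by (simp add: m_def frac_def)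
  have lin: "pop ([:1, - 1:] ^ m) V = (1 - V) ^ m"
    by (simp add: pop_power pop_linear cs_simps)
  show thesis
  proof (cases "frac \<alpha> = 0")
    case True
    then have "real m > 0" using m \<alpha> by linarith
    then have "m > 0" by simp
    show thesis
    proof (rule that[of "(1 - V) ^ m" "\<lambda>_. [:1, - 1:] ^ m" 1])
      show "rep_cop ((1 - V) ^ m) = frac_power (rep_cop (1 - V)) \<alpha>"
        using True by (simp only: frac_power_def op_power_rep_cop m_def if_True refl blinfun_compose_id_right)
      show "(\<lambda>n. pop ([:1, - 1:] ^ m) V) \<longlonglongrightarrow> (1 - V) ^ m"
        by (simp add: lin)
      show "cmod (poly ([:1, - 1:] ^ m) w) \<le> 1 * cmod (1 - w) powr \<alpha> + 1 / real (Suc n)" for n w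
      proof (cases "w = 1")
        case False
        have "cmod (1 - w) powr \<alpha> = cmod (1 - w) ^ m"
          using m True False by (simp add: powr_realpow)
        then show ?thesis by (simp add: poly_power norm_power)
      qed (use \<open>m > 0\<close> in \<open>simp add: poly_power zero_power\<close>)
    qed (use \<open>m > 0\<close> in \<open>simp_all add: poly_power\<close>)
  next
    case False
    define \<beta> where "\<beta> = frac \<alpha>"
    have \<beta>: "0 < \<beta>" "\<beta> < 1"
      using False frac_ge_0[of \<alpha>] frac_lt_1[of \<alpha>] by (auto simp: \<beta>_def)
    obtain F q where F: "rep_cop F = balakrishnan (rep_cop (1 - V)) \<beta>" "(\<lambda>n. pop (q n) V) \<longlonglongrightarrow> F"
      and q: "\<And>n. poly (q n) 1 = 0"
        "\<And>n w. cmod w \<le> 1 \<Longrightarrow> cmod (poly (q n) w) \<le> (1 / \<beta> + 1 / (1 - \<beta>)) * cmod (1 - w) powr \<beta> + 1 / real (Suc n)"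
      using frac_power_approx_balakrishnan[OF unit M growth \<beta>] by blast
    define B where "B = max (1 / \<beta> + 1 / (1 - \<beta>)) (2 ^ m)"
    show thesis
    proof (rule that[of "(1 - V) ^ m * F" "\<lambda>n. [:1, - 1:] ^ m * q n" B])
      show "rep_cop ((1 - V) ^ m * F) = frac_power (rep_cop (1 - V)) \<alpha>"
        using False F(1) by (simp only: frac_power_def op_power_rep_cop m_def \<beta>_def if_False rep_cop_simps(3))
      show "(\<lambda>n. pop ([:1, - 1:] ^ m * q n) V) \<longlonglongrightarrow> (1 - V) ^ m * F"
        unfolding pop_mult lin by (intro tendsto_intros F)
      show "poly ([:1, - 1:] ^ m * q n) 1 = 0" for n
        by (simp add: q)
      show "B \<ge> 0" unfolding B_def by (rule max.coboundedI2) simp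
      show "cmod (poly ([:1, - 1:] ^ m * q n) w) \<le> B * cmod (1 - w) powr \<alpha> + B / real (Suc n)"
        if w: "cmod w \<le> 1" for n w
      proof -
        have w2: "cmod (1 - w) \<le> 2"
          using norm_triangle_ineq4[of 1 w] w by simp
        have "cmod (poly ([:1, - 1:] ^ m * q n) w) = cmod (1 - w) ^ m * cmod (poly (q n) w)"
          by (simp add: norm_mult norm_power)
        also have "\<dots> \<le> cmod (1 - w) ^ m * ((1 / \<beta> + 1 / (1 - \<beta>)) * cmod (1 - w) powr \<beta> + 1 / real (Suc n))"
          by (intro mult_left_mono q w) auto
        also have "\<dots> = (1 / \<beta> + 1 / (1 - \<beta>)) * (cmod (1 - w) ^ m * cmod (1 - w) powr \<beta>) + cmod (1 - w) ^ m * (1 / real (Suc n))"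
          by (simp add: algebra_simps)
        also have "cmod (1 - w) ^ m * cmod (1 - w) powr \<beta> = cmod (1 - w) powr \<alpha>"
        proof (cases "w = 1")
          case False
          then show ?thesis
            using m by (simp add: \<beta>_def powr_realpow[symmetric] powr_add[symmetric])
        qed simp
        also have "(1 / \<beta> + 1 / (1 - \<beta>)) * cmod (1 - w) powr \<alpha> + cmod (1 - w) ^ m * (1 / real (Suc n))
          \<le> B * cmod (1 - w) powr \<alpha> + B * (1 / real (Suc n))"
        proof (intro add_mono mult_right_mono)
          show "cmod (1 - w) ^ m \<le> B"
            using power_mono[OF w2, of m] by (simp add: B_def)
        qed (auto simp: B_def)
        finally show ?thesis by simp
      qed
    qed
  qed
qed

subsection \<open>Products of fractional powers\<close>

text \<open>Interpolation of the constant 1: the degree is below \<open>card E\<close>, so agreement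
  on E suffices. The summand of \<xi> lacks exactly the factor 1 - cnj \<xi> z, which a factor 1 - V
  restores.\<close>

lemma lagrange_unit_circle:
  assumes E: "finite E" "E \<noteq> {}" "E \<subseteq> sphere 0 1"
  obtains c :: "complex \<Rightarrow> complex"
  where "(\<Sum>\<xi>\<in>E. Polynomial.smult (c \<xi>) (\<Prod>\<eta>\<in>E - {\<xi>}. [:1, - cnj \<eta>:])) = 1"
proof -
  have nz: "1 - cnj \<eta> * \<xi> \<noteq> 0" if "\<xi> \<in> E" "\<eta> \<in> E" "\<eta> \<noteq> \<xi>" for \<xi> \<eta>
  proof
    assume "1 - cnj \<eta> * \<xi> = 0"
    then have "\<eta> * (cnj \<eta> * \<xi>) = \<eta>" by simp
    moreover have "\<eta> * cnj \<eta> = 1"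
      using that E(3) complex_norm_square[of \<eta>] by auto
    ultimately show False
      using that(3) by (metis mult.assoc mult_1)
  qed
  define P where "P \<xi> = (\<Prod>\<eta>\<in>E - {\<xi>}. [:1, - cnj \<eta>:])" for \<xi>
  define p where "p = (\<Sum>\<xi>\<in>E. Polynomial.smult (1 / poly (P \<xi>) \<xi>) (P \<xi>))"
  have P0: "poly (P \<eta>) \<xi> = 0" if "\<xi> \<in> E" "\<eta> \<in> E" "\<eta> \<noteq> \<xi>" for \<xi> \<eta>
  proof -
    have "cnj \<xi> * \<xi> = 1"
      using that E(3) complex_norm_square[of \<xi>] by (auto simp: mult.commute)
    then have "poly [:1, - cnj \<xi>:] \<xi> = 0" by (simp add: mult.commute)
    then show ?thesis
      unfolding P_def poly_prod using that E(1) by (intro prod_zero) auto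
  qed
  have P1: "poly (P \<xi>) \<xi> \<noteq> 0" if "\<xi> \<in> E" for \<xi>
    unfolding P_def poly_prod using that E(1) nz[OF that] by (auto simp: mult.commute)
  have "p = 1"
  proof (rule poly_eqI_degree)
    show "poly p \<xi> = poly 1 \<xi>" if "\<xi> \<in> E" for \<xi>
    proof -
      have "poly p \<xi> = (\<Sum>\<eta>\<in>E. if \<eta> = \<xi> then 1 else 0)"
        unfolding p_def poly_sum using P0 P1 that by (intro sum.cong) auto
      then show ?thesis using E that by simp
    qed
    have "degree (P \<xi>) \<le> card E - 1" if "\<xi> \<in> E" for \<xi>
    proof -
      have "degree (P \<xi>) \<le> (\<Sum>\<eta>\<in>E - {\<xi>}. degree [:1, - cnj \<eta>:])"
        unfolding P_def using E degree_prod_sum_le[of "E - {\<xi>}" "\<lambda>\<eta>. [:1, - cnj \<eta>:]"]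
        by (simp add: o_def)
      also have "\<dots> \<le> (\<Sum>\<eta>\<in>E - {\<xi>}. 1)"
        by (intro sum_mono) simp
      finally show ?thesis using E that by simp
    qed
    then have "degree p \<le> card E - 1"
      unfolding p_def using E by (intro degree_sum_le) (auto intro: order_trans[OF degree_smult_le])
    then show "degree p < card E"
      using E by (metis One_nat_def Suc_pred card_gt_0_iff le_imp_less_Suc)
    show "degree (1 :: complex poly) < card E"
      using E by (simp add: card_gt_0_iff)
  qed
  then show thesis
    using that[of "\<lambda>\<xi>. 1 / poly (P \<xi>) \<xi>"] by (simp add: p_def P_def)
qed

lemma norm_rotate_power: "cmod c = 1 \<Longrightarrow> norm ((cs c * T) ^ k * S) = norm (T ^ k * S)"
proof (induction k arbitrary: S)
  case (Suc k)
  have "(cs c * T) ^ Suc k * S = cs c * (T * ((cs c * T) ^ k * S))"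
    by (simp add: mult.assoc)
  moreover have "T * ((cs c * T) ^ k * S) = (cs c * T) ^ k * (T * S)"
    by (simp add: mult.assoc[symmetric] power_commuting_commutes cs_commute[of T])
  ultimately have "norm ((cs c * T) ^ Suc k * S) = norm ((cs c * T) ^ k * (T * S))"
    using Suc.prems by (simp only: norm_cs_mult mult_1_left)
  also have "\<dots> = norm (T ^ k * (T * S))"
    by (rule Suc.IH[OF Suc.prems])
  also have "T ^ k * (T * S) = T ^ Suc k * S"
    by (simp only: power_Suc2 mult.assoc)
  finally show ?case .
qed simp

text \<open>An error d in every factor costs O(d) in the product. The constant is the one that the
  induction reproduces: D + (c + 1) D = (c + 2) D.\<close>

lemma prod_list_perturb:
  fixes f :: "'x \<Rightarrow> real"
  assumes "\<And>x. x \<in> set xs \<Longrightarrow> 0 \<le> f x \<and> f x \<le> c" "0 \<le> d" "d \<le> 1" "0 \<le> c"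
  shows "(\<Prod>x\<leftarrow>xs. f x + d) \<le> (\<Prod>x\<leftarrow>xs. f x) + d * (c + 2) ^ length xs \<and>
    0 \<le> (\<Prod>x\<leftarrow>xs. f x) \<and> (\<Prod>x\<leftarrow>xs. f x) \<le> (c + 2) ^ length xs"
  using assms(1)
proof (induction xs)
  case (Cons x xs)
  define P where "P = (\<Prod>x\<leftarrow>xs. f x)"
  define D where "D = (c + 2) ^ length xs"
  have IH: "(\<Prod>x\<leftarrow>xs. f x + d) \<le> P + d * D" "0 \<le> P" "P \<le> D" and x: "0 \<le> f x" "f x \<le> c"
    using Cons by (auto simp: P_def D_def)
  have "(f x + d) * (\<Prod>x\<leftarrow>xs. f x + d) \<le> (f x + d) * (P + d * D)"
    using x assms(2) IH by (intro mult_left_mono) auto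
  also have "\<dots> = f x * P + d * (P + (f x + d) * D)"
    by (simp add: algebra_simps)
  also have "\<dots> \<le> f x * P + d * (D + (c + 1) * D)"
    using x assms IH by (intro add_left_mono mult_left_mono add_mono mult_right_mono) auto
  also have "\<dots> = f x * P + d * ((c + 2) * D)"
    by (simp add: algebra_simps)
  finally have "(f x + d) * (\<Prod>x\<leftarrow>xs. f x + d) \<le> f x * P + d * ((c + 2) * D)" .
  moreover have "f x * P \<le> (c + 2) * D"
    using x IH assms by (intro mult_mono) auto
  ultimately show ?case
    using x IH by (simp add: P_def D_def)
qed (use assms in simp)

context
  fixes E :: "complex set" and T :: "'a::complex_banach cop" and s K :: real
  assumes E: "finite E" "E \<noteq> {}" "E \<subseteq> sphere 0 1" and s: "0 < s" "s < 1" and K: "K > 0"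
    and calc: "\<And>Q B. (\<And>\<xi>. \<xi> \<in> E \<Longrightarrow> poly Q \<xi> = 0) \<Longrightarrow>
      (\<And>z. z \<in> stolz_domain E s \<Longrightarrow> cmod (poly Q z) \<le> B) \<Longrightarrow> norm (pop Q T) \<le> K * B"
begin

lemma unimodular: "\<xi> \<in> E \<Longrightarrow> cmod \<xi> = 1" "\<xi> \<in> E \<Longrightarrow> cnj \<xi> * \<xi> = 1"
  using E(3) complex_norm_square[of \<xi>] by (auto simp: mult.commute[of "cnj _"])

lemma stolz_le_1: "z \<in> stolz_domain E s \<Longrightarrow> cmod z < 1"
  using stolz_subset_ball[OF E(1,3) s] by auto

text \<open>Linear growth of the powers replaces the spectral radius formula.\<close>

lemma power_growth: obtains C where "\<And>k. norm (T ^ k) \<le> C * (real k + 1)"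
proof -
  obtain c where c: "(\<Sum>\<xi>\<in>E. Polynomial.smult (c \<xi>) (\<Prod>\<eta>\<in>E - {\<xi>}. [:1, - cnj \<eta>:])) = 1"
    by (rule lagrange_unit_circle[OF E])
  define p where "p \<xi> = Polynomial.smult (c \<xi>) (\<Prod>\<eta>\<in>E - {\<xi>}. [:1, - cnj \<eta>:])" for \<xi>
  define C where "C \<xi> = norm (pop (p \<xi>) T) + K * (cmod (c \<xi>) * 2 ^ card E)" for \<xi>
  have step: "norm (T ^ k * pop (p \<xi>) T) \<le> norm (pop (p \<xi>) T) + real k * (K * (cmod (c \<xi>) * 2 ^ card E))"
    if \<xi>: "\<xi> \<in> E" for \<xi> k
  proof -
    define V where "V = cs (cnj \<xi>) * T"
    have "norm (V ^ k * pop (p \<xi>) T) \<le> norm (pop (p \<xi>) T) + real k * (K * (cmod (c \<xi>) * 2 ^ card E))"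
    proof (induction k)
      case (Suc k)
      have lin: "pop [:1, - cnj \<xi>:] T = 1 - V"
        by (simp add: pop_linear V_def cs_simps)
      \<comment> \<open>Multiplied by 1 - cnj \<xi> z, the polynomial \<open>p \<xi>\<close> becomes
        a multiple of the full product and vanishes on E. So \<open>calc\<close> bounds the
        increments of V^k \<open>p \<xi>\<close>(T) uniformly in k, and adding them up costs the
        linear growth.\<close>
      have split: "[:1, - cnj \<xi>:] * p \<xi> = Polynomial.smult (c \<xi>) (\<Prod>\<eta>\<in>E. [:1, - cnj \<eta>:])"
        unfolding p_def using E(1) \<xi> by (simp only: mult_smult_right prod.remove[of E \<xi>])
      have "norm (V ^ k * ((1 - V) * pop (p \<xi>) T)) = norm (T ^ k * ((1 - V) * pop (p \<xi>) T))"
        unfolding V_def using unimodular[OF \<xi>] by (intro norm_rotate_power) simp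
      also have "T ^ k * ((1 - V) * pop (p \<xi>) T) = pop (monom 1 k * Polynomial.smult (c \<xi>) (\<Prod>\<eta>\<in>E. [:1, - cnj \<eta>:])) T"
        by (simp only: split[symmetric] pop_mult lin pop_monom cs_simps mult_1_left)
      also have "norm \<dots> \<le> K * (cmod (c \<xi>) * 2 ^ card E)"
      proof (rule calc)
        fix \<eta> assume "\<eta> \<in> E"
        then have "(\<Prod>\<zeta>\<in>E. 1 - \<eta> * cnj \<zeta>) = 0"
          using E(1) unimodular(2) by (intro prod_zero) (auto simp: mult.commute intro!: bexI[of _ \<eta>])
        then show "poly (monom 1 k * Polynomial.smult (c \<xi>) (\<Prod>\<eta>\<in>E. [:1, - cnj \<eta>:])) \<eta> = 0"
          by (simp add: poly_prod)
      next
        fix z assume "z \<in> stolz_domain E s"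
        then have z: "cmod z \<le> 1" using stolz_le_1 by fastforce
        have "cmod (\<Prod>\<eta>\<in>E. 1 - z * cnj \<eta>) \<le> (\<Prod>\<eta>\<in>E. 2)"
          unfolding prod_norm[symmetric]
        proof (intro prod_mono conjI norm_ge_zero)
          fix \<eta> assume "\<eta> \<in> E"
          then have "cmod (z * cnj \<eta>) \<le> 1" using z unimodular(1) by (simp add: norm_mult)
          then show "cmod (1 - z * cnj \<eta>) \<le> 2"
            using norm_triangle_ineq4[of 1 "z * cnj \<eta>"] by simp
        qed
        then have "cmod z ^ k * (cmod (c \<xi>) * cmod (\<Prod>\<eta>\<in>E. 1 - z * cnj \<eta>)) \<le> 1 * (cmod (c \<xi>) * 2 ^ card E)"
          using z by (intro mult_mono power_le_one) auto
        then show "cmod (poly (monom 1 k * Polynomial.smult (c \<xi>) (\<Prod>\<eta>\<in>E. [:1, - cnj \<eta>:])) z) \<le> cmod (c \<xi>) * 2 ^ card E"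
          by (simp add: poly_monom poly_prod norm_mult norm_power mult.left_commute)
      qed
      finally have "norm (V ^ k * ((1 - V) * pop (p \<xi>) T)) \<le> K * (cmod (c \<xi>) * 2 ^ card E)" .
      moreover have "V ^ Suc k * pop (p \<xi>) T = V ^ k * pop (p \<xi>) T - V ^ k * ((1 - V) * pop (p \<xi>) T)"
        by (simp add: left_diff_distrib right_diff_distrib power_commutes mult.assoc[symmetric])
      ultimately have "norm (V ^ Suc k * pop (p \<xi>) T) \<le> norm (V ^ k * pop (p \<xi>) T) + K * (cmod (c \<xi>) * 2 ^ card E)"
        using norm_triangle_ineq4[of "V ^ k * pop (p \<xi>) T" "V ^ k * ((1 - V) * pop (p \<xi>) T)"] by simp
      with Suc show ?case by (simp add: algebra_simps)
    qed simp
    then show ?thesis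
      unfolding V_def using unimodular[OF \<xi>] by (subst (asm) norm_rotate_power) auto
  qed
  show thesis
  proof (rule that[of "\<Sum>\<xi>\<in>E. C \<xi>"])
    fix k
    have "T ^ k = T ^ k * pop (\<Sum>\<xi>\<in>E. p \<xi>) T"
      unfolding p_def c by simp
    also have "\<dots> = (\<Sum>\<xi>\<in>E. T ^ k * pop (p \<xi>) T)"
      by (simp add: pop_sum sum_distrib_left)
    finally have "norm (T ^ k) \<le> (\<Sum>\<xi>\<in>E. norm (T ^ k * pop (p \<xi>) T))"
      by (metis norm_sum)
    also have "\<dots> \<le> (\<Sum>\<xi>\<in>E. C \<xi> * (real k + 1))"
    proof (rule sum_mono)
      fix \<xi> assume "\<xi> \<in> E"
      have "0 \<le> real k * norm (pop (p \<xi>) T)" "0 \<le> K * (cmod (c \<xi>) * 2 ^ card E)" using K by auto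
      moreover have "C \<xi> * (real k + 1) = norm (pop (p \<xi>) T) + real k * (K * (cmod (c \<xi>) * 2 ^ card E))
          + (real k * norm (pop (p \<xi>) T) + K * (cmod (c \<xi>) * 2 ^ card E))"
        by (simp add: C_def algebra_simps)
      ultimately show "norm (T ^ k * pop (p \<xi>) T) \<le> C \<xi> * (real k + 1)"
        using step[OF \<open>\<xi> \<in> E\<close>, of k] by linarith
    qed
    finally show "norm (T ^ k) \<le> (\<Sum>\<xi>\<in>E. C \<xi>) * (real k + 1)"
      by (simp add: sum_distrib_right)
  qed
qed

text \<open>t + (1 - V) is cnj \<xi> times z - T for z = (1 + t) \<xi>, a point outside the closed
  disc. In the Ritt bound the factor of \<xi> has modulus t and the other factors stay above a
  positive constant, so t times the resolvent is bounded.\<close>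

lemma ritt_sectorial:
  assumes ritt: "ritt_op E (rep_cop T)" and \<xi>: "\<xi> \<in> E"
  defines "V \<equiv> cs (cnj \<xi>) * T"
  obtains M where "\<And>t. t > 0 \<Longrightarrow> cop_unit (t *\<^sub>R 1 + (1 - V))"
    "\<And>t. 0 < t \<Longrightarrow> t \<le> 1 \<Longrightarrow> t * norm (cop_inv (t *\<^sub>R 1 + (1 - V))) \<le> M"
proof -
  define z where "z t = complex_of_real (1 + t) * \<xi>" for t
  have cz: "cnj \<xi> * z t = complex_of_real (1 + t)" for t
    using unimodular(2)[OF \<xi>] by (simp add: z_def mult.left_commute)
  have norm_z: "cmod (z t) = 1 + t" if "t > 0" for t
    unfolding z_def norm_mult unimodular(1)[OF \<xi>] using that by (simp only: norm_of_real) simp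
  have W: "t *\<^sub>R 1 + (1 - V) = cs (cnj \<xi>) * (cs (z t) - T)" for t
    using cs_of_real[of t "1 :: 'a cop"]
    by (simp add: V_def right_diff_distrib cs_simps(3)[symmetric] cz) (simp add: cs_simps)
  have unit: "cop_unit (cs (z t) - T)" if "t > 0" for t
  proof -
    have "z t \<notin> spectrum (rep_cop T)"
      using ritt norm_z[OF that] that by (auto simp: ritt_op_def)
    then show ?thesis by (simp add: cop_unit_iff_spectrum)
  qed
  have inv: "cop_unit (t *\<^sub>R 1 + (1 - V))" "cop_inv (t *\<^sub>R 1 + (1 - V)) = cs \<xi> * cop_inv (cs (z t) - T)"
    if "t > 0" for t
  proof -
    have "cs (cnj \<xi>) * (cs (z t) - T) * (cs \<xi> * cop_inv (cs (z t) - T)) = cs (cnj \<xi>) * cs \<xi> * ((cs (z t) - T) * cop_inv (cs (z t) - T))"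
      by (simp only: mult.assoc cs_left_commute[of "cs (z t) - T"])
    moreover have "cs \<xi> * cop_inv (cs (z t) - T) * (cs (cnj \<xi>) * (cs (z t) - T)) = cs \<xi> * cs (cnj \<xi>) * (cop_inv (cs (z t) - T) * (cs (z t) - T))"
      by (simp only: mult.assoc cs_left_commute[of "cop_inv _"])
    ultimately show "cop_unit (t *\<^sub>R 1 + (1 - V))" "cop_inv (t *\<^sub>R 1 + (1 - V)) = cs \<xi> * cop_inv (cs (z t) - T)"
      unfolding W using unimodular(2)[OF \<xi>]
      by (auto intro!: cop_inv_unique simp: cop_inv[OF unit[OF that]] cs_simps(3)[symmetric] cs_simps(5) mult.commute)
  qed
  have "bounded ((\<lambda>z. (\<Prod>\<eta>\<in>E. 1 - cnj \<eta> * z) *\<^sub>C resolvent z (rep_cop T)) ` {z. 1 < cmod z \<and> cmod z < 3})"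
    using ritt by (simp add: ritt_op_def)
  then obtain b where b: "\<And>z. 1 < cmod z \<Longrightarrow> cmod z < 3 \<Longrightarrow> norm ((\<Prod>\<eta>\<in>E. 1 - cnj \<eta> * z) *\<^sub>C resolvent z (rep_cop T)) \<le> b"
    unfolding bounded_iff by blast
  define d where "d = (\<Prod>\<eta>\<in>E - {\<xi>}. cmod (\<xi> - \<eta>))"
  have d: "d > 0" unfolding d_def by (intro prod_pos) auto
  \<comment> \<open>Moving from \<xi> radially outwards does not approach another point of the
    circle, because (\<xi> - \<eta>) \<bullet> \<xi> \<ge> 0.\<close>
  have far: "cmod (\<xi> - \<eta>) \<le> cmod (1 - cnj \<eta> * z t)" if "\<eta> \<in> E" "t > 0" for \<eta> t
  proof -
    have "cmod (1 - cnj \<eta> * z t) = cmod (\<eta> * (1 - cnj \<eta> * z t))"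
      using unimodular(1)[OF that(1)] by (simp add: norm_mult)
    also have "\<eta> * (1 - cnj \<eta> * z t) = \<eta> - z t"
      using unimodular(2)[OF that(1)] by (simp add: right_diff_distrib mult.assoc[symmetric] mult.commute)
    finally have eq: "cmod (1 - cnj \<eta> * z t) = cmod (z t - \<eta>)"
      by (simp add: norm_minus_commute)
    have "\<xi> \<bullet> \<eta> \<le> 1"
      using norm_cauchy_schwarz[of \<xi> \<eta>] unimodular(1) \<xi> that by simp
    moreover have "\<xi> \<bullet> \<xi> = 1"
      using unimodular(1)[OF \<xi>] by (simp add: power2_norm_eq_inner[symmetric])
    ultimately have "0 \<le> (\<xi> - \<eta>) \<bullet> (t *\<^sub>R \<xi>)"
      using that(2) by (simp add: inner_diff_left inner_commute[of \<eta>])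
    then have "(norm (\<xi> - \<eta>))\<^sup>2 \<le> (norm ((\<xi> - \<eta>) + t *\<^sub>R \<xi>))\<^sup>2"
      using \<open>\<xi> \<bullet> \<xi> = 1\<close> by (simp add: power2_norm_eq_inner inner_add inner_commute)
    also have "(\<xi> - \<eta>) + t *\<^sub>R \<xi> = z t - \<eta>"
      by (simp add: z_def scaleR_conv_of_real algebra_simps)
    finally show ?thesis
      unfolding eq by (rule power2_le_imp_le) simp
  qed
  show thesis
  proof (rule that[of "b / d"])
    fix t :: real assume t: "0 < t" "t \<le> 1"
    have "t * d \<le> (\<Prod>\<eta>\<in>E. cmod (1 - cnj \<eta> * z t))"
    proof -
      have "(\<Prod>\<eta>\<in>E. cmod (1 - cnj \<eta> * z t)) = cmod (1 - cnj \<xi> * z t) * (\<Prod>\<eta>\<in>E - {\<xi>}. cmod (1 - cnj \<eta> * z t))"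
        using E(1) \<xi> by (rule prod.remove)
      moreover have "cmod (1 - cnj \<xi> * z t) = t"
        unfolding cz using t by (simp add: norm_minus_commute)
      moreover have "d \<le> (\<Prod>\<eta>\<in>E - {\<xi>}. cmod (1 - cnj \<eta> * z t))"
        unfolding d_def using far t by (intro prod_mono) auto
      ultimately show ?thesis using t by simp
    qed
    then have "t * d * norm (cop_inv (cs (z t) - T)) \<le> (\<Prod>\<eta>\<in>E. cmod (1 - cnj \<eta> * z t)) * norm (cop_inv (cs (z t) - T))"
      by (intro mult_right_mono) auto
    also have "\<dots> = norm ((\<Prod>\<eta>\<in>E. 1 - cnj \<eta> * z t) *\<^sub>C resolvent (z t) (rep_cop T))"
      by (simp add: norm_scaleC resolvent_rep_cop[OF unit[OF t(1)]] prod_norm)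
    also have "\<dots> \<le> b"
      using norm_z[OF t(1)] t by (intro b) auto
    finally have "t * norm (cop_inv (cs (z t) - T)) \<le> b / d"
      using d by (simp add: field_simps)
    then show "t * norm (cop_inv (t *\<^sub>R 1 + (1 - V))) \<le> b / d"
      using unimodular(1)[OF \<xi>] by (simp add: inv(2)[OF t(1)] norm_cs_mult)
  qed (rule inv)
qed

end

text \<open>For h = 1 - x one has x \<le> exp (-h) and (l h)^\<alpha> \<le> const exp (l h / 2).
  Half of the exponential decay absorbs the weight; the other half leaves a geometric series with
  sum O(1/h), which uses up the extra factor h.\<close>

lemma weighted_geometric_bound:
  assumes \<alpha>: "\<alpha> > 0"
  obtains C where "C > 0"
    "\<And>x n. 0 \<le> x \<Longrightarrow> x < 1 \<Longrightarrow> (\<Sum>l=1..n. real l powr \<alpha> * x ^ (l - 1)) * (1 - x) powr (1 + \<alpha>) \<le> C"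
    "\<And>x n. 0 \<le> x \<Longrightarrow> x < 1 \<Longrightarrow> n \<ge> 1 \<Longrightarrow> real n powr \<alpha> * x ^ (n - 1) * (1 - x) powr \<alpha> \<le> C"
proof -
  \<comment> \<open>exp (1/2) pays for the exponent l - 1 in place of l, as h \<le> 1.\<close>
  define A where "A = (2 * \<alpha>) powr \<alpha> * exp (1 / 2)"
  have A: "A > 0" using \<alpha> by (simp add: A_def)
  have single: "real l powr \<alpha> * x ^ (l - 1) * (1 - x) powr \<alpha> \<le> A * exp (- (1 - x) / 2) ^ (l - 1)"
    if x: "0 \<le> x" "x < 1" and l: "l \<ge> 1" for x l
  proof -
    define h where "h = 1 - x"
    have h: "0 < h" "h \<le> 1" using x by (auto simp: h_def)
    have "x \<le> exp (- h)"
      using exp_ge_add_one_self[of "- h"] by (simp add: h_def)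
    then have "x ^ (l - 1) \<le> exp (- h) ^ (l - 1)"
      using x by (intro power_mono) auto
    also have "exp (- h) = exp (- h / 2) * exp (- h / 2)"
      by (simp add: exp_add[symmetric])
    finally have x_le: "x ^ (l - 1) \<le> exp (- h / 2) ^ (l - 1) * exp (- h / 2) ^ (l - 1)"
      by (simp add: power_mult_distrib)
    have "real l * h / (2 * \<alpha>) \<le> exp (real l * h / (2 * \<alpha>))"
      using exp_ge_add_one_self[of "real l * h / (2 * \<alpha>)"] by linarith
    then have "(real l * h / (2 * \<alpha>)) powr \<alpha> \<le> exp (real l * h / (2 * \<alpha>)) powr \<alpha>"
      using h l \<alpha> by (intro powr_mono2) auto
    also have "\<dots> = exp (real l * h / 2)"
      using \<alpha> by (simp add: powr_def)
    finally have "(real l * h) powr \<alpha> \<le> (2 * \<alpha>) powr \<alpha> * exp (real l * h / 2)"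
      using h l \<alpha> by (simp add: powr_divide divide_le_eq mult.commute)
    also have "real l * h / 2 = h / 2 + real (l - 1) * (h / 2)"
      using l by (simp add: of_nat_diff algebra_simps diff_divide_distrib add_divide_distrib)
    also have "exp \<dots> = exp (h / 2) * exp (h / 2) ^ (l - 1)"
      by (simp only: exp_add exp_of_nat_mult)
    also have "(2 * \<alpha>) powr \<alpha> * (exp (h / 2) * exp (h / 2) ^ (l - 1)) \<le> A * exp (h / 2) ^ (l - 1)"
      unfolding A_def using h by (simp add: mult.assoc mult_left_mono)
    finally have "real l powr \<alpha> * h powr \<alpha> \<le> A * exp (h / 2) ^ (l - 1)"
      using h by (simp add: powr_mult)
    then have "(real l powr \<alpha> * h powr \<alpha>) * x ^ (l - 1)
      \<le> (A * exp (h / 2) ^ (l - 1)) * (exp (- h / 2) ^ (l - 1) * exp (- h / 2) ^ (l - 1))"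
      by (rule mult_mono[OF _ x_le]) (use x A in auto)
    also have "\<dots> = A * (exp (h / 2) ^ (l - 1) * (exp (- h / 2) ^ (l - 1) * exp (- h / 2) ^ (l - 1)))"
      by (rule mult.assoc)
    also have "exp (h / 2) ^ (l - 1) * (exp (- h / 2) ^ (l - 1) * exp (- h / 2) ^ (l - 1))
      = (exp (h / 2) * exp (- h / 2)) ^ (l - 1) * exp (- h / 2) ^ (l - 1)"
      by (simp only: power_mult_distrib mult.assoc)
    also have "exp (h / 2) * exp (- h / 2) = 1"
      by (simp add: exp_add[symmetric])
    finally show ?thesis
      by (simp add: h_def mult_ac)
  qed
  have sum: "(\<Sum>l=1..n. real l powr \<alpha> * x ^ (l - 1)) * (1 - x) powr (1 + \<alpha>) \<le> 4 * A"
    if x: "0 \<le> x" "x < 1" for x n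
  proof -
    define y where "y = exp (- (1 - x) / 2)"
    have y: "0 < y" "y < 1" using x by (auto simp: y_def)
    have "1 + (1 - x) / 2 \<le> exp ((1 - x) / 2)"
      by (rule exp_ge_add_one_self)
    then have "y * (1 + (1 - x) / 2) \<le> y * exp ((1 - x) / 2)"
      using y by (intro mult_left_mono) auto
    also have "\<dots> = 1"
      by (simp add: y_def exp_add[symmetric] add_divide_distrib[symmetric])
    finally have "y * ((1 - x) / 2) \<le> 1 - y"
      by (simp add: algebra_simps)
    moreover have "y \<ge> 1 / 2"
      using exp_ge_add_one_self[of "- (1 - x) / 2"] x by (simp add: y_def field_simps)
    ultimately have gap: "(1 - x) / 4 \<le> 1 - y"
      using mult_right_mono[of "1/2" y "(1 - x) / 2"] x by simp
    have "(\<Sum>l=1..n. real l powr \<alpha> * x ^ (l - 1)) * (1 - x) powr (1 + \<alpha>)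
      = (\<Sum>l=1..n. real l powr \<alpha> * x ^ (l - 1) * (1 - x) powr \<alpha>) * (1 - x)"
    proof -
      have "(1 - x) powr (1 + \<alpha>) = (1 - x) powr \<alpha> * (1 - x)"
        using x by (simp add: powr_add)
      then show ?thesis
        by (simp only: sum_distrib_right mult.assoc)
    qed
    also have "\<dots> \<le> (\<Sum>l=1..n. A * y ^ (l - 1)) * (1 - x)"
      using single x by (intro mult_right_mono sum_mono) (auto simp: y_def)
    also have "(\<Sum>l=1..n. A * y ^ (l - 1)) = A * (\<Sum>l<n. y ^ l)"
      by (simp add: sum_distrib_left sum.atLeast1_atMost_eq)
    also have "(\<Sum>l<n. y ^ l) = (1 - y ^ n) / (1 - y)"
      using y by (simp add: sum_gp_strict)
    also have "A * ((1 - y ^ n) / (1 - y)) * (1 - x) \<le> A * (1 / (1 - y)) * (4 * (1 - y))"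
    proof -
      have "0 \<le> (1 - y ^ n) / (1 - y)"
        using y by (intro divide_nonneg_pos) (auto simp: power_le_one)
      moreover have "(1 - y ^ n) / (1 - y) \<le> 1 / (1 - y)"
        using y by (intro divide_right_mono) auto
      moreover have "1 - x \<le> 4 * (1 - y)"
        using gap by (simp add: pos_divide_le_eq mult.commute)
      ultimately show ?thesis
        using A x y by (intro mult_mono mult_nonneg_nonneg) auto
    qed
    also have "\<dots> = 4 * A"
      using y by (simp add: divide_simps)
    finally show ?thesis .
  qed
  show thesis
  proof (rule that[of "4 * A"])
    show "real n powr \<alpha> * x ^ (n - 1) * (1 - x) powr \<alpha> \<le> 4 * A" if x: "0 \<le> x" "x < 1" "n \<ge> 1" for x n
    proof -
      have "exp (- (1 - x) / 2) ^ (n - 1) \<le> 1"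
        using x by (intro power_le_one) auto
      then have "A * exp (- (1 - x) / 2) ^ (n - 1) \<le> A * 1"
        using A by (intro mult_left_mono) auto
      with single[OF x] A show ?thesis by linarith
    qed
  qed (use A sum in auto)
qed

section \<open>Fractional powers as limits inside the calculus\<close>

lemma rep_cop_foldr:
  assumes "\<And>\<xi>. \<xi> \<in> set \<xi>s \<Longrightarrow> rep_cop (F \<xi>) = frac_power (id_blinfun - cnj \<xi> *\<^sub>C T) \<alpha>"
  shows "rep_cop (foldr (\<lambda>\<xi> B. F \<xi> * B) \<xi>s 1) = frac_prod \<xi>s \<alpha> T"
  using assms unfolding frac_prod_def by (induction \<xi>s) simp_all

lemma tendsto_foldr_mult:
  fixes F :: "'x \<Rightarrow> 'a::complex_banach cop"
  assumes "\<And>\<xi>. \<xi> \<in> set \<xi>s \<Longrightarrow> (\<lambda>n. G n \<xi>) \<longlonglongrightarrow> F \<xi>"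
  shows "(\<lambda>n. foldr (\<lambda>\<xi> B. G n \<xi> * B) \<xi>s 1) \<longlonglongrightarrow> foldr (\<lambda>\<xi> B. F \<xi> * B) \<xi>s 1"
  using assms by (induction \<xi>s) (auto intro!: tendsto_mult)

lemma pop_prod_list: "pop (\<Prod>\<xi>\<leftarrow>\<xi>s. p \<xi>) T = foldr (\<lambda>\<xi> B. pop (p \<xi>) T * B) \<xi>s 1"
  by (induction \<xi>s) (simp_all add: pop_mult)

lemma poly_prod_list: "poly (\<Prod>\<xi>\<leftarrow>\<xi>s. p \<xi>) z = (\<Prod>\<xi>\<leftarrow>\<xi>s. poly (p \<xi>) z)"
  by (induction \<xi>s) simp_all

lemma norm_prod_list_le:
  fixes f :: "'x \<Rightarrow> complex"
  assumes "\<And>x. x \<in> set xs \<Longrightarrow> cmod (f x) \<le> g x"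
  shows "cmod (\<Prod>x\<leftarrow>xs. f x) \<le> (\<Prod>x\<leftarrow>xs. g x) \<and> 0 \<le> (\<Prod>x\<leftarrow>xs. g x)"
  using assms
proof (induction xs)
  case (Cons x xs)
  then show ?case
    using norm_ge_zero[of "f x"] by (auto simp: norm_mult intro!: mult_mono mult_nonneg_nonneg
        intro: order_trans[OF norm_ge_zero])
qed simp

lemma pop_pcompose_linear: "pop (pcompose p [:0, c:]) T = pop p (cs c * T)"
proof (induction p)
  case (pCons a p)
  have "pop [:0, c:] T = cs c * T"
    by (simp add: pop_linear cs_simps)
  then show ?case
    using pCons by (simp only: pcompose_pCons pop_add pop_mult pop_const pop_pCons[of a])
qed simp

lemma prod_list_const_mult:
  fixes f :: "'x \<Rightarrow> real"
  shows "(\<Prod>x\<leftarrow>xs. b * f x) = b ^ length xs * (\<Prod>x\<leftarrow>xs. f x)"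
  by (induction xs) (simp_all add: mult_ac)

text \<open>The calculus is applied to Q times polynomials \<open>P n\<close> that approximate the
  product of fractional powers, and n tends to infinity. Since \<open>P n\<close> vanishes on E, Q
  may be arbitrary. The additive error in the scalar bound of \<open>P n\<close> disappears in the
  limit because Q is bounded on the disc, so only the \<alpha>-th power of the product survives as a
  weight.\<close>

lemma frac_prod_bound:
  fixes T :: "'a::complex_banach cop"
  assumes \<xi>s: "\<xi>s \<noteq> []" "distinct \<xi>s" "set \<xi>s \<subseteq> sphere 0 1" and s: "0 < s" "s < 1" and K: "K > 0"
    and calc: "\<And>Q B. (\<And>\<xi>. \<xi> \<in> set \<xi>s \<Longrightarrow> poly Q \<xi> = 0) \<Longrightarrow>
      (\<And>z. z \<in> stolz_domain (set \<xi>s) s \<Longrightarrow> cmod (poly Q z) \<le> B) \<Longrightarrow> norm (pop Q T) \<le> K * B"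
    and ritt: "ritt_op (set \<xi>s) (rep_cop T)" and \<alpha>: "\<alpha> > 0"
  obtains A K' where "rep_cop A = frac_prod \<xi>s \<alpha> (rep_cop T)" "K' > 0"
    "\<And>Q B. 0 \<le> B \<Longrightarrow> (\<And>z. z \<in> stolz_domain (set \<xi>s) s \<Longrightarrow>
      cmod (poly Q z) * (\<Prod>\<xi>\<in>set \<xi>s. cmod (\<xi> - z)) powr \<alpha> \<le> B) \<Longrightarrow> norm (pop Q T * A) \<le> K' * B"
proof -
  define E where "E = set \<xi>s"
  have E: "finite E" "E \<noteq> {}" "E \<subseteq> sphere 0 1" using \<xi>s by (auto simp: E_def)
  note calcE = calc[folded E_def]
  have unimod: "cmod \<xi> = 1" "cnj \<xi> * \<xi> = 1" if "\<xi> \<in> E" for \<xi>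
    using that E(3) complex_norm_square[of \<xi>] by (auto simp: mult.commute[of "cnj _"])
  have disc: "cmod z < 1" if "z \<in> stolz_domain E s" for z
    using stolz_subset_ball[OF E(1,3) s] that by auto
  have "\<exists>C. \<forall>k. norm (T ^ k) \<le> C * (real k + 1)"
  proof (rule power_growth[OF E s K])
    show "norm (pop Q T) \<le> K * B"
      if "\<And>\<xi>. \<xi> \<in> E \<Longrightarrow> poly Q \<xi> = 0" "\<And>z. z \<in> stolz_domain E s \<Longrightarrow> cmod (poly Q z) \<le> B" for Q B
      by (rule calcE[OF that])
  qed blast
  then obtain C where C: "\<And>k. norm (T ^ k) \<le> C * (real k + 1)"
    by blast
  define appr where "appr \<xi> F q B \<longleftrightarrow> rep_cop F = frac_power (id_blinfun - cnj \<xi> *\<^sub>C rep_cop T) \<alpha> \<and>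
      (\<lambda>n. pop (q n) (cs (cnj \<xi>) * T)) \<longlonglongrightarrow> F \<and> (\<forall>n. poly (q n) 1 = 0) \<and> B \<ge> 0 \<and>
      (\<forall>n w. cmod w \<le> 1 \<longrightarrow> cmod (poly (q n) w) \<le> B * cmod (1 - w) powr \<alpha> + B / real (Suc n))"
    for \<xi> and F :: "'a cop" and q and B :: real
  have "\<exists>F q B. appr \<xi> F q B"
    if \<xi>: "\<xi> \<in> E" for \<xi>
  proof -
    have "\<exists>M. (\<forall>t>0. cop_unit (t *\<^sub>R 1 + (1 - cs (cnj \<xi>) * T))) \<and>
      (\<forall>t. 0 < t \<and> t \<le> 1 \<longrightarrow> t * norm (cop_inv (t *\<^sub>R 1 + (1 - cs (cnj \<xi>) * T))) \<le> M)"
    proof (rule ritt_sectorial[OF E s K _ ritt[folded E_def] \<xi>])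
      show "norm (pop Q T) \<le> K * B"
        if "\<And>\<xi>. \<xi> \<in> E \<Longrightarrow> poly Q \<xi> = 0" "\<And>z. z \<in> stolz_domain E s \<Longrightarrow> cmod (poly Q z) \<le> B" for Q B
        by (rule calcE[OF that])
    qed blast
    then obtain M where M: "\<And>t. t > 0 \<Longrightarrow> cop_unit (t *\<^sub>R 1 + (1 - cs (cnj \<xi>) * T))"
      "\<And>t. 0 < t \<Longrightarrow> t \<le> 1 \<Longrightarrow> t * norm (cop_inv (t *\<^sub>R 1 + (1 - cs (cnj \<xi>) * T))) \<le> M"
      by blast
    have growth: "norm ((cs (cnj \<xi>) * T) ^ k) \<le> C * (real k + 1)" for k
      using C[of k] norm_rotate_power[of "cnj \<xi>" T k 1] unimod(1)[OF \<xi>] by simp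
    have rep: "rep_cop (1 - cs (cnj \<xi>) * T) = id_blinfun - cnj \<xi> *\<^sub>C rep_cop T"
      by (simp only: rep_cop_simps(2,6) rep_cs(2))
    obtain F q B where F: "rep_cop F = frac_power (rep_cop (1 - cs (cnj \<xi>) * T)) \<alpha>"
      "(\<lambda>n. pop (q n) (cs (cnj \<xi>) * T)) \<longlonglongrightarrow> F" "\<And>n. poly (q n) 1 = 0" "(B :: real) \<ge> 0"
      "\<And>n w. cmod w \<le> 1 \<Longrightarrow> cmod (poly (q n) w) \<le> B * cmod (1 - w) powr \<alpha> + B / real (Suc n)"
    proof (rule frac_power_approx[OF M growth \<alpha>])
      fix F q and B :: real
      assume 1: "rep_cop F = frac_power (rep_cop (1 - cs (cnj \<xi>) * T)) \<alpha>"
        "(\<lambda>n. pop (q n) (cs (cnj \<xi>) * T)) \<longlonglongrightarrow> F"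
        and 2: "\<And>n. poly (q n) 1 = 0" and 3: "B \<ge> 0"
        and 4: "\<And>n w. cmod w \<le> 1 \<Longrightarrow> cmod (poly (q n) w) \<le> B * cmod (1 - w) powr \<alpha> + B / real (Suc n)"
      show thesis
        by (rule that[OF 1 2 3 4])
    qed
    then have "appr \<xi> F q B"
      unfolding appr_def rep by simp
    then show ?thesis by blast
  qed
  then obtain F q B where "\<And>\<xi>. \<xi> \<in> E \<Longrightarrow> appr \<xi> (F \<xi>) (q \<xi>) (B \<xi>)"
    by metis
  then have F: "\<And>\<xi>. \<xi> \<in> E \<Longrightarrow> rep_cop (F \<xi>) = frac_power (id_blinfun - cnj \<xi> *\<^sub>C rep_cop T) \<alpha>"
    and q_lim: "\<And>\<xi>. \<xi> \<in> E \<Longrightarrow> (\<lambda>n. pop (q \<xi> n) (cs (cnj \<xi>) * T)) \<longlonglongrightarrow> F \<xi>"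
    and q1: "\<And>\<xi> n. \<xi> \<in> E \<Longrightarrow> poly (q \<xi> n) 1 = 0" and B0: "\<And>\<xi>. \<xi> \<in> E \<Longrightarrow> B \<xi> \<ge> 0"
    and qB: "\<And>\<xi> n w. \<xi> \<in> E \<Longrightarrow> cmod w \<le> 1 \<Longrightarrow> cmod (poly (q \<xi> n) w) \<le> B \<xi> * cmod (1 - w) powr \<alpha> + B \<xi> / real (Suc n)"
    unfolding appr_def by simp_all
  \<comment> \<open>A common bound for the constants \<open>B \<xi>\<close>, positive even if all of
    them are 0.\<close>
  define b where "b = 1 + (\<Sum>\<xi>\<in>E. B \<xi>)"
  have b: "b \<ge> 1" "B \<xi> \<le> b" if "\<xi> \<in> E" for \<xi>
    using B0 E(1) that member_le_sum[of \<xi> E B] sum_nonneg[of E B] by (auto simp: b_def)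
  have b1: "b \<ge> 1" using b E(2) by blast
  define A where "A = foldr (\<lambda>\<xi> B. F \<xi> * B) \<xi>s 1"
  define P where "P n = (\<Prod>\<xi>\<leftarrow>\<xi>s. pcompose (q \<xi> n) [:0, cnj \<xi>:])" for n
  have P_lim: "(\<lambda>n. pop (P n) T) \<longlonglongrightarrow> A"
    unfolding P_def A_def pop_prod_list
    by (rule tendsto_foldr_mult) (use q_lim in \<open>simp add: pop_pcompose_linear E_def\<close>)
  have P_zero: "poly (P n) \<xi> = 0" if "\<xi> \<in> E" for n \<xi>
  proof -
    have "poly (pcompose (q \<xi> n) [:0, cnj \<xi>:]) \<xi> = 0"
      using q1[OF that] unimod(2)[OF that] by (simp add: poly_pcompose mult.commute)
    then show ?thesis
      unfolding P_def poly_prod_list using that by (auto simp: E_def prod_list_zero_iff)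
  qed
  \<comment> \<open>Bounds one factor on the disc, where |\<xi> - z| \<le> 2.\<close>
  define c where "c = b * 2 powr \<alpha>"
  define w where "w z = (\<Prod>\<xi>\<in>E. cmod (\<xi> - z)) powr \<alpha>" for z
  have rot: "cmod (1 - cnj \<xi> * z) = cmod (\<xi> - z)" if "\<xi> \<in> E" for \<xi> z
  proof -
    have "\<xi> - z = \<xi> * (1 - cnj \<xi> * z)"
      using unimod(2)[OF that] by (simp add: right_diff_distrib mult.assoc[symmetric] mult.commute[of \<xi>])
    then show ?thesis using unimod(1)[OF that] by (simp add: norm_mult)
  qed
  have P_bound: "cmod (poly (P n) z) \<le> b ^ length \<xi>s * w z + b / real (Suc n) * (c + 2) ^ length \<xi>s"
    if z: "cmod z \<le> 1" and n: "b / real (Suc n) \<le> 1" for z n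
  proof -
    have "cmod (poly (P n) z) \<le> (\<Prod>\<xi>\<leftarrow>\<xi>s. b * cmod (\<xi> - z) powr \<alpha> + b / real (Suc n))"
      unfolding P_def poly_prod_list
    proof (rule conjunct1[OF norm_prod_list_le])
      fix \<xi> assume "\<xi> \<in> set \<xi>s"
      then have \<xi>: "\<xi> \<in> E" by (simp add: E_def)
      have "cmod (cnj \<xi> * z) \<le> 1" using z unimod(1)[OF \<xi>] by (simp add: norm_mult)
      from qB[OF \<xi> this, of n] rot[OF \<xi>]
      have "cmod (poly (pcompose (q \<xi> n) [:0, cnj \<xi>:]) z) \<le> B \<xi> * cmod (\<xi> - z) powr \<alpha> + B \<xi> / real (Suc n)"
        by (simp add: poly_pcompose mult.commute)
      also have "\<dots> \<le> b * cmod (\<xi> - z) powr \<alpha> + b / real (Suc n)"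
        using b(2)[OF \<xi>] by (intro add_mono mult_right_mono divide_right_mono) auto
      finally show "cmod (poly (pcompose (q \<xi> n) [:0, cnj \<xi>:]) z) \<le> b * cmod (\<xi> - z) powr \<alpha> + b / real (Suc n)" .
    qed
    also have "\<dots> \<le> (\<Prod>\<xi>\<leftarrow>\<xi>s. b * cmod (\<xi> - z) powr \<alpha>) + b / real (Suc n) * (c + 2) ^ length \<xi>s"
    proof (rule conjunct1[OF prod_list_perturb])
      fix \<xi> assume "\<xi> \<in> set \<xi>s"
      then have "cmod (\<xi> - z) \<le> 2"
        using norm_triangle_ineq4[of \<xi> z] z unimod(1)[of \<xi>] by (simp add: E_def)
      then show "0 \<le> b * cmod (\<xi> - z) powr \<alpha> \<and> b * cmod (\<xi> - z) powr \<alpha> \<le> c"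
        unfolding c_def using b1 \<alpha> by (auto intro!: mult_left_mono powr_mono2)
    qed (use n b1 in \<open>auto simp: c_def\<close>)
    also have "(\<Prod>\<xi>\<leftarrow>\<xi>s. b * cmod (\<xi> - z) powr \<alpha>) = b ^ length \<xi>s * w z"
      unfolding prod_list_const_mult w_def E_def
      by (simp add: prod.distinct_set_conv_list[OF \<xi>s(2), symmetric] prod_powr_distrib)
    finally show ?thesis .
  qed
  define K' where "K' = K * b ^ length \<xi>s"
  have "rep_cop A = frac_prod \<xi>s \<alpha> (rep_cop T)"
    unfolding A_def by (rule rep_cop_foldr) (use F in \<open>simp add: E_def\<close>)
  moreover have "K' > 0" using K b1 by (simp add: K'_def)
  moreover have "norm (pop Q T * A) \<le> K' * Bd"
    if Bd: "0 \<le> Bd" "\<And>z. z \<in> stolz_domain E s \<Longrightarrow> cmod (poly Q z) * w z \<le> Bd" for Q Bd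
  proof -
    obtain D where D: "D > 0" "\<And>z. cmod z \<le> 1 \<Longrightarrow> cmod (poly Q z) \<le> D"
      by (rule bounded_poly_cball[of 1 Q]) (rule that)
    define e where "e n = D * (b / real (Suc n) * (c + 2) ^ length \<xi>s)" for n
    have "(\<lambda>n. b / real (Suc n)) \<longlonglongrightarrow> 0"
      using tendsto_mult[OF tendsto_const[of b] LIMSEQ_Suc[OF lim_1_over_n[where 'a = real]]] by simp
    note b_lim = this
    have "(\<lambda>n. D * (b / real (Suc n) * (c + 2) ^ length \<xi>s)) \<longlonglongrightarrow> D * (0 * (c + 2) ^ length \<xi>s)"
      by (intro tendsto_mult tendsto_const b_lim)
    then have e_lim: "e \<longlonglongrightarrow> 0" by (simp add: e_def[abs_def])
    have ev: "eventually (\<lambda>n. b / real (Suc n) \<le> 1) sequentially"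
      using order_tendstoD(2)[OF b_lim, of 1] by (auto elim: eventually_mono)
    have "eventually (\<lambda>n. norm (pop Q T * pop (P n) T) \<le> K * (b ^ length \<xi>s * Bd + e n)) sequentially"
      using ev
    proof eventually_elim
      case (elim n)
      have "norm (pop (Q * P n) T) \<le> K * (b ^ length \<xi>s * Bd + e n)"
      proof (rule calcE)
        show "poly (Q * P n) \<xi> = 0" if "\<xi> \<in> E" for \<xi>
          using P_zero[OF that] by simp
        fix z assume z: "z \<in> stolz_domain E s"
        then have z1: "cmod z \<le> 1" using disc by fastforce
        have "cmod (poly (Q * P n) z) = cmod (poly Q z) * cmod (poly (P n) z)"
          by (simp add: norm_mult)
        also have "\<dots> \<le> cmod (poly Q z) * (b ^ length \<xi>s * w z + b / real (Suc n) * (c + 2) ^ length \<xi>s)"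
          by (intro mult_left_mono P_bound z1 elim) auto
        also have "\<dots> = b ^ length \<xi>s * (cmod (poly Q z) * w z) + cmod (poly Q z) * (b / real (Suc n) * (c + 2) ^ length \<xi>s)"
          by (simp add: algebra_simps)
        also have "\<dots> \<le> b ^ length \<xi>s * Bd + e n"
          unfolding e_def using Bd(2)[OF z] D(2)[OF z1] b1
          by (intro add_mono mult_left_mono mult_right_mono) (auto simp: c_def)
        finally show "cmod (poly (Q * P n) z) \<le> b ^ length \<xi>s * Bd + e n" .
      qed
      then show ?case by (simp add: pop_mult)
    qed
    moreover have "(\<lambda>n. norm (pop Q T * pop (P n) T)) \<longlonglongrightarrow> norm (pop Q T * A)"
      by (intro tendsto_norm tendsto_mult tendsto_const P_lim)
    moreover have "(\<lambda>n. K * (b ^ length \<xi>s * Bd + e n)) \<longlonglongrightarrow> K * (b ^ length \<xi>s * Bd + 0)"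
      by (intro tendsto_mult tendsto_add tendsto_const e_lim)
    ultimately have "norm (pop Q T * A) \<le> K * (b ^ length \<xi>s * Bd + 0)"
      by (intro tendsto_le[OF sequentially_bot])
    then show ?thesis by (simp add: K'_def mult.assoc)
  qed
  ultimately show thesis
    using that[of A K'] unfolding w_def E_def by blast
qed

subsection \<open>Cotype and Pisier's extrapolation\<close>

text \<open>The identity of the space is (q,1)-summing, in normalised form: the premise says that
  the family has weak l^1 norm at most 1, and K is the q-th power of the summing constant. The
  exponent is an integer that is later taken even, which makes the q-th power convex on the whole
  line.\<close>

definition sign_cotype :: "nat \<Rightarrow> real \<Rightarrow> 'a::real_normed_vector itself \<Rightarrow> bool"
  where "sign_cotype q K (_ :: 'a itself) \<longleftrightarrow> (\<forall>n. \<forall>y :: nat \<Rightarrow> 'a.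
    (\<forall>\<sigma>. (\<forall>k. \<bar>\<sigma> k\<bar> = 1) \<longrightarrow> norm (\<Sum>k=1..n. \<sigma> k *\<^sub>R y k) \<le> 1) \<longrightarrow> (\<Sum>k=1..n. norm (y k) ^ q) \<le> K)"

lemma power_even_convex_comb:
  fixes a b d :: real
  assumes "even q" "0 < d" "d < 1"
  shows "(a + b) ^ q \<le> (1 - d) * (a / (1 - d)) ^ q + d * (b / d) ^ q"
proof -
  have "convex_on UNIV (\<lambda>x::real. x ^ q)"
    by (rule convex_power_even[OF assms(1)])
  from convex_onD[OF this, of d "a / (1 - d)" "b / d"] show ?thesis
    using assms by simp
qed

text \<open>Pisier's extrapolation argument: a family \<open>g\<close> that almost attains the \<open>(q,1)\<close>-summing constant
  is perturbed to \<open>g (1 - \<bar>f\<bar>)\<close> together with \<open>f\<close>, and the gain is averaged over \<open>f\<close>.\<close>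

lemma pisier_average:
  fixes v :: "'i \<Rightarrow> 'a::real_normed_vector"
  assumes cot: "sign_cotype q K TYPE('a)" and q: "even q" "q > 0" and K: "K \<ge> 1"
    and fin: "finite L" "finite \<Omega>"
    and u: "\<And>\<eta>. (\<And>l. l \<in> L \<Longrightarrow> \<bar>\<eta> l\<bar> \<le> 1) \<Longrightarrow> norm (\<Sum>l\<in>L. \<eta> l *\<^sub>R v l) \<le> 1"
    and w: "\<And>\<omega>. \<omega> \<in> \<Omega> \<Longrightarrow> 0 \<le> w \<omega>" "sum w \<Omega> = 1"
    and f: "\<And>\<omega> l. \<omega> \<in> \<Omega> \<Longrightarrow> l \<in> L \<Longrightarrow> \<bar>f \<omega> l\<bar> \<le> 1"
    and \<delta>: "\<delta> > 0" "\<And>l. l \<in> L \<Longrightarrow> (\<Sum>\<omega>\<in>\<Omega>. w \<omega> * \<bar>f \<omega> l\<bar>) \<le> \<delta>"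
  shows "(\<Sum>\<omega>\<in>\<Omega>. w \<omega> * norm (\<Sum>l\<in>L. f \<omega> l *\<^sub>R v l) ^ q) \<le> K * real q * \<delta>"
proof (cases "\<delta> \<ge> 1")
  \<comment> \<open>Every term is at most 1 here, so the bound is trivial.\<close>
  case True
  have "(\<Sum>\<omega>\<in>\<Omega>. w \<omega> * norm (\<Sum>l\<in>L. f \<omega> l *\<^sub>R v l) ^ q) \<le> (\<Sum>\<omega>\<in>\<Omega>. w \<omega> * 1)"
    using w f by (intro sum_mono mult_left_mono power_le_one u) auto
  also have "\<dots> = 1" using w by simp
  also have "1 \<le> K * real q * \<delta>"
    using K True q(2) mult_mono[of 1 K 1 "real q"] mult_mono[of 1 "K * real q" 1 \<delta>] by simp
  finally show ?thesis .
next
  case False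
  define U where "U \<eta> = (\<Sum>l\<in>L. \<eta> l *\<^sub>R v l)" for \<eta>
  have U_add: "U (\<lambda>l. \<eta> l + \<zeta> l) = U \<eta> + U \<zeta>" for \<eta> \<zeta>
    by (simp add: U_def scaleR_add_left sum.distrib)
  have U_scale: "U (\<lambda>l. c * \<eta> l) = c *\<^sub>R U \<eta>" for c \<eta>
    by (simp add: U_def scaleR_sum_right)
  have U_sum: "U (\<lambda>l. \<Sum>i\<in>I. \<eta> i l) = (\<Sum>i\<in>I. U (\<eta> i))" for I :: "'z set" and \<eta>
    unfolding U_def scaleR_sum_left by (rule sum.swap)
  \<comment> \<open>Signed sums of such a family have coefficients of modulus at most 1, so that
    \<open>sign_cotype\<close> bounds \<open>val\<close> by K. The supremum \<pi> of
    \<open>val\<close> is therefore finite and can be attained up to any e > 0.\<close>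
  define admissible where "admissible n g \<longleftrightarrow> (\<forall>l\<in>L. (\<Sum>i=1..n. \<bar>g i l\<bar>) \<le> 1)"
    for n :: nat and g :: "nat \<Rightarrow> 'i \<Rightarrow> real"
  define val where "val n g = (\<Sum>i=1..n. norm (U (g i)) ^ q)" for n and g :: "nat \<Rightarrow> 'i \<Rightarrow> real"
  have val_K: "val n g \<le> K" if adm: "admissible n g" for n g
  proof -
    have "norm (\<Sum>i=1..n. \<sigma> i *\<^sub>R U (g i)) \<le> 1" if \<sigma>: "\<forall>i. \<bar>\<sigma> i\<bar> = (1::real)" for \<sigma>
    proof -
      have "(\<Sum>i=1..n. \<sigma> i *\<^sub>R U (g i)) = U (\<lambda>l. \<Sum>i=1..n. \<sigma> i * g i l)"
        by (simp add: U_sum U_scale)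
      also have "norm \<dots> \<le> 1"
        unfolding U_def
      proof (rule u)
        fix l assume "l \<in> L"
        have "\<bar>\<Sum>i=1..n. \<sigma> i * g i l\<bar> \<le> (\<Sum>i=1..n. \<bar>\<sigma> i * g i l\<bar>)"
          by (rule sum_abs)
        also have "\<dots> = (\<Sum>i=1..n. \<bar>g i l\<bar>)"
          using \<sigma> by (simp add: abs_mult)
        also have "\<dots> \<le> 1" using adm \<open>l \<in> L\<close> by (simp add: admissible_def)
        finally show "\<bar>\<Sum>i=1..n. \<sigma> i * g i l\<bar> \<le> 1" .
      qed
      finally show ?thesis .
    qed
    then show ?thesis
      using cot by (simp add: sign_cotype_def val_def)
  qed
  define S where "S = {val n g | n g. admissible n g}"
  have S: "bdd_above S" "S \<noteq> {}"
  proof -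
    show "bdd_above S"
      unfolding S_def bdd_above_def using val_K by blast
    have "admissible 0 (\<lambda>_ _. 0)" by (simp add: admissible_def)
    then show "S \<noteq> {}" unfolding S_def by blast
  qed
  define \<pi> where "\<pi> = Sup S"
  have val_\<pi>: "val n g \<le> \<pi>" if "admissible n g" for n g
    unfolding \<pi>_def using that S by (intro cSup_upper) (auto simp: S_def)
  have \<pi>_K: "\<pi> \<le> K"
    unfolding \<pi>_def using S val_K by (intro cSup_least) (auto simp: S_def)
  have \<pi>0: "\<pi> \<ge> 0"
    using val_\<pi>[of 0 "\<lambda>_ _. 0"] by (simp add: admissible_def val_def)
  define h where "h l = (\<Sum>\<omega>\<in>\<Omega>. w \<omega> * \<bar>f \<omega> l\<bar>)" for l
  have h: "0 \<le> h l" "h l \<le> \<delta>" if "l \<in> L" for l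
    using \<delta>(2)[OF that] w by (auto simp: h_def intro!: sum_nonneg)
  define A where "A = (\<Sum>\<omega>\<in>\<Omega>. w \<omega> * norm (U (f \<omega>)) ^ q)"
  have "A \<le> \<pi> * (real q * \<delta>) + e" if e: "e > 0" for e
  proof -
    obtain n g where adm: "admissible n g" and g: "\<pi> - e < val n g"
      using less_cSupD[OF S(2), of "\<pi> - e"] e by (auto simp: S_def \<pi>_def)
    define B where "B = (\<Sum>i=1..n. norm (U (\<lambda>l. g i l * (1 - h l))) ^ q)"
    have one: "norm (U (f \<omega>)) ^ q \<le> \<pi> - (\<Sum>i=1..n. norm (U (\<lambda>l. g i l * (1 - \<bar>f \<omega> l\<bar>))) ^ q)"
      if \<omega>: "\<omega> \<in> \<Omega>" for \<omega>
    proof -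
      define g' where "g' i l = (if i = Suc n then f \<omega> l else g i l * (1 - \<bar>f \<omega> l\<bar>))" for i l
      have "admissible (Suc n) g'"
        unfolding admissible_def
      proof
        fix l assume l: "l \<in> L"
        have "(\<Sum>i=1..Suc n. \<bar>g' i l\<bar>) = (\<Sum>i=1..n. \<bar>g i l\<bar>) * (1 - \<bar>f \<omega> l\<bar>) + \<bar>f \<omega> l\<bar>"
          using f[OF \<omega> l] by (simp add: g'_def abs_mult sum_distrib_right)
        also have "\<dots> \<le> 1 * (1 - \<bar>f \<omega> l\<bar>) + \<bar>f \<omega> l\<bar>"
          using adm l f[OF \<omega> l] by (intro add_right_mono mult_right_mono) (auto simp: admissible_def)
        finally show "(\<Sum>i=1..Suc n. \<bar>g' i l\<bar>) \<le> 1" by simp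
      qed
      from val_\<pi>[OF this] have "(\<Sum>i=1..n. norm (U (g' i)) ^ q) + norm (U (g' (Suc n))) ^ q \<le> \<pi>"
        by (simp add: val_def)
      moreover have "g' (Suc n) = f \<omega>"
        by (auto simp: g'_def)
      moreover have "(\<Sum>i=1..n. norm (U (g' i)) ^ q) = (\<Sum>i=1..n. norm (U (\<lambda>l. g i l * (1 - \<bar>f \<omega> l\<bar>))) ^ q)"
        by (intro sum.cong) (auto simp: g'_def[abs_def])
      ultimately show ?thesis by simp
    qed
    have "A \<le> (\<Sum>\<omega>\<in>\<Omega>. w \<omega> * (\<pi> - (\<Sum>i=1..n. norm (U (\<lambda>l. g i l * (1 - \<bar>f \<omega> l\<bar>))) ^ q)))"
      unfolding A_def using one w by (intro sum_mono mult_left_mono) auto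
    also have "\<dots> = \<pi> - (\<Sum>\<omega>\<in>\<Omega>. \<Sum>i=1..n. w \<omega> * norm (U (\<lambda>l. g i l * (1 - \<bar>f \<omega> l\<bar>))) ^ q)"
      using w(2) by (simp add: right_diff_distrib sum_subtractf sum_distrib_right[symmetric] sum_distrib_left)
    also have "(\<Sum>\<omega>\<in>\<Omega>. \<Sum>i=1..n. w \<omega> * norm (U (\<lambda>l. g i l * (1 - \<bar>f \<omega> l\<bar>))) ^ q)
      = (\<Sum>i=1..n. \<Sum>\<omega>\<in>\<Omega>. w \<omega> * norm (U (\<lambda>l. g i l * (1 - \<bar>f \<omega> l\<bar>))) ^ q)"
      by (rule sum.swap)
    \<comment> \<open>Jensen's inequality for the q-th power: averaging 1 -
      |\<open>f \<omega> l\<close>| over \<omega> gives 1 - \<open>h l\<close>.\<close>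
    also have "\<pi> - \<dots> \<le> \<pi> - B"
      unfolding B_def
    proof (intro diff_left_mono sum_mono)
      fix i
      define a where "a \<omega> = U (\<lambda>l. g i l * (1 - \<bar>f \<omega> l\<bar>))" for \<omega>
      have "(\<lambda>l. g i l * (1 - h l)) = (\<lambda>l. \<Sum>\<omega>\<in>\<Omega>. w \<omega> * (g i l * (1 - \<bar>f \<omega> l\<bar>)))"
      proof
        fix l
        have "(\<Sum>\<omega>\<in>\<Omega>. w \<omega> * (g i l * (1 - \<bar>f \<omega> l\<bar>))) = (\<Sum>\<omega>\<in>\<Omega>. g i l * w \<omega> - g i l * (w \<omega> * \<bar>f \<omega> l\<bar>))"
          by (intro sum.cong) (auto simp: algebra_simps)
        also have "\<dots> = g i l * (1 - h l)"
          using w(2) by (simp add: sum_subtractf sum_distrib_left[symmetric] h_def right_diff_distrib)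
        finally show "g i l * (1 - h l) = (\<Sum>\<omega>\<in>\<Omega>. w \<omega> * (g i l * (1 - \<bar>f \<omega> l\<bar>)))" ..
      qed
      then have "U (\<lambda>l. g i l * (1 - h l)) = (\<Sum>\<omega>\<in>\<Omega>. w \<omega> *\<^sub>R a \<omega>)"
        by (simp add: U_sum U_scale a_def)
      also have "norm \<dots> \<le> (\<Sum>\<omega>\<in>\<Omega>. w \<omega> * norm (a \<omega>))"
        using w by (intro sum_norm_le) simp
      finally have "norm (U (\<lambda>l. g i l * (1 - h l))) ^ q \<le> (\<Sum>\<omega>\<in>\<Omega>. w \<omega> * norm (a \<omega>)) ^ q"
        by (intro power_mono) auto
      also have "\<dots> \<le> (\<Sum>\<omega>\<in>\<Omega>. w \<omega> * norm (a \<omega>) ^ q)"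
      proof -
        have "\<Omega> \<noteq> {}" using w(2) by auto
        then show ?thesis
          using convex_on_sum[OF fin(2) _ convex_power_even[OF q(1)] w(2), of "\<lambda>\<omega>. norm (a \<omega>)"] w(1)
          by simp
      qed
      finally show "norm (U (\<lambda>l. g i l * (1 - h l))) ^ q \<le> (\<Sum>\<omega>\<in>\<Omega>. w \<omega> * norm (U (\<lambda>l. g i l * (1 - \<bar>f \<omega> l\<bar>))) ^ q)"
        by (simp add: a_def)
    qed
    finally have A_B: "A \<le> \<pi> - B" .
    have d1: "\<delta> < 1" using False by simp
    \<comment> \<open>Convexity splits g into g (1 - h) and g h with the weights 1 - \<delta> and
      \<delta>. As h \<le> \<delta>, the family g h / \<delta> is again admissible and costs at most
      \<delta> \<pi>. So B is at least (1 - \<delta>)^q \<pi> up to e, and Bernoulli's inequality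
      bounds \<pi> - B by q \<delta> \<pi> + e.\<close>
    have "val n g \<le> (1 - \<delta>) * (B / (1 - \<delta>) ^ q) + \<delta> * val n (\<lambda>i l. g i l * (h l / \<delta>))"
    proof -
      have "val n g \<le> (\<Sum>i=1..n. (1 - \<delta>) * (norm (U (\<lambda>l. g i l * (1 - h l))) ^ q / (1 - \<delta>) ^ q) +
          \<delta> * norm (U (\<lambda>l. g i l * (h l / \<delta>))) ^ q)"
        unfolding val_def
      proof (rule sum_mono)
        fix i
        have "U (g i) = U (\<lambda>l. g i l * (1 - h l)) + U (\<lambda>l. g i l * h l)"
          by (simp add: U_add[symmetric] algebra_simps)
        then have "norm (U (g i)) ^ q \<le> (norm (U (\<lambda>l. g i l * (1 - h l))) + norm (U (\<lambda>l. g i l * h l))) ^ q"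
          by (simp add: norm_triangle_ineq power_mono)
        also have "\<dots> \<le> (1 - \<delta>) * (norm (U (\<lambda>l. g i l * (1 - h l))) / (1 - \<delta>)) ^ q + \<delta> * (norm (U (\<lambda>l. g i l * h l)) / \<delta>) ^ q"
          by (rule power_even_convex_comb[OF q(1) \<delta>(1) d1])
        also have "norm (U (\<lambda>l. g i l * h l)) / \<delta> = norm (U (\<lambda>l. g i l * (h l / \<delta>)))"
          using U_scale[of "1 / \<delta>" "\<lambda>l. g i l * h l"] \<delta>(1) by (simp add: field_simps)
        finally show "norm (U (g i)) ^ q \<le> (1 - \<delta>) * (norm (U (\<lambda>l. g i l * (1 - h l))) ^ q / (1 - \<delta>) ^ q) +
          \<delta> * norm (U (\<lambda>l. g i l * (h l / \<delta>))) ^ q"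
          by (simp add: power_divide)
      qed
      then show ?thesis
        by (simp add: sum.distrib sum_distrib_left[symmetric] sum_divide_distrib[symmetric] B_def val_def)
    qed
    moreover have "val n (\<lambda>i l. g i l * (h l / \<delta>)) \<le> \<pi>"
    proof (rule val_\<pi>)
      show "admissible n (\<lambda>i l. g i l * (h l / \<delta>))"
        unfolding admissible_def
      proof
        fix l assume l: "l \<in> L"
        have "(\<Sum>i=1..n. \<bar>g i l * (h l / \<delta>)\<bar>) = (\<Sum>i=1..n. \<bar>g i l\<bar>) * (h l / \<delta>)"
          using h[OF l] \<delta>(1) by (simp add: abs_mult sum_distrib_right sum_divide_distrib)
        also have "\<dots> \<le> 1 * 1"
          using adm l h[OF l] \<delta>(1) by (intro mult_mono) (auto simp: admissible_def sum_nonneg)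
        finally show "(\<Sum>i=1..n. \<bar>g i l * (h l / \<delta>)\<bar>) \<le> 1" by simp
      qed
    qed
    then have "\<delta> * val n (\<lambda>i l. g i l * (h l / \<delta>)) \<le> \<delta> * \<pi>"
      using \<delta>(1) by (intro mult_left_mono) auto
    ultimately have "\<pi> * (1 - \<delta>) - e \<le> (1 - \<delta>) * (B / (1 - \<delta>) ^ q)"
      using g by (simp add: algebra_simps)
    moreover define x where "x = 1 - \<delta>"
    ultimately have "\<pi> * x - e \<le> x * (B / x ^ q)" by simp
    then have "(\<pi> * x - e) * x ^ (q - 1) \<le> (x * (B / x ^ q)) * x ^ (q - 1)"
      using d1 by (intro mult_right_mono) (auto simp: x_def)
    also have "\<dots> = B * ((x * x ^ (q - 1)) / x ^ q)" by simp
    also have "x * x ^ (q - 1) = x ^ q" using q(2) by (simp add: power_eq_if)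
    also have "B * (x ^ q / x ^ q) = B" using d1 by (simp add: x_def)
    finally have "\<pi> * (x * x ^ (q - 1)) - e * x ^ (q - 1) \<le> B" by (simp add: algebra_simps)
    moreover have "x * x ^ (q - 1) = x ^ q" using q(2) by (simp add: power_eq_if)
    moreover have "e * x ^ (q - 1) \<le> e"
      using e d1 \<delta>(1) by (intro mult_left_le power_le_one) (auto simp: x_def)
    moreover have "\<pi> * (1 - real q * \<delta>) \<le> \<pi> * x ^ q"
      using Bernoulli_inequality[of "- \<delta>" q] d1 \<pi>0 by (intro mult_left_mono) (auto simp: x_def)
    ultimately show ?thesis
      using A_B by (simp add: algebra_simps)
  qed
  then have "A \<le> \<pi> * (real q * \<delta>)"
    by (rule field_le_epsilon)
  also have "\<dots> \<le> K * (real q * \<delta>)"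
    using \<pi>_K \<delta>(1) by (intro mult_right_mono) auto
  finally show ?thesis by (simp add: A_def U_def mult.assoc)
qed

subsection \<open>Random signs\<close>

definition sign_vectors :: "nat \<Rightarrow> (nat \<Rightarrow> real) set"
  where "sign_vectors n = PiE {1..n} (\<lambda>_. {- 1, 1})"

lemma finite_sign_vectors: "finite (sign_vectors n)"
  by (auto simp: sign_vectors_def intro!: finite_PiE)

lemma card_sign_vectors: "card (sign_vectors n) = 2 ^ n"
  by (simp add: sign_vectors_def card_PiE numeral_2_eq_2)

text \<open>The moment generating function at 1: it factors into hyperbolic cosines, and cosh x
  \<le> exp (x^2) is available for |x| \<le> 1, which the normalisation guarantees.\<close>

lemma sum_exp_signs_le:
  fixes c :: "nat \<Rightarrow> real"
  assumes "(\<Sum>k=1..n. (c k)\<^sup>2) \<le> 1"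
  shows "(\<Sum>\<sigma>\<in>sign_vectors n. exp (\<Sum>k=1..n. c k * \<sigma> k)) \<le> 2 ^ n * exp 1"
proof -
  have cosh_le: "exp x + exp (- x) \<le> 2 * exp (x\<^sup>2)" if "\<bar>x\<bar> \<le> 1" for x :: real
  proof -
    have main: "exp y + exp (- y) \<le> 2 * exp (y\<^sup>2)" if y: "0 \<le> y" "y \<le> 1" for y :: real
    proof -
      have "exp y \<le> 1 + y + y\<^sup>2"
        by (rule exp_bound[OF y])
      moreover have "exp (- y) \<le> 1 - y + y\<^sup>2"
      proof -
        have "1 + y + y\<^sup>2 / 2 \<le> exp y"
          by (rule exp_lower_Taylor_quadratic[OF y(1)])
        moreover have "0 \<le> 1 - y + y\<^sup>2"
          using y by simp
        ultimately have "(1 - y + y\<^sup>2) * (1 + y + y\<^sup>2 / 2) \<le> (1 - y + y\<^sup>2) * exp y"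
          by (intro mult_left_mono)
        moreover have "(1 - y + y\<^sup>2) * (1 + y + y\<^sup>2 / 2) = 1 + y\<^sup>2 / 2 + y ^ 3 / 2 + y ^ 4 / 2"
          by (simp add: field_simps power2_eq_square power3_eq_cube power4_eq_xxxx)
        moreover have "0 \<le> y\<^sup>2 / 2 + y ^ 3 / 2 + y ^ 4 / 2"
          using y by simp
        ultimately have "1 \<le> (1 - y + y\<^sup>2) * exp y" by linarith
        then show ?thesis
          by (simp add: exp_minus field_simps)
      qed
      moreover have "1 + y\<^sup>2 \<le> exp (y\<^sup>2)"
        by (rule exp_ge_add_one_self)
      ultimately show ?thesis by linarith
    qed
    show ?thesis
      using main[of x] main[of "- x"] that by (cases "x \<ge> 0") auto
  qed
  have c1: "\<bar>c k\<bar> \<le> 1" if "k \<in> {1..n}" for k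
  proof -
    have "(c k)\<^sup>2 \<le> (\<Sum>k=1..n. (c k)\<^sup>2)"
      by (rule member_le_sum[OF that]) auto
    then have "(c k)\<^sup>2 \<le> 1" using assms by linarith
    then show ?thesis by (simp add: abs_square_le_1)
  qed
  have "(\<Sum>\<sigma>\<in>sign_vectors n. exp (\<Sum>k=1..n. c k * \<sigma> k)) = (\<Sum>\<sigma>\<in>sign_vectors n. \<Prod>k=1..n. exp (c k * \<sigma> k))"
    by (simp add: exp_sum)
  also have "\<dots> = (\<Prod>k=1..n. \<Sum>s\<in>{- 1, 1}. exp (c k * s))"
    unfolding sign_vectors_def by (rule prod_sum_PiE[symmetric]) auto
  also have "\<dots> \<le> (\<Prod>k=1..n. 2 * exp ((c k)\<^sup>2))"
    using cosh_le[OF c1] by (intro prod_mono) (auto simp: add.commute)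
  also have "\<dots> = 2 ^ n * exp (\<Sum>k=1..n. (c k)\<^sup>2)"
    by (simp add: prod.distrib exp_sum)
  also have "\<dots> \<le> 2 ^ n * exp 1"
    using assms by simp
  finally show ?thesis .
qed

text \<open>Chernoff's bound with parameter 1. An exponential tail is all that
  \<open>layered_average\<close> asks for; 2 exp 1 becomes its constant D.\<close>

lemma sign_sum_tail:
  fixes c :: "nat \<Rightarrow> real"
  assumes "(\<Sum>k=1..n. (c k)\<^sup>2) \<le> 1"
  shows "(\<Sum>\<sigma>\<in>sign_vectors n. (1 / 2 ^ n) * of_bool (t \<le> \<bar>\<Sum>k=1..n. c k * \<sigma> k\<bar>)) \<le> 2 * exp 1 * exp (- t)"
proof -
  have "of_bool (t \<le> \<bar>S\<bar>) \<le> exp (- t) * (exp S + exp (- S))" for S :: real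
  proof (cases "t \<le> \<bar>S\<bar>")
    case True
    then have "exp t \<le> exp \<bar>S\<bar>" by simp
    also have "\<dots> \<le> exp S + exp (- S)"
      by (simp add: abs_if add_increasing add_increasing2)
    finally show ?thesis
      using True by (simp add: exp_minus field_simps)
  qed (simp add: add_nonneg_nonneg)
  then have "(\<Sum>\<sigma>\<in>sign_vectors n. (1 / 2 ^ n) * of_bool (t \<le> \<bar>\<Sum>k=1..n. c k * \<sigma> k\<bar>))
    \<le> (\<Sum>\<sigma>\<in>sign_vectors n. (1 / 2 ^ n) * (exp (- t) * (exp (\<Sum>k=1..n. c k * \<sigma> k) + exp (- (\<Sum>k=1..n. c k * \<sigma> k)))))"
    by (intro sum_mono mult_left_mono) auto
  also have "\<dots> = (1 / 2 ^ n) * (exp (- t) * ((\<Sum>\<sigma>\<in>sign_vectors n. exp (\<Sum>k=1..n. c k * \<sigma> k)) +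
      (\<Sum>\<sigma>\<in>sign_vectors n. exp (\<Sum>k=1..n. - c k * \<sigma> k))))"
    by (simp add: sum.distrib sum_distrib_left distrib_left sum_negf)
  also have "\<dots> \<le> (1 / 2 ^ n) * (exp (- t) * (2 ^ n * exp 1 + 2 ^ n * exp 1))"
    using assms by (intro mult_left_mono add_mono sum_exp_signs_le) auto
  also have "\<dots> = 2 * exp 1 * exp (- t)" by simp
  finally show ?thesis .
qed

lemma rademacher_AE:
  assumes "rademacher_seq M \<epsilon>" "k \<ge> 1"
  shows "\<epsilon> k \<in> borel_measurable M" "AE \<omega> in M. \<epsilon> k \<omega> \<in> {- 1, 1}"
proof -
  interpret prob_space M using assms by (simp add: rademacher_seq_def)
  show meas: "\<epsilon> k \<in> borel_measurable M"
    using assms by (auto simp: rademacher_seq_def indep_vars_def)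
  have sets: "{\<omega>\<in>space M. \<epsilon> k \<omega> = 1} \<in> events" "{\<omega>\<in>space M. \<epsilon> k \<omega> = - 1} \<in> events"
    using meas by measurable
  have "prob ({\<omega>\<in>space M. \<epsilon> k \<omega> = 1} \<union> {\<omega>\<in>space M. \<epsilon> k \<omega> = - 1}) = 1"
    using assms by (subst finite_measure_Union[OF sets]) (auto simp: rademacher_seq_def)
  from AE_prob_1[OF this] show "AE \<omega> in M. \<epsilon> k \<omega> \<in> {- 1, 1}"
    by eventually_elim auto
qed

lemma rademacher_AE_all:
  assumes "rademacher_seq M \<epsilon>"
  shows "AE \<omega> in M. \<forall>k\<in>{1..n}. \<epsilon> k \<omega> \<in> {- 1, 1}"
  using rademacher_AE(2)[OF assms] by (intro AE_finite_allI) auto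

text \<open>By independence each sign pattern has probability 2^(-n). All averaging below is over
  this finite set of patterns.\<close>

lemma rad_norm_eq:
  fixes x :: "nat \<Rightarrow> 'a::real_normed_vector"
  assumes rad: "rademacher_seq M \<epsilon>"
  shows "rad_norm M \<epsilon> n x = sqrt (\<Sum>\<sigma>\<in>sign_vectors n. (1 / 2 ^ n) * (norm (\<Sum>k=1..n. \<sigma> k *\<^sub>R x k))\<^sup>2)"
proof -
  interpret prob_space M using rad by (simp add: rademacher_seq_def)
  define F where "F \<sigma> = (norm (\<Sum>k=1..n. \<sigma> k *\<^sub>R x k))\<^sup>2" for \<sigma> :: "nat \<Rightarrow> real"
  define A where "A \<sigma> = {\<omega>\<in>space M. \<forall>k\<in>{1..n}. \<epsilon> k \<omega> = \<sigma> k}" for \<sigma>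
  note [measurable] = rademacher_AE(1)[OF rad]
  have A_sets: "A \<sigma> \<in> events" for \<sigma>
    unfolding A_def by (intro sets.sets_Collect_finite_All) (auto intro: measurable_sets borel_measurable_eq rademacher_AE(1)[OF rad])
  have prob_A: "prob (A \<sigma>) = 1 / 2 ^ n" if \<sigma>: "\<sigma> \<in> sign_vectors n" for \<sigma>
  proof (cases "n = 0")
    case True
    then show ?thesis by (simp add: A_def prob_space)
  next
    case False
    have "A \<sigma> = (\<Inter>k\<in>{1..n}. \<epsilon> k -` {\<sigma> k} \<inter> space M)"
      using False by (auto simp: A_def)
    also have "prob \<dots> = (\<Prod>k\<in>{1..n}. prob (\<epsilon> k -` {\<sigma> k} \<inter> space M))"
      using rad False by (intro indep_varsD[of "\<lambda>_. borel" \<epsilon> "{1..}"]) (auto simp: rademacher_seq_def)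
    also have "\<dots> = (\<Prod>k\<in>{1..n}. 1 / 2)"
    proof (rule prod.cong)
      fix k assume k: "k \<in> {1..n}"
      then have "\<sigma> k \<in> {- 1, 1}" using \<sigma> by (auto simp: sign_vectors_def PiE_def Pi_def)
      moreover have "\<epsilon> k -` {s} \<inter> space M = {\<omega>\<in>space M. \<epsilon> k \<omega> = s}" for s by auto
      ultimately show "prob (\<epsilon> k -` {\<sigma> k} \<inter> space M) = 1 / 2"
        using rad k by (auto simp: rademacher_seq_def)
    qed simp
    finally show ?thesis by (simp add: power_one_over)
  qed
  \<comment> \<open>Measurability of \<open>\<epsilon> k\<close> is only known for k \<ge> 1, so the
    coordinates outside 1..n are set to 0; F depends on the others alone and is continuous in
    them.\<close>
  define e where "e \<omega> k = (if k \<in> {1..n} then \<epsilon> k \<omega> else 0)" for \<omega> k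
  have "e \<in> borel_measurable M"
  proof (rule measurable_coordinatewise_then_product)
    show "(\<lambda>\<omega>. e \<omega> k) \<in> borel_measurable M" for k
    proof (cases "k \<in> {1..n}")
      case True
      then have "(\<lambda>\<omega>. e \<omega> k) = \<epsilon> k" by (auto simp: e_def)
      then show ?thesis using rademacher_AE(1)[OF rad, of k] True by simp
    next
      case False
      then have "(\<lambda>\<omega>. e \<omega> k) = (\<lambda>_. 0)" by (auto simp: e_def)
      then show ?thesis by simp
    qed
  qed
  moreover have "F \<in> borel_measurable borel"
  proof (rule borel_measurable_continuous_onI)
    show "continuous_on UNIV F"
      unfolding F_def by (intro continuous_intros) auto
  qed
  ultimately have "(\<lambda>\<omega>. F (e \<omega>)) \<in> borel_measurable M"
    by (rule measurable_compose)
  moreover have "F (e \<omega>) = F (\<lambda>k. \<epsilon> k \<omega>)" for \<omega>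
    unfolding F_def e_def by (intro arg_cong[where f = "\<lambda>y. (norm y)\<^sup>2"] sum.cong) auto
  ultimately have F_meas: "(\<lambda>\<omega>. F (\<lambda>k. \<epsilon> k \<omega>)) \<in> borel_measurable M" by simp
  have "(\<integral>\<omega>. F (\<lambda>k. \<epsilon> k \<omega>) \<partial>M) = (\<integral>\<omega>. (\<Sum>\<sigma>\<in>sign_vectors n. F \<sigma> * indicator (A \<sigma>) \<omega>) \<partial>M)"
  proof (rule integral_cong_AE[OF F_meas])
    show "(\<lambda>\<omega>. \<Sum>\<sigma>\<in>sign_vectors n. F \<sigma> * indicator (A \<sigma>) \<omega>) \<in> borel_measurable M"
      using A_sets by (intro borel_measurable_sum borel_measurable_times borel_measurable_indicator) auto
    show "AE \<omega> in M. F (\<lambda>k. \<epsilon> k \<omega>) = (\<Sum>\<sigma>\<in>sign_vectors n. F \<sigma> * indicator (A \<sigma>) \<omega>)"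
      using rademacher_AE_all[OF rad, of n] AE_space
    proof eventually_elim
      case (elim \<omega>)
      define \<tau> where "\<tau> = restrict (\<lambda>k. \<epsilon> k \<omega>) {1..n}"
      have \<tau>: "\<tau> \<in> sign_vectors n" using elim by (auto simp: \<tau>_def sign_vectors_def)
      have "F \<sigma> * indicator (A \<sigma>) \<omega> = (if \<sigma> = \<tau> then F \<tau> else 0)" if "\<sigma> \<in> sign_vectors n" for \<sigma>
      proof -
        have "\<omega> \<in> A \<sigma> \<longleftrightarrow> \<sigma> = \<tau>"
        proof
          assume "\<omega> \<in> A \<sigma>"
          then show "\<sigma> = \<tau>"
            using that by (intro ext) (auto simp: A_def \<tau>_def sign_vectors_def PiE_def extensional_def restrict_def)
        qed (use elim in \<open>auto simp: A_def \<tau>_def\<close>)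
        then show ?thesis by (simp add: indicator_def)
      qed
      then have "(\<Sum>\<sigma>\<in>sign_vectors n. F \<sigma> * indicator (A \<sigma>) \<omega>) = (\<Sum>\<sigma>\<in>sign_vectors n. if \<sigma> = \<tau> then F \<tau> else 0)"
        by (intro sum.cong) auto
      also have "\<dots> = F \<tau>"
        using \<tau> finite_sign_vectors by simp
      also have "F \<tau> = F (\<lambda>k. \<epsilon> k \<omega>)"
        unfolding F_def \<tau>_def by (intro arg_cong[where f = "\<lambda>y. (norm y)\<^sup>2"] sum.cong) auto
      finally show ?case ..
    qed
  qed
  also have "\<dots> = (\<Sum>\<sigma>\<in>sign_vectors n. \<integral>\<omega>. F \<sigma> * indicator (A \<sigma>) \<omega> \<partial>M)"
    using A_sets by (intro Bochner_Integration.integral_sum integrable_mult_right integrable_real_indicator)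
      (auto simp: less_top[symmetric])
  also have "\<dots> = (\<Sum>\<sigma>\<in>sign_vectors n. (1 / 2 ^ n) * F \<sigma>)"
    using prob_A A_sets by (intro sum.cong) (auto simp: mult.commute)
  finally show ?thesis
    by (simp add: rad_norm_def F_def)
qed

text \<open>Adding an independent symmetric term cannot decrease the mean square, because 2 |a|^2
  \<le> |a - b|^2 + |a + b|^2. This makes the limit in \<open>square_fun\<close> a supremum.\<close>

lemma rad_norm_mono:
  fixes x :: "nat \<Rightarrow> 'a::real_normed_vector"
  assumes rad: "rademacher_seq M \<epsilon>"
  shows "rad_norm M \<epsilon> n x \<le> rad_norm M \<epsilon> (Suc n) x"
proof -
  define S where "S \<sigma> = (\<Sum>k=1..n. \<sigma> k *\<^sub>R x k)" for \<sigma> :: "nat \<Rightarrow> real"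
  define b where "b = x (Suc n)"
  have ins: "{1..Suc n} = insert (Suc n) {1..n}" by auto
  have inj: "inj_on (\<lambda>(s, \<sigma>). \<sigma>(Suc n := s)) ({- 1, 1} \<times> sign_vectors n)"
    unfolding sign_vectors_def by (rule inj_combinator) simp
  have "(\<Sum>\<sigma>\<in>sign_vectors (Suc n). (norm (\<Sum>k=1..Suc n. \<sigma> k *\<^sub>R x k))\<^sup>2)
    = (\<Sum>(s, \<sigma>)\<in>{- 1, 1} \<times> sign_vectors n. (norm (\<Sum>k=1..Suc n. (\<sigma>(Suc n := s)) k *\<^sub>R x k))\<^sup>2)"
    unfolding sign_vectors_def ins PiE_insert_eq
    using inj[unfolded sign_vectors_def] by (subst sum.reindex) (simp_all add: case_prod_unfold)
  also have "\<dots> = (\<Sum>(s, \<sigma>)\<in>{- 1, 1} \<times> sign_vectors n. (norm (S \<sigma> + s *\<^sub>R b))\<^sup>2)"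
    by (intro sum.cong) (auto simp: S_def b_def intro!: arg_cong[where f = "\<lambda>y. (norm y)\<^sup>2"] sum.cong)
  also have "\<dots> = (\<Sum>\<sigma>\<in>sign_vectors n. (norm (S \<sigma> - b))\<^sup>2 + (norm (S \<sigma> + b))\<^sup>2)"
    by (simp add: sum.cartesian_product[symmetric] sum.distrib)
  finally have eq: "(\<Sum>\<sigma>\<in>sign_vectors (Suc n). (norm (\<Sum>k=1..Suc n. \<sigma> k *\<^sub>R x k))\<^sup>2)
    = (\<Sum>\<sigma>\<in>sign_vectors n. (norm (S \<sigma> - b))\<^sup>2 + (norm (S \<sigma> + b))\<^sup>2)" .
  have conv: "2 * (norm a)\<^sup>2 \<le> (norm (a - b))\<^sup>2 + (norm (a + b))\<^sup>2" for a
  proof -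
    have "2 * norm a \<le> norm (a - b) + norm (a + b)"
      using norm_triangle_ineq[of "a - b" "a + b"] by (simp add: scaleR_2[symmetric])
    then have "(2 * norm a)\<^sup>2 \<le> (norm (a - b) + norm (a + b))\<^sup>2"
      by (intro power_mono) auto
    then show ?thesis
      using zero_le_power2[of "norm (a - b) - norm (a + b)"]
      by (simp add: power2_sum power2_diff power_mult_distrib)
  qed
  have "(\<Sum>\<sigma>\<in>sign_vectors n. (1 / 2 ^ n) * (norm (S \<sigma>))\<^sup>2) = (\<Sum>\<sigma>\<in>sign_vectors n. (1 / 2 ^ Suc n) * (2 * (norm (S \<sigma>))\<^sup>2))"
    by simp
  also have "\<dots> \<le> (\<Sum>\<sigma>\<in>sign_vectors n. (1 / 2 ^ Suc n) * ((norm (S \<sigma> - b))\<^sup>2 + (norm (S \<sigma> + b))\<^sup>2))"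
    by (intro sum_mono mult_left_mono conv) auto
  also have "\<dots> = (\<Sum>\<sigma>\<in>sign_vectors (Suc n). (1 / 2 ^ Suc n) * (norm (\<Sum>k=1..Suc n. \<sigma> k *\<^sub>R x k))\<^sup>2)"
    unfolding sum_distrib_left[symmetric] eq ..
  finally show ?thesis
    unfolding rad_norm_eq[OF rad] S_def by (rule real_sqrt_le_mono)
qed

text \<open>The premise on signs bounds the Rademacher average by 1, and also every single term: the
  sum with all signs plus and the one with only the k-th sign plus add up to twice
  \<open>y k\<close>. For terms of norm at most 1 the exponent can be raised to an even
  integer.\<close>

lemma finite_cotype_imp_sign_cotype:
  assumes rad: "rademacher_seq M \<epsilon>" and cot: "finite_cotype M \<epsilon> TYPE('a::real_normed_vector)"
  obtains q K where "even q" "q > 0" "K \<ge> 1" "sign_cotype q K TYPE('a)"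
proof -
  interpret prob_space M using rad by (simp add: rademacher_seq_def)
  obtain q0 K0 where q0: "q0 \<ge> 2" and K0: "\<And>n (x :: nat \<Rightarrow> 'a).
      (\<Sum>k=1..n. norm (x k) powr q0) powr (1/q0) \<le> K0 * rad_norm M \<epsilon> n x"
    using cot by (auto simp: finite_cotype_def)
  define q where "q = 2 * nat \<lceil>q0\<rceil>"
  have q: "q0 \<le> real q" "q > 0" using q0 by (auto simp: q_def) linarith+
  have "(\<Sum>k=1..n. norm (y k) ^ q) \<le> max 1 (\<bar>K0\<bar> powr q0)"
    if y: "\<forall>\<sigma>. (\<forall>k. \<bar>\<sigma> k\<bar> = (1::real)) \<longrightarrow> norm (\<Sum>k=1..n. \<sigma> k *\<^sub>R y k) \<le> 1" for n and y :: "nat \<Rightarrow> 'a"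
  proof -
    have signs: "norm (\<Sum>k=1..n. \<sigma> k *\<^sub>R y k) \<le> 1" if "\<sigma> \<in> sign_vectors n" for \<sigma>
    proof -
      have "(\<Sum>k=1..n. \<sigma> k *\<^sub>R y k) = (\<Sum>k=1..n. (if k \<in> {1..n} then \<sigma> k else 1) *\<^sub>R y k)"
        by (intro sum.cong) auto
      moreover have "\<forall>k. \<bar>if k \<in> {1..n} then \<sigma> k else 1\<bar> = 1"
        using that by (auto simp: sign_vectors_def PiE_def Pi_def abs_if)
      ultimately show ?thesis
        using y[THEN spec, of "\<lambda>k. if k \<in> {1..n} then \<sigma> k else 1"] by simp
    qed
    have small: "norm (y k) \<le> 1" if k: "k \<in> {1..n}" for k
    proof -
      have 1: "norm (\<Sum>j=1..n. (1::real) *\<^sub>R y j) \<le> 1"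
        using y[THEN spec, of "\<lambda>_. 1"] by simp
      have 2: "norm (\<Sum>j=1..n. (if j = k then 1 else - 1 :: real) *\<^sub>R y j) \<le> 1"
        using y[THEN spec, of "\<lambda>j. if j = k then 1 else - 1"] by simp
      have "(\<Sum>j=1..n. (1::real) *\<^sub>R y j) + (\<Sum>j=1..n. (if j = k then 1 else - 1 :: real) *\<^sub>R y j)
        = (\<Sum>j=1..n. if j = k then 2 *\<^sub>R y k else 0)"
        unfolding sum.distrib[symmetric] by (intro sum.cong) (auto simp: scaleR_2)
      also have "\<dots> = 2 *\<^sub>R y k" using k by simp
      finally have "norm (2 *\<^sub>R y k) \<le> 1 + 1"
        using norm_triangle_le[OF add_mono[OF 1 2]] by simp
      then show ?thesis by simp
    qed
    have "rad_norm M \<epsilon> n y \<le> 1"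
    proof -
      have "(\<Sum>\<sigma>\<in>sign_vectors n. (1 / 2 ^ n) * (norm (\<Sum>k=1..n. \<sigma> k *\<^sub>R y k))\<^sup>2) \<le> (\<Sum>\<sigma>\<in>sign_vectors n. (1 / 2 ^ n) * 1)"
        using signs by (intro sum_mono mult_left_mono power_le_one) auto
      also have "\<dots> = 1" by (simp add: card_sign_vectors)
      finally show ?thesis
        unfolding rad_norm_eq[OF rad] by simp
    qed
    moreover have "0 \<le> rad_norm M \<epsilon> n y"
      unfolding rad_norm_eq[OF rad] by (intro real_sqrt_ge_zero sum_nonneg) auto
    ultimately have "K0 * rad_norm M \<epsilon> n y \<le> \<bar>K0\<bar> * 1"
      by (intro mult_mono) auto
    then have le: "(\<Sum>k=1..n. norm (y k) powr q0) powr (1/q0) \<le> \<bar>K0\<bar>"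
      using K0[of y n] by simp
    have "(\<Sum>k=1..n. norm (y k) powr q0) = ((\<Sum>k=1..n. norm (y k) powr q0) powr (1/q0)) powr q0"
      using q0 by (simp add: powr_powr sum_nonneg)
    also have "\<dots> \<le> \<bar>K0\<bar> powr q0"
      using le q0 by (intro powr_mono2) auto
    finally have "(\<Sum>k=1..n. norm (y k) powr q0) \<le> \<bar>K0\<bar> powr q0" .
    moreover have "(\<Sum>k=1..n. norm (y k) ^ q) \<le> (\<Sum>k=1..n. norm (y k) powr q0)"
    proof (rule sum_mono)
      fix k assume k: "k \<in> {1..n}"
      show "norm (y k) ^ q \<le> norm (y k) powr q0"
      proof (cases "y k = 0")
        case False
        then have "norm (y k) ^ q = norm (y k) powr real q"
          by (simp add: powr_realpow)
        also have "\<dots> \<le> norm (y k) powr q0"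
          using small[OF k] q False by (intro powr_mono') auto
        finally show ?thesis .
      qed (use q in \<open>simp add: zero_power\<close>)
    qed
    ultimately show ?thesis by linarith
  qed
  then have "sign_cotype q (max 1 (\<bar>K0\<bar> powr q0)) TYPE('a)"
    unfolding sign_cotype_def by blast
  then show thesis
    by (intro that[of q "max 1 (\<bar>K0\<bar> powr q0)"]) (use q in \<open>auto simp: q_def\<close>)
qed

text \<open>The random coefficients are cut into the layers \<open>m \<le> \<bar>S\<bar> < m + 1\<close>, whose probabilities decay
  exponentially; Pisier's estimate applies to each layer.\<close>

lemma layered_average:
  fixes q :: nat and K D :: real
  assumes q: "even q" "q > 0" and K: "K \<ge> 1" and D: "D > 0"
    and cot: "sign_cotype q K TYPE('a::real_normed_vector)"
  obtains C where "C > 0"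
    "\<And>(v :: 'i \<Rightarrow> 'a) L (\<Omega> :: 'w set) w S. finite L \<Longrightarrow> finite \<Omega> \<Longrightarrow>
      (\<And>\<eta>. (\<And>l. l \<in> L \<Longrightarrow> \<bar>\<eta> l\<bar> \<le> 1) \<Longrightarrow> norm (\<Sum>l\<in>L. \<eta> l *\<^sub>R v l) \<le> 1) \<Longrightarrow>
      (\<And>\<omega>. \<omega> \<in> \<Omega> \<Longrightarrow> 0 \<le> w \<omega>) \<Longrightarrow> sum w \<Omega> = 1 \<Longrightarrow>
      (\<And>l m. l \<in> L \<Longrightarrow> (\<Sum>\<omega>\<in>\<Omega>. w \<omega> * of_bool (real m \<le> \<bar>S \<omega> l\<bar>)) \<le> D * exp (- real m)) \<Longrightarrow>
      (\<Sum>\<omega>\<in>\<Omega>. w \<omega> * (norm (\<Sum>l\<in>L. S \<omega> l *\<^sub>R v l))\<^sup>2) \<le> C"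
proof -
  \<comment> \<open>The exponents at layer m are budgeted in units of r m. The layer estimate yields
    exp (-4 r m); the squared height (m + 1)^2 costs exp (r m), and the weight 1 / x^m from the
    Cauchy-Schwarz inequality costs another exp (r m). What remains is exp (-2 r m), which is below
    x^m.\<close>
  define r where "r = 1 / (2 * real q)"
  have r: "r > 0" using q by (simp add: r_def)
  define B where "B = 1 + K * real q * D"
  have B: "B > 0" using K D by (simp add: B_def add_pos_nonneg)
  define A where "A = (2 / r)\<^sup>2 * exp r * B"
  have A: "A > 0" using r B by (simp add: A_def)
  define x where "x = exp (- r)"
  have x: "0 < x" "x < 1" using r by (auto simp: x_def)
  have geo: "(\<Sum>m<N. x ^ m) \<le> 1 / (1 - x)" for N
    using x by (simp add: sum_gp_strict divide_right_mono)
  have poly_exp: "(real m + 1)\<^sup>2 \<le> (2 / r)\<^sup>2 * exp r * exp (r * real m)" for m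
  proof -
    have "r / 2 * (real m + 1) \<le> exp (r / 2 * (real m + 1))"
      using exp_ge_add_one_self[of "r / 2 * (real m + 1)"] by linarith
    then have "real m + 1 \<le> 2 / r * exp (r / 2 * (real m + 1))"
      using r by (simp add: field_simps)
    then have "(real m + 1)\<^sup>2 \<le> (2 / r * exp (r / 2 * (real m + 1)))\<^sup>2"
      by (intro power_mono) auto
    also have "\<dots> = (2 / r)\<^sup>2 * exp (2 * (r / 2 * (real m + 1)))"
      unfolding power_mult_distrib exp_double ..
    also have "2 * (r / 2 * (real m + 1)) = r + r * real m"
      by (simp add: algebra_simps)
    finally show ?thesis by (simp add: exp_add mult.assoc)
  qed
  show thesis
  proof (rule that[of "1 / (1 - x) * (A / (1 - x)) + 1"])
    show "1 / (1 - x) * (A / (1 - x)) + 1 > 0"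
      using x A by (intro add_nonneg_pos) auto
  next
    fix v :: "'i \<Rightarrow> 'a" and L and \<Omega> :: "'w set" and w S
    assume fin: "finite L" "finite \<Omega>"
      and u: "\<And>\<eta>. (\<And>l. l \<in> L \<Longrightarrow> \<bar>\<eta> l\<bar> \<le> 1) \<Longrightarrow> norm (\<Sum>l\<in>L. \<eta> l *\<^sub>R v l) \<le> 1"
      and w: "\<And>\<omega>. \<omega> \<in> \<Omega> \<Longrightarrow> 0 \<le> w \<omega>" "sum w \<Omega> = 1"
      and tail: "\<And>l m. l \<in> L \<Longrightarrow> (\<Sum>\<omega>\<in>\<Omega>. w \<omega> * of_bool (real m \<le> \<bar>S \<omega> l\<bar>)) \<le> D * exp (- real m)"
    define U where "U \<eta> = (\<Sum>l\<in>L. \<eta> l *\<^sub>R v l)" for \<eta>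
    have "finite ((\<lambda>(\<omega>, l). \<bar>S \<omega> l\<bar>) ` (\<Omega> \<times> L))" using fin by simp
    then obtain R where R: "\<And>\<omega> l. \<omega> \<in> \<Omega> \<Longrightarrow> l \<in> L \<Longrightarrow> \<bar>S \<omega> l\<bar> \<le> R"
      using bdd_above_finite by (force simp: bdd_above_def)
    define N where "N = nat \<lceil>R\<rceil> + 1"
    \<comment> \<open>The m-th layer divided by m + 1, hence bounded by 1 as
      \<open>pisier_average\<close> demands.\<close>
    define f where "f m \<omega> l = S \<omega> l * of_bool (nat \<lfloor>\<bar>S \<omega> l\<bar>\<rfloor> = m) / (real m + 1)" for m \<omega> l
    have level: "real m \<le> \<bar>s\<bar>" "\<bar>s\<bar> \<le> real m + 1" if "nat \<lfloor>\<bar>s\<bar>\<rfloor> = m" for s :: real and m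
      using that by linarith+
    have f1: "\<bar>f m \<omega> l\<bar> \<le> of_bool (real m \<le> \<bar>S \<omega> l\<bar>)" for m \<omega> l
      using level[of "S \<omega> l" m] by (auto simp: f_def abs_divide divide_le_eq)
    then have f2: "\<bar>f m \<omega> l\<bar> \<le> 1" for m \<omega> l
      by (rule order_trans) simp
    have decomp: "U (S \<omega>) = (\<Sum>m<N. (real m + 1) *\<^sub>R U (f m \<omega>))" if \<omega>: "\<omega> \<in> \<Omega>" for \<omega>
    proof -
      have "S \<omega> l = (\<Sum>m<N. (real m + 1) * f m \<omega> l)" if l: "l \<in> L" for l
      proof -
        have "nat \<lfloor>\<bar>S \<omega> l\<bar>\<rfloor> < N"
          using R[OF \<omega> l] unfolding N_def by linarith
        then have "S \<omega> l = (\<Sum>m<N. if m = nat \<lfloor>\<bar>S \<omega> l\<bar>\<rfloor> then S \<omega> l else 0)"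
          by simp
        also have "\<dots> = (\<Sum>m<N. (real m + 1) * f m \<omega> l)"
          by (intro sum.cong) (auto simp: f_def)
        finally show ?thesis .
      qed
      then have "U (S \<omega>) = (\<Sum>l\<in>L. \<Sum>m<N. ((real m + 1) * f m \<omega> l) *\<^sub>R v l)"
        unfolding U_def by (intro sum.cong) (simp_all add: scaleR_sum_left)
      also have "\<dots> = (\<Sum>m<N. \<Sum>l\<in>L. ((real m + 1) * f m \<omega> l) *\<^sub>R v l)"
        by (rule sum.swap)
      finally show ?thesis by (simp add: U_def scaleR_sum_right)
    qed
    have layer: "(\<Sum>\<omega>\<in>\<Omega>. w \<omega> * (norm (U (f m \<omega>)))\<^sup>2) \<le> B * exp (- 4 * r * real m)" for m
    proof -
      define lam where "lam = exp (- 2 * r * real m)"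
      have lam: "lam > 0" by (simp add: lam_def)
      have lam_q: "lam ^ q = exp (- real m)"
        using q by (simp add: lam_def exp_of_nat_mult[symmetric] r_def)
      have "(\<Sum>\<omega>\<in>\<Omega>. w \<omega> * norm (U (f m \<omega>)) ^ q) \<le> K * real q * (D * exp (- real m))"
        unfolding U_def
      proof (rule pisier_average[OF cot q K fin u w f2])
        show "D * exp (- real m) > 0" using D by simp
        fix l assume "l \<in> L"
        have "(\<Sum>\<omega>\<in>\<Omega>. w \<omega> * \<bar>f m \<omega> l\<bar>) \<le> (\<Sum>\<omega>\<in>\<Omega>. w \<omega> * of_bool (real m \<le> \<bar>S \<omega> l\<bar>))"
          using w f1 by (intro sum_mono mult_left_mono) auto
        also have "\<dots> \<le> D * exp (- real m)" by (rule tail[OF \<open>l \<in> L\<close>])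
        finally show "(\<Sum>\<omega>\<in>\<Omega>. w \<omega> * \<bar>f m \<omega> l\<bar>) \<le> D * exp (- real m)" .
      qed auto
      then have avg: "(\<Sum>\<omega>\<in>\<Omega>. w \<omega> * norm (U (f m \<omega>)) ^ q) \<le> K * real q * D * lam ^ q"
        by (simp add: lam_q mult.assoc)
      have q2: "q = 2 + (q - 2)" using q by (auto elim!: evenE)
      \<comment> \<open>Passes from the q-th to the second moment. The threshold lam satisfies lam^q
        = exp (-m), the size of the tail, which balances the two terms.\<close>
      have young: "y\<^sup>2 \<le> lam\<^sup>2 + y ^ q / lam ^ (q - 2)" if "y \<ge> 0" for y
      proof (cases "y \<le> lam")
        case True
        then show ?thesis using that lam by (intro add_increasing2 power_mono) auto
      next
        case False
        then have "y\<^sup>2 * lam ^ (q - 2) \<le> y\<^sup>2 * y ^ (q - 2)"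
          using lam by (intro mult_left_mono power_mono) auto
        also have "\<dots> = y ^ q" by (subst (2) q2) (simp only: power_add)
        finally have "y\<^sup>2 \<le> y ^ q / lam ^ (q - 2)"
          using lam by (simp add: pos_le_divide_eq)
        then show ?thesis by (simp add: add_increasing)
      qed
      have "(\<Sum>\<omega>\<in>\<Omega>. w \<omega> * (norm (U (f m \<omega>)))\<^sup>2) \<le> (\<Sum>\<omega>\<in>\<Omega>. w \<omega> * (lam\<^sup>2 + norm (U (f m \<omega>)) ^ q / lam ^ (q - 2)))"
        using w young by (intro sum_mono mult_left_mono) auto
      also have "\<dots> = lam\<^sup>2 + (\<Sum>\<omega>\<in>\<Omega>. w \<omega> * norm (U (f m \<omega>)) ^ q) / lam ^ (q - 2)"
        using w(2) by (simp add: distrib_left sum.distrib sum_distrib_right[symmetric] sum_divide_distrib)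
      also have "\<dots> \<le> lam\<^sup>2 + K * real q * D * lam ^ q / lam ^ (q - 2)"
        using avg lam by (intro add_left_mono divide_right_mono) auto
      also have "lam ^ q = lam\<^sup>2 * lam ^ (q - 2)"
        by (subst q2) (simp only: power_add)
      also have "K * real q * D * (lam\<^sup>2 * lam ^ (q - 2)) / lam ^ (q - 2) = K * real q * D * lam\<^sup>2"
        using lam by simp
      also have "lam\<^sup>2 + K * real q * D * lam\<^sup>2 = B * lam\<^sup>2"
        by (simp add: B_def algebra_simps)
      also have "lam\<^sup>2 = exp (- 4 * r * real m)"
        by (simp add: lam_def exp_double[symmetric])
      finally show ?thesis .
    qed
    have point: "(norm (U (S \<omega>)))\<^sup>2 \<le> 1 / (1 - x) * (\<Sum>m<N. (real m + 1)\<^sup>2 * (norm (U (f m \<omega>)))\<^sup>2 / x ^ m)" if \<omega>: "\<omega> \<in> \<Omega>" for \<omega>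
    proof -
      have "norm (U (S \<omega>)) \<le> (\<Sum>m<N. (real m + 1) * norm (U (f m \<omega>)))"
        unfolding decomp[OF \<omega>] by (intro sum_norm_le) simp
      also have "\<dots> = (\<Sum>m<N. sqrt (x ^ m) * ((real m + 1) * norm (U (f m \<omega>)) / sqrt (x ^ m)))"
        using x by (intro sum.cong) auto
      finally have "(norm (U (S \<omega>)))\<^sup>2 \<le> (\<Sum>m<N. sqrt (x ^ m) * ((real m + 1) * norm (U (f m \<omega>)) / sqrt (x ^ m)))\<^sup>2"
        by (intro power_mono) auto
      also have "\<dots> \<le> (\<Sum>m<N. (sqrt (x ^ m))\<^sup>2) * (\<Sum>m<N. ((real m + 1) * norm (U (f m \<omega>)) / sqrt (x ^ m))\<^sup>2)"
        by (rule Cauchy_Schwarz_ineq_sum)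
      also have "(\<Sum>m<N. (sqrt (x ^ m))\<^sup>2) = (\<Sum>m<N. x ^ m)"
        using x by simp
      also have "(\<Sum>m<N. ((real m + 1) * norm (U (f m \<omega>)) / sqrt (x ^ m))\<^sup>2) = (\<Sum>m<N. (real m + 1)\<^sup>2 * (norm (U (f m \<omega>)))\<^sup>2 / x ^ m)"
        using x by (simp add: power_divide power_mult_distrib)
      also have "(\<Sum>m<N. x ^ m) * \<dots> \<le> 1 / (1 - x) * \<dots>"
        using x by (intro mult_right_mono geo sum_nonneg) auto
      finally show ?thesis .
    qed
    have "(\<Sum>\<omega>\<in>\<Omega>. \<Sum>m<N. (real m + 1)\<^sup>2 / x ^ m * (w \<omega> * (norm (U (f m \<omega>)))\<^sup>2))
      = (\<Sum>m<N. (real m + 1)\<^sup>2 / x ^ m * (\<Sum>\<omega>\<in>\<Omega>. w \<omega> * (norm (U (f m \<omega>)))\<^sup>2))"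
      by (subst sum.swap) (simp add: sum_distrib_left)
    also have "\<dots> \<le> (\<Sum>m<N. A * x ^ m)"
    proof (rule sum_mono)
      fix m
      have "(real m + 1)\<^sup>2 / x ^ m * (\<Sum>\<omega>\<in>\<Omega>. w \<omega> * (norm (U (f m \<omega>)))\<^sup>2)
        \<le> (real m + 1)\<^sup>2 / x ^ m * (B * exp (- 4 * r * real m))"
        using x layer by (intro mult_left_mono) auto
      also have "\<dots> \<le> ((2 / r)\<^sup>2 * exp r * exp (r * real m)) / x ^ m * (B * exp (- 4 * r * real m))"
        using x B poly_exp by (intro mult_right_mono divide_right_mono) auto
      also have "\<dots> = A * (exp (r * real m) * exp (r * real m) * exp (- 4 * r * real m))"
      proof -
        have "x ^ m = exp (- (r * real m))"
          by (simp add: x_def exp_of_nat_mult[symmetric] mult.commute)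
        then have inv_x: "1 / x ^ m = exp (r * real m)"
          by (simp add: exp_minus inverse_eq_divide)
        have "((2 / r)\<^sup>2 * exp r * exp (r * real m)) / x ^ m * (B * exp (- 4 * r * real m))
          = ((2 / r)\<^sup>2 * exp r * exp (r * real m)) * (1 / x ^ m) * (B * exp (- 4 * r * real m))"
          by simp
        then show ?thesis unfolding inv_x A_def by (simp only: mult_ac)
      qed
      also have "exp (r * real m) * exp (r * real m) * exp (- 4 * r * real m) = exp (- 2 * r * real m)"
        by (simp add: exp_add[symmetric])
      also have "\<dots> \<le> x ^ m"
        using r by (simp add: x_def exp_of_nat_mult[symmetric] mult.commute)
      finally show "(real m + 1)\<^sup>2 / x ^ m * (\<Sum>\<omega>\<in>\<Omega>. w \<omega> * (norm (U (f m \<omega>)))\<^sup>2) \<le> A * x ^ m"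
        using A by simp
    qed
    also have "\<dots> = A * (\<Sum>m<N. x ^ m)"
      by (simp add: sum_distrib_left)
    also have "\<dots> \<le> A * (1 / (1 - x))"
      using geo[of N] A by (intro mult_left_mono) auto
    finally have total: "(\<Sum>\<omega>\<in>\<Omega>. \<Sum>m<N. (real m + 1)\<^sup>2 / x ^ m * (w \<omega> * (norm (U (f m \<omega>)))\<^sup>2)) \<le> A * (1 / (1 - x))" .
    have "(\<Sum>\<omega>\<in>\<Omega>. w \<omega> * (norm (U (S \<omega>)))\<^sup>2)
      \<le> (\<Sum>\<omega>\<in>\<Omega>. w \<omega> * (1 / (1 - x) * (\<Sum>m<N. (real m + 1)\<^sup>2 * (norm (U (f m \<omega>)))\<^sup>2 / x ^ m)))"
      using w point by (intro sum_mono mult_left_mono) auto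
    also have "\<dots> = 1 / (1 - x) * (\<Sum>\<omega>\<in>\<Omega>. \<Sum>m<N. (real m + 1)\<^sup>2 / x ^ m * (w \<omega> * (norm (U (f m \<omega>)))\<^sup>2))"
      by (simp add: sum_distrib_left mult_ac)
    also have "\<dots> \<le> 1 / (1 - x) * (A * (1 / (1 - x)))"
      using total x by (intro mult_left_mono) auto
    finally have "(\<Sum>\<omega>\<in>\<Omega>. w \<omega> * (norm (U (S \<omega>)))\<^sup>2) \<le> 1 / (1 - x) * (A / (1 - x)) + 1"
      by simp
    then show "(\<Sum>\<omega>\<in>\<Omega>. w \<omega> * (norm (\<Sum>l\<in>L. S \<omega> l *\<^sub>R v l))\<^sup>2) \<le> 1 / (1 - x) * (A / (1 - x)) + 1"
      by (simp add: U_def)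
  qed
qed

text \<open>The variance of the partial sums, with p = 2\<alpha>. For p \<ge> 1 the largest summand
  is the last one; for p < 1 the sum is compared with l^p / p by induction.\<close>

lemma power_sum_le:
  assumes \<alpha>: "\<alpha> > 0"
  shows "(\<Sum>k=1..l. (real k powr (\<alpha> - 1/2))\<^sup>2) \<le> max 1 (1 / (2 * \<alpha>)) * (real l powr \<alpha>)\<^sup>2"
proof -
  define p where "p = 2 * \<alpha>"
  have p: "p > 0" using \<alpha> by (simp add: p_def)
  have sq: "(real k powr (\<alpha> - 1/2))\<^sup>2 = real k powr (p - 1)" "(real l powr \<alpha>)\<^sup>2 = real l powr p" for k
    by (simp_all add: powr_powr[symmetric] p_def powr_add[symmetric] power2_eq_square)
  have "(\<Sum>k=1..l. real k powr (p - 1)) \<le> max 1 (1 / p) * real l powr p"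
  proof (cases "p \<ge> 1")
    case True
    have "(\<Sum>k=1..l. real k powr (p - 1)) \<le> (\<Sum>k=1..l. real l powr (p - 1))"
      using True by (intro sum_mono powr_mono2) auto
    also have "\<dots> = real l powr p"
      by (cases "l = 0") (simp_all add: powr_diff)
    also have "\<dots> \<le> max 1 (1 / p) * real l powr p"
      using mult_right_mono[of 1 "max 1 (1 / p)" "real l powr p"] by simp
    finally show ?thesis .
  next
    case False
    have "(\<Sum>k=1..l. real k powr (p - 1)) \<le> real l powr p / p"
    proof (induction l)
      case (Suc l)
      have "real l powr p \<le> real (Suc l) powr p - p * real (Suc l) powr (p - 1)"
      proof (cases "l = 0")
        case True
        then show ?thesis using False by simp
      next
        case l: False
        define y where "y = real l / real (Suc l)"
        have y: "y > 0" using l by (simp add: y_def)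
        \<comment> \<open>Bernoulli's inequality for the exponent p < 1 at y = l/(l+1), that is y^p
          \<le> 1 - p (1 - y). It shows that l^p grows by at least p (l+1)^(p-1) in the step to l +
          1.\<close>
        have "y powr p * 1 powr (1 - p) \<le> p * y + (1 - p) * 1"
          using False p y by (intro Youngs_inequality_0) auto
        then have "real (Suc l) powr p * y powr p \<le> real (Suc l) powr p * (1 - p * (1 - y))"
          by (intro mult_left_mono) (auto simp: algebra_simps)
        moreover have "real (Suc l) powr p * y powr p = real l powr p"
          by (simp add: y_def powr_mult[symmetric])
        moreover have "1 - y = 1 / real (Suc l)"
          by (simp add: y_def field_simps)
        ultimately show ?thesis
          by (simp add: powr_diff right_diff_distrib mult.commute)
      qed
      with Suc p show ?case by (simp add: field_simps)
    qed simp
    also have "\<dots> \<le> max 1 (1 / p) * real l powr p"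
      using mult_right_mono[of "1 / p" "max 1 (1 / p)" "real l powr p"] by simp
    finally show ?thesis .
  qed
  then show ?thesis unfolding sq p_def .
qed

text \<open>\<open>layered_average\<close> for uniformly distributed signs, with the normalisation
  removed by scaling v with 1/G. One C serves all lengths n and all families.\<close>

lemma sign_coefficient_average:
  assumes "even q" "q > 0" "K \<ge> 1" "sign_cotype q K TYPE('a::real_normed_vector)"
  obtains C where "C > 0"
    "\<And>(v :: nat \<Rightarrow> 'a) L n c G. finite L \<Longrightarrow> G > 0 \<Longrightarrow>
      (\<And>\<eta>. (\<And>l. l \<in> L \<Longrightarrow> \<bar>\<eta> l\<bar> \<le> 1) \<Longrightarrow> norm (\<Sum>l\<in>L. \<eta> l *\<^sub>R v l) \<le> G) \<Longrightarrow>
      (\<And>l. l \<in> L \<Longrightarrow> (\<Sum>k=1..n. (c l k)\<^sup>2) \<le> 1) \<Longrightarrow>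
      (\<Sum>\<sigma>\<in>sign_vectors n. (1 / 2 ^ n) * (norm (\<Sum>l\<in>L. (\<Sum>k=1..n. c l k * \<sigma> k) *\<^sub>R v l))\<^sup>2) \<le> C * G\<^sup>2"
proof -
  obtain C where C: "C > 0" and avg:
    "\<And>(v :: nat \<Rightarrow> 'a) L (\<Omega> :: (nat \<Rightarrow> real) set) w S. finite L \<Longrightarrow> finite \<Omega> \<Longrightarrow>
      (\<And>\<eta>. (\<And>l. l \<in> L \<Longrightarrow> \<bar>\<eta> l\<bar> \<le> 1) \<Longrightarrow> norm (\<Sum>l\<in>L. \<eta> l *\<^sub>R v l) \<le> 1) \<Longrightarrow>
      (\<And>\<omega>. \<omega> \<in> \<Omega> \<Longrightarrow> 0 \<le> w \<omega>) \<Longrightarrow> sum w \<Omega> = 1 \<Longrightarrow>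
      (\<And>l m. l \<in> L \<Longrightarrow> (\<Sum>\<omega>\<in>\<Omega>. w \<omega> * of_bool (real m \<le> \<bar>S \<omega> l\<bar>)) \<le> 2 * exp 1 * exp (- real m)) \<Longrightarrow>
      (\<Sum>\<omega>\<in>\<Omega>. w \<omega> * (norm (\<Sum>l\<in>L. S \<omega> l *\<^sub>R v l))\<^sup>2) \<le> C"
    by (rule layered_average[OF assms(1-3) _ assms(4), where D = "2 * exp 1" and 'i = nat and 'w = "nat \<Rightarrow> real"]) auto
  show thesis
  proof (rule that[OF C])
    fix v :: "nat \<Rightarrow> 'a" and L and n :: nat and c :: "nat \<Rightarrow> nat \<Rightarrow> real" and G :: real
    assume L: "finite L" and G: "G > 0"
      and u: "\<And>\<eta>. (\<And>l. l \<in> L \<Longrightarrow> \<bar>\<eta> l\<bar> \<le> 1) \<Longrightarrow> norm (\<Sum>l\<in>L. \<eta> l *\<^sub>R v l) \<le> G"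
      and c: "\<And>l. l \<in> L \<Longrightarrow> (\<Sum>k=1..n. (c l k)\<^sup>2) \<le> 1"
    define S where "S \<sigma> l = (\<Sum>k=1..n. c l k * \<sigma> k)" for \<sigma> l
    have pull: "(\<Sum>l\<in>L. \<eta> l *\<^sub>R (1 / G) *\<^sub>R v l) = (1 / G) *\<^sub>R (\<Sum>l\<in>L. \<eta> l *\<^sub>R v l)" for \<eta>
      by (simp add: scaleR_sum_right mult.commute)
    have "(\<Sum>\<sigma>\<in>sign_vectors n. (1 / 2 ^ n) * (norm (\<Sum>l\<in>L. S \<sigma> l *\<^sub>R (1 / G) *\<^sub>R v l))\<^sup>2) \<le> C"
    proof (rule avg[OF L finite_sign_vectors])
      show "norm (\<Sum>l\<in>L. \<eta> l *\<^sub>R (1 / G) *\<^sub>R v l) \<le> 1" if "\<And>l. l \<in> L \<Longrightarrow> \<bar>\<eta> l\<bar> \<le> 1" for \<eta>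
        unfolding pull using u[OF that] G by simp
      show "(\<Sum>\<sigma>\<in>sign_vectors n. 1 / 2 ^ n * of_bool (real m \<le> \<bar>S \<sigma> l\<bar>)) \<le> 2 * exp 1 * exp (- real m)"
        if "l \<in> L" for l m
        unfolding S_def by (rule sign_sum_tail[OF c[OF that]])
    qed (simp_all add: card_sign_vectors)
    then have "(\<Sum>\<sigma>\<in>sign_vectors n. (1 / 2 ^ n) * (norm (\<Sum>l\<in>L. S \<sigma> l *\<^sub>R v l))\<^sup>2) / G\<^sup>2 \<le> C"
      unfolding pull using G by (simp add: power_divide sum_divide_distrib)
    then show "(\<Sum>\<sigma>\<in>sign_vectors n. (1 / 2 ^ n) * (norm (\<Sum>l\<in>L. (\<Sum>k=1..n. c l k * \<sigma> k) *\<^sub>R v l))\<^sup>2) \<le> C * G\<^sup>2"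
      using G by (simp add: S_def divide_le_eq)
  qed
qed

text \<open>The averages above take real coefficients, whereas powers of j enter the partial sums;
  real and imaginary parts are averaged separately.\<close>

lemma norm_scaleC_sum_sq_le:
  fixes z :: "'i \<Rightarrow> 'a::complex_normed_vector"
  shows "(norm (\<Sum>l\<in>L. s l *\<^sub>C z l))\<^sup>2 \<le>
    2 * (norm (\<Sum>l\<in>L. Re (s l) *\<^sub>R z l))\<^sup>2 + 2 * (norm (\<Sum>l\<in>L. Im (s l) *\<^sub>R \<i> *\<^sub>C z l))\<^sup>2"
proof -
  have split: "a *\<^sub>C y = Re a *\<^sub>R y + Im a *\<^sub>R \<i> *\<^sub>C y" for a and y :: 'a
  proof -
    have "a *\<^sub>C y = (of_real (Re a) + of_real (Im a) * \<i>) *\<^sub>C y"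
      by (simp add: complex_eq[of a, symmetric] mult.commute)
    then show ?thesis
      by (simp only: scaleC_add_left scaleC_scaleC[symmetric] scaleC_of_real)
  qed
  have "(\<Sum>l\<in>L. s l *\<^sub>C z l) = (\<Sum>l\<in>L. Re (s l) *\<^sub>R z l) + (\<Sum>l\<in>L. Im (s l) *\<^sub>R \<i> *\<^sub>C z l)" (is "_ = ?a + ?b")
    unfolding sum.distrib[symmetric] by (intro sum.cong split refl)
  then have "(norm (\<Sum>l\<in>L. s l *\<^sub>C z l))\<^sup>2 \<le> (norm ?a + norm ?b)\<^sup>2"
    by (simp add: norm_triangle_ineq power_mono)
  also have "\<dots> \<le> 2 * (norm ?a)\<^sup>2 + 2 * (norm ?b)\<^sup>2"
    using zero_le_power2[of "norm ?a - norm ?b"] by (simp add: power2_sum power2_diff)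
  finally show ?thesis .
qed

lemma scaleC_sum_right: "c *\<^sub>C (\<Sum>i\<in>I. f i) = (\<Sum>i\<in>I. c *\<^sub>C (f i :: 'a::complex_normed_vector))"
  by (rule linear_sum[OF bounded_linear.linear[OF bounded_linear_scaleC]])

text \<open>By \<open>power_sum_le\<close> the division by l^\<alpha> leaves coefficients of bounded
  variance. The factor 4 comes from the real and the imaginary part, each entering with a factor
  2.\<close>

lemma block_average:
  fixes z :: "nat \<Rightarrow> 'a::complex_normed_vector" and j :: complex
  assumes C: "\<And>(v :: nat \<Rightarrow> 'a) L n c G. finite L \<Longrightarrow> G > 0 \<Longrightarrow>
      (\<And>\<eta>. (\<And>l. l \<in> L \<Longrightarrow> \<bar>\<eta> l\<bar> \<le> 1) \<Longrightarrow> norm (\<Sum>l\<in>L. \<eta> l *\<^sub>R v l) \<le> G) \<Longrightarrow>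
      (\<And>l. l \<in> L \<Longrightarrow> (\<Sum>k=1..n. (c l k)\<^sup>2) \<le> 1) \<Longrightarrow>
      (\<Sum>\<sigma>\<in>sign_vectors n. (1 / 2 ^ n) * (norm (\<Sum>l\<in>L. (\<Sum>k=1..n. c l k * \<sigma> k) *\<^sub>R v l))\<^sup>2) \<le> C * G\<^sup>2"
    and \<alpha>: "\<alpha> > 0" and j: "cmod j = 1" and G: "G > 0"
    and z: "\<And>\<eta>. (\<And>l. l \<in> {1..n} \<Longrightarrow> \<bar>\<eta> l\<bar> \<le> 1) \<Longrightarrow> norm (\<Sum>l=1..n. \<eta> l *\<^sub>R z l) \<le> G"
  shows "(\<Sum>\<sigma>\<in>sign_vectors n. (1 / 2 ^ n) * (norm (\<Sum>l=1..n.
      ((\<Sum>k=1..l. complex_of_real (\<sigma> k * real k powr (\<alpha> - 1/2)) * j ^ (k - 1)) / complex_of_real (real l powr \<alpha>)) *\<^sub>C z l))\<^sup>2)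
    \<le> 4 * max 1 (1 / (2 * \<alpha>)) * C * G\<^sup>2"
proof -
  define D where "D = max 1 (1 / (2 * \<alpha>))"
  have D: "D > 0" by (simp add: D_def)
  define s where "s \<sigma> l = (\<Sum>k=1..l. complex_of_real (\<sigma> k * real k powr (\<alpha> - 1/2)) * j ^ (k - 1)) / complex_of_real (real l powr \<alpha>)"
    for \<sigma> and l :: nat
  \<comment> \<open>P stands for Re and Im.\<close>
  have one: "(\<Sum>\<sigma>\<in>sign_vectors n. (1 / 2 ^ n) * (norm (\<Sum>l=1..n. P (s \<sigma> l) *\<^sub>R y l))\<^sup>2) \<le> D * C * G\<^sup>2"
    if P: "\<And>a b. P (a + b) = P a + P b" "\<And>r a. P (of_real r * a) = r * P a" "\<And>a. \<bar>P a\<bar> \<le> cmod a"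
      and y: "\<And>\<eta>. (\<And>l. l \<in> {1..n} \<Longrightarrow> \<bar>\<eta> l\<bar> \<le> 1) \<Longrightarrow> norm (\<Sum>l=1..n. \<eta> l *\<^sub>R y l) \<le> G"
    for P :: "complex \<Rightarrow> real" and y :: "nat \<Rightarrow> 'a"
  proof -
    have P0: "P 0 = 0" using P(2)[of 0 0] by simp
    have P_sum: "P (\<Sum>k\<in>I. g k) = (\<Sum>k\<in>I. P (g k))" for g and I :: "nat set"
      by (induction I rule: infinite_finite_induct) (simp_all add: P P0)
    \<comment> \<open>The partial sum up to l is padded with zeros to length n, and the division by
      sqrt D makes the squares add up to at most 1.\<close>
    define c where "c l k = (if k \<le> l then real k powr (\<alpha> - 1/2) * P (j ^ (k - 1)) / (sqrt D * real l powr \<alpha>) else 0)"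
      for l k :: nat
    have Ps: "P (s \<sigma> l) = sqrt D * (\<Sum>k=1..n. c l k * \<sigma> k)" if l: "l \<in> {1..n}" for \<sigma> l
    proof -
      have "s \<sigma> l = (\<Sum>k=1..l. of_real (\<sigma> k * real k powr (\<alpha> - 1/2) / real l powr \<alpha>) * j ^ (k - 1))"
        by (simp add: s_def sum_divide_distrib)
      then have "P (s \<sigma> l) = (\<Sum>k=1..l. \<sigma> k * real k powr (\<alpha> - 1/2) / real l powr \<alpha> * P (j ^ (k - 1)))"
        by (simp only: P_sum P(2))
      also have "\<dots> = (\<Sum>k=1..l. sqrt D * (c l k * \<sigma> k))"
        using D by (intro sum.cong) (auto simp: c_def)
      also have "\<dots> = (\<Sum>k=1..n. sqrt D * (c l k * \<sigma> k))"
        using l by (intro sum.mono_neutral_left) (auto simp: c_def)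
      finally show ?thesis by (simp add: sum_distrib_left)
    qed
    have avg: "(\<Sum>\<sigma>\<in>sign_vectors n. (1 / 2 ^ n) * (norm (\<Sum>l\<in>{1..n}. (\<Sum>k=1..n. c l k * \<sigma> k) *\<^sub>R y l))\<^sup>2) \<le> C * G\<^sup>2"
    proof (rule C[OF finite_atLeastAtMost G y])
      fix l assume l: "l \<in> {1..n}"
      have "(\<Sum>k=1..n. (c l k)\<^sup>2) = (\<Sum>k=1..l. (c l k)\<^sup>2)"
        using l by (intro sum.mono_neutral_right) (auto simp: c_def)
      also have "\<dots> \<le> (\<Sum>k=1..l. (real k powr (\<alpha> - 1/2))\<^sup>2 / (D * (real l powr \<alpha>)\<^sup>2))"
      proof (rule sum_mono)
        fix k assume k: "k \<in> {1..l}"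
        have "\<bar>P (j ^ (k - 1))\<bar> \<le> 1"
          using P(3)[of "j ^ (k - 1)"] j by (simp add: norm_power)
        then have "(P (j ^ (k - 1)))\<^sup>2 \<le> 1"
          by (simp add: abs_square_le_1)
        then have "(real k powr (\<alpha> - 1/2))\<^sup>2 * (P (j ^ (k - 1)))\<^sup>2 / (D * (real l powr \<alpha>)\<^sup>2) \<le> (real k powr (\<alpha> - 1/2))\<^sup>2 * 1 / (D * (real l powr \<alpha>)\<^sup>2)"
          using D by (intro divide_right_mono mult_left_mono) auto
        then show "(c l k)\<^sup>2 \<le> (real k powr (\<alpha> - 1/2))\<^sup>2 / (D * (real l powr \<alpha>)\<^sup>2)"
          using k D by (simp add: c_def power_divide power_mult_distrib)
      qed
      also have "\<dots> = (\<Sum>k=1..l. (real k powr (\<alpha> - 1/2))\<^sup>2) / (D * (real l powr \<alpha>)\<^sup>2)"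
        by (simp only: sum_divide_distrib)
      also have "\<dots> \<le> 1"
        using power_sum_le[OF \<alpha>, of l] l D by (simp add: divide_le_eq D_def)
      finally show "(\<Sum>k=1..n. (c l k)\<^sup>2) \<le> 1" .
    qed
    have eq: "(\<Sum>l=1..n. P (s \<sigma> l) *\<^sub>R y l) = sqrt D *\<^sub>R (\<Sum>l\<in>{1..n}. (\<Sum>k=1..n. c l k * \<sigma> k) *\<^sub>R y l)" for \<sigma>
      unfolding scaleR_sum_right by (intro sum.cong refl) (simp only: Ps scaleR_scaleR)
    have "(\<Sum>\<sigma>\<in>sign_vectors n. (1 / 2 ^ n) * (norm (\<Sum>l=1..n. P (s \<sigma> l) *\<^sub>R y l))\<^sup>2)
      = D * (\<Sum>\<sigma>\<in>sign_vectors n. (1 / 2 ^ n) * (norm (\<Sum>l\<in>{1..n}. (\<Sum>k=1..n. c l k * \<sigma> k) *\<^sub>R y l))\<^sup>2)"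
      unfolding eq sum_distrib_left using D by (intro sum.cong) (simp_all add: power_mult_distrib)
    also have "\<dots> \<le> D * (C * G\<^sup>2)"
      using avg D by (intro mult_left_mono) auto
    finally show ?thesis by (simp add: mult.assoc)
  qed
  have zi: "norm (\<Sum>l=1..n. \<eta> l *\<^sub>R \<i> *\<^sub>C z l) \<le> G" if "\<And>l. l \<in> {1..n} \<Longrightarrow> \<bar>\<eta> l\<bar> \<le> 1" for \<eta>
  proof -
    have "(\<Sum>l=1..n. \<eta> l *\<^sub>R \<i> *\<^sub>C z l) = \<i> *\<^sub>C (\<Sum>l=1..n. \<eta> l *\<^sub>R z l)"
      by (simp add: scaleC_sum_right scaleC_scaleR_commute)
    then show ?thesis using z[OF that] by (simp add: norm_scaleC)
  qed
  have "(\<Sum>\<sigma>\<in>sign_vectors n. (1 / 2 ^ n) * (norm (\<Sum>l=1..n. s \<sigma> l *\<^sub>C z l))\<^sup>2)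
    \<le> (\<Sum>\<sigma>\<in>sign_vectors n. (1 / 2 ^ n) * (2 * (norm (\<Sum>l=1..n. Re (s \<sigma> l) *\<^sub>R z l))\<^sup>2 +
        2 * (norm (\<Sum>l=1..n. Im (s \<sigma> l) *\<^sub>R \<i> *\<^sub>C z l))\<^sup>2))"
    by (intro sum_mono mult_left_mono norm_scaleC_sum_sq_le) auto
  also have "\<dots> = 2 * (\<Sum>\<sigma>\<in>sign_vectors n. (1 / 2 ^ n) * (norm (\<Sum>l=1..n. Re (s \<sigma> l) *\<^sub>R z l))\<^sup>2)
    + 2 * (\<Sum>\<sigma>\<in>sign_vectors n. (1 / 2 ^ n) * (norm (\<Sum>l=1..n. Im (s \<sigma> l) *\<^sub>R \<i> *\<^sub>C z l))\<^sup>2)"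
    unfolding sum_distrib_left sum.distrib[symmetric] by (intro sum.cong) (simp_all add: algebra_simps)
  also have "\<dots> \<le> 2 * (D * C * G\<^sup>2) + 2 * (D * C * G\<^sup>2)"
    by (intro add_mono mult_left_mono one z zi) (simp_all add: abs_Re_le_cmod abs_Im_le_cmod)
  also have "\<dots> = 4 * D * C * G\<^sup>2"
    by simp
  finally show ?thesis
    unfolding s_def D_def .
qed

subsection \<open>Square functions\<close>

text \<open>The boundary term has no factor 1 - V; it stays on as the last member of the family and
  needs its own estimate in \<open>family_bound\<close>.\<close>

lemma abel_summation:
  fixes V :: "'a::complex_banach cop"
  shows "(\<Sum>k=1..Suc m. cs (b k) * V ^ (k - 1)) =
    (\<Sum>l=1..m. cs (\<Sum>k=1..l. b k) * (V ^ (l - 1) * (1 - V))) + cs (\<Sum>k=1..Suc m. b k) * V ^ m"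
proof (induction m)
  case (Suc m)
  have "(\<Sum>k=1..Suc (Suc m). cs (b k) * V ^ (k - 1)) = (\<Sum>k=1..Suc m. cs (b k) * V ^ (k - 1)) + cs (b (Suc (Suc m))) * V ^ Suc m"
    by simp
  also have "\<dots> = (\<Sum>l=1..m. cs (\<Sum>k=1..l. b k) * (V ^ (l - 1) * (1 - V))) + cs (\<Sum>k=1..Suc m. b k) * V ^ m + cs (b (Suc (Suc m))) * V ^ Suc m"
    by (simp only: Suc)
  also have "cs (\<Sum>k=1..Suc m. b k) * V ^ m = cs (\<Sum>k=1..Suc m. b k) * (V ^ m * (1 - V)) + cs (\<Sum>k=1..Suc m. b k) * V ^ Suc m"
    by (simp only: power_Suc2 right_diff_distrib mult_1_right) simp
  also have "(\<Sum>l=1..m. cs (\<Sum>k=1..l. b k) * (V ^ (l - 1) * (1 - V))) + (cs (\<Sum>k=1..Suc m. b k) * (V ^ m * (1 - V)) + cs (\<Sum>k=1..Suc m. b k) * V ^ Suc m) + cs (b (Suc (Suc m))) * V ^ Suc m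
    = (\<Sum>l=1..Suc m. cs (\<Sum>k=1..l. b k) * (V ^ (l - 1) * (1 - V))) + cs (\<Sum>k=1..Suc (Suc m). b k) * V ^ Suc m"
    by (simp add: cs_simps(1) distrib_right add.assoc)
  finally show ?case .
qed (simp add: cs_simps)

text \<open>Here the exponents meet. With x = |z|, the l-th term is l^\<alpha> x^(l-1) times the
  full product, and the fractional powers raise the product to the power 1 + \<alpha>, at most a
  constant times (1 - x)^(1+\<alpha>). The boundary term only has the power \<alpha>, which suffices
  for a single term.\<close>

lemma family_bound:
  fixes T A :: "'a::complex_banach cop" and c :: complex
  assumes E: "finite E" "E \<noteq> {}" "E \<subseteq> sphere 0 1" and s: "0 < s" "s < 1" and K': "K' > 0" and \<alpha>: "\<alpha> > 0"
    and bound: "\<And>Q B. 0 \<le> B \<Longrightarrow> (\<And>z. z \<in> stolz_domain E s \<Longrightarrow>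
      cmod (poly Q z) * (\<Prod>\<xi>\<in>E. cmod (\<xi> - z)) powr \<alpha> \<le> B) \<Longrightarrow> norm (pop Q T * A) \<le> K' * B"
    and j: "j \<in> E"
  defines "V \<equiv> cs (cnj j) * T"
    and "X \<equiv> pop (Polynomial.smult c (\<Prod>\<eta>\<in>E - {j}. [:1, - cnj \<eta>:])) T * A"
  obtains G where "G > 0" "\<And>m \<eta>. (\<And>l. l \<in> {1..Suc m} \<Longrightarrow> \<bar>\<eta> l\<bar> \<le> 1) \<Longrightarrow>
    norm ((\<Sum>l=1..m. (\<eta> l * real l powr \<alpha>) *\<^sub>R (V ^ (l - 1) * (1 - V) * X)) +
      (\<eta> (Suc m) * real (Suc m) powr \<alpha>) *\<^sub>R (V ^ m * X)) \<le> G"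
proof -
  have unimod: "cmod \<xi> = 1" "cnj \<xi> * \<xi> = 1" if "\<xi> \<in> E" for \<xi>
    using that E(3) complex_norm_square[of \<xi>] by (auto simp: mult.commute[of "cnj _"])
  define P where "P z = (\<Prod>\<xi>\<in>E. cmod (\<xi> - z))" for z
  have P0: "P z \<ge> 0" for z by (simp add: P_def prod_nonneg)
  obtain C0 where C0: "C0 > 0" "\<And>z. z \<in> stolz_domain E s \<Longrightarrow> P z \<le> C0 * (1 - cmod z)"
  proof (rule stolz_prod_bound[OF E s])
    fix C assume 1: "C > 0" and 2: "\<And>z. z \<in> stolz_domain E s \<Longrightarrow> (\<Prod>\<xi>\<in>E. cmod (\<xi> - z)) \<le> C * (1 - cmod z)"
    show thesis
      by (rule that[OF 1 2[folded P_def]])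
  qed
  obtain Cg where Cg: "Cg > 0"
    "\<And>x n. 0 \<le> x \<Longrightarrow> x < 1 \<Longrightarrow> (\<Sum>l=1..n. real l powr \<alpha> * x ^ (l - 1)) * (1 - x) powr (1 + \<alpha>) \<le> Cg"
    "\<And>x n. 0 \<le> x \<Longrightarrow> x < 1 \<Longrightarrow> n \<ge> 1 \<Longrightarrow> real n powr \<alpha> * x ^ (n - 1) * (1 - x) powr \<alpha> \<le> Cg"
    by (rule weighted_geometric_bound[OF \<alpha>]) (rule that)
  define p where "p = Polynomial.smult c (\<Prod>\<eta>\<in>E - {j}. [:1, - cnj \<eta>:])"
  \<comment> \<open>The first summand pays for the sum over l, the second for the boundary term,
    where p is only bounded by |c| 2^N with N = \<open>card E\<close>.\<close>
  define B where "B = cmod c * (C0 powr (1 + \<alpha>) * Cg) + cmod c * 2 ^ card E * (C0 powr \<alpha> * Cg)"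
  have B0: "B \<ge> 0" using Cg by (simp add: B_def)
  have rot: "cmod (1 - z * cnj \<xi>) = cmod (\<xi> - z)" if "\<xi> \<in> E" for \<xi> z
  proof -
    have "\<xi> - z = \<xi> * (1 - z * cnj \<xi>)"
      using unimod(2)[OF that] by (simp add: right_diff_distrib mult.left_commute[of \<xi>] mult.commute[of \<xi>])
    then show ?thesis using unimod(1)[OF that] by (simp add: norm_mult)
  qed
  have p1: "cmod (poly ([:1, - cnj j:] * p) z) = cmod c * P z" for z
  proof -
    have "[:1, - cnj j:] * p = Polynomial.smult c (\<Prod>\<eta>\<in>E. [:1, - cnj \<eta>:])"
      unfolding p_def using E(1) j by (simp only: mult_smult_right prod.remove[of E j])
    then have "cmod (poly ([:1, - cnj j:] * p) z) = cmod c * cmod (\<Prod>\<eta>\<in>E. 1 - z * cnj \<eta>)"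
      by (simp only:) (simp add: poly_prod norm_mult)
    also have "cmod (\<Prod>\<eta>\<in>E. 1 - z * cnj \<eta>) = P z"
      unfolding prod_norm[symmetric] P_def using rot by (intro prod.cong) auto
    finally show ?thesis .
  qed
  have p2: "cmod (poly p z) \<le> cmod c * 2 ^ card E" if z: "cmod z \<le> 1" for z
  proof -
    have "cmod (\<Prod>\<eta>\<in>E - {j}. 1 - z * cnj \<eta>) \<le> (\<Prod>\<eta>\<in>E - {j}. 2)"
      unfolding prod_norm[symmetric]
    proof (intro prod_mono conjI norm_ge_zero)
      fix \<eta> assume "\<eta> \<in> E - {j}"
      then show "cmod (1 - z * cnj \<eta>) \<le> 2"
        using rot[of \<eta> z] norm_triangle_ineq4[of \<eta> z] unimod(1)[of \<eta>] z by simp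
    qed
    also have "(\<Prod>\<eta>\<in>E - {j}. 2 :: real) = 2 ^ card (E - {j})"
      by simp
    also have "\<dots> \<le> 2 ^ card E"
      using E(1) by (intro power_increasing card_mono) auto
    finally show ?thesis
      by (simp add: p_def poly_prod norm_mult mult_left_mono)
  qed
  have lin: "pop [:0, cnj j:] T = V" "pop [:1, - cnj j:] T = 1 - V"
    by (simp_all add: pop_linear V_def cs_simps)
  show thesis
  \<comment> \<open>The added 1 makes the bound positive even when c = 0 and therefore B =
    0.\<close>
  proof (rule that[of "K' * B + 1"])
    show "K' * B + 1 > 0" using K' B0 by (simp add: add_nonneg_pos)
  next
    fix m and \<eta> :: "nat \<Rightarrow> real" assume \<eta>: "\<And>l. l \<in> {1..Suc m} \<Longrightarrow> \<bar>\<eta> l\<bar> \<le> 1"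
    define Q where "Q = (\<Sum>l=1..m. Polynomial.smult (complex_of_real (\<eta> l * real l powr \<alpha>)) ([:0, cnj j:] ^ (l - 1) * ([:1, - cnj j:] * p)))
      + Polynomial.smult (complex_of_real (\<eta> (Suc m) * real (Suc m) powr \<alpha>)) ([:0, cnj j:] ^ m * p)"
    have "pop Q T * A = (\<Sum>l=1..m. (\<eta> l * real l powr \<alpha>) *\<^sub>R (V ^ (l - 1) * (1 - V) * X)) +
      (\<eta> (Suc m) * real (Suc m) powr \<alpha>) *\<^sub>R (V ^ m * X)"
      unfolding Q_def pop_add pop_sum pop_smult pop_mult pop_power lin X_def p_def[symmetric] cs_of_real
      by (simp only: distrib_right sum_distrib_right mult_scaleR_left mult.assoc)
    moreover have "norm (pop Q T * A) \<le> K' * B"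
    proof (rule bound[OF B0])
      fix z assume z: "z \<in> stolz_domain E s"
      define x where "x = cmod z"
      have x: "0 \<le> x" "x < 1"
        using stolz_subset_ball[OF E(1,3) s] z by (auto simp: x_def)
      have P_le: "P z \<le> C0 * (1 - x)"
        using C0(2)[OF z] by (simp add: x_def)
      have Pa: "P z powr \<alpha> \<le> C0 powr \<alpha> * (1 - x) powr \<alpha>"
        using P_le P0 \<alpha> C0(1) x by (simp add: powr_mult[symmetric] powr_mono2)
      have P1a: "P z * P z powr \<alpha> \<le> C0 powr (1 + \<alpha>) * (1 - x) powr (1 + \<alpha>)"
      proof -
        have "P z * P z powr \<alpha> = P z powr (1 + \<alpha>)"
          using P0[of z] by (cases "P z = 0") (simp_all add: powr_add)
        then show ?thesis
          using P_le P0 \<alpha> C0(1) x by (simp add: powr_mult[symmetric] powr_mono2)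
      qed
      have base: "cmod (poly [:0, cnj j:] z) = x"
        using unimod(1)[OF j] by (simp add: norm_mult x_def)
      have "cmod (poly Q z) \<le> (\<Sum>l=1..m. real l powr \<alpha> * x ^ (l - 1) * (cmod c * P z))
          + real (Suc m) powr \<alpha> * x ^ m * (cmod c * 2 ^ card E)"
      proof -
        have "cmod (poly Q z) \<le> (\<Sum>l=1..m. cmod (poly (Polynomial.smult (complex_of_real (\<eta> l * real l powr \<alpha>)) ([:0, cnj j:] ^ (l - 1) * ([:1, - cnj j:] * p))) z))
          + cmod (poly (Polynomial.smult (complex_of_real (\<eta> (Suc m) * real (Suc m) powr \<alpha>)) ([:0, cnj j:] ^ m * p)) z)"
          unfolding Q_def poly_add poly_sum
          by (intro order_trans[OF norm_triangle_ineq] add_right_mono norm_sum)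
        also have "\<dots> \<le> (\<Sum>l=1..m. real l powr \<alpha> * x ^ (l - 1) * (cmod c * P z))
          + real (Suc m) powr \<alpha> * x ^ m * (cmod c * 2 ^ card E)"
        proof (intro add_mono sum_mono)
          fix l assume l: "l \<in> {1..m}"
          have "cmod (poly (Polynomial.smult (complex_of_real (\<eta> l * real l powr \<alpha>)) ([:0, cnj j:] ^ (l - 1) * ([:1, - cnj j:] * p))) z)
            = \<bar>\<eta> l\<bar> * (real l powr \<alpha> * x ^ (l - 1) * (cmod c * P z))"
            unfolding poly_smult poly_mult[of "_ ^ _"] poly_power norm_mult norm_power base p1 norm_of_real abs_mult
            by simp
          also have "\<dots> \<le> 1 * (real l powr \<alpha> * x ^ (l - 1) * (cmod c * P z))"
            using \<eta>[of l] l P0 x by (intro mult_right_mono) auto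
          finally show "cmod (poly (Polynomial.smult (complex_of_real (\<eta> l * real l powr \<alpha>)) ([:0, cnj j:] ^ (l - 1) * ([:1, - cnj j:] * p))) z)
            \<le> real l powr \<alpha> * x ^ (l - 1) * (cmod c * P z)" by simp
        next
          have "cmod (poly (Polynomial.smult (complex_of_real (\<eta> (Suc m) * real (Suc m) powr \<alpha>)) ([:0, cnj j:] ^ m * p)) z)
            = \<bar>\<eta> (Suc m)\<bar> * (real (Suc m) powr \<alpha> * x ^ m * cmod (poly p z))"
            unfolding poly_smult poly_mult poly_power norm_mult norm_power base norm_of_real abs_mult
            by simp
          also have "\<dots> \<le> 1 * (real (Suc m) powr \<alpha> * x ^ m * (cmod c * 2 ^ card E))"
            using \<eta>[of "Suc m"] p2[of z] x by (intro mult_mono) (auto simp: x_def)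
          finally show "cmod (poly (Polynomial.smult (complex_of_real (\<eta> (Suc m) * real (Suc m) powr \<alpha>)) ([:0, cnj j:] ^ m * p)) z)
            \<le> real (Suc m) powr \<alpha> * x ^ m * (cmod c * 2 ^ card E)" by simp
        qed
        finally show ?thesis .
      qed
      then have "cmod (poly Q z) * P z powr \<alpha> \<le> ((\<Sum>l=1..m. real l powr \<alpha> * x ^ (l - 1) * (cmod c * P z))
          + real (Suc m) powr \<alpha> * x ^ m * (cmod c * 2 ^ card E)) * P z powr \<alpha>"
        by (intro mult_right_mono) auto
      also have "\<dots> = cmod c * ((\<Sum>l=1..m. real l powr \<alpha> * x ^ (l - 1)) * (P z * P z powr \<alpha>))
          + cmod c * 2 ^ card E * (real (Suc m) powr \<alpha> * x ^ m * P z powr \<alpha>)"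
        by (simp add: distrib_left distrib_right sum_distrib_left sum_distrib_right mult_ac)
      also have "\<dots> \<le> cmod c * (C0 powr (1 + \<alpha>) * Cg) + cmod c * 2 ^ card E * (C0 powr \<alpha> * Cg)"
      proof (intro add_mono mult_left_mono)
        have "(\<Sum>l=1..m. real l powr \<alpha> * x ^ (l - 1)) * (P z * P z powr \<alpha>)
          \<le> (\<Sum>l=1..m. real l powr \<alpha> * x ^ (l - 1)) * (C0 powr (1 + \<alpha>) * (1 - x) powr (1 + \<alpha>))"
          using x by (intro mult_left_mono P1a sum_nonneg) auto
        also have "\<dots> = C0 powr (1 + \<alpha>) * ((\<Sum>l=1..m. real l powr \<alpha> * x ^ (l - 1)) * (1 - x) powr (1 + \<alpha>))"
          by simp
        also have "\<dots> \<le> C0 powr (1 + \<alpha>) * Cg"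
          using Cg(2)[OF x] by (intro mult_left_mono) auto
        finally show "(\<Sum>l=1..m. real l powr \<alpha> * x ^ (l - 1)) * (P z * P z powr \<alpha>) \<le> C0 powr (1 + \<alpha>) * Cg" .
        have "real (Suc m) powr \<alpha> * x ^ m * P z powr \<alpha> \<le> real (Suc m) powr \<alpha> * x ^ m * (C0 powr \<alpha> * (1 - x) powr \<alpha>)"
          using x by (intro mult_left_mono Pa) auto
        also have "\<dots> = C0 powr \<alpha> * (real (Suc m) powr \<alpha> * x ^ m * (1 - x) powr \<alpha>)"
          by simp
        also have "\<dots> \<le> C0 powr \<alpha> * Cg"
          using Cg(3)[OF x, of "Suc m"] by (intro mult_left_mono) auto
        finally show "real (Suc m) powr \<alpha> * x ^ m * P z powr \<alpha> \<le> C0 powr \<alpha> * Cg" .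
      qed auto
      finally show "cmod (poly Q z) * (\<Prod>\<xi>\<in>E. cmod (\<xi> - z)) powr \<alpha> \<le> B"
        by (simp only: B_def P_def)
    qed
    ultimately show "norm ((\<Sum>l=1..m. (\<eta> l * real l powr \<alpha>) *\<^sub>R (V ^ (l - 1) * (1 - V) * X)) +
      (\<eta> (Suc m) * real (Suc m) powr \<alpha>) *\<^sub>R (V ^ m * X)) \<le> K' * B + 1"
      by simp
  qed
qed

section \<open>From the blocks to the square function\<close>

lemma rep_cop_sum: "rep_cop (\<Sum>i\<in>I. f i) = (\<Sum>i\<in>I. rep_cop (f i))"
  by (induction I rule: infinite_finite_induct) simp_all

lemma rep_cs_apply: "rep_cop (cs c * a) x = c *\<^sub>C rep_cop a x"
  by (simp only: rep_cs scaleC_blinfun.rep_eq)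

text \<open>Abel summation in the rotated operator \<open>V\<close> turns the square function sum into random partial
  sums times a family that is unconditionally bounded by \<open>family_bound\<close>.\<close>

lemma block_decomposition:
  fixes T V X :: "'a::complex_banach cop" and \<sigma> :: "nat \<Rightarrow> real" and x :: 'a and m :: nat and \<alpha> :: real and j :: complex
  assumes j: "cmod j = 1"
  defines "V \<equiv> cs (cnj j) * T"
    and "zv \<equiv> (\<lambda>l. real l powr \<alpha> *\<^sub>R rep_cop (if l = Suc m then V ^ m * X else V ^ (l - 1) * (1 - V) * X) x)"
  shows "(\<Sum>k=1..Suc m. (\<sigma> k * real k powr (\<alpha> - 1/2)) *\<^sub>R rep_cop (T ^ (k - 1) * X) x) =
    (\<Sum>l=1..Suc m. ((\<Sum>k=1..l. complex_of_real (\<sigma> k * real k powr (\<alpha> - 1/2)) * j ^ (k - 1)) / complex_of_real (real l powr \<alpha>)) *\<^sub>C zv l)"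
proof -
  define b where "b k = complex_of_real (\<sigma> k * real k powr (\<alpha> - 1/2)) * j ^ (k - 1)" for k
  have jj: "j * cnj j = 1"
    using j complex_norm_square[of j] by simp
  have V_pow: "V ^ i = cs (cnj j ^ i) * T ^ i" for i
  proof (induction i)
    case (Suc i)
    have "V ^ Suc i = cs (cnj j) * (T * (cs (cnj j ^ i) * T ^ i))"
      using Suc by (simp add: V_def mult.assoc)
    also have "\<dots> = cs (cnj j) * (cs (cnj j ^ i) * (T * T ^ i))"
      by (simp only: cs_left_commute[of T])
    finally show ?case
      by (simp add: cs_simps(3) mult.assoc)
  qed (simp add: cs_simps)
  have T_pow: "cs (j ^ i) * V ^ i = T ^ i" for i
    unfolding V_pow mult.assoc[symmetric] cs_simps(3)[symmetric] power_mult_distrib[symmetric] jj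
    by (simp add: cs_simps)
  have "(\<Sum>k=1..Suc m. (\<sigma> k * real k powr (\<alpha> - 1/2)) *\<^sub>R rep_cop (T ^ (k - 1) * X) x)
    = rep_cop ((\<Sum>k=1..Suc m. cs (b k) * V ^ (k - 1)) * X) x"
  proof -
    have "(\<sigma> k * real k powr (\<alpha> - 1/2)) *\<^sub>R rep_cop (T ^ (k - 1) * X) x = rep_cop (cs (b k) * V ^ (k - 1) * X) x" for k
    proof -
      have "cs (b k) * V ^ (k - 1) * X = cs (complex_of_real (\<sigma> k * real k powr (\<alpha> - 1/2))) * (T ^ (k - 1) * X)"
        unfolding b_def cs_simps(3) mult.assoc T_pow[symmetric, of "k - 1"] ..
      then show ?thesis
        unfolding cs_of_real by (simp only: rep_cop_simps(4) scaleR_blinfun.rep_eq)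
    qed
    then show ?thesis
      by (simp only: sum_distrib_right rep_cop_sum blinfun.sum_left)
  qed
  also have "\<dots> = rep_cop ((\<Sum>l=1..m. cs (\<Sum>k=1..l. b k) * (V ^ (l - 1) * (1 - V) * X)) + cs (\<Sum>k=1..Suc m. b k) * (V ^ m * X)) x"
    unfolding abel_summation by (simp only: distrib_right sum_distrib_right mult.assoc)
  also have "\<dots> = (\<Sum>l=1..m. (\<Sum>k=1..l. b k) *\<^sub>C rep_cop (V ^ (l - 1) * (1 - V) * X) x) + (\<Sum>k=1..Suc m. b k) *\<^sub>C rep_cop (V ^ m * X) x"
    by (simp only: rep_cop_simps(1) rep_cop_sum blinfun.add_left blinfun.sum_left rep_cs_apply)
  also have "\<dots> = (\<Sum>l=1..Suc m. (\<Sum>k=1..l. b k) *\<^sub>C rep_cop (if l = Suc m then V ^ m * X else V ^ (l - 1) * (1 - V) * X) x)"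
  proof -
    have "(\<Sum>l=1..m. (\<Sum>k=1..l. b k) *\<^sub>C rep_cop (V ^ (l - 1) * (1 - V) * X) x) =
      (\<Sum>l=1..m. (\<Sum>k=1..l. b k) *\<^sub>C rep_cop (if l = Suc m then V ^ m * X else V ^ (l - 1) * (1 - V) * X) x)"
      by (intro sum.cong) auto
    then show ?thesis by simp
  qed
  also have "\<dots> = (\<Sum>l=1..Suc m. ((\<Sum>k=1..l. b k) / complex_of_real (real l powr \<alpha>)) *\<^sub>C zv l)"
  proof (rule sum.cong)
    fix l assume "l \<in> {1..Suc m}"
    then have "real l powr \<alpha> \<noteq> 0" by simp
    then have "(\<Sum>k=1..l. b k) / complex_of_real (real l powr \<alpha>) * complex_of_real (real l powr \<alpha>) = (\<Sum>k=1..l. b k)"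
      by simp
    then show "(\<Sum>k=1..l. b k) *\<^sub>C rep_cop (if l = Suc m then V ^ m * X else V ^ (l - 1) * (1 - V) * X) x
      = ((\<Sum>k=1..l. b k) / complex_of_real (real l powr \<alpha>)) *\<^sub>C zv l"
      unfolding zv_def scaleC_of_real[symmetric] scaleC_scaleC by simp
  qed simp
  finally show ?thesis by (simp only: b_def)
qed

theorem corollary6p4:
  fixes \<xi>s :: "complex list"
    and T :: "'a::complex_banach \<Rightarrow>\<^sub>L 'a"
    and M :: "'w measure"
    and \<epsilon> :: "nat \<Rightarrow> 'w \<Rightarrow> real"
    and \<alpha> :: real
  assumes "\<xi>s \<noteq> []" and "distinct \<xi>s" and "set \<xi>s \<subseteq> sphere 0 1"
    and "rademacher_seq M \<epsilon>"
    and "finite_cotype M \<epsilon> TYPE('a)"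
    and "ritt_op (set \<xi>s) T"
    and "\<exists>r. 0 < r \<and> r < 1 \<and> bounded_H_inf_calculus (set \<xi>s) r T"
    and "\<alpha> > 0"
  shows "\<exists>C>0. \<forall>x. square_fun M \<epsilon> \<xi>s T \<alpha> x \<le> ennreal (C * norm x)"
proof -
  note rad = assms(4) and \<alpha> = assms(8)
  define E where "E = set \<xi>s"
  have E: "finite E" "E \<noteq> {}" "E \<subseteq> sphere 0 1" using assms by (auto simp: E_def)
  have "complex_linear T" using assms(6) by (simp add: ritt_op_def)
  then obtain S where S: "rep_cop S = T"
    by (metis abs_cop_inverse mem_Collect_eq)
  obtain s where s: "0 < s" "s < 1" and calc: "bounded_H_inf_calculus E s (rep_cop S)"
    using assms(7) by (auto simp: S E_def)
  obtain K where K: "K > 0"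
    "\<And>Q B. (\<And>\<xi>. \<xi> \<in> E \<Longrightarrow> poly Q \<xi> = 0) \<Longrightarrow> (\<And>z. z \<in> stolz_domain E s \<Longrightarrow> cmod (poly Q z) \<le> B) \<Longrightarrow>
      norm (pop Q S) \<le> K * B"
  proof (rule poly_calculus_bound[OF E(1,3) s(2) calc])
    fix K assume 1: "K > 0"
      and 2: "\<And>Q B. (\<And>\<xi>. \<xi> \<in> E \<Longrightarrow> poly Q \<xi> = 0) \<Longrightarrow> (\<And>z. z \<in> stolz_domain E s \<Longrightarrow> cmod (poly Q z) \<le> B) \<Longrightarrow>
        norm (pop Q S) \<le> K * B"
    show thesis
      by (rule that[OF 1]) (rule 2)
  qed
  have ritt: "ritt_op (set \<xi>s) (rep_cop S)" using assms(6) S by simp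
  obtain A K' where A: "rep_cop A = frac_prod \<xi>s \<alpha> (rep_cop S)" and K': "K' > 0"
    "\<And>Q B. 0 \<le> B \<Longrightarrow> (\<And>z. z \<in> stolz_domain E s \<Longrightarrow>
      cmod (poly Q z) * (\<Prod>\<xi>\<in>E. cmod (\<xi> - z)) powr \<alpha> \<le> B) \<Longrightarrow> norm (pop Q S * A) \<le> K' * B"
  proof (rule frac_prod_bound[OF assms(1-3) s K(1) _ ritt \<alpha>])
    show "norm (pop Q S) \<le> K * B" if "\<And>\<xi>. \<xi> \<in> set \<xi>s \<Longrightarrow> poly Q \<xi> = 0"
      "\<And>z. z \<in> stolz_domain (set \<xi>s) s \<Longrightarrow> cmod (poly Q z) \<le> B" for Q B
      using K(2)[of Q B] that by (simp add: E_def)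
  next
    fix A K'
    assume 1: "rep_cop A = frac_prod \<xi>s \<alpha> (rep_cop S)" "K' > 0"
      and 2: "\<And>Q B. 0 \<le> B \<Longrightarrow> (\<And>z. z \<in> stolz_domain (set \<xi>s) s \<Longrightarrow>
        cmod (poly Q z) * (\<Prod>\<xi>\<in>set \<xi>s. cmod (\<xi> - z)) powr \<alpha> \<le> B) \<Longrightarrow> norm (pop Q S * A) \<le> K' * B"
    show thesis
      by (rule that[OF 1]) (rule 2[folded E_def])
  qed
  obtain c where c: "(\<Sum>\<xi>\<in>E. Polynomial.smult (c \<xi>) (\<Prod>\<eta>\<in>E - {\<xi>}. [:1, - cnj \<eta>:])) = 1"
    by (rule lagrange_unit_circle[OF E])
  \<comment> \<open>The share of j in A; by Lagrange interpolation the shares add up to A.\<close>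
  define X where "X j = pop (Polynomial.smult (c j) (\<Prod>\<eta>\<in>E - {j}. [:1, - cnj \<eta>:])) S * A" for j
  have X_sum: "(\<Sum>j\<in>E. X j) = A"
    unfolding X_def sum_distrib_right[symmetric] pop_sum[symmetric] c by simp
  define fam where "fam j G \<longleftrightarrow> G > 0 \<and> (\<forall>m \<eta>. (\<forall>l\<in>{1..Suc m}. \<bar>\<eta> l\<bar> \<le> 1) \<longrightarrow>
    norm ((\<Sum>l=1..m. (\<eta> l * real l powr \<alpha>) *\<^sub>R ((cs (cnj j) * S) ^ (l - 1) * (1 - cs (cnj j) * S) * X j)) +
      (\<eta> (Suc m) * real (Suc m) powr \<alpha>) *\<^sub>R ((cs (cnj j) * S) ^ m * X j)) \<le> G)" for j and G :: real
  have "\<exists>G. fam j G" if j: "j \<in> E" for j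
  proof (rule family_bound[OF E s K'(1) \<alpha> _ j])
    show "norm (pop Q S * A) \<le> K' * B" if "0 \<le> B" "\<And>z. z \<in> stolz_domain E s \<Longrightarrow>
      cmod (poly Q z) * (\<Prod>\<xi>\<in>E. cmod (\<xi> - z)) powr \<alpha> \<le> B" for Q B
      by (rule K'(2)[OF that])
  next
    fix G :: real
    assume G: "G > 0" "\<And>m \<eta>. (\<And>l. l \<in> {1..Suc m} \<Longrightarrow> \<bar>\<eta> l\<bar> \<le> 1) \<Longrightarrow>
      norm ((\<Sum>l=1..m. (\<eta> l * real l powr \<alpha>) *\<^sub>R ((cs (cnj j) * S) ^ (l - 1) * (1 - cs (cnj j) * S) *
          (pop (Polynomial.smult (c j) (\<Prod>\<eta>\<in>E - {j}. [:1, - cnj \<eta>:])) S * A))) +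
        (\<eta> (Suc m) * real (Suc m) powr \<alpha>) *\<^sub>R ((cs (cnj j) * S) ^ m *
          (pop (Polynomial.smult (c j) (\<Prod>\<eta>\<in>E - {j}. [:1, - cnj \<eta>:])) S * A))) \<le> G"
    show ?thesis
      unfolding fam_def by (intro exI[of _ G] conjI allI impI G(1) G(2)[folded X_def]) blast
  qed
  then obtain G where G: "\<And>j. j \<in> E \<Longrightarrow> fam j (G j)" by metis
  obtain q Kc where q: "even q" "q > 0" "Kc \<ge> 1" "sign_cotype q Kc TYPE('a)"
    by (rule finite_cotype_imp_sign_cotype[OF rad assms(5)])
  obtain C where C: "C > 0" and avg:
    "\<And>(v :: nat \<Rightarrow> 'a) L n c G. finite L \<Longrightarrow> G > 0 \<Longrightarrow>
      (\<And>\<eta>. (\<And>l. l \<in> L \<Longrightarrow> \<bar>\<eta> l\<bar> \<le> 1) \<Longrightarrow> norm (\<Sum>l\<in>L. \<eta> l *\<^sub>R v l) \<le> G) \<Longrightarrow>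
      (\<And>l. l \<in> L \<Longrightarrow> (\<Sum>k=1..n. (c l k)\<^sup>2) \<le> 1) \<Longrightarrow>
      (\<Sum>\<sigma>\<in>sign_vectors n. (1 / 2 ^ n) * (norm (\<Sum>l\<in>L. (\<Sum>k=1..n. c l k * \<sigma> k) *\<^sub>R v l))\<^sup>2) \<le> C * G\<^sup>2"
  proof (rule sign_coefficient_average[OF q])
    fix C :: real
    assume 1: "C > 0" and 2: "\<And>(v :: nat \<Rightarrow> 'a) L n c G. finite L \<Longrightarrow> G > 0 \<Longrightarrow>
      (\<And>\<eta>. (\<And>l. l \<in> L \<Longrightarrow> \<bar>\<eta> l\<bar> \<le> 1) \<Longrightarrow> norm (\<Sum>l\<in>L. \<eta> l *\<^sub>R v l) \<le> G) \<Longrightarrow>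
      (\<And>l. l \<in> L \<Longrightarrow> (\<Sum>k=1..n. (c l k)\<^sup>2) \<le> 1) \<Longrightarrow>
      (\<Sum>\<sigma>\<in>sign_vectors n. (1 / 2 ^ n) * (norm (\<Sum>l\<in>L. (\<Sum>k=1..n. c l k * \<sigma> k) *\<^sub>R v l))\<^sup>2) \<le> C * G\<^sup>2"
    show thesis
      by (rule that[OF 1]) (fact 2)
  qed
  \<comment> \<open>The Cauchy-Schwarz inequality over the blocks contributes \<open>card E\<close>,
    each block the constant of \<open>block_average\<close>.\<close>
  define D where "D = real (card E) * (\<Sum>j\<in>E. 4 * max 1 (1 / (2 * \<alpha>)) * C * (G j)\<^sup>2)"
  have D0: "D \<ge> 0" using C by (auto simp: D_def intro!: mult_nonneg_nonneg sum_nonneg)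
  define y where "y x k = real k powr (\<alpha> - 1/2) *\<^sub>R rep_cop (S ^ (k - 1) * A) x" for x k
  \<comment> \<open>Abel summation needs a last term, hence the length \<open>Suc m\<close>;
    monotonicity in the length covers n = 0 at the end. The case x = 0 is separated because the
    averages ask for a positive bound \<open>G j * norm x\<close>.\<close>
  have main: "rad_norm M \<epsilon> (Suc m) (y x) \<le> sqrt D * norm x" for m x
  proof (cases "x = 0")
    case True
    then show ?thesis by (simp add: rad_norm_eq[OF rad] y_def blinfun.zero_right)
  next
    case False
    define a where "a j \<sigma> = (\<Sum>k=1..Suc m. (\<sigma> k * real k powr (\<alpha> - 1/2)) *\<^sub>R rep_cop (S ^ (k - 1) * X j) x)" for j \<sigma>
    have split: "(\<Sum>k=1..Suc m. \<sigma> k *\<^sub>R y x k) = (\<Sum>j\<in>E. a j \<sigma>)" for \<sigma>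
    proof -
      have "(\<Sum>j\<in>E. a j \<sigma>) = (\<Sum>k=1..Suc m. \<Sum>j\<in>E. (\<sigma> k * real k powr (\<alpha> - 1/2)) *\<^sub>R rep_cop (S ^ (k - 1) * X j) x)"
        unfolding a_def by (rule sum.swap)
      also have "\<dots> = (\<Sum>k=1..Suc m. \<sigma> k *\<^sub>R y x k)"
      proof (rule sum.cong)
        fix k
        have "rep_cop (S ^ (k - 1) * A) x = (\<Sum>j\<in>E. rep_cop (S ^ (k - 1) * X j) x)"
          unfolding X_sum[symmetric] sum_distrib_left rep_cop_sum blinfun.sum_left ..
        then show "(\<Sum>j\<in>E. (\<sigma> k * real k powr (\<alpha> - 1/2)) *\<^sub>R rep_cop (S ^ (k - 1) * X j) x) = \<sigma> k *\<^sub>R y x k"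
          by (simp only: y_def scaleR_sum_right scaleR_scaleR)
      qed simp
      finally show ?thesis ..
    qed
    have block: "(\<Sum>\<sigma>\<in>sign_vectors (Suc m). (1 / 2 ^ Suc m) * (norm (a j \<sigma>))\<^sup>2) \<le> 4 * max 1 (1 / (2 * \<alpha>)) * C * (G j * norm x)\<^sup>2"
      if j: "j \<in> E" for j
    proof -
      have j1: "cmod j = 1" using j E(3) by auto
      have Gj: "G j > 0" using G[OF j] by (simp add: fam_def)
      define V where "V = cs (cnj j) * S"
      define zv where "zv l = real l powr \<alpha> *\<^sub>R rep_cop (if l = Suc m then V ^ m * X j else V ^ (l - 1) * (1 - V) * X j) x" for l
      have "norm (\<Sum>l=1..Suc m. \<eta> l *\<^sub>R zv l) \<le> G j * norm x" if \<eta>: "\<And>l. l \<in> {1..Suc m} \<Longrightarrow> \<bar>\<eta> l\<bar> \<le> 1" for \<eta>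
      proof -
        define Y where "Y = (\<Sum>l=1..m. (\<eta> l * real l powr \<alpha>) *\<^sub>R (V ^ (l - 1) * (1 - V) * X j)) +
          (\<eta> (Suc m) * real (Suc m) powr \<alpha>) *\<^sub>R (V ^ m * X j)"
        have "(\<Sum>l=1..m. \<eta> l *\<^sub>R zv l) = (\<Sum>l=1..m. rep_cop ((\<eta> l * real l powr \<alpha>) *\<^sub>R (V ^ (l - 1) * (1 - V) * X j)) x)"
          by (intro sum.cong) (auto simp: zv_def scaleR_blinfun.rep_eq)
        moreover have "\<eta> (Suc m) *\<^sub>R zv (Suc m) = rep_cop ((\<eta> (Suc m) * real (Suc m) powr \<alpha>) *\<^sub>R (V ^ m * X j)) x"
          by (simp add: zv_def scaleR_blinfun.rep_eq)
        moreover have "(\<Sum>l=1..Suc m. \<eta> l *\<^sub>R zv l) = (\<Sum>l=1..m. \<eta> l *\<^sub>R zv l) + \<eta> (Suc m) *\<^sub>R zv (Suc m)"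
          by simp
        ultimately have "(\<Sum>l=1..Suc m. \<eta> l *\<^sub>R zv l) = rep_cop Y x"
          unfolding Y_def by (simp only: rep_cop_simps(1) rep_cop_sum blinfun.add_left blinfun.sum_left)
        moreover have "norm Y \<le> G j"
          using G[OF j] \<eta> unfolding fam_def Y_def V_def by blast
        moreover have "norm (rep_cop Y x) \<le> norm Y * norm x"
          using norm_blinfun[of "rep_cop Y" x] by simp
        ultimately show ?thesis
          using mult_right_mono[of "norm Y" "G j" "norm x"] by simp
      qed
      note z = this
      have "a j \<sigma> = (\<Sum>l=1..Suc m. ((\<Sum>k=1..l. complex_of_real (\<sigma> k * real k powr (\<alpha> - 1/2)) * j ^ (k - 1)) / complex_of_real (real l powr \<alpha>)) *\<^sub>C zv l)" for \<sigma>
        unfolding a_def zv_def V_def by (rule block_decomposition[OF j1])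
      note a_eq = this
      show ?thesis
        unfolding a_eq
      proof (rule block_average[OF _ \<alpha> j1])
        show "G j * norm x > 0" using Gj False by simp
      qed (fact avg z)+
    qed
    have "(\<Sum>\<sigma>\<in>sign_vectors (Suc m). (1 / 2 ^ Suc m) * (norm (\<Sum>k=1..Suc m. \<sigma> k *\<^sub>R y x k))\<^sup>2)
      \<le> (\<Sum>\<sigma>\<in>sign_vectors (Suc m). (1 / 2 ^ Suc m) * (real (card E) * (\<Sum>j\<in>E. (norm (a j \<sigma>))\<^sup>2)))"
    proof (intro sum_mono mult_left_mono)
      fix \<sigma>
      have "(norm (\<Sum>j\<in>E. a j \<sigma>))\<^sup>2 \<le> (\<Sum>j\<in>E. 1 * norm (a j \<sigma>))\<^sup>2"
        by (intro power_mono) (simp_all add: norm_sum)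
      also have "\<dots> \<le> (\<Sum>j\<in>E. 1\<^sup>2) * (\<Sum>j\<in>E. (norm (a j \<sigma>))\<^sup>2)"
        by (rule Cauchy_Schwarz_ineq_sum)
      finally show "(norm (\<Sum>k=1..Suc m. \<sigma> k *\<^sub>R y x k))\<^sup>2 \<le> real (card E) * (\<Sum>j\<in>E. (norm (a j \<sigma>))\<^sup>2)"
        unfolding split by simp
    qed simp
    also have "\<dots> = (\<Sum>\<sigma>\<in>sign_vectors (Suc m). \<Sum>j\<in>E. real (card E) * ((1 / 2 ^ Suc m) * (norm (a j \<sigma>))\<^sup>2))"
      unfolding sum_distrib_left by (intro sum.cong) simp_all
    also have "\<dots> = (\<Sum>j\<in>E. \<Sum>\<sigma>\<in>sign_vectors (Suc m). real (card E) * ((1 / 2 ^ Suc m) * (norm (a j \<sigma>))\<^sup>2))"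
      by (rule sum.swap)
    also have "\<dots> = real (card E) * (\<Sum>j\<in>E. \<Sum>\<sigma>\<in>sign_vectors (Suc m). (1 / 2 ^ Suc m) * (norm (a j \<sigma>))\<^sup>2)"
      by (simp only: sum_distrib_left)
    also have "\<dots> \<le> real (card E) * (\<Sum>j\<in>E. 4 * max 1 (1 / (2 * \<alpha>)) * C * (G j * norm x)\<^sup>2)"
      by (intro mult_left_mono sum_mono block) auto
    also have "\<dots> = D * (norm x)\<^sup>2"
      by (simp only: D_def sum_distrib_left sum_distrib_right power_mult_distrib mult.assoc)
    finally have "rad_norm M \<epsilon> (Suc m) (y x) \<le> sqrt (D * (norm x)\<^sup>2)"
      unfolding rad_norm_eq[OF rad] by (rule real_sqrt_le_mono)
    then show ?thesis
      by (simp add: real_sqrt_mult)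
  qed
  have y_eq: "(\<lambda>k. (real k powr (\<alpha> - 1/2)) *\<^sub>R blinfun_apply (op_power T (k - 1) o\<^sub>L frac_prod \<xi>s \<alpha> T) x) = y x" for x
    by (simp add: y_def fun_eq_iff A[unfolded S, symmetric] op_power_rep_cop[of S, unfolded S])
  show ?thesis
  \<comment> \<open>Only D \<ge> 0 has been recorded, so 1 is added for a positive constant.\<close>
  proof (intro exI[of _ "sqrt D + 1"] conjI allI)
    show "sqrt D + 1 > 0" using D0 by (simp add: add_nonneg_pos)
    fix x
    have mono: "incseq (\<lambda>n. ennreal (rad_norm M \<epsilon> n (y x)))"
      by (intro incseq_SucI ennreal_leI rad_norm_mono rad)
    have "square_fun M \<epsilon> \<xi>s T \<alpha> x = (SUP n. ennreal (rad_norm M \<epsilon> n (y x)))"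
      unfolding square_fun_def y_eq by (rule limI[OF LIMSEQ_SUP[OF mono]])
    also have "\<dots> \<le> ennreal ((sqrt D + 1) * norm x)"
    proof (rule SUP_least)
      fix n
      have "rad_norm M \<epsilon> n (y x) \<le> sqrt D * norm x"
        using rad_norm_mono[OF rad, of n "y x"] main[of n x] by linarith
      also have "\<dots> \<le> (sqrt D + 1) * norm x"
        by (simp add: distrib_right)
      finally show "ennreal (rad_norm M \<epsilon> n (y x)) \<le> ennreal ((sqrt D + 1) * norm x)"
        by (rule ennreal_leI)
    qed
    finally show "square_fun M \<epsilon> \<xi>s T \<alpha> x \<le> ennreal ((sqrt D + 1) * norm x)" .
  qed
qed

end
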